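(* Let $E$ be an arbitrary directed graph, $K$ a field, and $L=L_K(E)$ the Leavitt path algebra. The following are equivalent: (1) every proper ideal of $L$ is a product of (finitely many) strongly prime ideals; (2) every ideal of $L$ is graded, $L$ is a generalized ZPI ring, and every non-zero homomorphic image of $L$ is a Leavitt path algebra and is either strongly prime or contains only a finite number of minimal prime ideals, each of which is strongly primitive; (3) the graph $E$ satisfies Condition (K) and for every quotient graph $E\backslash(H,S)$ with $(H,S)$ an admissible pair, $H\neq E^0$, the set $(E\backslash(H,S))^0$ is either downward directed satisfying the strong CSP, or is the union of finitely many maximal tails $S_j$, each of which satisfies the strong CSP with respect to a countable subset $C_j\subseteq S_j$.
   Context: A directed graph $E=(E^0,E^1,r,s)$ consists of sets $E^0$ (vertices), $E^1$ (edges) and maps $r,s:E^1\to E^0$; no finiteness or countability is assumed. A vertex is regular if it emits a nonempty finite set of edges, and an infinite emitter if it emits infinitely many. $L_K(E)$ is the (not necessarily unital) $K$-algebra generated by pairwise orthogonal idempotents $v\in E^0$ and elements $e,e^*$ ($e\in E^1$) subject to: $s(e)e=e=er(e)$; $r(e)e^*=e^*=e^*s(e)$; $e^*e=r(e)$ and $e^*f=0$ for edges $e\neq f$; $v=\sum_{s(e)=v}ee^*$ for every regular vertex $v$. It is $\mathbb Z$-graded by $\deg v=0$, $\deg e=1$, $\deg e^*=-1$. "Ideal" means two-sided ideal; prime ideals are proper. $L$ is a generalized ZPI ring if every proper ideal of $L$ is a product of finitely many prime ideals. A proper ideal $P$ of a ring $R$ is strongly prime if for every family of ideals $(A_i)_{i\in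 X}$ of $R$ ($X$ an arbitrary nonempty index set), $\bigcap_{i\in X}A_i\subseteq P$ implies $A_i\subseteq P$ for some $i\in X$. A ring is strongly prime if $\{0\}$ is a strongly prime ideal. An ideal $P$ of $R$ is (right) primitive if $R/P$ has a faithful simple right module. Write $u\ge v$ if there is a path (possibly of length $0$) from $u$ to $v$. A set $D$ of vertices is downward directed if for all $u,v\in D$ there is $w\in D$ with $u\ge w$, $v\ge w$. $H\subseteq E^0$ is hereditary if $v\in H$, $v\ge w$ imply $w\in H$; it is saturated if a regular vertex $v$ with $r(s^{-1}(v))\subseteq H$ lies in $H$. For $H$ hereditary saturated, $B_H$ is the set of infinite emitters $w\in E^0\backslash H$ with $0<|s^{-1}(w)\cap r^{-1}(E^0\backslash H)|<\infty$, and for $v\in B_H$, $v^H=v-\sum_{s(e)=v,\,r(e)\notin H}ee^*$. An admissible pair is $(H,S)$ with $H$ hereditary saturated and $S\subseteq B_H$; $I(H,S)$ is the ideal generated by $H\cup\{v^H:v\in S\}$ (these are exactly the graded ideals). For an ideal $I$, $gr(I)=I(H,S)$ with $H=I\cap E^0$, $S=\{v\in B_H:v^H\in I\}$. The quotient graph $E\backslash(H,S)$ has vertices $(E^0\backslash H)\cup\{v':v\in B_H\backslash S\}$ and edges $\{e\in E^1:r(e)\notin H\}\cup\{e':e\in E^1,\ r(e)\in B_H\backslash S\}$, with $s(e')=s(e)$, $r(e')=r(e)'$. One has $L_K(E)/I(H,S)\cong L_K(E\backslash(H,S))$. A maximal tail in a graph $F$ is a subset $M\subseteq F^0$ such that: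 (i) $M$ is downward directed; (ii) if $u\in M$, $v\in F^0$ and $v\ge u$ then $v\in M$; (iii) if $u\in M$ emits edges, there is an edge $e$ with $s(e)=u$, $r(e)\in M$. In (3), maximal tails are taken in $E\backslash(H,S)$. A graph $F$ satisfies the strong CSP with respect to $C$ if $C\subseteq F^0$ is non-empty and countable, every $u\in F^0$ satisfies $u\ge v$ for some $v\in C$, and $C$ is contained in every non-empty hereditary saturated subset of $F^0$. A maximal tail satisfies the strong CSP if the full subgraph on it does. A primitive ideal $P$ of $L_K(F)$ with $gr(P)=I(H,S)$ is strongly primitive if $F\backslash(H,S)$ satisfies the strong CSP (with respect to some $C$); in (2), a homomorphic image $L/I(H,S)$ is identified with $L_K(F)$, $F=E\backslash(H,S)$. A closed path $e_1\cdots e_n$ ($n\ge 1$, $r(e_n)=s(e_1)$), based at $s(e_1)$, is simple if $s(e_i)\ne s(e_1)$ for $i=2,\dots,n$. $E$ satisfies Condition (K) if any vertex that is the base of a simple closed path $c$ is also the base of another simple closed path $c'\ne c$. *)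

theory Defs
  imports
    "HOL-Algebra.QuotRing"
    "HOL-Algebra.Ideal_Product"
    "HOL-Algebra.Module"
    "HOL-Library.Poly_Mapping"
    "HOL-Library.Countable_Set"
    "Graph_Theory.Digraph"
    "Graph_Theory.Digraph_Component"
    "Graph_Theory.Arc_Walk"
begin

section \<open>Ideals of rings without unit\<close>

text \<open>
  Leavitt path algebras need not have a unit, so the locales of HOL-Algebra for ideals (which
  extend \<^locale>\<open>ring\<close>) do not apply.  We keep its records, ignoring the field \<^const>\<open>one\<close>, and
  its constants \<^const>\<open>additive_subgroup\<close>, \<^const>\<open>ideal_prod\<close> and \<^const>\<open>FactRing\<close>, whose
  definitions do not involve the unit.
\<close>

definition two_sided_ideal :: "'a set \<Rightarrow> ('a, 'm) ring_scheme \<Rightarrow> bool" where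
  "two_sided_ideal I R \<longleftrightarrow>
     additive_subgroup I R \<and>
     (\<forall>a\<in>I. \<forall>x\<in>carrier R. x \<otimes>\<^bsub>R\<^esub> a \<in> I \<and> a \<otimes>\<^bsub>R\<^esub> x \<in> I)"

definition proper_ideal :: "'a set \<Rightarrow> ('a, 'm) ring_scheme \<Rightarrow> bool" where
  "proper_ideal I R \<longleftrightarrow> two_sided_ideal I R \<and> I \<noteq> carrier R"

definition ideal_generated :: "('a, 'm) ring_scheme \<Rightarrow> 'a set \<Rightarrow> 'a set" where
  "ideal_generated R X = \<Inter>{I. two_sided_ideal I R \<and> X \<subseteq> I}"

definition prime_ideal :: "'a set \<Rightarrow> ('a, 'm) ring_scheme \<Rightarrow> bool" where
  "prime_ideal P R \<longleftrightarrow>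
     proper_ideal P R \<and>
     (\<forall>A B. two_sided_ideal A R \<longrightarrow> two_sided_ideal B R \<longrightarrow> A \<cdot>\<^bsub>R\<^esub> B \<subseteq> P \<longrightarrow>
        A \<subseteq> P \<or> B \<subseteq> P)"

definition minimal_prime_ideal :: "'a set \<Rightarrow> ('a, 'm) ring_scheme \<Rightarrow> bool" where
  "minimal_prime_ideal P R \<longleftrightarrow>
     prime_ideal P R \<and> (\<forall>Q. prime_ideal Q R \<longrightarrow> Q \<subseteq> P \<longrightarrow> Q = P)"

text \<open>Only the set of members of a family of ideals matters here, so families are sets of ideals.\<close>

definition strongly_prime_ideal :: "'a set \<Rightarrow> ('a, 'm) ring_scheme \<Rightarrow> bool" where
  "strongly_prime_ideal P R \<longleftrightarrow>
     proper_ideal P R \<and>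
     (\<forall>\<A>. \<A> \<noteq> {} \<longrightarrow> (\<forall>A\<in>\<A>. two_sided_ideal A R) \<longrightarrow> \<Inter>\<A> \<subseteq> P \<longrightarrow> (\<exists>A\<in>\<A>. A \<subseteq> P))"

definition strongly_prime_ring :: "('a, 'm) ring_scheme \<Rightarrow> bool" where
  "strongly_prime_ring R \<longleftrightarrow> strongly_prime_ideal {\<zero>\<^bsub>R\<^esub>} R"

fun ideal_list_prod :: "('a, 'm) ring_scheme \<Rightarrow> 'a set list \<Rightarrow> 'a set" where
  "ideal_list_prod R [] = carrier R"
| "ideal_list_prod R [P] = P"
| "ideal_list_prod R (P # Q # Ps) = P \<cdot>\<^bsub>R\<^esub> ideal_list_prod R (Q # Ps)"

definition finite_product_of ::
    "('a set \<Rightarrow> ('a, 'm) ring_scheme \<Rightarrow> bool) \<Rightarrow> 'a set \<Rightarrow> ('a, 'm) ring_scheme \<Rightarrow> bool" where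
  "finite_product_of \<Phi> I R \<longleftrightarrow> (\<exists>Ps. Ps \<noteq> [] \<and> (\<forall>P\<in>set Ps. \<Phi> P R) \<and> I = ideal_list_prod R Ps)"

definition generalized_ZPI_ring :: "('a, 'm) ring_scheme \<Rightarrow> bool" where
  "generalized_ZPI_ring R \<longleftrightarrow> (\<forall>I. proper_ideal I R \<longrightarrow> finite_product_of prime_ideal I R)"

text \<open>Right modules over a ring without unit; \<open>act m a\<close> is \<open>m \<cdot> a\<close>, and only the additive
  structure of the record \<open>M\<close> is used.\<close>

definition right_module ::
    "('a, 'm) ring_scheme \<Rightarrow> ('b, 'n) ring_scheme \<Rightarrow> ('b \<Rightarrow> 'a \<Rightarrow> 'b) \<Rightarrow> bool" where
  "right_module R M act \<longleftrightarrow>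
     abelian_group M \<and>
     (\<forall>m\<in>carrier M. \<forall>a\<in>carrier R. act m a \<in> carrier M) \<and>
     (\<forall>m\<in>carrier M. \<forall>n\<in>carrier M. \<forall>a\<in>carrier R.
        act (m \<oplus>\<^bsub>M\<^esub> n) a = act m a \<oplus>\<^bsub>M\<^esub> act n a) \<and>
     (\<forall>m\<in>carrier M. \<forall>a\<in>carrier R. \<forall>b\<in>carrier R.
        act m (a \<oplus>\<^bsub>R\<^esub> b) = act m a \<oplus>\<^bsub>M\<^esub> act m b \<and>
        act m (a \<otimes>\<^bsub>R\<^esub> b) = act (act m a) b)"

text \<open>As usual for rings without unit, a simple module is required to satisfy \<open>MR \<noteq> 0\<close>.\<close>

definition simple_right_module ::
    "('a, 'm) ring_scheme \<Rightarrow> ('b, 'n) ring_scheme \<Rightarrow> ('b \<Rightarrow> 'a \<Rightarrow> 'b) \<Rightarrow> bool" where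
  "simple_right_module R M act \<longleftrightarrow>
     right_module R M act \<and>
     (\<exists>m\<in>carrier M. \<exists>a\<in>carrier R. act m a \<noteq> \<zero>\<^bsub>M\<^esub>) \<and>
     (\<forall>N. additive_subgroup N M \<longrightarrow> (\<forall>m\<in>N. \<forall>a\<in>carrier R. act m a \<in> N) \<longrightarrow>
        N = {\<zero>\<^bsub>M\<^esub>} \<or> N = carrier M)"

definition faithful_right_module ::
    "('a, 'm) ring_scheme \<Rightarrow> ('b, 'n) ring_scheme \<Rightarrow> ('b \<Rightarrow> 'a \<Rightarrow> 'b) \<Rightarrow> bool" where
  "faithful_right_module R M act \<longleftrightarrow>
     (\<forall>a\<in>carrier R. (\<forall>m\<in>carrier M. act m a = \<zero>\<^bsub>M\<^esub>) \<longrightarrow> a = \<zero>\<^bsub>R\<^esub>)"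

text \<open>
  The existential quantifier over modules has to fix a type of module elements.  This loses
  nothing: a simple right \<open>T\<close>-module is of the form \<open>mT\<close>, hence isomorphic to a quotient of the
  right module \<open>T\<close>, and can be realised on cosets of elements of \<open>T = R/P\<close>.
\<close>

definition primitive_ideal :: "'a set \<Rightarrow> ('a, 'm) ring_scheme \<Rightarrow> bool" where
  "primitive_ideal P R \<longleftrightarrow>
     two_sided_ideal P R \<and>
     (\<exists>(M :: 'a set set ring) act.
        simple_right_module (R Quot P) M act \<and> faithful_right_module (R Quot P) M act)"


section \<open>Algebras given by generators and relations\<close>

text \<open>
  The words over an alphabet form a monoid under concatenation, here written additively because
  \<^typ>\<open>'w \<Rightarrow>\<^sub>0 'k\<close> carries the convolution product of the monoid algebra for additive monoids \<open>'w\<close>.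
\<close>

datatype 'g free_word = Free_Word (letters: "'g list")

instantiation free_word :: (type) monoid_add
begin

definition zero_free_word :: "'a free_word" where
  "zero_free_word = Free_Word []"

definition plus_free_word :: "'a free_word \<Rightarrow> 'a free_word \<Rightarrow> 'a free_word" where
  "plus_free_word u v = Free_Word (letters u @ letters v)"

instance
  by standard (simp_all add: zero_free_word_def plus_free_word_def)

end

definition generator :: "'g \<Rightarrow> ('g free_word \<Rightarrow>\<^sub>0 'k::field)" where
  "generator g = Poly_Mapping.single (Free_Word [g]) 1"

text \<open>
  The free algebra without unit on a set \<open>X\<close> of generators: linear combinations of nonempty words
  over \<open>X\<close>.  The argument \<open>K\<close> only names the coefficient field.  The field \<^const>\<open>one\<close> of the
  record is not used.
\<close>

definition free_algebra ::
    "'k::field itself \<Rightarrow> 'g set \<Rightarrow> ('k, 'g free_word \<Rightarrow>\<^sub>0 'k) module" where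
  "free_algebra K X =
     \<lparr>carrier = {x. \<forall>w\<in>Poly_Mapping.keys x. letters w \<noteq> [] \<and> set (letters w) \<subseteq> X},
      monoid.mult = (*), one = undefined, zero = 0, add = (+),
      smult = (\<lambda>c x. Poly_Mapping.single 0 c * x)\<rparr>"

definition algebra_ideal_generated :: "('k, 'a) module \<Rightarrow> 'a set \<Rightarrow> 'a set" where
  "algebra_ideal_generated A X =
     \<Inter>{I. two_sided_ideal I A \<and> (\<forall>c. \<forall>a\<in>I. c \<odot>\<^bsub>A\<^esub> a \<in> I) \<and> X \<subseteq> I}"

definition quotient_algebra :: "('k, 'a) module \<Rightarrow> 'a set \<Rightarrow> ('k, 'a set) module" where
  "quotient_algebra A I =
     ring.extend (A Quot I)
       (module.fields (\<lambda>c B. \<Union>b\<in>B. I +>\<^bsub>A\<^esub> (c \<odot>\<^bsub>A\<^esub> b)))"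

text \<open>Isomorphism of algebras without unit over the type \<^typ>\<open>'k\<close> of scalars.\<close>

definition algebra_isomorphic :: "('k, 'a) module \<Rightarrow> ('k, 'b) module \<Rightarrow> bool" where
  "algebra_isomorphic A B \<longleftrightarrow>
     (\<exists>h. h \<in> iso (add_monoid A) (add_monoid B) \<and> h \<in> hom A B \<and>
        (\<forall>c. \<forall>a\<in>carrier A. h (c \<odot>\<^bsub>A\<^esub> a) = c \<odot>\<^bsub>B\<^esub> h a))"


section \<open>Directed graphs\<close>

definition regular_vertex :: "('v, 'e) pre_digraph \<Rightarrow> 'v \<Rightarrow> bool" where
  "regular_vertex E v \<longleftrightarrow> v \<in> verts E \<and> out_arcs E v \<noteq> {} \<and> finite (out_arcs E v)"

definition infinite_emitter :: "('v, 'e) pre_digraph \<Rightarrow> 'v \<Rightarrow> bool" where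
  "infinite_emitter E v \<longleftrightarrow> v \<in> verts E \<and> infinite (out_arcs E v)"

definition downward_directed :: "('v, 'e) pre_digraph \<Rightarrow> 'v set \<Rightarrow> bool" where
  "downward_directed E D \<longleftrightarrow> (\<forall>u\<in>D. \<forall>v\<in>D. \<exists>w\<in>D. u \<rightarrow>\<^sup>*\<^bsub>E\<^esub> w \<and> v \<rightarrow>\<^sup>*\<^bsub>E\<^esub> w)"

definition hereditary :: "('v, 'e) pre_digraph \<Rightarrow> 'v set \<Rightarrow> bool" where
  "hereditary E H \<longleftrightarrow> H \<subseteq> verts E \<and> (\<forall>v\<in>H. \<forall>w. v \<rightarrow>\<^sup>*\<^bsub>E\<^esub> w \<longrightarrow> w \<in> H)"

definition saturated :: "('v, 'e) pre_digraph \<Rightarrow> 'v set \<Rightarrow> bool" where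
  "saturated E H \<longleftrightarrow> (\<forall>v. regular_vertex E v \<and> head E ` out_arcs E v \<subseteq> H \<longrightarrow> v \<in> H)"

definition breaking_vertices :: "('v, 'e) pre_digraph \<Rightarrow> 'v set \<Rightarrow> 'v set" where
  "breaking_vertices E H =
     {w \<in> verts E - H. infinite_emitter E w \<and>
        {e \<in> out_arcs E w. head E e \<in> verts E - H} \<noteq> {} \<and>
        finite {e \<in> out_arcs E w. head E e \<in> verts E - H}}"

definition admissible_pair :: "('v, 'e) pre_digraph \<Rightarrow> 'v set \<Rightarrow> 'v set \<Rightarrow> bool" where
  "admissible_pair E H S \<longleftrightarrow>
     hereditary E H \<and> saturated E H \<and> S \<subseteq> breaking_vertices E H"

text \<open>\<^term>\<open>Inl x\<close> is the copy of \<open>x\<close> itself and \<^term>\<open>Inr x\<close> is the primed copy \<open>x'\<close>.\<close>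

definition quotient_graph ::
    "('v, 'e) pre_digraph \<Rightarrow> 'v set \<Rightarrow> 'v set \<Rightarrow> ('v + 'v, 'e + 'e) pre_digraph" where
  "quotient_graph E H S =
     \<lparr>verts = Inl ` (verts E - H) \<union> Inr ` (breaking_vertices E H - S),
      arcs = Inl ` {e \<in> arcs E. head E e \<notin> H} \<union>
             Inr ` {e \<in> arcs E. head E e \<in> breaking_vertices E H - S},
      tail = case_sum (\<lambda>e. Inl (tail E e)) (\<lambda>e. Inl (tail E e)),
      head = case_sum (\<lambda>e. Inl (head E e)) (\<lambda>e. Inr (head E e))\<rparr>"

definition maximal_tail :: "('v, 'e) pre_digraph \<Rightarrow> 'v set \<Rightarrow> bool" where
  "maximal_tail F M \<longleftrightarrow>
     M \<subseteq> verts F \<and>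
     downward_directed F M \<and>
     (\<forall>u\<in>M. \<forall>v\<in>verts F. v \<rightarrow>\<^sup>*\<^bsub>F\<^esub> u \<longrightarrow> v \<in> M) \<and>
     (\<forall>u\<in>M. out_arcs F u \<noteq> {} \<longrightarrow> (\<exists>e\<in>out_arcs F u. head F e \<in> M))"

definition strong_CSP :: "('v, 'e) pre_digraph \<Rightarrow> 'v set \<Rightarrow> bool" where
  "strong_CSP F C \<longleftrightarrow>
     C \<subseteq> verts F \<and> C \<noteq> {} \<and> countable C \<and>
     (\<forall>u\<in>verts F. \<exists>v\<in>C. u \<rightarrow>\<^sup>*\<^bsub>F\<^esub> v) \<and>
     (\<forall>H. H \<noteq> {} \<and> hereditary F H \<and> saturated F H \<longrightarrow> C \<subseteq> H)"

definition simple_closed_path :: "('v, 'e) pre_digraph \<Rightarrow> 'v \<Rightarrow> 'e awalk \<Rightarrow> bool" where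
  "simple_closed_path E v p \<longleftrightarrow>
     p \<noteq> [] \<and> pre_digraph.awalk E v p v \<and> (\<forall>e\<in>set (tl p). tail E e \<noteq> v)"

definition condition_K :: "('v, 'e) pre_digraph \<Rightarrow> bool" where
  "condition_K E \<longleftrightarrow>
     (\<forall>v c. simple_closed_path E v c \<longrightarrow> (\<exists>c'. simple_closed_path E v c' \<and> c' \<noteq> c))"


section \<open>Leavitt path algebras\<close>

datatype ('v, 'e) lpa_gen = Vertex 'v | Edge 'e | Ghost 'e

fun lpa_gen_degree :: "('v, 'e) lpa_gen \<Rightarrow> int" where
  "lpa_gen_degree (Vertex v) = 0"
| "lpa_gen_degree (Edge e) = 1"
| "lpa_gen_degree (Ghost e) = - 1"

type_synonym ('v, 'e, 'k) lpa_free = "('v, 'e) lpa_gen free_word \<Rightarrow>\<^sub>0 'k"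

definition lpa_free_algebra ::
    "'k::field itself \<Rightarrow> ('v, 'e) pre_digraph \<Rightarrow> ('k, ('v, 'e, 'k) lpa_free) module" where
  "lpa_free_algebra K E =
     free_algebra K (Vertex ` verts E \<union> Edge ` arcs E \<union> Ghost ` arcs E)"

abbreviation vtx :: "'v \<Rightarrow> ('v, 'e, 'k::field) lpa_free" where
  "vtx v \<equiv> generator (Vertex v)"

abbreviation edg :: "'e \<Rightarrow> ('v, 'e, 'k::field) lpa_free" where
  "edg e \<equiv> generator (Edge e)"

abbreviation gho :: "'e \<Rightarrow> ('v, 'e, 'k::field) lpa_free" where
  "gho e \<equiv> generator (Ghost e)"

text \<open>The defining relations \<open>a = b\<close>, in the form \<open>a - b\<close>.\<close>

definition lpa_relators ::
    "'k::field itself \<Rightarrow> ('v, 'e) pre_digraph \<Rightarrow> ('v, 'e, 'k) lpa_free set" where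
  "lpa_relators K E =
     {vtx v * vtx w - (if v = w then vtx v else 0) | v w. v \<in> verts E \<and> w \<in> verts E} \<union>
     {vtx (tail E e) * edg e - edg e | e. e \<in> arcs E} \<union>
     {edg e * vtx (head E e) - edg e | e. e \<in> arcs E} \<union>
     {vtx (head E e) * gho e - gho e | e. e \<in> arcs E} \<union>
     {gho e * vtx (tail E e) - gho e | e. e \<in> arcs E} \<union>
     {gho e * edg f - (if e = f then vtx (head E e) else 0) | e f. e \<in> arcs E \<and> f \<in> arcs E} \<union>
     {vtx v - (\<Sum>e\<in>out_arcs E v. edg e * gho e) | v. regular_vertex E v}"

definition lpa_relation_ideal ::
    "'k::field itself \<Rightarrow> ('v, 'e) pre_digraph \<Rightarrow> ('v, 'e, 'k) lpa_free set" where
  "lpa_relation_ideal K E = algebra_ideal_generated (lpa_free_algebra K E) (lpa_relators K E)"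

definition leavitt_path_algebra ::
    "'k::field itself \<Rightarrow> ('v, 'e) pre_digraph \<Rightarrow> ('k, ('v, 'e, 'k) lpa_free set) module" where
  "leavitt_path_algebra K E =
     quotient_algebra (lpa_free_algebra K E) (lpa_relation_ideal K E)"

definition lpa_class ::
    "'k::field itself \<Rightarrow> ('v, 'e) pre_digraph \<Rightarrow> ('v, 'e, 'k) lpa_free \<Rightarrow> ('v, 'e, 'k) lpa_free set"
  where "lpa_class K E x = lpa_relation_ideal K E +>\<^bsub>lpa_free_algebra K E\<^esub> x"

definition lpa_component ::
    "'k::field itself \<Rightarrow> ('v, 'e) pre_digraph \<Rightarrow> int \<Rightarrow> ('v, 'e, 'k) lpa_free set set" where
  "lpa_component K E n =
     lpa_class K E ` {x \<in> carrier (lpa_free_algebra K E).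
       \<forall>w\<in>Poly_Mapping.keys x. sum_list (map lpa_gen_degree (letters w)) = n}"

text \<open>An ideal \<open>I\<close> is graded if it is the sum of its intersections with the homogeneous components.\<close>

definition graded_ideal ::
    "'k::field itself \<Rightarrow> ('v, 'e) pre_digraph \<Rightarrow> ('v, 'e, 'k) lpa_free set set \<Rightarrow> bool" where
  "graded_ideal K E I \<longleftrightarrow>
     two_sided_ideal I (leavitt_path_algebra K E) \<and>
     (\<forall>a\<in>I. \<exists>N c. finite N \<and> (\<forall>n\<in>N. c n \<in> I \<inter> lpa_component K E n) \<and>
        a = finsum (leavitt_path_algebra K E) c N)"

text \<open>The element \<open>v\<^sup>H\<close> attached to \<open>v \<in> B\<^sub>H\<close>.\<close>

definition breaking_element ::
    "'k::field itself \<Rightarrow> ('v, 'e) pre_digraph \<Rightarrow> 'v set \<Rightarrow> 'v \<Rightarrow> ('v, 'e, 'k) lpa_free set" where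
  "breaking_element K E H v =
     lpa_class K E (vtx v - (\<Sum>e\<in>{e \<in> out_arcs E v. head E e \<notin> H}. edg e * gho e))"

text \<open>The ideal \<open>I(H, S)\<close>.\<close>

definition admissible_ideal ::
    "'k::field itself \<Rightarrow> ('v, 'e) pre_digraph \<Rightarrow> 'v set \<Rightarrow> 'v set \<Rightarrow> ('v, 'e, 'k) lpa_free set set"
  where "admissible_ideal K E H S =
     ideal_generated (leavitt_path_algebra K E)
       ((\<lambda>v. lpa_class K E (vtx v)) ` H \<union> breaking_element K E H ` S)"

text \<open>The admissible pair \<open>(H, S)\<close> with \<open>gr(I) = I(H, S)\<close>.\<close>

definition gr_vertices ::
    "'k::field itself \<Rightarrow> ('v, 'e) pre_digraph \<Rightarrow> ('v, 'e, 'k) lpa_free set set \<Rightarrow> 'v set" where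
  "gr_vertices K E I = {v \<in> verts E. lpa_class K E (vtx v) \<in> I}"

definition gr_breaking ::
    "'k::field itself \<Rightarrow> ('v, 'e) pre_digraph \<Rightarrow> ('v, 'e, 'k) lpa_free set set \<Rightarrow> 'v set" where
  "gr_breaking K E I =
     {v \<in> breaking_vertices E (gr_vertices K E I).
        breaking_element K E (gr_vertices K E I) v \<in> I}"

definition strongly_primitive_ideal ::
    "'k::field itself \<Rightarrow> ('v, 'e) pre_digraph \<Rightarrow> ('v, 'e, 'k) lpa_free set set \<Rightarrow> bool" where
  "strongly_primitive_ideal K F P \<longleftrightarrow>
     primitive_ideal P (leavitt_path_algebra K F) \<and>
     (\<exists>C. strong_CSP (quotient_graph F (gr_vertices K F P) (gr_breaking K F P)) C)"

end

(*
  Under Condition (K) every ideal I of L = L_K(E) is I(H,S): multiplying an element of I by ghost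
  paths and by paths c^M d, for two simple closed paths c, d at one vertex, isolates single paths,
  so I is generated by its vertices and breaking elements.  Hence all ideals are idempotent and
  products of ideals are intersections.  If (K) fails at the unique simple closed path c at v,
  let c act as 1 + t over K[[t]]: the ideals of elements acting by multiples of t^n are not generated
  by idempotents, and as (c - v)^n lies in the n-th one, no product of strongly prime ideals can
  equal the annihilator.

  The ring L(F) has a least nonzero ideal iff some vertex of F lies in every nonempty hereditary
  saturated set, and this is the strong CSP: from such a vertex u every vertex is reached through
  the countable set of successors of u along edges leaving regular vertices.  So each of the three
  conditions says, for every proper I = I(H,S), that I is a finite intersection of ideals P such that
  L/P has a least nonzero ideal; when this holds for all I, distributivity of the ideal lattice makes
  such P strongly prime.  On the graph side these P correspond to the maximal tails of the quotient.
*)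
theory Submission
  imports Defs "HOL-Library.Function_Algebras" "HOL-Computational_Algebra.Formal_Power_Series"
begin

no_notation Sum_Type.Plus (infixr "<+>" 65)

section \<open>Rings without unit\<close>

text \<open>Conditions (1) and (2) are each made to yield Condition (K) before anything is compared,
  because idempotence of ideals is derived from (K). Two nonvanishing facts cannot be had by
  rewriting in an algebra given by generators and relations: that the vertices and breaking elements
  of I(H,S) are those prescribed by (H,S), and that no power of c - v is zero. Both come from one
  kind of module: functions on a set, on which edges act along injections with disjoint images. With
  trivial weights it shows that the vertices of the quotient graph are nonzero; with weight 1 + t on
  the edges leaving v it gives the filtration that refutes (1) and (2). Power series serve there for
  two reasons. An idempotent acting by multiples of t acts by multiples of every power of t, hence
  as zero; so the first term of the filtration is not generated by idempotents. And the filtration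
  intersects in the annihilator, so strong primeness, applied to this infinite family, puts one of
  its terms inside each factor.\<close>

locale nonunital_ring = abelian_group R for R (structure) +
  assumes m_closed: "x \<in> carrier R \<Longrightarrow> y \<in> carrier R \<Longrightarrow> x \<otimes> y \<in> carrier R"
    and m_assoc: "x \<in> carrier R \<Longrightarrow> y \<in> carrier R \<Longrightarrow> z \<in> carrier R \<Longrightarrow>
      (x \<otimes> y) \<otimes> z = x \<otimes> (y \<otimes> z)"
    and l_distr: "x \<in> carrier R \<Longrightarrow> y \<in> carrier R \<Longrightarrow> z \<in> carrier R \<Longrightarrow>
      (x \<oplus> y) \<otimes> z = x \<otimes> z \<oplus> y \<otimes> z"
    and r_distr: "x \<in> carrier R \<Longrightarrow> y \<in> carrier R \<Longrightarrow> z \<in> carrier R \<Longrightarrow>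
      z \<otimes> (x \<oplus> y) = z \<otimes> x \<oplus> z \<otimes> y"
begin

lemma l_null: "x \<in> carrier R \<Longrightarrow> \<zero> \<otimes> x = \<zero>"
  using l_distr[of \<zero> \<zero> x] m_closed[of \<zero> x]
  by (metis add.r_cancel_one' l_zero zero_closed)

lemma r_null: "x \<in> carrier R \<Longrightarrow> x \<otimes> \<zero> = \<zero>"
  using r_distr[of \<zero> \<zero> x] m_closed[of x \<zero>]
  by (metis add.r_cancel_one' l_zero zero_closed)

lemma l_minus: "x \<in> carrier R \<Longrightarrow> y \<in> carrier R \<Longrightarrow> (\<ominus> x) \<otimes> y = \<ominus> (x \<otimes> y)"
  using l_distr[of "\<ominus> x" x y] m_closed l_null[of y] l_neg[of x]
  by (metis a_inv_closed minus_equality)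

lemma r_minus: "x \<in> carrier R \<Longrightarrow> y \<in> carrier R \<Longrightarrow> x \<otimes> (\<ominus> y) = \<ominus> (x \<otimes> y)"
  using r_distr[of "\<ominus> y" y x] m_closed r_null[of x] l_neg[of y]
  by (metis a_inv_closed minus_equality)

lemma additive_subgroup_iff:
  "additive_subgroup I R \<longleftrightarrow> I \<subseteq> carrier R \<and> \<zero> \<in> I \<and> (\<forall>x\<in>I. \<forall>y\<in>I. x \<oplus> y \<in> I) \<and> (\<forall>x\<in>I. \<ominus> x \<in> I)"
proof
  assume "additive_subgroup I R"
  then interpret additive_subgroup I R .
  show "I \<subseteq> carrier R \<and> \<zero> \<in> I \<and> (\<forall>x\<in>I. \<forall>y\<in>I. x \<oplus> y \<in> I) \<and> (\<forall>x\<in>I. \<ominus> x \<in> I)"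
    using a_subset zero_closed a_closed abelian_group.a_inv_closed
    by (auto simp: a_inv_def intro: subgroup.m_inv_closed[OF a_subgroup, simplified])
next
  assume *: "I \<subseteq> carrier R \<and> \<zero> \<in> I \<and> (\<forall>x\<in>I. \<forall>y\<in>I. x \<oplus> y \<in> I) \<and> (\<forall>x\<in>I. \<ominus> x \<in> I)"
  show "additive_subgroup I R"
    using * by (intro additive_subgroup.intro subgroup.intro) (auto simp: a_inv_def)
qed

lemma two_sided_ideal_iff:
  "two_sided_ideal I R \<longleftrightarrow> I \<subseteq> carrier R \<and> \<zero> \<in> I \<and> (\<forall>x\<in>I. \<forall>y\<in>I. x \<oplus> y \<in> I) \<and>
     (\<forall>x\<in>I. \<ominus> x \<in> I) \<and> (\<forall>a\<in>I. \<forall>x\<in>carrier R. x \<otimes> a \<in> I \<and> a \<otimes> x \<in> I)"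
  unfolding two_sided_ideal_def additive_subgroup_iff by blast

lemma idealD:
  assumes "two_sided_ideal I R"
  shows "I \<subseteq> carrier R" "\<zero> \<in> I" "x \<in> I \<Longrightarrow> y \<in> I \<Longrightarrow> x \<oplus> y \<in> I" "x \<in> I \<Longrightarrow> \<ominus> x \<in> I"
    "a \<in> I \<Longrightarrow> z \<in> carrier R \<Longrightarrow> z \<otimes> a \<in> I" "a \<in> I \<Longrightarrow> z \<in> carrier R \<Longrightarrow> a \<otimes> z \<in> I"
  using assms unfolding two_sided_ideal_iff by blast+

lemma ideal_carrier: "two_sided_ideal (carrier R) R"
  unfolding two_sided_ideal_iff by (auto intro: m_closed)

lemma ideal_zero: "two_sided_ideal {\<zero>} R"
  unfolding two_sided_ideal_iff by (auto simp: l_null r_null)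

lemma ideal_Inter:
  assumes "\<A> \<noteq> {}" "\<And>A. A \<in> \<A> \<Longrightarrow> two_sided_ideal A R"
  shows "two_sided_ideal (\<Inter>\<A>) R"
  using assms unfolding two_sided_ideal_iff by blast

lemma ideal_Int: "two_sided_ideal A R \<Longrightarrow> two_sided_ideal B R \<Longrightarrow> two_sided_ideal (A \<inter> B) R"
  using ideal_Inter[of "{A, B}"] by auto

lemma ideal_generated_ideal:
  assumes "X \<subseteq> carrier R"
  shows "two_sided_ideal (ideal_generated R X) R" "X \<subseteq> ideal_generated R X"
proof -
  show "two_sided_ideal (ideal_generated R X) R"
    unfolding ideal_generated_def using assms ideal_carrier by (intro ideal_Inter) auto
  show "X \<subseteq> ideal_generated R X"
    unfolding ideal_generated_def by auto
qed

lemma ideal_generated_least: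
  "two_sided_ideal I R \<Longrightarrow> X \<subseteq> I \<Longrightarrow> ideal_generated R X \<subseteq> I"
  unfolding ideal_generated_def by auto

lemma mem_set_add: "z \<in> A <+> B \<longleftrightarrow> (\<exists>a\<in>A. \<exists>b\<in>B. z = a \<oplus> b)"
  by (auto simp: set_add_def set_mult_def)

lemma ideal_set_add:
  assumes A: "two_sided_ideal A R" and B: "two_sided_ideal B R"
  shows "two_sided_ideal (A <+> B) R" "A \<subseteq> A <+> B" "B \<subseteq> A <+> B"
proof -
  note AD = idealD[OF A] and BD = idealD[OF B]
  have sub: "a \<in> A \<Longrightarrow> a \<in> carrier R" "b \<in> B \<Longrightarrow> b \<in> carrier R" for a b
    using AD(1) BD(1) by auto
  show "A \<subseteq> A <+> B"
    using BD(2) sub by (auto simp: mem_set_add) (metis r_zero)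
  show "B \<subseteq> A <+> B"
    using AD(2) sub by (auto simp: mem_set_add) (metis l_zero)
  show "two_sided_ideal (A <+> B) R"
    unfolding two_sided_ideal_iff
  proof (intro conjI ballI)
    show "A <+> B \<subseteq> carrier R" using sub by (auto simp: mem_set_add)
    show "\<zero> \<in> A <+> B" using \<open>A \<subseteq> A <+> B\<close> AD(2) by auto
  next
    fix x y assume "x \<in> A <+> B" "y \<in> A <+> B"
    then obtain a b a' b' where "a \<in> A" "b \<in> B" "a' \<in> A" "b' \<in> B" and
      xy: "x = a \<oplus> b" "y = a' \<oplus> b'" by (auto simp: mem_set_add)
    moreover have "x \<oplus> y = (a \<oplus> a') \<oplus> (b \<oplus> b')"
      using calculation sub by (simp add: a_ac)
    ultimately show "x \<oplus> y \<in> A <+> B" using AD(3) BD(3) unfolding mem_set_add by metis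
  next
    fix x assume "x \<in> A <+> B"
    then obtain a b where "a \<in> A" "b \<in> B" "x = a \<oplus> b" by (auto simp: mem_set_add)
    moreover have "\<ominus> x = \<ominus> a \<oplus> \<ominus> b" using calculation sub by (simp add: minus_add)
    ultimately show "\<ominus> x \<in> A <+> B" using AD(4) BD(4) unfolding mem_set_add by metis
  next
    fix x z assume "x \<in> A <+> B" and z: "z \<in> carrier R"
    then obtain a b where ab: "a \<in> A" "b \<in> B" "x = a \<oplus> b" by (auto simp: mem_set_add)
    have "z \<otimes> x = z \<otimes> a \<oplus> z \<otimes> b" using ab sub z by (simp add: r_distr)
    then show "z \<otimes> x \<in> A <+> B" using AD(5) BD(5) ab z unfolding mem_set_add by metis
    have "x \<otimes> z = a \<otimes> z \<oplus> b \<otimes> z" using ab sub z by (simp add: l_distr)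
    then show "x \<otimes> z \<in> A <+> B" using AD(6) BD(6) ab z unfolding mem_set_add by metis
  qed
qed

lemma set_add_least:
  "two_sided_ideal C R \<Longrightarrow> A \<subseteq> C \<Longrightarrow> B \<subseteq> C \<Longrightarrow> A <+> B \<subseteq> C"
  using idealD(3)[of C] by (fastforce simp: mem_set_add)

lemma ideal_prod_least:
  assumes "two_sided_ideal C R" "\<And>a b. a \<in> A \<Longrightarrow> b \<in> B \<Longrightarrow> a \<otimes> b \<in> C"
  shows "A \<cdot> B \<subseteq> C"
proof
  fix x assume "x \<in> A \<cdot> B"
  then show "x \<in> C" by induction (auto intro: assms idealD(3)[OF assms(1)])
qed

lemma ideal_prod_ideal:
  assumes A: "two_sided_ideal A R" and B: "two_sided_ideal B R"
  shows "two_sided_ideal (A \<cdot> B) R"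
proof -
  note AD = idealD[OF A] and BD = idealD[OF B]
  have sub: "a \<in> A \<Longrightarrow> a \<in> carrier R" "b \<in> B \<Longrightarrow> b \<in> carrier R" for a b
    using AD(1) BD(1) by auto
  have car: "A \<cdot> B \<subseteq> carrier R"
    by (rule ideal_prod_least[OF ideal_carrier]) (auto intro: m_closed sub)
  show ?thesis
    unfolding two_sided_ideal_iff
  proof (intro conjI ballI)
    show "A \<cdot> B \<subseteq> carrier R" by (rule car)
    show "\<zero> \<in> A \<cdot> B" using ideal_prod.prod[OF AD(2) BD(2), of R] by (simp add: l_null)
    show "x \<oplus> y \<in> A \<cdot> B" if "x \<in> A \<cdot> B" "y \<in> A \<cdot> B" for x y
      using that by (rule ideal_prod.sum)
  next
    fix x assume "x \<in> A \<cdot> B"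
    then show "\<ominus> x \<in> A \<cdot> B"
    proof induction
      case (prod i j)
      then show ?case
        using ideal_prod.prod[OF AD(4)[OF prod(1)] prod(2), of R] by (simp add: l_minus sub)
    next
      case (sum s t)
      then show ?case using car by (simp add: minus_add subsetD ideal_prod.sum)
    qed
  next
    fix x z assume "x \<in> A \<cdot> B" and z: "z \<in> carrier R"
    then show "z \<otimes> x \<in> A \<cdot> B"
    proof induction
      case (prod i j)
      then show ?case
        using ideal_prod.prod[OF AD(5)[OF prod(1) z] prod(2), of R] z by (simp add: m_assoc sub)
    next
      case (sum s t)
      then show ?case using car z by (simp add: r_distr subsetD ideal_prod.sum)
    qed
  next
    fix x z assume "x \<in> A \<cdot> B" and z: "z \<in> carrier R"
    then show "x \<otimes> z \<in> A \<cdot> B"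
    proof induction
      case (prod i j)
      then show ?case
        using ideal_prod.prod[OF prod(1) BD(6)[OF prod(2) z], of R] z by (simp add: m_assoc sub)
    next
      case (sum s t)
      then show ?case using car z by (simp add: l_distr subsetD ideal_prod.sum)
    qed
  qed
qed

lemma ideal_prod_subset_Int:
  assumes A: "two_sided_ideal A R" and B: "two_sided_ideal B R"
  shows "A \<cdot> B \<subseteq> A \<inter> B"
proof (rule ideal_prod_least[OF ideal_Int[OF A B]])
  fix a b assume "a \<in> A" "b \<in> B"
  moreover from this have "a \<in> carrier R" "b \<in> carrier R" using idealD(1) A B by blast+
  ultimately show "a \<otimes> b \<in> A \<inter> B" using idealD(6)[OF A] idealD(5)[OF B] by simp
qed

lemma ideal_list_prod_ideal:
  assumes "\<And>P. P \<in> set Ps \<Longrightarrow> two_sided_ideal P R"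
  shows "two_sided_ideal (ideal_list_prod R Ps) R"
  using assms by (induction Ps rule: induct_list012) (simp_all add: ideal_carrier ideal_prod_ideal)

lemma ideal_list_prod_subset:
  assumes "\<And>P. P \<in> set Ps \<Longrightarrow> two_sided_ideal P R" "Q \<in> set Ps"
  shows "ideal_list_prod R Ps \<subseteq> Q"
  using assms
proof (induction Ps rule: induct_list012)
  case (3 P P' Ps)
  have "P \<cdot> ideal_list_prod R (P' # Ps) \<subseteq> P \<inter> ideal_list_prod R (P' # Ps)"
    using 3(3) by (intro ideal_prod_subset_Int ideal_list_prod_ideal) simp_all
  moreover have "ideal_list_prod R (P' # Ps) \<subseteq> Q" if "Q \<in> set (P' # Ps)"
    using 3(2)[OF _ that] 3(3) by simp
  ultimately show ?case using 3(4) by auto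
qed auto

text \<open>\<open>R/P\<close> is a strongly prime ring.  This is weaker than strong primeness of the ideal \<open>P\<close>,
  which also restricts families of ideals that do not contain \<open>P\<close>.\<close>

definition strongly_prime_over :: "'a set \<Rightarrow> bool" where
  "strongly_prime_over P \<longleftrightarrow> two_sided_ideal P R \<and>
     (\<exists>J. two_sided_ideal J R \<and> P \<subset> J \<and> (\<forall>A. two_sided_ideal A R \<and> P \<subset> A \<longrightarrow> J \<subseteq> A))"

lemma strongly_prime_overE:
  assumes "strongly_prime_over P"
  obtains J where "two_sided_ideal J R" "P \<subset> J"
    "\<forall>A. two_sided_ideal A R \<and> P \<subset> A \<longrightarrow> J \<subseteq> A"
  using assms unfolding strongly_prime_over_def by (elim conjE exE)

lemma strongly_prime_over_ideal: "strongly_prime_over P \<Longrightarrow> two_sided_ideal P R"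
  by (simp add: strongly_prime_over_def)

lemma strongly_prime_over_proper: "strongly_prime_over P \<Longrightarrow> proper_ideal P R"
  using idealD(1) by (fastforce elim: strongly_prime_overE simp: proper_ideal_def strongly_prime_over_ideal)

text \<open>Strong primeness is applied to the family of all ideals strictly above \<open>P\<close>:
  no member lies in \<open>P\<close>, so neither does the intersection, which is therefore the least
  ideal strictly above \<open>P\<close>.\<close>

lemma strongly_prime_imp_over:
  assumes "strongly_prime_ideal P R"
  shows "strongly_prime_over P"
proof -
  from assms have P: "two_sided_ideal P R" "P \<noteq> carrier R"
    by (auto simp: strongly_prime_ideal_def proper_ideal_def)
  let ?\<A> = "{A. two_sided_ideal A R \<and> P \<subset> A}"
  have ne: "carrier R \<in> ?\<A>" using P idealD(1)[OF P(1)] ideal_carrier by auto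
  have "\<not> \<Inter>?\<A> \<subseteq> P"
  proof
    assume "\<Inter>?\<A> \<subseteq> P"
    moreover have "?\<A> \<noteq> {} \<longrightarrow> (\<forall>A\<in>?\<A>. two_sided_ideal A R) \<longrightarrow> \<Inter>?\<A> \<subseteq> P \<longrightarrow> (\<exists>A\<in>?\<A>. A \<subseteq> P)"
      using assms unfolding strongly_prime_ideal_def by (elim conjE) (rule spec)
    ultimately have "\<exists>A\<in>?\<A>. A \<subseteq> P" using ne by (auto simp del: Inter_iff)
    then show False by auto
  qed
  moreover have "two_sided_ideal (\<Inter>?\<A>) R" using ne by (intro ideal_Inter) auto
  ultimately have "two_sided_ideal (\<Inter>?\<A>) R \<and> P \<subset> \<Inter>?\<A> \<and>
      (\<forall>A. two_sided_ideal A R \<and> P \<subset> A \<longrightarrow> \<Inter>?\<A> \<subseteq> A)"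
    by auto
  with P(1) show ?thesis
    unfolding strongly_prime_over_def by (intro conjI) (assumption, rule exI)
qed

text \<open>Every ideal contains \<open>\<zero>\<close>, so a family without a zero member consists
  of ideals strictly above zero, and all of them contain the least one. For the zero ideal the two
  notions therefore agree.\<close>

lemma strongly_prime_ring_iff: "strongly_prime_ring R \<longleftrightarrow> strongly_prime_over {\<zero>}"
proof
  assume "strongly_prime_ring R"
  then show "strongly_prime_over {\<zero>}"
    by (simp add: strongly_prime_ring_def strongly_prime_imp_over)
next
  assume spo: "strongly_prime_over {\<zero>}"
  then obtain J where J: "two_sided_ideal J R" "{\<zero>} \<subset> J"
    "\<forall>A. two_sided_ideal A R \<and> {\<zero>} \<subset> A \<longrightarrow> J \<subseteq> A"
    by (rule strongly_prime_overE)
  show "strongly_prime_ring R"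
    unfolding strongly_prime_ring_def strongly_prime_ideal_def
  proof (intro conjI allI impI)
    show "proper_ideal {\<zero>} R" using spo by (rule strongly_prime_over_proper)
    fix \<A> assume \<A>: "\<A> \<noteq> {}" "\<forall>A\<in>\<A>. two_sided_ideal A R" "\<Inter>\<A> \<subseteq> {\<zero>}"
    show "\<exists>A\<in>\<A>. A \<subseteq> {\<zero>}"
    proof (rule ccontr)
      assume "\<not> (\<exists>A\<in>\<A>. A \<subseteq> {\<zero>})"
      then have "J \<subseteq> A" if "A \<in> \<A>" for A
        using that \<A>(2) idealD(2) by (intro J(3)[rule_format]) auto
      then show False using \<A>(3) J(2) by blast
    qed
  qed
qed

end

section \<open>Rings all of whose ideals are idempotent\<close>

locale idempotent_ideals = nonunital_ring +
  assumes idempotent: "two_sided_ideal I R \<Longrightarrow> I \<subseteq> I \<cdot> I"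
begin

lemma ideal_prod_eq_Int:
  assumes A: "two_sided_ideal A R" and B: "two_sided_ideal B R"
  shows "A \<cdot> B = A \<inter> B"
proof
  show "A \<cdot> B \<subseteq> A \<inter> B" by (rule ideal_prod_subset_Int[OF assms])
  have "A \<inter> B \<subseteq> (A \<inter> B) \<cdot> (A \<inter> B)" by (intro idempotent ideal_Int assms)
  also have "\<dots> \<subseteq> A \<cdot> B"
    by (rule ideal_prod_least[OF ideal_prod_ideal[OF assms]]) (auto intro: ideal_prod.prod)
  finally show "A \<inter> B \<subseteq> A \<cdot> B" .
qed

lemma ideal_list_prod_eq_Inter:
  assumes "Ps \<noteq> []" "\<And>P. P \<in> set Ps \<Longrightarrow> two_sided_ideal P R"
  shows "ideal_list_prod R Ps = \<Inter>(set Ps)"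
  using assms
proof (induction Ps rule: induct_list012)
  case (3 P P' Ps)
  then show ?case
    using ideal_prod_eq_Int[of P "ideal_list_prod R (P' # Ps)"] ideal_list_prod_ideal[of "P' # Ps"]
    by auto
qed auto

text \<open>Under idempotence a product forgets order and repetitions, so lists become finite sets.
  The set has to be nonempty because \<open>\<Inter>{}\<close> is the whole type and not
  \<open>carrier R\<close>.\<close>

lemma finite_product_of_iff:
  assumes "\<And>P. \<Phi> P R \<Longrightarrow> two_sided_ideal P R"
  shows "finite_product_of \<Phi> I R \<longleftrightarrow>
    (\<exists>\<P>. finite \<P> \<and> \<P> \<noteq> {} \<and> (\<forall>P\<in>\<P>. \<Phi> P R) \<and> I = \<Inter>\<P>)"
proof
  assume "finite_product_of \<Phi> I R"
  then obtain Ps where "Ps \<noteq> []" "\<forall>P\<in>set Ps. \<Phi> P R" "I = ideal_list_prod R Ps"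
    unfolding finite_product_of_def by blast
  then show "\<exists>\<P>. finite \<P> \<and> \<P> \<noteq> {} \<and> (\<forall>P\<in>\<P>. \<Phi> P R) \<and> I = \<Inter>\<P>"
    using ideal_list_prod_eq_Inter[of Ps] assms by (intro exI[of _ "set Ps"]) auto
next
  assume "\<exists>\<P>. finite \<P> \<and> \<P> \<noteq> {} \<and> (\<forall>P\<in>\<P>. \<Phi> P R) \<and> I = \<Inter>\<P>"
  then obtain \<P> where "finite \<P>" "\<P> \<noteq> {}" "\<forall>P\<in>\<P>. \<Phi> P R" "I = \<Inter>\<P>" by blast
  moreover obtain Ps where "set Ps = \<P>" using finite_list[OF \<open>finite \<P>\<close>] by blast
  ultimately show "finite_product_of \<Phi> I R"
    unfolding finite_product_of_def
    using ideal_list_prod_eq_Inter[of Ps] assms by (intro exI[of _ Ps]) auto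
qed

text \<open>Intersections are products here, and products distribute over sums. This is the
  distributivity of the ideal lattice.\<close>

lemma ideal_Int_set_add:
  assumes "two_sided_ideal A R" "two_sided_ideal B R" "two_sided_ideal C R"
  shows "A \<inter> (B <+> C) \<subseteq> (A \<inter> B) <+> (A \<inter> C)"
proof -
  have "A \<inter> (B <+> C) = A \<cdot> (B <+> C)"
    by (rule ideal_prod_eq_Int[symmetric]) (intro assms ideal_set_add)+
  also have "\<dots> \<subseteq> (A \<inter> B) <+> (A \<inter> C)"
  proof (rule ideal_prod_least)
    show "two_sided_ideal ((A \<inter> B) <+> (A \<inter> C)) R"
      by (intro assms ideal_set_add ideal_Int)
    fix a x assume a: "a \<in> A" and "x \<in> B <+> C"
    then obtain b c where bc: "b \<in> B" "c \<in> C" "x = b \<oplus> c" by (auto simp: mem_set_add)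
    have car: "a \<in> carrier R" "b \<in> carrier R" "c \<in> carrier R"
      using a bc idealD(1) assms by blast+
    then have "a \<otimes> x = a \<otimes> b \<oplus> a \<otimes> c" using bc by (simp add: r_distr)
    moreover have "a \<otimes> b \<in> A \<inter> B" "a \<otimes> c \<in> A \<inter> C"
      using assms a bc car idealD(5,6) by blast+
    ultimately show "a \<otimes> x \<in> (A \<inter> B) <+> (A \<inter> C)" unfolding mem_set_add by blast
  qed
  finally show ?thesis .
qed

text \<open>The ideals \<open>A\<close> and \<open>B\<close> are replaced by \<open>P <+> A\<close>
  and \<open>P <+> B\<close>, whose intersection lies in \<open>P\<close> by distributivity. The
  criterion speaks only of ideals above \<open>P\<close>, which are the ones that correspond under a
  surjective homomorphism.\<close>

lemma prime_ideal_iff: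
  "prime_ideal P R \<longleftrightarrow> proper_ideal P R \<and>
     (\<forall>A B. two_sided_ideal A R \<longrightarrow> two_sided_ideal B R \<longrightarrow> P \<subseteq> A \<longrightarrow> P \<subseteq> B \<longrightarrow> A \<inter> B \<subseteq> P \<longrightarrow>
        A \<subseteq> P \<or> B \<subseteq> P)"
proof (intro iffI conjI allI impI)
  assume r: "proper_ideal P R \<and>
     (\<forall>A B. two_sided_ideal A R \<longrightarrow> two_sided_ideal B R \<longrightarrow> P \<subseteq> A \<longrightarrow> P \<subseteq> B \<longrightarrow> A \<inter> B \<subseteq> P \<longrightarrow>
        A \<subseteq> P \<or> B \<subseteq> P)"
  show "prime_ideal P R"
    unfolding prime_ideal_def
  proof (intro conjI allI impI)
    show "proper_ideal P R" using r by blast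
    then have P: "two_sided_ideal P R" by (simp add: proper_ideal_def)
    fix A B assume AB: "two_sided_ideal A R" "two_sided_ideal B R" "A \<cdot> B \<subseteq> P"
    have "(P <+> A) \<inter> (P <+> B) \<subseteq> ((P <+> A) \<inter> P) <+> ((P <+> A) \<inter> B)"
      by (intro ideal_Int_set_add ideal_set_add P AB)
    also have "\<dots> \<subseteq> P"
    proof (rule set_add_least[OF P])
      have "(P <+> A) \<inter> B \<subseteq> (B \<inter> P) <+> (B \<inter> A)"
        using ideal_Int_set_add[OF AB(2) P AB(1)] by blast
      also have "\<dots> \<subseteq> P"
        using AB(3) ideal_prod_eq_Int[OF AB(1,2)] by (intro set_add_least[OF P]) auto
      finally show "(P <+> A) \<inter> B \<subseteq> P" .
    qed auto
    finally have "P <+> A \<subseteq> P \<or> P <+> B \<subseteq> P"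
      using ideal_set_add[OF P AB(1)] ideal_set_add[OF P AB(2)]
      by (intro r[THEN conjunct2, rule_format])
    then show "A \<subseteq> P \<or> B \<subseteq> P"
      using ideal_set_add[OF P AB(1)] ideal_set_add[OF P AB(2)] by blast
  qed
next
  fix A B assume P: "prime_ideal P R"
  then show "proper_ideal P R" by (simp add: prime_ideal_def)
  assume "two_sided_ideal A R" "two_sided_ideal B R" "A \<inter> B \<subseteq> P"
  then show "A \<subseteq> P \<or> B \<subseteq> P" using P ideal_prod_eq_Int[of A B] unfolding prime_ideal_def by simp
qed

lemma prime_ideal_Int:
  assumes "prime_ideal P R" "two_sided_ideal A R" "two_sided_ideal B R" "A \<inter> B \<subseteq> P"
  shows "A \<subseteq> P \<or> B \<subseteq> P"
  using assms ideal_prod_eq_Int[of A B] unfolding prime_ideal_def by simp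

text \<open>The factor \<open>carrier R\<close> gives the intersection of the empty family its
  proper value: for \<open>\<A> = {}\<close> the conclusion fails, but so does the hypothesis, as
  \<open>P\<close> is proper.\<close>

lemma prime_ideal_finite_Inter:
  assumes P: "prime_ideal P R" and "finite \<A>" "\<And>A. A \<in> \<A> \<Longrightarrow> two_sided_ideal A R"
    "carrier R \<inter> \<Inter>\<A> \<subseteq> P"
  shows "\<exists>A\<in>\<A>. A \<subseteq> P"
  using assms(2-)
proof (induction \<A> rule: finite_induct)
  case empty
  then show ?case
    using P idealD(1)[of P] by (auto simp: prime_ideal_def proper_ideal_def)
next
  case (insert A \<A>)
  have "two_sided_ideal (carrier R \<inter> \<Inter>\<A>) R"
    using ideal_Inter[of "insert (carrier R) \<A>"] insert.prems(1) ideal_carrier by auto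
  moreover have "A \<inter> (carrier R \<inter> \<Inter>\<A>) \<subseteq> P" using insert.prems(2) by auto
  ultimately have "A \<subseteq> P \<or> carrier R \<inter> \<Inter>\<A> \<subseteq> P"
    using insert.prems(1)[of A] by (intro prime_ideal_Int[OF P]) simp_all
  then show ?case using insert.IH insert.prems(1) by auto
qed

text \<open>Two ideals strictly above \<open>P\<close> both contain the least such ideal, and so
  does their intersection.\<close>

lemma strongly_prime_over_imp_prime:
  assumes "strongly_prime_over P"
  shows "prime_ideal P R"
proof -
  from assms obtain J where "two_sided_ideal J R"
    and J: "P \<subset> J" "\<forall>A. two_sided_ideal A R \<and> P \<subset> A \<longrightarrow> J \<subseteq> A"
    by (rule strongly_prime_overE)
  show ?thesis
    unfolding prime_ideal_iff
  proof (intro conjI allI impI)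
    show "proper_ideal P R" by (rule strongly_prime_over_proper[OF assms])
    fix A B assume AB: "two_sided_ideal A R" "two_sided_ideal B R" "P \<subseteq> A" "P \<subseteq> B" "A \<inter> B \<subseteq> P"
    show "A \<subseteq> P \<or> B \<subseteq> P"
    proof (rule ccontr)
      assume "\<not> (A \<subseteq> P \<or> B \<subseteq> P)"
      with AB have "P \<subset> A" "P \<subset> B" by blast+
      then have "J \<subseteq> A" "J \<subseteq> B" using J(2) AB(1,2) by simp_all
      with AB(5) J(1) show False by blast
    qed
  qed
qed

text \<open>The point is the modular law: if \<open>A \<inter> B\<close> is not contained in a minimal \<open>Q\<close>, where \<open>B\<close> is the
  intersection of the remaining components of \<open>J = \<Inter>\<A>\<close>, then the smallest ideal \<open>M\<close> above \<open>Q\<close>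
  satisfies \<open>M \<inter> B \<subseteq> (Q + (A \<inter> B)) \<inter> B \<subseteq> J + (A \<inter> B) \<subseteq> A\<close>.\<close>

lemma strongly_prime_over_imp_strongly_prime:
  assumes dec: "\<And>I. proper_ideal I R \<Longrightarrow>
      \<exists>\<P>. finite \<P> \<and> \<P> \<noteq> {} \<and> (\<forall>P\<in>\<P>. strongly_prime_over P) \<and> I = \<Inter>\<P>"
    and P: "strongly_prime_over P"
  shows "strongly_prime_ideal P R"
  unfolding strongly_prime_ideal_def
proof (intro conjI allI impI)
  show proper: "proper_ideal P R" using P by (rule strongly_prime_over_proper)
  fix \<A> assume \<A>: "\<A> \<noteq> {}" "\<forall>A\<in>\<A>. two_sided_ideal A R" "\<Inter>\<A> \<subseteq> P"
  have J: "two_sided_ideal (\<Inter>\<A>) R" using \<A> by (intro ideal_Inter) auto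
  have "\<Inter>\<A> \<noteq> carrier R"
    using \<A>(3) proper idealD(1)[of P] by (auto simp: proper_ideal_def)
  with J obtain \<Q> where \<Q>: "finite \<Q>" "\<Q> \<noteq> {}" "\<And>Q. Q \<in> \<Q> \<Longrightarrow> strongly_prime_over Q" "\<Inter>\<A> = \<Inter>\<Q>"
    using dec[of "\<Inter>\<A>"] unfolding proper_ideal_def by blast
  have \<Q>I: "two_sided_ideal Q R" if "Q \<in> \<Q>" for Q
    using \<Q>(3)[OF that] by (simp add: strongly_prime_over_def)
  have "\<exists>Q\<in>\<Q>. Q \<subseteq> P"
    using \<Q> \<Q>I \<A>(3) by (intro prime_ideal_finite_Inter[OF strongly_prime_over_imp_prime[OF P]]) auto
  then have "{Q \<in> \<Q>. Q \<subseteq> P} \<noteq> {}" by auto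
  then obtain Q where Q: "Q \<in> \<Q>" "Q \<subseteq> P" and
    min: "\<And>Q'. Q' \<in> \<Q> \<Longrightarrow> Q' \<subseteq> P \<Longrightarrow> Q' \<subseteq> Q \<Longrightarrow> Q = Q'"
    using finite_has_minimal[of "{Q \<in> \<Q>. Q \<subseteq> P}"] \<Q>(1) by auto
  have Qprime: "prime_ideal Q R" using \<Q>(3)[OF Q(1)] by (rule strongly_prime_over_imp_prime)
  \<comment> \<open>Components above \<open>Q\<close> are redundant next to \<open>Q\<close>, so
    \<open>Q \<inter> B\<close> still lies in \<open>\<Inter>\<A>\<close>. With them removed,
    minimality of \<open>Q\<close> among the components below \<open>P\<close> prevents
    \<open>B \<subseteq> Q\<close>.\<close>
  define \<Q>' where "\<Q>' = {Q' \<in> \<Q>. \<not> Q \<subseteq> Q'}"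
  define B where "B = carrier R \<inter> \<Inter>\<Q>'"
  have B: "two_sided_ideal B R"
    unfolding B_def \<Q>'_def using ideal_Inter[of "insert (carrier R) {Q' \<in> \<Q>. \<not> Q \<subseteq> Q'}"] \<Q>I ideal_carrier
    by auto
  have BQ: "Q \<inter> B \<subseteq> \<Inter>\<A>" unfolding \<Q>(4) B_def \<Q>'_def by blast
  have BnQ: "\<not> B \<subseteq> Q"
  proof
    assume "B \<subseteq> Q"
    then have "\<exists>Q'\<in>\<Q>'. Q' \<subseteq> Q"
      unfolding B_def using \<Q>(1) \<Q>I by (intro prime_ideal_finite_Inter[OF Qprime]) (auto simp: \<Q>'_def)
    then show False using min Q(2) unfolding \<Q>'_def by blast
  qed
  from \<Q>(3)[OF Q(1)] obtain M where M: "two_sided_ideal M R" "Q \<subset> M"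
    "\<forall>A. two_sided_ideal A R \<and> Q \<subset> A \<longrightarrow> M \<subseteq> A"
    by (rule strongly_prime_overE)
  show "\<exists>A\<in>\<A>. A \<subseteq> P"
  proof (rule ccontr)
    assume none: "\<not> (\<exists>A\<in>\<A>. A \<subseteq> P)"
    have "M \<inter> B \<subseteq> A" if A: "A \<in> \<A>" for A
    proof -
      have AI: "two_sided_ideal A R" using A \<A>(2) by blast
      have "\<not> A \<inter> B \<subseteq> Q"
        using prime_ideal_Int[OF Qprime AI B] none A Q(2) BnQ by blast
      then have "M \<subseteq> Q <+> (A \<inter> B)"
        using ideal_set_add[OF \<Q>I[OF Q(1)] ideal_Int[OF AI B]] by (intro M(3)[rule_format]) auto
      then have "M \<inter> B \<subseteq> (B \<inter> Q) <+> (B \<inter> (A \<inter> B))"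
        using ideal_Int_set_add[OF B \<Q>I[OF Q(1)] ideal_Int[OF AI B]] by blast
      also have "\<dots> \<subseteq> A" using BQ A by (intro set_add_least[OF AI]) auto
      finally show ?thesis .
    qed
    then have "M \<inter> B \<subseteq> \<Inter>\<A>" by (rule Inter_greatest)
    also have "\<dots> \<subseteq> Q" unfolding \<Q>(4) using Q(1) by (rule Inter_lower)
    finally show False using prime_ideal_Int[OF Qprime M(1) B] M(2) BnQ by blast
  qed
qed

text \<open>A prime ideal contains the finite intersection \<open>{\<zero>}\<close> and hence some
  member of \<open>\<P>\<close>. So minimal primes occur among the members, and each member contains
  a minimal member of the finite set, which is a minimal prime.\<close>

lemma minimal_primes_of_zero:
  assumes fin: "finite \<P>" and prime: "\<And>P. P \<in> \<P> \<Longrightarrow> prime_ideal P R"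
    and zero: "\<Inter>\<P> = {\<zero>}"
  shows "{P. minimal_prime_ideal P R} \<subseteq> \<P>"
    and "Q \<in> \<P> \<Longrightarrow> \<exists>P. minimal_prime_ideal P R \<and> P \<subseteq> Q"
proof -
  have ideal: "two_sided_ideal P R" if "prime_ideal P R" for P
    using that by (simp add: prime_ideal_def proper_ideal_def)
  have below: "\<exists>P\<in>\<P>. P \<subseteq> Q" if Q: "prime_ideal Q R" for Q
  proof (rule prime_ideal_finite_Inter[OF Q fin])
    show "two_sided_ideal A R" if "A \<in> \<P>" for A using prime[OF that] by (rule ideal)
    show "carrier R \<inter> \<Inter>\<P> \<subseteq> Q" unfolding zero using idealD(2)[OF ideal[OF Q]] by simp
  qed
  show "{P. minimal_prime_ideal P R} \<subseteq> \<P>"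
  proof
    fix Q assume "Q \<in> {P. minimal_prime_ideal P R}"
    then have Q: "prime_ideal Q R" "\<And>P. prime_ideal P R \<Longrightarrow> P \<subseteq> Q \<Longrightarrow> P = Q"
      by (auto simp: minimal_prime_ideal_def)
    from below[OF Q(1)] obtain P where "P \<in> \<P>" "P \<subseteq> Q" by blast
    with Q(2)[OF prime] show "Q \<in> \<P>" by blast
  qed
  assume "Q \<in> \<P>"
  then have "\<exists>P\<in>{P \<in> \<P>. P \<subseteq> Q}. \<forall>P'\<in>{P \<in> \<P>. P \<subseteq> Q}. P' \<subseteq> P \<longrightarrow> P = P'"
    using fin by (intro finite_has_minimal) auto
  then obtain P where "P \<in> {P \<in> \<P>. P \<subseteq> Q}"
    and min: "\<forall>P'\<in>{P \<in> \<P>. P \<subseteq> Q}. P' \<subseteq> P \<longrightarrow> P = P'"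
    by (rule bexE)
  then have P: "P \<in> \<P>" "P \<subseteq> Q" by simp_all
  have "minimal_prime_ideal P R"
    unfolding minimal_prime_ideal_def
  proof (intro conjI allI impI)
    show "prime_ideal P R" using P(1) by (rule prime)
    fix P' assume P': "prime_ideal P' R" "P' \<subseteq> P"
    obtain P'' where P'': "P'' \<in> \<P>" "P'' \<subseteq> P'" using below[OF P'(1)] by (rule bexE)
    then have "P = P''" using min P(2) P'(2) by simp
    then show "P' = P" using P''(2) P'(2) by simp
  qed
  with P(2) show "\<exists>P. minimal_prime_ideal P R \<and> P \<subseteq> Q" by blast
qed

end

section \<open>Surjective homomorphisms and quotients\<close>

lemma abelian_group_image:
  assumes R: "abelian_group R" and image: "h ` carrier R = carrier S"
    and add: "\<And>x y. x \<in> carrier R \<Longrightarrow> y \<in> carrier R \<Longrightarrow> h (x \<oplus>\<^bsub>R\<^esub> y) = h x \<oplus>\<^bsub>S\<^esub> h y"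
    and zero: "h \<zero>\<^bsub>R\<^esub> = \<zero>\<^bsub>S\<^esub>"
  shows "abelian_group S"
proof -
  interpret R: abelian_group R by (rule R)
  show ?thesis
  proof (rule abelian_groupI; (unfold image[symmetric])?)
    show "x \<oplus>\<^bsub>S\<^esub> y \<in> h ` carrier R" if "x \<in> h ` carrier R" "y \<in> h ` carrier R" for x y
      using that by (auto simp: add[symmetric])
    show "\<zero>\<^bsub>S\<^esub> \<in> h ` carrier R" by (metis zero R.zero_closed imageI)
    show "x \<oplus>\<^bsub>S\<^esub> y \<oplus>\<^bsub>S\<^esub> z = x \<oplus>\<^bsub>S\<^esub> (y \<oplus>\<^bsub>S\<^esub> z)"
      if "x \<in> h ` carrier R" "y \<in> h ` carrier R" "z \<in> h ` carrier R" for x y z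
      using that by (auto simp: add[symmetric] R.a_assoc)
    show "x \<oplus>\<^bsub>S\<^esub> y = y \<oplus>\<^bsub>S\<^esub> x" if "x \<in> h ` carrier R" "y \<in> h ` carrier R" for x y
      using that by (auto simp: add[symmetric] R.a_comm)
    show "\<zero>\<^bsub>S\<^esub> \<oplus>\<^bsub>S\<^esub> x = x" if "x \<in> h ` carrier R" for x
      using that by (auto simp: add[symmetric] zero[symmetric])
    show "\<exists>y\<in>h ` carrier R. y \<oplus>\<^bsub>S\<^esub> x = \<zero>\<^bsub>S\<^esub>" if "x \<in> h ` carrier R" for x
      using that by (auto simp: add[symmetric] zero[symmetric] R.l_neg intro!: bexI[of _ "\<ominus>\<^bsub>R\<^esub> _"])
  qed
qed

locale surjective_hom = R: nonunital_ring R + S: nonunital_ring S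
  for R (structure) and S (structure) and h +
  assumes image: "h ` carrier R = carrier S"
    and hom_add: "x \<in> carrier R \<Longrightarrow> y \<in> carrier R \<Longrightarrow> h (x \<oplus>\<^bsub>R\<^esub> y) = h x \<oplus>\<^bsub>S\<^esub> h y"
    and hom_mult: "x \<in> carrier R \<Longrightarrow> y \<in> carrier R \<Longrightarrow> h (x \<otimes>\<^bsub>R\<^esub> y) = h x \<otimes>\<^bsub>S\<^esub> h y"
begin

lemma hom_closed [simp]: "x \<in> carrier R \<Longrightarrow> h x \<in> carrier S"
  using image by blast

lemma hom_zero [simp]: "h \<zero>\<^bsub>R\<^esub> = \<zero>\<^bsub>S\<^esub>"
  using hom_add[of "\<zero>\<^bsub>R\<^esub>" "\<zero>\<^bsub>R\<^esub>"] hom_closed[OF R.zero_closed]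
  by (simp add: S.add.r_cancel_one')

lemma hom_minus: "x \<in> carrier R \<Longrightarrow> h (\<ominus>\<^bsub>R\<^esub> x) = \<ominus>\<^bsub>S\<^esub> h x"
  using hom_add[of "\<ominus>\<^bsub>R\<^esub> x" x] by (intro S.minus_equality[symmetric]) (simp_all add: R.l_neg)

definition preimage :: "'c set \<Rightarrow> 'a set" where
  "preimage J = {x \<in> carrier R. h x \<in> J}"

lemma preimage_ideal: "two_sided_ideal J S \<Longrightarrow> two_sided_ideal (preimage J) R"
  unfolding R.two_sided_ideal_iff S.two_sided_ideal_iff preimage_def
  by (auto simp: hom_add hom_mult hom_minus R.m_closed)

lemma image_ideal: "two_sided_ideal I R \<Longrightarrow> two_sided_ideal (h ` I) S"
proof -
  assume I: "two_sided_ideal I R"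
  note ID = R.idealD[OF I]
  have car: "x \<in> carrier R" if "x \<in> I" for x using ID(1) that by blast
  show ?thesis
    unfolding S.two_sided_ideal_iff
  proof (intro conjI ballI)
    show "h ` I \<subseteq> carrier S" using car by auto
    show "\<zero>\<^bsub>S\<^esub> \<in> h ` I" using imageI[OF ID(2), of h] by simp
    show "x \<oplus>\<^bsub>S\<^esub> y \<in> h ` I" if "x \<in> h ` I" "y \<in> h ` I" for x y
      using that by (auto simp: hom_add[symmetric] car ID(3))
    show "\<ominus>\<^bsub>S\<^esub> x \<in> h ` I" if "x \<in> h ` I" for x
      using that by (auto simp: hom_minus[symmetric] car ID(4))
    fix a z assume a: "a \<in> h ` I" and "z \<in> carrier S"
    then obtain w where w: "w \<in> carrier R" "z = h w" using image by blast
    show "z \<otimes>\<^bsub>S\<^esub> a \<in> h ` I" using a w by (auto simp: hom_mult[symmetric] car ID(5))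
    show "a \<otimes>\<^bsub>S\<^esub> z \<in> h ` I" using a w by (auto simp: hom_mult[symmetric] car ID(6))
  qed
qed

lemma image_preimage: "J \<subseteq> carrier S \<Longrightarrow> h ` preimage J = J"
  by (fastforce simp: preimage_def image[symmetric])

lemma preimage_mono_iff:
  assumes "J \<subseteq> carrier S" "J' \<subseteq> carrier S"
  shows "preimage J \<subseteq> preimage J' \<longleftrightarrow> J \<subseteq> J'"
proof
  assume "preimage J \<subseteq> preimage J'"
  then have "h ` preimage J \<subseteq> h ` preimage J'" by blast
  then show "J \<subseteq> J'" using assms by (simp add: image_preimage)
qed (auto simp: preimage_def)

lemma preimage_Int: "preimage (J \<inter> J') = preimage J \<inter> preimage J'"
  by (auto simp: preimage_def)

lemma preimage_carrier: "preimage (carrier S) = carrier R"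
  by (auto simp: preimage_def)

lemma kernel_subset: "two_sided_ideal J S \<Longrightarrow> preimage {\<zero>\<^bsub>S\<^esub>} \<subseteq> preimage J"
  using S.idealD(2) by (auto simp: preimage_def)

lemma preimage_image:
  assumes I: "two_sided_ideal I R" and ker: "preimage {\<zero>\<^bsub>S\<^esub>} \<subseteq> I"
  shows "preimage (h ` I) = I"
proof
  note ID = R.idealD[OF I]
  show "I \<subseteq> preimage (h ` I)" using ID(1) by (auto simp: preimage_def)
  show "preimage (h ` I) \<subseteq> I"
  proof
    fix x assume "x \<in> preimage (h ` I)"
    then obtain y where y: "y \<in> I" "x \<in> carrier R" "h x = h y" by (auto simp: preimage_def)
    then have yc: "y \<in> carrier R" using ID(1) by blast
    have "x \<oplus>\<^bsub>R\<^esub> \<ominus>\<^bsub>R\<^esub> y \<in> preimage {\<zero>\<^bsub>S\<^esub>}"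
      using y yc by (simp add: preimage_def hom_add hom_minus S.r_neg)
    then have "x \<oplus>\<^bsub>R\<^esub> \<ominus>\<^bsub>R\<^esub> y \<oplus>\<^bsub>R\<^esub> y \<in> I" using ker y(1) ID(3) by blast
    then show "x \<in> I" using y yc by (simp add: R.a_assoc R.l_neg)
  qed
qed

lemma ideal_above_preimage:
  assumes "two_sided_ideal P S" "two_sided_ideal I R" "preimage P \<subseteq> I"
  shows "\<exists>J. two_sided_ideal J S \<and> I = preimage J"
  using image_ideal[OF assms(2)] preimage_image[OF assms(2) order_trans[OF kernel_subset[OF assms(1)] assms(3)]]
  by metis

lemma proper_preimage_iff:
  assumes "two_sided_ideal J S"
  shows "proper_ideal (preimage J) R \<longleftrightarrow> proper_ideal J S"
  using preimage_ideal[OF assms] assms preimage_mono_iff[of "carrier S" J] S.idealD(1)[OF assms]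
    preimage_carrier by (auto simp: proper_ideal_def)

text \<open>The property concerns only the ordered set of ideals above \<open>P\<close>, and
  \<open>preimage\<close> is an order isomorphism from the ideals of \<open>S\<close> onto the
  ideals of \<open>R\<close> above the kernel.\<close>

lemma strongly_prime_over_preimage_iff:
  assumes P: "two_sided_ideal P S"
  shows "R.strongly_prime_over (preimage P) \<longleftrightarrow> S.strongly_prime_over P"
proof -
  have ss: "preimage P \<subset> preimage A \<longleftrightarrow> P \<subset> A" if "two_sided_ideal A S" for A
    using preimage_mono_iff[of P A] preimage_mono_iff[of A P] S.idealD(1) P that by auto
  have all: "(\<forall>A. two_sided_ideal A R \<and> preimage P \<subset> A \<longrightarrow> preimage J \<subseteq> A) \<longleftrightarrow>
      (\<forall>A. two_sided_ideal A S \<and> P \<subset> A \<longrightarrow> J \<subseteq> A)" if J: "two_sided_ideal J S" for J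
  proof (intro iffI allI impI)
    fix A assume "\<forall>A. two_sided_ideal A R \<and> preimage P \<subset> A \<longrightarrow> preimage J \<subseteq> A"
      and "two_sided_ideal A S \<and> P \<subset> A"
    then have "two_sided_ideal A S" "preimage J \<subseteq> preimage A"
      using preimage_ideal[of A] ss[of A] by auto
    then show "J \<subseteq> A" using preimage_mono_iff[of J A] S.idealD(1) J by auto
  next
    fix A assume *: "\<forall>A. two_sided_ideal A S \<and> P \<subset> A \<longrightarrow> J \<subseteq> A"
      and A: "two_sided_ideal A R \<and> preimage P \<subset> A"
    then obtain A' where A': "two_sided_ideal A' S" "A = preimage A'"
      using ideal_above_preimage[OF P, of A] by auto
    with A ss have "P \<subset> A'" by blast
    with * A' have "J \<subseteq> A'" by blast
    then show "preimage J \<subseteq> A" using A' by (auto simp: preimage_def)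
  qed
  show ?thesis
  proof
    assume "R.strongly_prime_over (preimage P)"
    then obtain J where J: "two_sided_ideal J R" "preimage P \<subset> J"
      "\<forall>A. two_sided_ideal A R \<and> preimage P \<subset> A \<longrightarrow> J \<subseteq> A"
      by (rule R.strongly_prime_overE)
    obtain J' where J': "two_sided_ideal J' S" "J = preimage J'"
      using J(2) ideal_above_preimage[OF P J(1)] by auto
    have "\<forall>A. two_sided_ideal A S \<and> P \<subset> A \<longrightarrow> J' \<subseteq> A"
      using J(3) all[OF J'(1)] J'(2) by simp
    moreover have "P \<subset> J'" using J(2) J' ss by blast
    ultimately show "S.strongly_prime_over P"
      unfolding S.strongly_prime_over_def using P J'(1) by blast
  next
    assume "S.strongly_prime_over P"
    then obtain J where J: "two_sided_ideal J S" "P \<subset> J"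
      "\<forall>A. two_sided_ideal A S \<and> P \<subset> A \<longrightarrow> J \<subseteq> A"
      by (rule S.strongly_prime_overE)
    have "two_sided_ideal (preimage J) R \<and> preimage P \<subset> preimage J \<and>
        (\<forall>A. two_sided_ideal A R \<and> preimage P \<subset> A \<longrightarrow> preimage J \<subseteq> A)"
      using all[OF J(1)] J(3) preimage_ideal[OF J(1)] ss[OF J(1)] J(2) by simp
    then show "R.strongly_prime_over (preimage P)"
      unfolding R.strongly_prime_over_def using preimage_ideal[OF P]
      by (intro conjI) (assumption, rule exI)
  qed
qed

text \<open>Idempotence in both rings allows primeness to be tested by intersections of ideals above
  \<open>P\<close>. Such ideals are preimages, and \<open>preimage\<close> commutes with
  intersections.\<close>

lemma prime_preimage_iff:
  assumes R: "idempotent_ideals R" and S: "idempotent_ideals S" and P: "two_sided_ideal P S"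
  shows "prime_ideal (preimage P) R \<longleftrightarrow> prime_ideal P S"
  unfolding idempotent_ideals.prime_ideal_iff[OF R] idempotent_ideals.prime_ideal_iff[OF S]
    proper_preimage_iff[OF P]
proof (intro conj_cong refl iffI allI impI)
  note sub = S.idealD(1)
  fix A B assume *: "\<forall>A B. two_sided_ideal A R \<longrightarrow> two_sided_ideal B R \<longrightarrow> preimage P \<subseteq> A \<longrightarrow>
      preimage P \<subseteq> B \<longrightarrow> A \<inter> B \<subseteq> preimage P \<longrightarrow> A \<subseteq> preimage P \<or> B \<subseteq> preimage P"
    and AB: "two_sided_ideal A S" "two_sided_ideal B S" "P \<subseteq> A" "P \<subseteq> B" "A \<inter> B \<subseteq> P"
  have "preimage A \<subseteq> preimage P \<or> preimage B \<subseteq> preimage P"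
    by (rule *[rule_format]) (use AB preimage_ideal in \<open>auto simp: preimage_def\<close>)
  then show "A \<subseteq> P \<or> B \<subseteq> P"
    using preimage_mono_iff sub[OF AB(1)] sub[OF AB(2)] sub[OF P] by simp
next
  fix A B assume *: "\<forall>A B. two_sided_ideal A S \<longrightarrow> two_sided_ideal B S \<longrightarrow> P \<subseteq> A \<longrightarrow>
      P \<subseteq> B \<longrightarrow> A \<inter> B \<subseteq> P \<longrightarrow> A \<subseteq> P \<or> B \<subseteq> P"
    and AB: "two_sided_ideal A R" "two_sided_ideal B R" "preimage P \<subseteq> A" "preimage P \<subseteq> B"
      "A \<inter> B \<subseteq> preimage P"
  obtain A' where A': "two_sided_ideal A' S" "A = preimage A'"
    using ideal_above_preimage[OF P AB(1) AB(3)] by auto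
  obtain B' where B': "two_sided_ideal B' S" "B = preimage B'"
    using ideal_above_preimage[OF P AB(2) AB(4)] by auto
  note sub = S.idealD(1)[OF A'(1)] S.idealD(1)[OF B'(1)] S.idealD(1)[OF P]
  have "A' \<inter> B' \<subseteq> P"
    using AB(5) sub preimage_mono_iff[of "A' \<inter> B'" P] unfolding A' B' preimage_Int by blast
  moreover have "P \<subseteq> A'" "P \<subseteq> B'"
    using AB(3,4) sub preimage_mono_iff unfolding A' B' by blast+
  ultimately have "A' \<subseteq> P \<or> B' \<subseteq> P" using * A'(1) B'(1) by blast
  then show "A \<subseteq> preimage P \<or> B \<subseteq> preimage P"
    unfolding A' B' by (auto simp: preimage_def)
qed

end

text \<open>The ring axioms are transported to the target, of which only compatibility with
  \<open>h\<close> is known. In this way quotients become rings.\<close>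

lemma nonunital_ring_image:
  assumes R: "nonunital_ring R" and image: "h ` carrier R = carrier S"
    and add: "\<And>x y. x \<in> carrier R \<Longrightarrow> y \<in> carrier R \<Longrightarrow> h (x \<oplus>\<^bsub>R\<^esub> y) = h x \<oplus>\<^bsub>S\<^esub> h y"
    and mult: "\<And>x y. x \<in> carrier R \<Longrightarrow> y \<in> carrier R \<Longrightarrow> h (x \<otimes>\<^bsub>R\<^esub> y) = h x \<otimes>\<^bsub>S\<^esub> h y"
    and zero: "h \<zero>\<^bsub>R\<^esub> = \<zero>\<^bsub>S\<^esub>"
  shows "surjective_hom R S h"
proof -
  interpret R: nonunital_ring R by (rule R)
  have "abelian_group S"
    by (rule abelian_group_image[OF R.abelian_group_axioms image add zero])
  moreover have "nonunital_ring_axioms S"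
  proof (unfold_locales; (unfold image[symmetric])?)
    show "x \<otimes>\<^bsub>S\<^esub> y \<in> h ` carrier R" if "x \<in> h ` carrier R" "y \<in> h ` carrier R" for x y
      using that by (auto simp: mult[symmetric] R.m_closed)
    show "x \<otimes>\<^bsub>S\<^esub> y \<otimes>\<^bsub>S\<^esub> z = x \<otimes>\<^bsub>S\<^esub> (y \<otimes>\<^bsub>S\<^esub> z)"
      if "x \<in> h ` carrier R" "y \<in> h ` carrier R" "z \<in> h ` carrier R" for x y z
      using that by (auto simp: mult[symmetric] R.m_assoc R.m_closed)
    show "(x \<oplus>\<^bsub>S\<^esub> y) \<otimes>\<^bsub>S\<^esub> z = x \<otimes>\<^bsub>S\<^esub> z \<oplus>\<^bsub>S\<^esub> y \<otimes>\<^bsub>S\<^esub> z"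
      if "x \<in> h ` carrier R" "y \<in> h ` carrier R" "z \<in> h ` carrier R" for x y z
      using that by (auto simp: mult[symmetric] add[symmetric] R.l_distr R.m_closed)
    show "z \<otimes>\<^bsub>S\<^esub> (x \<oplus>\<^bsub>S\<^esub> y) = z \<otimes>\<^bsub>S\<^esub> x \<oplus>\<^bsub>S\<^esub> z \<otimes>\<^bsub>S\<^esub> y"
      if "x \<in> h ` carrier R" "y \<in> h ` carrier R" "z \<in> h ` carrier R" for x y z
      using that by (auto simp: mult[symmetric] add[symmetric] R.r_distr R.m_closed)
  qed
  ultimately show ?thesis
    by (intro surjective_hom.intro R nonunital_ring.intro surjective_hom_axioms.intro image add mult)
qed

section \<open>Residue class rings\<close>

context nonunital_ring
begin

lemma coset_eq_iff:
  assumes "additive_subgroup I R" "x \<in> carrier R" "y \<in> carrier R"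
  shows "I +> x = I +> y \<longleftrightarrow> x \<oplus> \<ominus> y \<in> I"
proof -
  interpret I: abelian_subgroup I R
    by (rule abelian_subgroupI3[OF assms(1)]) (rule abelian_group_axioms)
  have xy: "x \<oplus> \<ominus> y \<in> carrier R" using assms(2,3) by simp
  show ?thesis
  proof
    assume "I +> x = I +> y"
    then have "I +> (x \<oplus> \<ominus> y) = I" by (rule a_coset_add_inv2) (use assms I.a_subset in auto)
    then show "x \<oplus> \<ominus> y \<in> I" using xy I.a_subgroup by (rule a_coset_join1)
  next
    assume "x \<oplus> \<ominus> y \<in> I"
    then have "I +> (x \<oplus> \<ominus> y) = I" by (intro a_coset_join2 xy I.a_subgroup)
    then show "I +> x = I +> y" by (rule a_coset_add_inv1) (use assms I.a_subset in auto)
  qed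
qed

lemma coset_eq_self_iff:
  assumes I: "additive_subgroup I R" and "x \<in> carrier R"
  shows "I +> x = I \<longleftrightarrow> x \<in> I"
  using a_coset_join1[of I x] a_coset_join2[of x I] assms unfolding additive_subgroup_def by auto

lemma mem_coset_iff:
  assumes I: "additive_subgroup I R" and "x \<in> carrier R"
  shows "y \<in> I +> x \<longleftrightarrow> y \<in> carrier R \<and> I +> y = I +> x"
proof -
  interpret I: abelian_subgroup I R
    by (rule abelian_subgroupI3[OF I]) (rule abelian_group_axioms)
  show ?thesis
  proof
    assume y: "y \<in> I +> x"
    then show "y \<in> carrier R \<and> I +> y = I +> x"
      using a_repr_independence[OF y assms(2) I.a_subgroup]
        a_r_coset_subset_G[OF I.a_subset assms(2)] by auto
  next
    assume "y \<in> carrier R \<and> I +> y = I +> x"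
    then show "y \<in> I +> x" using I.a_rcos_self[of y] by simp
  qed
qed

lemma coset_add:
  assumes "additive_subgroup I R" "x \<in> carrier R" "y \<in> carrier R"
  shows "(I +> x) <+> (I +> y) = I +> (x \<oplus> y)"
  by (rule abelian_subgroup.a_rcos_sum[OF abelian_subgroupI3[OF assms(1)] assms(2,3)])
    (rule abelian_group_axioms)

text \<open>\<open>rcoset_mult\<close> is a union of cosets over all products of representatives, so
  the equation amounts to the coincidence of all these cosets.\<close>

lemma coset_mult:
  assumes I: "two_sided_ideal I R" and x: "x \<in> carrier R" and y: "y \<in> carrier R"
  shows "[mod I:] (I +> x) \<Otimes> (I +> y) = I +> (x \<otimes> y)"
proof -
  have Ia: "additive_subgroup I R" using I by (simp add: two_sided_ideal_def)
  note ID = idealD[OF I]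
  have "I +> (a \<otimes> b) = I +> (x \<otimes> y)" if "a \<in> I +> x" "b \<in> I +> y" for a b
  proof -
    have ab: "a \<in> carrier R" "b \<in> carrier R" "a \<oplus> \<ominus> x \<in> I" "b \<oplus> \<ominus> y \<in> I"
      using that x y by (auto simp: mem_coset_iff[OF Ia] coset_eq_iff[OF Ia])
    have "a \<otimes> b \<oplus> \<ominus> (x \<otimes> y) = (a \<oplus> \<ominus> x) \<otimes> b \<oplus> x \<otimes> (b \<oplus> \<ominus> y)"
      using ab x y
      by (simp add: l_distr r_distr l_minus r_minus m_closed a_assoc r_neg1 a_lcomm r_neg2)
    also have "\<dots> \<in> I" using ID(3)[OF ID(6)[OF ab(3,2)] ID(5)[OF ab(4) x]] .
    finally show ?thesis using ab x y by (simp add: coset_eq_iff[OF Ia] m_closed)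
  qed
  moreover have "x \<in> I +> x" "y \<in> I +> y" using x y by (simp_all add: mem_coset_iff[OF Ia])
  ultimately show ?thesis unfolding rcoset_mult_def by fast
qed

text \<open>The target is described by four record fields so that one statement covers both
  \<open>R Quot I\<close> and \<open>quotient_algebra\<close>, which are records of different
  types.\<close>

lemma surjective_hom_coset:
  assumes I: "two_sided_ideal I R"
    and S: "carrier S = a_rcosets I" "monoid.mult S = rcoset_mult R I" "add S = set_add R" "zero S = I"
  shows "surjective_hom R S (\<lambda>x. I +> x)"
proof (rule nonunital_ring_image)
  have Ia: "additive_subgroup I R" using I by (simp add: two_sided_ideal_def)
  show "nonunital_ring R" by (rule nonunital_ring_axioms)
  show "(+>) I ` carrier R = carrier S" by (auto simp: S A_RCOSETS_def')
  show "I +> \<zero> = \<zero>\<^bsub>S\<^esub>" using idealD(1)[OF I] by (simp add: S)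
qed (use I in \<open>simp_all add: S coset_mult coset_add two_sided_ideal_def\<close>)

lemma surjective_hom_Quot:
  "two_sided_ideal I R \<Longrightarrow> surjective_hom R (R Quot I) (\<lambda>x. I +> x)"
  by (rule surjective_hom_coset) (simp_all add: FactRing_def)

end

lemma quotient_algebra_simps:
  "carrier (quotient_algebra A I) = a_rcosets\<^bsub>A\<^esub> I"
  "monoid.mult (quotient_algebra A I) = rcoset_mult A I"
  "add (quotient_algebra A I) = set_add A"
  "zero (quotient_algebra A I) = I"
  "c \<odot>\<^bsub>quotient_algebra A I\<^esub> B = (\<Union>b\<in>B. I +>\<^bsub>A\<^esub> (c \<odot>\<^bsub>A\<^esub> b))"
  by (simp_all add: quotient_algebra_def FactRing_def ring.defs module.defs)

lemma surjective_hom_quotient_algebra: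
  assumes "nonunital_ring A" "two_sided_ideal I A"
  shows "surjective_hom A (quotient_algebra A I) (\<lambda>x. I +>\<^bsub>A\<^esub> x)"
  by (rule nonunital_ring.surjective_hom_coset[OF assms]) (simp_all add: quotient_algebra_simps)

text \<open>The first isomorphism theorem, including scalars. On cosets, scalar multiplication is a
  union over representatives; it collapses to one coset because \<open>f\<close> respects scalars
  and has kernel \<open>I\<close>.\<close>

lemma quotient_algebra_isomorphic:
  fixes A :: "('k, 'a) module" and T :: "('k, 'b) module"
  assumes "surjective_hom A T f"
    and smult_closed: "\<And>c x. x \<in> carrier A \<Longrightarrow> c \<odot>\<^bsub>A\<^esub> x \<in> carrier A"
    and smult: "\<And>c x. x \<in> carrier A \<Longrightarrow> f (c \<odot>\<^bsub>A\<^esub> x) = c \<odot>\<^bsub>T\<^esub> f x"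
    and ker: "\<And>x. x \<in> carrier A \<Longrightarrow> f x = \<zero>\<^bsub>T\<^esub> \<longleftrightarrow> x \<in> I"
    and I: "two_sided_ideal I A"
  shows "algebra_isomorphic (quotient_algebra A I) T"
proof -
  interpret f: surjective_hom A T f by (rule assms(1))
  interpret q: surjective_hom A "quotient_algebra A I" "\<lambda>x. I +>\<^bsub>A\<^esub> x"
    by (rule surjective_hom_quotient_algebra[OF f.R.nonunital_ring_axioms I])
  let ?Q = "quotient_algebra A I"
  let ?q = "\<lambda>x. I +>\<^bsub>A\<^esub> x"
  have Ia: "additive_subgroup I A" using I by (simp add: two_sided_ideal_def)
  have eq: "?q x = ?q y \<longleftrightarrow> f x = f y" if "x \<in> carrier A" "y \<in> carrier A" for x y
  proof -
    have "?q x = ?q y \<longleftrightarrow> f (x \<oplus>\<^bsub>A\<^esub> \<ominus>\<^bsub>A\<^esub> y) = \<zero>\<^bsub>T\<^esub>"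
      using that ker f.R.coset_eq_iff[OF Ia that] by simp
    also have "\<dots> \<longleftrightarrow> f x = f y"
    proof
      assume "f (x \<oplus>\<^bsub>A\<^esub> \<ominus>\<^bsub>A\<^esub> y) = \<zero>\<^bsub>T\<^esub>"
      then have "f x \<oplus>\<^bsub>T\<^esub> \<ominus>\<^bsub>T\<^esub> f y = \<zero>\<^bsub>T\<^esub>" using that by (simp add: f.hom_add f.hom_minus)
      then have "f x = \<ominus>\<^bsub>T\<^esub> (\<ominus>\<^bsub>T\<^esub> f y)"
        using that by (intro f.S.minus_equality[symmetric]) simp_all
      then show "f x = f y" using that by simp
    qed (use that in \<open>simp add: f.hom_add f.hom_minus f.S.r_neg\<close>)
    finally show ?thesis .
  qed
  define h where "h X = f (SOME x. x \<in> carrier A \<and> X = ?q x)" for X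
  have hq: "h (?q x) = f x" if "x \<in> carrier A" for x
  proof -
    have "(SOME y. y \<in> carrier A \<and> ?q x = ?q y) \<in> carrier A \<and>
        ?q x = ?q (SOME y. y \<in> carrier A \<and> ?q x = ?q y)"
      by (rule someI) (use that in simp)
    then show ?thesis unfolding h_def using eq that by metis
  qed
  have Qcar: "carrier ?Q = ?q ` carrier A" using q.image by simp
  show ?thesis
    unfolding algebra_isomorphic_def
  proof (intro exI[of _ h] conjI allI ballI)
    show "h \<in> iso (add_monoid ?Q) (add_monoid T)"
      unfolding iso_def hom_def
    proof (safe; (simp only: partial_object.simps monoid.simps)?)
      show "h X \<in> carrier T" if "X \<in> carrier ?Q" for X using that by (auto simp: Qcar hq)
      show "h (X \<oplus>\<^bsub>?Q\<^esub> Y) = h X \<oplus>\<^bsub>T\<^esub> h Y" if "X \<in> carrier ?Q" "Y \<in> carrier ?Q" for X Y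
        using that by (auto simp: Qcar hq q.hom_add[symmetric] f.hom_add)
      show "bij_betw h (carrier ?Q) (carrier T)"
        unfolding bij_betw_def
      proof
        show "inj_on h (carrier ?Q)"
        proof (rule inj_onI)
          fix X Y assume XY: "X \<in> carrier ?Q" "Y \<in> carrier ?Q" "h X = h Y"
          then obtain x y where "x \<in> carrier A" "y \<in> carrier A" "X = ?q x" "Y = ?q y"
            unfolding Qcar by (elim imageE)
          then show "X = Y" using XY(3) hq eq by simp
        qed
        show "h ` carrier ?Q = carrier T"
          unfolding Qcar f.image[symmetric] image_image by (rule image_cong) (simp_all add: hq)
      qed
    qed
    show "h \<in> hom ?Q T"
      unfolding hom_def by (auto simp: Qcar hq q.hom_mult[symmetric] f.hom_mult f.R.m_closed)
    fix c X assume "X \<in> carrier ?Q"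
    then obtain x where x: "x \<in> carrier A" "X = ?q x" by (auto simp: Qcar)
    have "?q (c \<odot>\<^bsub>A\<^esub> b) = ?q (c \<odot>\<^bsub>A\<^esub> x)" if "b \<in> ?q x" for b
    proof -
      have b: "b \<in> carrier A" "?q b = ?q x"
        using that f.R.mem_coset_iff[OF Ia x(1)] by simp_all
      then have "f b = f x" using eq x(1) by simp
      then show ?thesis using b(1) x(1) by (simp add: eq smult_closed smult)
    qed
    moreover have "x \<in> ?q x" using x by (simp add: f.R.mem_coset_iff[OF Ia])
    ultimately have "c \<odot>\<^bsub>?Q\<^esub> X = ?q (c \<odot>\<^bsub>A\<^esub> x)"
      unfolding quotient_algebra_simps x by blast
    then show "h (c \<odot>\<^bsub>?Q\<^esub> X) = c \<odot>\<^bsub>T\<^esub> h X" using x by (simp add: hq smult_closed smult)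
  qed
qed

section \<open>Faithful simple modules from idempotents\<close>

text \<open>The module is a simple quotient of the right ideal e R, realised as \<open>R\<close>
  modulo a right ideal \<open>N\<close> that contains the kernel \<open>Z\<close> of left
  multiplication by \<open>e\<close> and is maximal among those avoiding \<open>e\<close>. Its
  annihilator is a two-sided ideal without \<open>e\<close>, hence zero by
  \<open>inI\<close>.\<close>

lemma (in nonunital_ring) faithful_simple_module_exists:
  assumes e: "e \<in> carrier R" "e \<otimes> e = e" "e \<noteq> \<zero>"
    and inI: "\<And>A. two_sided_ideal A R \<Longrightarrow> A \<noteq> {\<zero>} \<Longrightarrow> e \<in> A"
  shows "\<exists>(M :: 'a set ring) act. simple_right_module R M act \<and> faithful_right_module R M act"
proof -
  define rid where "rid N \<longleftrightarrow> additive_subgroup N R \<and> (\<forall>n\<in>N. \<forall>a\<in>carrier R. n \<otimes> a \<in> N)" for N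
  \<comment> \<open>\<open>Z\<close> plays the role of (1 - e) R in the absence of a unit: t - e t
    lies in it for every t, so a right ideal that contains \<open>Z\<close> and \<open>e\<close> is
    the whole ring.\<close>
  define Z where "Z = {t \<in> carrier R. e \<otimes> t = \<zero>}"
  define C where "C = {N. rid N \<and> Z \<subseteq> N \<and> e \<notin> N}"
  have ridD: "N \<subseteq> carrier R" "\<zero> \<in> N" "x \<in> N \<Longrightarrow> y \<in> N \<Longrightarrow> x \<oplus> y \<in> N" "x \<in> N \<Longrightarrow> \<ominus> x \<in> N"
    "x \<in> N \<Longrightarrow> a \<in> carrier R \<Longrightarrow> x \<otimes> a \<in> N" if "rid N" for N x y a
    using that unfolding rid_def additive_subgroup_iff by auto
  have "Z \<in> C"
    using e by (auto simp: C_def rid_def Z_def additive_subgroup_iff r_null r_distr r_minus m_closed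
        m_assoc[symmetric] l_null)
  have "\<exists>N\<in>C. \<forall>X\<in>C. N \<subseteq> X \<longrightarrow> X = N"
  proof (rule subset_Zorn_nonempty)
    show "C \<noteq> {}" using \<open>Z \<in> C\<close> by auto
    fix \<C> assume ne: "\<C> \<noteq> {}" and ch: "subset.chain C \<C>"
    then have sub: "\<C> \<subseteq> C" and lin: "\<And>X Y. X \<in> \<C> \<Longrightarrow> Y \<in> \<C> \<Longrightarrow> X \<subseteq> Y \<or> Y \<subseteq> X"
      by (auto simp: subset_chain_def)
    have r: "rid X" if "X \<in> \<C>" for X using that sub by (auto simp: C_def)
    have "rid (\<Union>\<C>)"
      unfolding rid_def additive_subgroup_iff
    proof (intro conjI ballI)
      show "\<Union>\<C> \<subseteq> carrier R" using r ridD(1) by blast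
      show "\<zero> \<in> \<Union>\<C>" using ne r ridD(2) by blast
      show "\<ominus> x \<in> \<Union>\<C>" if "x \<in> \<Union>\<C>" for x using that r ridD(4) by blast
      show "n \<otimes> a \<in> \<Union>\<C>" if "n \<in> \<Union>\<C>" "a \<in> carrier R" for n a using that r ridD(5) by blast
      fix x y assume "x \<in> \<Union>\<C>" "y \<in> \<Union>\<C>"
      then obtain X Y where "X \<in> \<C>" "Y \<in> \<C>" "x \<in> X" "y \<in> Y" by blast
      with lin[of X Y] obtain W where "W \<in> \<C>" "x \<in> W" "y \<in> W" by blast
      then show "x \<oplus> y \<in> \<Union>\<C>" using r[of W] ridD(3)[of W x y] by blast
    qed
    moreover have "Z \<subseteq> \<Union>\<C>" "e \<notin> \<Union>\<C>" using ne sub by (auto simp: C_def)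
    ultimately show "\<Union>\<C> \<in> C" by (simp add: C_def)
  qed
  then obtain N where "N \<in> C" and max: "\<forall>X\<in>C. N \<subseteq> X \<longrightarrow> X = N" by (rule bexE)
  then have N: "rid N" "Z \<subseteq> N" "e \<notin> N" by (auto simp: C_def)
  then have Na: "additive_subgroup N R" by (simp add: rid_def)
  note ND = ridD[OF N(1)]
  let ?q = "\<lambda>x. N +> x"
  define M :: "'a set ring" where
    "M = \<lparr>carrier = a_rcosets N, monoid.mult = undefined, one = undefined, zero = N, add = set_add R\<rparr>"
  define act where "act m a = (\<Union>x\<in>m. ?q (x \<otimes> a))" for m a
  have Mcar: "carrier M = ?q ` carrier R" by (auto simp: M_def A_RCOSETS_def')
  have Mzero: "\<zero>\<^bsub>M\<^esub> = N" by (simp add: M_def)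
  have Madd: "?q x \<oplus>\<^bsub>M\<^esub> ?q y = ?q (x \<oplus> y)" if "x \<in> carrier R" "y \<in> carrier R" for x y
    using that by (simp add: M_def coset_add[OF Na])
  have q0: "?q x = N \<longleftrightarrow> x \<in> N" if "x \<in> carrier R" for x
    using that by (rule coset_eq_self_iff[OF Na])
  have actq: "act (?q x) a = ?q (x \<otimes> a)" if "x \<in> carrier R" "a \<in> carrier R" for x a
  proof -
    have "?q (y \<otimes> a) = ?q (x \<otimes> a)" if y: "y \<in> ?q x" for y
    proof -
      have y: "y \<in> carrier R" "y \<oplus> \<ominus> x \<in> N"
        using y \<open>x \<in> carrier R\<close> by (auto simp: mem_coset_iff[OF Na] coset_eq_iff[OF Na])
      have "y \<otimes> a \<oplus> \<ominus> (x \<otimes> a) = (y \<oplus> \<ominus> x) \<otimes> a"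
        using y that \<open>x \<in> carrier R\<close> \<open>a \<in> carrier R\<close> by (simp add: l_distr l_minus)
      also have "\<dots> \<in> N" using y \<open>a \<in> carrier R\<close> by (intro ND(5))
      finally show ?thesis
        using y \<open>x \<in> carrier R\<close> \<open>a \<in> carrier R\<close> by (simp add: coset_eq_iff[OF Na] m_closed)
    qed
    moreover have "x \<in> ?q x" using that by (simp add: mem_coset_iff[OF Na])
    ultimately show ?thesis unfolding act_def by blast
  qed
  have MG: "abelian_group M"
    by (rule abelian_group_image[of R ?q]) (simp_all add: abelian_group_axioms Mcar Madd Mzero q0 ND(2))
  have module: "right_module R M act"
    unfolding right_module_def
    by (auto simp: MG Mcar actq Madd m_closed l_distr r_distr m_assoc)
  have simple: "simple_right_module R M act"
    unfolding simple_right_module_def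
  proof (intro conjI allI impI)
    show "right_module R M act" by (rule module)
    have "?q e \<in> carrier M" "act (?q e) e \<noteq> \<zero>\<^bsub>M\<^esub>"
      using e N(3) by (auto simp: Mcar actq Mzero q0)
    then show "\<exists>m\<in>carrier M. \<exists>a\<in>carrier R. act m a \<noteq> \<zero>\<^bsub>M\<^esub>" using e(1) by blast
    fix U assume U: "additive_subgroup U M" and Uact: "\<forall>m\<in>U. \<forall>a\<in>carrier R. act m a \<in> U"
    interpret U: abelian_subgroup U M by (rule abelian_subgroupI3[OF U MG])
    have NU: "N \<in> U" using additive_subgroup.zero_closed[OF U] by (simp add: Mzero)
    \<comment> \<open>Submodules of \<open>M\<close> are compared with right ideals above
      \<open>N\<close>. By maximality such a right ideal is \<open>N\<close> itself or contains
      \<open>e\<close>.\<close>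
    define W where "W = {t \<in> carrier R. ?q t \<in> U}"
    have W: "rid W"
      unfolding rid_def additive_subgroup_iff
    proof (intro conjI ballI)
      show "W \<subseteq> carrier R" by (auto simp: W_def)
      have "?q \<zero> = \<zero>\<^bsub>M\<^esub>" by (simp add: q0 ND(2) Mzero)
      then show "\<zero> \<in> W" using additive_subgroup.zero_closed[OF U] by (simp add: W_def)
      show "x \<oplus> y \<in> W" if "x \<in> W" "y \<in> W" for x y
        using that U.a_closed by (auto simp: W_def Madd[symmetric])
      show "n \<otimes> a \<in> W" if "n \<in> W" "a \<in> carrier R" for n a
        using that Uact by (auto simp: W_def actq[symmetric] m_closed)
      fix x assume x: "x \<in> W"
      then have xc: "x \<in> carrier R" by (simp add: W_def)
      have "?q (\<ominus> x) \<oplus>\<^bsub>M\<^esub> ?q x = \<zero>\<^bsub>M\<^esub>" using xc by (simp add: Madd l_neg q0 ND(2) Mzero)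
      then have "?q (\<ominus> x) = \<ominus>\<^bsub>M\<^esub> ?q x"
        using xc by (intro abelian_group.minus_equality[OF MG, symmetric]) (auto simp: Mcar)
      then show "\<ominus> x \<in> W" using x additive_subgroup.a_inv_closed[OF U] by (simp add: W_def)
    qed
    have NW: "N \<subseteq> W"
    proof
      fix x assume "x \<in> N"
      then have "x \<in> carrier R" "N +> x = N" using ND(1) q0 by auto
      then show "x \<in> W" using NU by (simp add: W_def)
    qed
    show "U = {\<zero>\<^bsub>M\<^esub>} \<or> U = carrier M"
    proof (cases "e \<in> W")
      case False
      then have "W \<in> C" using W NW N(2) by (auto simp: C_def)
      then have "W = N" using max NW by blast
      then have "m = N" if "m \<in> U" for m
        using that U.a_subset q0 by (auto simp: W_def Mcar)
      then have "U = {N}" using NU by blast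
      then show ?thesis by (simp add: Mzero)
    next
      case True
      have "t \<in> W" if t: "t \<in> carrier R" for t
      proof -
        have "e \<otimes> (e \<otimes> t) = e \<otimes> t" using m_assoc[of e e t] e t by simp
        then have "t \<oplus> \<ominus> (e \<otimes> t) \<in> Z"
          using t e(1) by (simp add: Z_def m_closed r_distr r_minus r_neg)
        then have "t \<oplus> \<ominus> (e \<otimes> t) \<in> W" using N(2) NW by blast
        then have "t \<oplus> \<ominus> (e \<otimes> t) \<oplus> e \<otimes> t \<in> W"
          by (rule ridD(3)[OF W _ ridD(5)[OF W True t]])
        then show ?thesis using t e by (simp add: a_assoc l_neg m_closed)
      qed
      then show ?thesis using U.a_subset by (auto simp: W_def Mcar)
    qed
  qed
  have "faithful_right_module R M act"
    unfolding faithful_right_module_def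
  proof (intro ballI impI)
    fix a assume a: "a \<in> carrier R" "\<forall>m\<in>carrier M. act m a = \<zero>\<^bsub>M\<^esub>"
    \<comment> \<open>The annihilator of \<open>M\<close>. It omits \<open>e\<close>, because e e =
      e lies outside \<open>N\<close>.\<close>
    define Ann where "Ann = {a \<in> carrier R. \<forall>x\<in>carrier R. x \<otimes> a \<in> N}"
    have "two_sided_ideal Ann R"
      unfolding two_sided_ideal_iff
      by (auto simp: Ann_def r_null ND r_distr r_minus m_closed m_assoc[symmetric])
    moreover have "e \<notin> Ann" using e N(3) by (auto simp: Ann_def intro!: bexI[of _ e])
    ultimately have "Ann = {\<zero>}" using inI[of Ann] by auto
    moreover have "a \<in> Ann"
      using a by (auto simp: Ann_def Mcar actq Mzero q0 m_closed)
    ultimately show "a = \<zero>" by simp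
  qed
  with simple show ?thesis by (intro exI conjI)
qed

section \<open>Free algebras\<close>

lemma poly_mapping_sum_single: "(\<Sum>w\<in>Poly_Mapping.keys x. Poly_Mapping.single w (Poly_Mapping.lookup x w)) = x"
  by (rule poly_mapping_eqI)
    (simp add: lookup_sum lookup_single when_def in_keys_iff)

text \<open>In the case \<open>single\<close> the word is taken from the support of
  \<open>x\<close>, so a condition on that support remains available without being part of the
  property \<open>P\<close>.\<close>

lemma poly_mapping_single_induct [case_names zero single add]:
  fixes x :: "'w \<Rightarrow>\<^sub>0 'k::ab_group_add"
  assumes "P 0" "\<And>w c. w \<in> Poly_Mapping.keys x \<Longrightarrow> P (Poly_Mapping.single w c)"
    "\<And>a b. P a \<Longrightarrow> P b \<Longrightarrow> P (a + b)"
  shows "P x"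
proof -
  have "P (\<Sum>w\<in>S. Poly_Mapping.single w (Poly_Mapping.lookup x w))"
    if "finite S" "S \<subseteq> Poly_Mapping.keys x" for S
    using that by (induction S rule: finite_induct) (auto intro: assms)
  from this[OF finite_keys subset_refl] show ?thesis by (simp add: poly_mapping_sum_single)
qed

lemma zero_Free_Word: "(0 :: 'g free_word) = Free_Word []"
  by (simp add: zero_free_word_def)

lemma plus_Free_Word: "Free_Word u + Free_Word v = Free_Word (u @ v)"
  by (simp add: plus_free_word_def)

lemma letters_plus: "letters (u + v) = letters u @ letters v"
  by (simp add: plus_free_word_def)

lemma letters_zero: "letters 0 = []"
  by (simp add: zero_free_word_def)

lemma scalar_commute:
  fixes x :: "'g free_word \<Rightarrow>\<^sub>0 'k::field"
  shows "x * Poly_Mapping.single 0 c = Poly_Mapping.single 0 c * x"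
  by (induction x rule: poly_mapping_single_induct)
    (simp_all add: mult_single algebra_simps)

lemma single_Cons:
  "Poly_Mapping.single (Free_Word (g # ws)) (1::'k::field) =
     generator g * Poly_Mapping.single (Free_Word ws) 1"
  by (simp add: generator_def mult_single plus_Free_Word)

text \<open>The empty word is allowed here, in contrast to
  \<open>carrier (free_algebra K X)\<close>. So \<open>1\<close> and the scalars belong, and this is
  the unitization of the free algebra.\<close>

definition words_over :: "'g set \<Rightarrow> ('g free_word \<Rightarrow>\<^sub>0 'k::field) set" where
  "words_over X = {x. \<forall>w\<in>Poly_Mapping.keys x. set (letters w) \<subseteq> X}"

lemma free_algebra_simps:
  "carrier (free_algebra K X) = {x. \<forall>w\<in>Poly_Mapping.keys x. letters w \<noteq> [] \<and> set (letters w) \<subseteq> X}"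
  "x \<otimes>\<^bsub>free_algebra K X\<^esub> y = x * y" "x \<oplus>\<^bsub>free_algebra K X\<^esub> y = x + y"
  "\<zero>\<^bsub>free_algebra K X\<^esub> = 0" "c \<odot>\<^bsub>free_algebra K X\<^esub> x = Poly_Mapping.single 0 c * x"
  by (simp_all add: free_algebra_def)

lemma words_over_closed:
  "0 \<in> words_over X" "1 \<in> words_over X"
  "x \<in> words_over X \<Longrightarrow> y \<in> words_over X \<Longrightarrow> x + y \<in> words_over X"
  "x \<in> words_over X \<Longrightarrow> - x \<in> words_over X"
  "x \<in> words_over X \<Longrightarrow> y \<in> words_over X \<Longrightarrow> x - y \<in> words_over X"
  "x \<in> words_over X \<Longrightarrow> y \<in> words_over X \<Longrightarrow> x * y \<in> words_over X"
  "Poly_Mapping.single 0 c \<in> words_over X"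
  "g \<in> X \<Longrightarrow> generator g \<in> words_over X"
proof -
  show "0 \<in> words_over X" "1 \<in> words_over X" "Poly_Mapping.single 0 c \<in> words_over X"
    by (auto simp: words_over_def letters_zero split: if_splits)
  show "g \<in> X \<Longrightarrow> generator g \<in> words_over X"
    by (auto simp: words_over_def generator_def)
  show add: "x + y \<in> words_over X" if "x \<in> words_over X" "y \<in> words_over X" for x y
    using that keys_add[of x y] by (auto simp: words_over_def)
  show minus: "- x \<in> words_over X" if "x \<in> words_over X" for x
    using that by (auto simp: words_over_def in_keys_iff)
  show "x - y \<in> words_over X" if "x \<in> words_over X" "y \<in> words_over X" for x y
    using add[OF that(1) minus[OF that(2)]] by simp
  show "x * y \<in> words_over X" if "x \<in> words_over X" "y \<in> words_over X" for x y
    unfolding words_over_def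
  proof (intro CollectI ballI)
    fix w assume "w \<in> Poly_Mapping.keys (x * y)"
    then obtain u v where "w = u + v" "u \<in> Poly_Mapping.keys x" "v \<in> Poly_Mapping.keys y"
      using keys_mult[of x y] by blast
    then show "set (letters w) \<subseteq> X" using that by (simp add: letters_plus words_over_def)
  qed
qed

lemma words_over_sum: "(\<And>i. i \<in> S \<Longrightarrow> f i \<in> words_over X) \<Longrightarrow> sum f S \<in> words_over X"
  by (induction S rule: infinite_finite_induct) (auto intro: words_over_closed)

lemma words_over_prod_list: "(\<And>x. x \<in> set xs \<Longrightarrow> x \<in> words_over X) \<Longrightarrow> prod_list xs \<in> words_over X"
  by (induction xs) (auto intro: words_over_closed)

lemma free_algebra_carrier_iff:
  "x \<in> carrier (free_algebra K X) \<longleftrightarrow> x \<in> words_over X \<and> Poly_Mapping.lookup x 0 = 0"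
proof -
  have eq: "letters w = [] \<longleftrightarrow> w = 0" for w :: "'a free_word"
    by (cases w) (simp add: zero_Free_Word)
  have "x \<in> carrier (free_algebra K X) \<longleftrightarrow> x \<in> words_over X \<and> 0 \<notin> Poly_Mapping.keys x"
    unfolding free_algebra_simps words_over_def eq by blast
  then show ?thesis by (simp add: in_keys_iff)
qed

text \<open>A concatenation of words is empty only if both words are. Consequently the free algebra
  without unit, in which the coefficient of the empty word vanishes, is an ideal of its
  unitization.\<close>

lemma lookup_mult_zero_word:
  fixes x y :: "'g free_word \<Rightarrow>\<^sub>0 'k::field"
  shows "Poly_Mapping.lookup (x * y) 0 = Poly_Mapping.lookup x 0 * Poly_Mapping.lookup y 0"
proof (induction x rule: poly_mapping_single_induct)
  case (single w c)
  show ?case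
  proof (induction y rule: poly_mapping_single_induct)
    case (single v d)
    have "w + v = 0 \<longleftrightarrow> w = 0 \<and> v = 0"
      by (cases w; cases v) (simp add: zero_Free_Word plus_Free_Word)
    then show ?case by (auto simp: mult_single lookup_single when_def)
  qed (simp_all add: lookup_add algebra_simps)
qed (simp_all add: lookup_add algebra_simps)

lemma free_algebra_closed:
  "0 \<in> carrier (free_algebra K X)"
  "x \<in> carrier (free_algebra K X) \<Longrightarrow> y \<in> carrier (free_algebra K X) \<Longrightarrow> x + y \<in> carrier (free_algebra K X)"
  "x \<in> carrier (free_algebra K X) \<Longrightarrow> - x \<in> carrier (free_algebra K X)"
  "x \<in> carrier (free_algebra K X) \<Longrightarrow> y \<in> carrier (free_algebra K X) \<Longrightarrow> x - y \<in> carrier (free_algebra K X)"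
  "x \<in> words_over X \<Longrightarrow> y \<in> carrier (free_algebra K X) \<Longrightarrow> x * y \<in> carrier (free_algebra K X)"
  "x \<in> carrier (free_algebra K X) \<Longrightarrow> y \<in> words_over X \<Longrightarrow> x * y \<in> carrier (free_algebra K X)"
  "g \<in> X \<Longrightarrow> generator g \<in> carrier (free_algebra K X)"
proof -
  have "Poly_Mapping.lookup (generator g :: _ \<Rightarrow>\<^sub>0 'b) 0 = 0"
    by (simp add: generator_def lookup_single zero_Free_Word)
  then show "g \<in> X \<Longrightarrow> generator g \<in> carrier (free_algebra K X)"
    by (simp add: free_algebra_carrier_iff words_over_closed)
qed (auto simp: free_algebra_carrier_iff lookup_add lookup_minus lookup_mult_zero_word
    intro: words_over_closed)

lemma free_algebra_words_over: "x \<in> carrier (free_algebra K X) \<Longrightarrow> x \<in> words_over X"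
  by (simp add: free_algebra_carrier_iff)

lemma free_algebra_sum:
  "(\<And>i. i \<in> S \<Longrightarrow> f i \<in> carrier (free_algebra K X)) \<Longrightarrow> sum f S \<in> carrier (free_algebra K X)"
  by (induction S rule: infinite_finite_induct) (auto intro: free_algebra_closed)

lemma nonunital_ring_free_algebra: "nonunital_ring (free_algebra K X)"
proof -
  have "abelian_group (free_algebra K X)"
    by (rule abelian_groupI)
      (auto simp: free_algebra_simps(2-) algebra_simps intro: free_algebra_closed
        intro!: bexI[of _ "- _"] simp del: free_algebra_simps(1))
  then show ?thesis
    by (intro nonunital_ring.intro nonunital_ring_axioms.intro)
      (auto simp: free_algebra_simps(2-) algebra_simps
        intro: free_algebra_closed free_algebra_words_over)
qed

lemma free_algebra_ideal_iff:
  "two_sided_ideal I (free_algebra K X) \<longleftrightarrow>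
     I \<subseteq> carrier (free_algebra K X) \<and> 0 \<in> I \<and> (\<forall>x\<in>I. \<forall>y\<in>I. x + y \<in> I) \<and> (\<forall>x\<in>I. - x \<in> I) \<and>
     (\<forall>a\<in>I. \<forall>x\<in>carrier (free_algebra K X). x * a \<in> I \<and> a * x \<in> I)"
proof -
  interpret nonunital_ring "free_algebra K X" by (rule nonunital_ring_free_algebra)
  have "\<ominus>\<^bsub>free_algebra K X\<^esub> x = - x" if "x \<in> carrier (free_algebra K X)" for x
    by (rule minus_equality) (use that in \<open>simp_all add: free_algebra_simps(2-) free_algebra_closed\<close>)
  then show ?thesis
    unfolding two_sided_ideal_iff by (auto simp: free_algebra_simps(2-) subset_iff)
qed

lemma single_in_ideal_closed:
  assumes "x \<in> words_over X" "w \<in> Poly_Mapping.keys x"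
  shows "set (letters w) \<subseteq> X"
  using assms by (auto simp: words_over_def)

lemma free_algebra_induct [consumes 1, case_names zero generator add mult scalar]:
  assumes "x \<in> carrier (free_algebra K X)"
    and zero: "P 0" and gen: "\<And>g. g \<in> X \<Longrightarrow> P (generator g)"
    and add: "\<And>a b. P a \<Longrightarrow> P b \<Longrightarrow> P (a + b)"
    and mult: "\<And>a b. P a \<Longrightarrow> P b \<Longrightarrow> P (a * b)"
    and scalar: "\<And>a c. P a \<Longrightarrow> P (Poly_Mapping.single 0 c * a)"
  shows "P x"
proof -
  have word: "P (Poly_Mapping.single (Free_Word ws) 1)" if "set ws \<subseteq> X" "ws \<noteq> []" for ws
    using that
  proof (induction ws)
    case (Cons g ws)
    show ?case
    proof (cases "ws = []")
      case True
      then show ?thesis using gen[of g] Cons.prems by (simp add: generator_def)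
    qed (use Cons gen in \<open>simp add: single_Cons mult\<close>)
  qed simp
  show ?thesis
  proof (induction x rule: poly_mapping_single_induct)
    case (single w c)
    have "P (Poly_Mapping.single 0 c * Poly_Mapping.single (Free_Word (letters w)) 1)"
      using assms(1) single by (intro scalar word) (auto simp: free_algebra_simps)
    then show ?case by (simp add: mult_single)
  qed (rule zero, rule add)
qed

section \<open>Modules over the free algebra\<close>

locale word_action =
  fixes act :: "'g \<Rightarrow> 'm::ab_group_add \<Rightarrow> 'm" and sc :: "'k::field \<Rightarrow> 'm \<Rightarrow> 'm"
  assumes act_add: "act g (m + n) = act g m + act g n"
    and act_sc: "act g (sc c m) = sc c (act g m)"
    and sc_add_right: "sc c (m + n) = sc c m + sc c n"
    and sc_add_left: "sc (c + d) m = sc c m + sc d m"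
    and sc_mult: "sc (c * d) m = sc c (sc d m)"
    and sc_one: "sc 1 m = m"
begin

definition word :: "'g free_word \<Rightarrow> 'm \<Rightarrow> 'm" where
  "word w m = foldr act (letters w) m"

text \<open>Any choice of linear operators for the letters extends to the unitized free algebra.
  This serves for representations of L and, with letters acting by left multiplication on another
  free algebra, for the definition of a homomorphism.\<close>

definition ev :: "('g free_word \<Rightarrow>\<^sub>0 'k) \<Rightarrow> 'm \<Rightarrow> 'm" where
  "ev a m = (\<Sum>w\<in>Poly_Mapping.keys a. sc (Poly_Mapping.lookup a w) (word w m))"

lemma sc_zero_left [simp]: "sc 0 m = 0"
  using sc_add_left[of 0 0 m] by simp

lemma sc_zero_right [simp]: "sc c 0 = 0"
  using sc_add_right[of c 0 0] by simp

lemma act_zero [simp]: "act g 0 = 0"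
  using act_add[of g 0 0] by simp

lemma word_add: "word w (m + n) = word w m + word w n"
proof -
  have "foldr act ws (m + n) = foldr act ws m + foldr act ws n" for ws
    by (induction ws) (simp_all add: act_add)
  then show ?thesis by (simp add: word_def)
qed

lemma word_sc: "word w (sc c m) = sc c (word w m)"
proof -
  have "foldr act ws (sc c m) = sc c (foldr act ws m)" for ws
    by (induction ws) (simp_all add: act_sc)
  then show ?thesis by (simp add: word_def)
qed

lemma ev_superset:
  assumes "finite S" "Poly_Mapping.keys a \<subseteq> S"
  shows "ev a m = (\<Sum>w\<in>S. sc (Poly_Mapping.lookup a w) (word w m))"
  unfolding ev_def by (rule sum.mono_neutral_left[OF assms]) (simp add: in_keys_iff)

lemma ev_add_left: "ev (a + b) m = ev a m + ev b m"
  using ev_superset[of "Poly_Mapping.keys a \<union> Poly_Mapping.keys b" a m]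
    ev_superset[of "Poly_Mapping.keys a \<union> Poly_Mapping.keys b" b m]
    ev_superset[of "Poly_Mapping.keys a \<union> Poly_Mapping.keys b" "a + b" m] keys_add[of a b]
  by (simp add: lookup_add sc_add_left sum.distrib)

lemma ev_single: "ev (Poly_Mapping.single w c) m = sc c (word w m)"
  by (cases "c = 0") (simp_all add: ev_def)

lemma ev_zero_left [simp]: "ev 0 m = 0"
  by (simp add: ev_def)

lemma ev_uminus_left: "ev (- a) m = - ev a m"
  using ev_add_left[of a "- a" m] by (simp add: eq_neg_iff_add_eq_0 add.commute)

lemma ev_diff_left: "ev (a - b) m = ev a m - ev b m"
  using ev_add_left[of a "- b" m] by (simp add: ev_uminus_left)

lemma ev_sum_left: "ev (sum f S) m = (\<Sum>i\<in>S. ev (f i) m)"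
  by (induction S rule: infinite_finite_induct) (simp_all add: ev_add_left)

lemma ev_add_right: "ev a (m + n) = ev a m + ev a n"
  by (simp add: ev_def word_add sc_add_right sum.distrib)

lemma ev_zero_right [simp]: "ev a 0 = 0"
  using ev_add_right[of a 0 0] by simp

lemma ev_mult: "ev (a * b) m = ev a (ev b m)"
proof (induction a rule: poly_mapping_single_induct)
  case (single w c)
  show ?case
  proof (induction b rule: poly_mapping_single_induct)
    case (single v d)
    show ?case
      by (simp add: mult_single ev_single word_sc sc_mult) (simp add: word_def letters_plus)
  qed (simp_all add: ring_distribs ev_add_left ev_add_right)
qed (simp_all add: ring_distribs ev_add_left)

lemma ev_generator [simp]: "ev (generator g) m = act g m"
  by (simp add: generator_def ev_single word_def sc_one)

lemma ev_scalar: "ev (Poly_Mapping.single 0 c) m = sc c m"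
  by (simp add: ev_single word_def letters_zero)

lemma ev_one [simp]: "ev 1 m = m"
  using ev_scalar[of 1 m] by (simp add: sc_one)

text \<open>Elements that carry the module into a stable subgroup \<open>W\<close> absorb products:
  a left factor preserves \<open>W\<close>, a right factor preserves the module.
  \<open>W = {0}\<close> gives the annihilator; multiples of powers of t will give a filtration
  above it.\<close>

lemma action_ideal:
  assumes W: "0 \<in> W" "\<And>m n. m \<in> W \<Longrightarrow> n \<in> W \<Longrightarrow> m + n \<in> W" "\<And>m. m \<in> W \<Longrightarrow> - m \<in> W"
    "\<And>g m. m \<in> W \<Longrightarrow> act g m \<in> W" "\<And>c m. m \<in> W \<Longrightarrow> sc c m \<in> W"
  shows "two_sided_ideal {x \<in> carrier (free_algebra K X). \<forall>m. ev x m \<in> W} (free_algebra K X)"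
proof -
  have wordW: "word w m \<in> W" if "m \<in> W" for w m
  proof -
    have "foldr act ws m \<in> W" for ws
      by (induction ws) (use that W(4) in auto)
    then show ?thesis by (simp add: word_def)
  qed
  have evW: "ev a m \<in> W" if "m \<in> W" for a m
  proof (induction a rule: poly_mapping_single_induct)
    case (single w c)
    then show ?case using that by (simp add: ev_single wordW W(5))
  qed (simp_all add: ev_add_left W)
  show ?thesis
    unfolding free_algebra_ideal_iff
    by (auto simp: ev_add_left ev_uminus_left ev_mult W evW free_algebra_closed free_algebra_words_over)
qed

end

section \<open>Computing in Leavitt path algebras\<close>

text \<open>We compute in the free algebra modulo the relation ideal \<open>N\<close>.  As \<open>N\<close> is closed under
  scalars, it is closed under multiplication by \<open>U\<close>, the unitization of the free algebra.\<close>

locale lpa = wf_digraph E for E :: "('v, 'e) pre_digraph" +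
  fixes K :: "'k::field itself"
begin

abbreviation gens :: "('v, 'e) lpa_gen set" where
  "gens \<equiv> Vertex ` verts E \<union> Edge ` arcs E \<union> Ghost ` arcs E"

abbreviation A :: "('v, 'e, 'k) lpa_free set" where
  "A \<equiv> carrier (lpa_free_algebra K E)"

abbreviation U :: "('v, 'e, 'k) lpa_free set" where
  "U \<equiv> words_over gens"

abbreviation N :: "('v, 'e, 'k) lpa_free set" where
  "N \<equiv> lpa_relation_ideal K E"

lemma lpa_free_algebra_eq: "lpa_free_algebra K E = free_algebra K gens"
  by (simp add: lpa_free_algebra_def)

lemmas A_simps = free_algebra_simps(2-)[where X = gens and K = K, folded lpa_free_algebra_eq]
lemmas A_closed = free_algebra_closed[where X = gens and K = K, folded lpa_free_algebra_eq]
lemmas A_sum = free_algebra_sum[where X = gens and K = K, folded lpa_free_algebra_eq]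
lemmas A_U = free_algebra_words_over[where X = gens and K = K, folded lpa_free_algebra_eq]
lemmas A_ideal_iff = free_algebra_ideal_iff[where X = gens and K = K, folded lpa_free_algebra_eq]
lemmas A_ring = nonunital_ring_free_algebra[where X = gens and K = K, folded lpa_free_algebra_eq]
lemmas A_induct = free_algebra_induct[where X = gens and K = K, folded lpa_free_algebra_eq,
    consumes 1, case_names zero generator add mult scalar]

lemma U_gens [simp, intro]:
  "v \<in> verts E \<Longrightarrow> vtx v \<in> U" "e \<in> arcs E \<Longrightarrow> edg e \<in> U" "e \<in> arcs E \<Longrightarrow> gho e \<in> U"
  by (auto intro: words_over_closed)

lemma A_gens [simp, intro]:
  "v \<in> verts E \<Longrightarrow> vtx v \<in> A" "e \<in> arcs E \<Longrightarrow> edg e \<in> A" "e \<in> arcs E \<Longrightarrow> gho e \<in> A"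
  by (auto intro: A_closed)

lemmas U_closed [simp, intro] = words_over_closed[where X = gens]
declare A_closed [simp, intro]
declare A_U [simp, intro]

lemma relators_A: "lpa_relators K E \<subseteq> A"
  unfolding lpa_relators_def by (auto intro!: A_closed A_sum simp: regular_vertex_def)

lemma N_ideal: "two_sided_ideal N (lpa_free_algebra K E)"
  and N_scalar: "x \<in> N \<Longrightarrow> Poly_Mapping.single 0 c * x \<in> N"
  and N_relators: "lpa_relators K E \<subseteq> N"
proof -
  let ?F = "{I. two_sided_ideal I (lpa_free_algebra K E) \<and>
      (\<forall>c. \<forall>a\<in>I. Poly_Mapping.single 0 c * a \<in> I) \<and> lpa_relators K E \<subseteq> I}"
  have N: "N = \<Inter>?F"
    by (simp add: lpa_relation_ideal_def algebra_ideal_generated_def A_simps)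
  have "A \<in> ?F"
    using nonunital_ring.ideal_carrier[OF A_ring] relators_A by auto
  then show "two_sided_ideal N (lpa_free_algebra K E)"
    unfolding N by (intro nonunital_ring.ideal_Inter[OF A_ring]) auto
  show "x \<in> N \<Longrightarrow> Poly_Mapping.single 0 c * x \<in> N" "lpa_relators K E \<subseteq> N"
    unfolding N by auto
qed

lemma N_least:
  assumes "two_sided_ideal I (lpa_free_algebra K E)"
    "\<And>c a. a \<in> I \<Longrightarrow> Poly_Mapping.single 0 c * a \<in> I" "lpa_relators K E \<subseteq> I"
  shows "N \<subseteq> I"
  unfolding lpa_relation_ideal_def algebra_ideal_generated_def A_simps using assms by auto

lemma N_A: "x \<in> N \<Longrightarrow> x \<in> A"
  using N_ideal by (auto simp: A_ideal_iff)

lemma U_decompose: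
  assumes "x \<in> U"
  obtains c y where "y \<in> A" "x = Poly_Mapping.single 0 c + y"
proof -
  have "x - Poly_Mapping.single 0 (Poly_Mapping.lookup x 0) \<in> A"
    unfolding lpa_free_algebra_eq free_algebra_carrier_iff using assms by (simp add: lookup_minus)
  then show ?thesis using that[of "x - Poly_Mapping.single 0 (Poly_Mapping.lookup x 0)" "Poly_Mapping.lookup x 0"] by simp
qed

definition cong :: "('v, 'e, 'k) lpa_free \<Rightarrow> ('v, 'e, 'k) lpa_free \<Rightarrow> bool" (infix "\<approx>" 50) where
  "x \<approx> y \<longleftrightarrow> x - y \<in> N"

lemma N_closed: "0 \<in> N" "x \<in> N \<Longrightarrow> y \<in> N \<Longrightarrow> x + y \<in> N" "x \<in> N \<Longrightarrow> - x \<in> N"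
  using N_ideal by (auto simp: A_ideal_iff)

lemma N_mult: "x \<in> N \<Longrightarrow> u \<in> U \<Longrightarrow> u * x \<in> N" "x \<in> N \<Longrightarrow> u \<in> U \<Longrightarrow> x * u \<in> N"
  using N_ideal N_scalar scalar_commute[of x]
  by (auto elim!: U_decompose intro!: N_closed simp: A_ideal_iff distrib_left distrib_right)

lemma cong_refl [simp, intro]: "x \<approx> x"
  by (simp add: cong_def N_closed)

lemma cong_sym: "x \<approx> y \<Longrightarrow> y \<approx> x"
  unfolding cong_def by (drule N_closed(3)) simp

lemma cong_trans [trans]: "x \<approx> y \<Longrightarrow> y \<approx> z \<Longrightarrow> x \<approx> z"
  unfolding cong_def by (drule (1) N_closed(2)) simp

lemma cong_add: "x \<approx> y \<Longrightarrow> x' \<approx> y' \<Longrightarrow> x + x' \<approx> y + y'"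
  unfolding cong_def by (drule (1) N_closed(2)) (simp add: algebra_simps)

lemma cong_uminus: "x \<approx> y \<Longrightarrow> - x \<approx> - y"
  unfolding cong_def by (drule N_closed(3)) simp

lemma cong_diff: "x \<approx> y \<Longrightarrow> x' \<approx> y' \<Longrightarrow> x - x' \<approx> y - y'"
  using cong_add[OF _ cong_uminus, of x y x' y'] by simp

lemma cong_left: "x \<approx> y \<Longrightarrow> u \<in> U \<Longrightarrow> u * x \<approx> u * y"
  unfolding cong_def by (drule (1) N_mult(1)) (simp add: algebra_simps)

lemma cong_right: "x \<approx> y \<Longrightarrow> u \<in> U \<Longrightarrow> x * u \<approx> y * u"
  unfolding cong_def by (drule (1) N_mult(2)) (simp add: algebra_simps)

lemma cong_mult: "x \<approx> y \<Longrightarrow> x' \<approx> y' \<Longrightarrow> x' \<in> U \<Longrightarrow> y \<in> U \<Longrightarrow> x * x' \<approx> y * y'"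
  by (rule cong_trans[OF cong_right cong_left])

lemma cong_sum: "(\<And>i. i \<in> S \<Longrightarrow> f i \<approx> g i) \<Longrightarrow> sum f S \<approx> sum g S"
  by (induction S rule: infinite_finite_induct) (auto intro: cong_add)

lemma eq_cong_trans [trans]: "x = y \<Longrightarrow> y \<approx> z \<Longrightarrow> x \<approx> z" "x \<approx> y \<Longrightarrow> y = z \<Longrightarrow> x \<approx> z"
  by simp_all

lemma relator_cong: "a - b \<in> lpa_relators K E \<Longrightarrow> a \<approx> b"
  unfolding cong_def using N_relators by blast

lemma vtx_vtx:
  assumes "v \<in> verts E" "w \<in> verts E"
  shows "vtx v * vtx w \<approx> (if v = w then vtx v else 0)"
  by (rule relator_cong) (unfold lpa_relators_def, use assms in blast)

lemma tail_edg: "e \<in> arcs E \<Longrightarrow> vtx (tail E e) * edg e \<approx> edg e"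
  and edg_head: "e \<in> arcs E \<Longrightarrow> edg e * vtx (head E e) \<approx> edg e"
  and head_gho: "e \<in> arcs E \<Longrightarrow> vtx (head E e) * gho e \<approx> gho e"
  and gho_tail: "e \<in> arcs E \<Longrightarrow> gho e * vtx (tail E e) \<approx> gho e"
  by (rule relator_cong; unfold lpa_relators_def; blast)+

lemma gho_edg:
  assumes "e \<in> arcs E" "f \<in> arcs E"
  shows "gho e * edg f \<approx> (if e = f then vtx (head E e) else 0)"
  by (rule relator_cong) (unfold lpa_relators_def, use assms in blast)

lemma vtx_CK2: "regular_vertex E v \<Longrightarrow> vtx v \<approx> (\<Sum>e\<in>out_arcs E v. edg e * gho e)"
  by (rule relator_cong) (unfold lpa_relators_def, blast)

lemma vtx_edg:
  assumes v: "v \<in> verts E" and e: "e \<in> arcs E"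
  shows "vtx v * edg e \<approx> (if v = tail E e then edg e else 0)"
proof -
  have "vtx v * edg e \<approx> vtx v * (vtx (tail E e) * edg e)"
    by (rule cong_left[OF cong_sym[OF tail_edg[OF e]] U_gens(1)[OF v]])
  also have "\<dots> = (vtx v * vtx (tail E e)) * edg e" by (simp add: mult.assoc)
  also have "\<dots> \<approx> (if v = tail E e then vtx v else 0) * edg e"
    using v e by (intro cong_right[OF vtx_vtx]) (simp_all add: U_gens)
  finally show ?thesis using tail_edg[OF e] by (auto intro: cong_trans)
qed

lemma edg_vtx:
  assumes v: "v \<in> verts E" and e: "e \<in> arcs E"
  shows "edg e * vtx v \<approx> (if v = head E e then edg e else 0)"
proof -
  have "edg e * vtx v \<approx> (edg e * vtx (head E e)) * vtx v"
    by (rule cong_right[OF cong_sym[OF edg_head[OF e]] U_gens(1)[OF v]])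
  also have "\<dots> = edg e * (vtx (head E e) * vtx v)" by (simp add: mult.assoc)
  also have "\<dots> \<approx> edg e * (if head E e = v then vtx (head E e) else 0)"
    using v e by (intro cong_left[OF vtx_vtx]) (simp_all add: U_gens)
  finally show ?thesis using edg_head[OF e] by (auto intro: cong_trans)
qed

lemma vtx_gho:
  assumes v: "v \<in> verts E" and e: "e \<in> arcs E"
  shows "vtx v * gho e \<approx> (if v = head E e then gho e else 0)"
proof -
  have "vtx v * gho e \<approx> vtx v * (vtx (head E e) * gho e)"
    by (rule cong_left[OF cong_sym[OF head_gho[OF e]] U_gens(1)[OF v]])
  also have "\<dots> = (vtx v * vtx (head E e)) * gho e" by (simp add: mult.assoc)
  also have "\<dots> \<approx> (if v = head E e then vtx v else 0) * gho e"
    using v e by (intro cong_right[OF vtx_vtx]) (simp_all add: U_gens)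
  finally show ?thesis using head_gho[OF e] by (auto intro: cong_trans)
qed

lemma gho_vtx:
  assumes v: "v \<in> verts E" and e: "e \<in> arcs E"
  shows "gho e * vtx v \<approx> (if v = tail E e then gho e else 0)"
proof -
  have "gho e * vtx v \<approx> (gho e * vtx (tail E e)) * vtx v"
    by (rule cong_right[OF cong_sym[OF gho_tail[OF e]] U_gens(1)[OF v]])
  also have "\<dots> = gho e * (vtx (tail E e) * vtx v)" by (simp add: mult.assoc)
  also have "\<dots> \<approx> gho e * (if tail E e = v then vtx (tail E e) else 0)"
    using v e by (intro cong_left[OF vtx_vtx]) (simp_all add: U_gens)
  finally show ?thesis using gho_tail[OF e] by (auto intro: cong_trans)
qed

text \<open>Stand-ins inside the free algebra for the ideals of L, to which they correspond along
  \<open>lpa_class K E\<close>.\<close>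

definition ideal_above :: "('v, 'e, 'k) lpa_free set \<Rightarrow> bool" where
  "ideal_above I \<longleftrightarrow> two_sided_ideal I (lpa_free_algebra K E) \<and> N \<subseteq> I"

lemma ideal_above_N: "ideal_above N"
  by (simp add: ideal_above_def N_ideal)

text \<open>Sums of vertices replace the missing unit. All larger finite sets \<open>T\<close> are
  included in the claim because a sum or a product of two elements needs one set of vertices that
  serves both.\<close>

lemma local_unit:
  assumes "x \<in> A"
  shows "\<exists>S. finite S \<and> S \<subseteq> verts E \<and>
    (\<forall>T. finite T \<longrightarrow> S \<subseteq> T \<longrightarrow> T \<subseteq> verts E \<longrightarrow> (\<Sum>v\<in>T. vtx v) * x \<approx> x \<and> x * (\<Sum>v\<in>T. vtx v) \<approx> x)"
proof -
  define lu where "lu S x \<longleftrightarrow> (\<forall>T. finite T \<longrightarrow> S \<subseteq> T \<longrightarrow> T \<subseteq> verts E \<longrightarrow>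
      (\<Sum>v\<in>T. vtx v) * x \<approx> x \<and> x * (\<Sum>v\<in>T. vtx v) \<approx> x)" for S and x :: "('v, 'e, 'k) lpa_free"
  have mono: "lu S' x" if "lu S x" "S \<subseteq> S'" for S S' x
    using that unfolding lu_def by blast
  have TU: "(\<Sum>v\<in>T. vtx v) \<in> U" if "T \<subseteq> verts E" for T
    using that by (intro words_over_sum) auto
  have delta: "(\<Sum>v\<in>T. f v) \<approx> y" if "finite T" "w \<in> T" "\<And>v. v \<in> T \<Longrightarrow> f v \<approx> (if v = w then y else 0)"
    for T w and f :: "'v \<Rightarrow> _" and y
  proof -
    have "(\<Sum>v\<in>T. f v) \<approx> (\<Sum>v\<in>T. if v = w then y else 0)" by (rule cong_sum) (rule that(3))
    then show ?thesis using that(1,2) by (simp add: sum.delta')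
  qed
  \<comment> \<open>On each side a generator is fixed by exactly one vertex and killed by the
    others; \<open>w1\<close> and \<open>w2\<close> are these vertices.\<close>
  have lu_generator: "lu {w1, w2} x"
    if "\<And>v. v \<in> verts E \<Longrightarrow> vtx v * x \<approx> (if v = w1 then x else 0)"
      "\<And>v. v \<in> verts E \<Longrightarrow> x * vtx v \<approx> (if v = w2 then x else 0)" for w1 w2 x
    unfolding lu_def sum_distrib_left sum_distrib_right
  proof (intro allI impI conjI)
    fix T assume T: "finite T" "{w1, w2} \<subseteq> T" "T \<subseteq> verts E"
    show "(\<Sum>v\<in>T. vtx v * x) \<approx> x"
      using T(3) by (intro delta[OF T(1), of w1] that(1)) (use T(2) in auto)
    show "(\<Sum>v\<in>T. x * vtx v) \<approx> x"
      using T(3) by (intro delta[OF T(1), of w2] that(2)) (use T(2) in auto)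
  qed
  have "x \<in> A \<and> (\<exists>S. finite S \<and> S \<subseteq> verts E \<and> lu S x)"
    using assms
  proof (induction x rule: A_induct)
    case zero
    show ?case by (intro conjI exI[of _ "{}"]) (simp_all add: lu_def)
  next
    case (generator g)
    then consider v where "g = Vertex v" "v \<in> verts E" | e where "g = Edge e" "e \<in> arcs E"
      | e where "g = Ghost e" "e \<in> arcs E" by blast
    then show ?case
    proof cases
      case 1
      have "lu {v, v} (vtx v)"
      proof (rule lu_generator)
        fix w assume w: "w \<in> verts E"
        show "vtx w * vtx v \<approx> (if w = v then vtx v else 0)"
          using vtx_vtx[OF w 1(2)] by (cases "w = v") simp_all
        show "vtx v * vtx w \<approx> (if w = v then vtx v else 0)"
          using vtx_vtx[OF 1(2) w] by (cases "w = v") simp_all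
      qed
      then show ?thesis using 1 by (intro conjI exI[of _ "{v, v}"]) auto
    next
      case 2
      have "lu {tail E e, head E e} (edg e)"
        using vtx_edg[OF _ 2(2)] edg_vtx[OF _ 2(2)] by (rule lu_generator)
      then show ?thesis using 2 by (intro conjI exI[of _ "{tail E e, head E e}"]) auto
    next
      case 3
      have "lu {head E e, tail E e} (gho e)"
        using vtx_gho[OF _ 3(2)] gho_vtx[OF _ 3(2)] by (rule lu_generator)
      then show ?thesis using 3 by (intro conjI exI[of _ "{head E e, tail E e}"]) auto
    qed
  next
    case (add a b)
    then obtain S S' where S: "a \<in> A" "b \<in> A" "finite S" "S \<subseteq> verts E" "lu S a"
      "finite S'" "S' \<subseteq> verts E" "lu S' b"
      by blast
    have "lu (S \<union> S') (a + b)"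
      unfolding lu_def distrib_left distrib_right
    proof (intro allI impI conjI cong_add)
      fix T assume T: "finite T" "S \<union> S' \<subseteq> T" "T \<subseteq> verts E"
      show "(\<Sum>v\<in>T. vtx v) * a \<approx> a" "a * (\<Sum>v\<in>T. vtx v) \<approx> a"
        using S(5) T by (auto simp: lu_def)
      show "(\<Sum>v\<in>T. vtx v) * b \<approx> b" "b * (\<Sum>v\<in>T. vtx v) \<approx> b"
        using S(8) T by (auto simp: lu_def)
    qed
    then show ?case using S by (intro conjI exI[of _ "S \<union> S'"]) auto
  next
    case (scalar a c)
    then obtain S where S: "a \<in> A" "finite S" "S \<subseteq> verts E" "lu S a" by blast
    have "lu S (Poly_Mapping.single 0 c * a)"
      unfolding lu_def
    proof (intro allI impI)
      fix T assume T: "finite T" "S \<subseteq> T" "T \<subseteq> verts E"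
      have "Poly_Mapping.single 0 c * ((\<Sum>v\<in>T. vtx v) * a) \<approx> Poly_Mapping.single 0 c * a"
        "Poly_Mapping.single 0 c * (a * (\<Sum>v\<in>T. vtx v)) \<approx> Poly_Mapping.single 0 c * a"
        using S(4) T by (auto simp: lu_def intro!: cong_left)
      moreover have "(\<Sum>v\<in>T. vtx v) * (Poly_Mapping.single 0 c * a) = Poly_Mapping.single 0 c * ((\<Sum>v\<in>T. vtx v) * a)"
        unfolding mult.assoc[symmetric] scalar_commute ..
      ultimately show "(\<Sum>v\<in>T. vtx v) * (Poly_Mapping.single 0 c * a) \<approx> Poly_Mapping.single 0 c * a \<and>
          Poly_Mapping.single 0 c * a * (\<Sum>v\<in>T. vtx v) \<approx> Poly_Mapping.single 0 c * a"
        by (simp only: mult.assoc)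
    qed
    then show ?case using S by blast
  next
    case (mult a b)
    then obtain S S' where S: "a \<in> A" "b \<in> A" "finite S" "S \<subseteq> verts E" "lu S a"
      "finite S'" "S' \<subseteq> verts E" "lu S' b"
      by blast
    have "lu (S \<union> S') (a * b)"
      unfolding lu_def
    proof (intro allI impI)
      fix T assume T: "finite T" "S \<union> S' \<subseteq> T" "T \<subseteq> verts E"
      then have "(\<Sum>v\<in>T. vtx v) * a \<approx> a" "b * (\<Sum>v\<in>T. vtx v) \<approx> b"
        using S(5,8) by (auto simp: lu_def)
      then have "((\<Sum>v\<in>T. vtx v) * a) * b \<approx> a * b" "a * (b * (\<Sum>v\<in>T. vtx v)) \<approx> a * b"
        using S(1,2) by (auto intro: cong_left cong_right)
      then show "(\<Sum>v\<in>T. vtx v) * (a * b) \<approx> a * b \<and> a * b * (\<Sum>v\<in>T. vtx v) \<approx> a * b"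
        by (simp add: mult.assoc)
    qed
    then show ?case using S by (intro conjI exI[of _ "S \<union> S'"]) auto
  qed
  then show ?thesis unfolding lu_def by blast
qed

end

context lpa
begin

lemma ideal_aboveD:
  assumes "ideal_above I"
  shows "I \<subseteq> A" "N \<subseteq> I" "0 \<in> I" "x \<in> I \<Longrightarrow> y \<in> I \<Longrightarrow> x + y \<in> I" "x \<in> I \<Longrightarrow> - x \<in> I"
    "x \<in> I \<Longrightarrow> a \<in> A \<Longrightarrow> a * x \<in> I" "x \<in> I \<Longrightarrow> a \<in> A \<Longrightarrow> x * a \<in> I"
  using assms unfolding ideal_above_def A_ideal_iff by blast+

lemma ideal_above_diff: "ideal_above I \<Longrightarrow> x \<in> I \<Longrightarrow> y \<in> I \<Longrightarrow> x - y \<in> I"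
  using ideal_aboveD(4)[of I x "- y"] ideal_aboveD(5)[of I y] by simp

lemma ideal_above_sum: "ideal_above I \<Longrightarrow> (\<And>i. i \<in> S \<Longrightarrow> f i \<in> I) \<Longrightarrow> sum f S \<in> I"
  by (induction S rule: infinite_finite_induct) (simp_all add: ideal_aboveD)

lemma ideal_above_cong:
  assumes "ideal_above I" "x \<approx> y"
  shows "x \<in> I \<longleftrightarrow> y \<in> I"
proof -
  have "x - y \<in> I" using assms ideal_aboveD(2) by (auto simp: cong_def)
  then show ?thesis
    using ideal_aboveD(4)[OF assms(1), of "x - y" y] ideal_above_diff[OF assms(1), of x "x - y"] by auto
qed

text \<open>A scalar can be absorbed into a local unit: c x is congruent to the product of c times
  the local unit, which lies in the algebra without unit, and x. So ring ideals of L are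
  automatically subspaces.\<close>

lemma ideal_above_scalar:
  assumes I: "ideal_above I" and x: "x \<in> I"
  shows "Poly_Mapping.single 0 c * x \<in> I"
proof -
  have "x \<in> A" using ideal_aboveD(1)[OF I] x by blast
  then obtain T where T: "finite T" "T \<subseteq> verts E" "(\<Sum>v\<in>T. vtx v) * x \<approx> x"
    using local_unit[of x] by blast
  have "(\<Sum>v\<in>T. vtx v) \<in> A" using T(2) by (intro A_sum A_gens) auto
  then have "Poly_Mapping.single 0 c * (\<Sum>v\<in>T. vtx v) \<in> A" by (intro A_closed(5)) auto
  then have "Poly_Mapping.single 0 c * (\<Sum>v\<in>T. vtx v) * x \<in> I" by (rule ideal_aboveD(6)[OF I x])
  moreover have "Poly_Mapping.single 0 c * ((\<Sum>v\<in>T. vtx v) * x) \<approx> Poly_Mapping.single 0 c * x"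
    using T(3) by (rule cong_left) simp
  ultimately show ?thesis
    using ideal_above_cong[OF I] by (simp add: mult.assoc)
qed

lemma ideal_above_mult:
  assumes I: "ideal_above I" and x: "x \<in> I" and u: "u \<in> U"
  shows "u * x \<in> I" "x * u \<in> I"
proof -
  obtain c y where y: "y \<in> A" "u = Poly_Mapping.single 0 c + y" using u by (rule U_decompose)
  show "u * x \<in> I" "x * u \<in> I"
    unfolding y(2) distrib_left distrib_right scalar_commute
    by (intro ideal_aboveD(4,6,7)[OF I] ideal_above_scalar[OF I] x y(1))+
qed

section \<open>From the free algebra modulo relations to L\<close>

abbreviation cl :: "('v, 'e, 'k) lpa_free \<Rightarrow> ('v, 'e, 'k) lpa_free set" where
  "cl \<equiv> lpa_class K E"

abbreviation L :: "('k, ('v, 'e, 'k) lpa_free set) module" where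
  "L \<equiv> leavitt_path_algebra K E"

sublocale cl: surjective_hom "lpa_free_algebra K E" "leavitt_path_algebra K E" "lpa_class K E"
proof -
  have "lpa_class K E = (\<lambda>x. N +>\<^bsub>lpa_free_algebra K E\<^esub> x)"
    by (rule ext) (simp add: lpa_class_def)
  then show "surjective_hom (lpa_free_algebra K E) L (lpa_class K E)"
    using surjective_hom_quotient_algebra[OF A_ring N_ideal] by (simp add: leavitt_path_algebra_def)
qed

lemma cl_zero_iff: "x \<in> A \<Longrightarrow> cl x = \<zero>\<^bsub>L\<^esub> \<longleftrightarrow> x \<in> N"
  using nonunital_ring.coset_eq_self_iff[OF A_ring, of N x] N_ideal
  by (simp add: lpa_class_def leavitt_path_algebra_def quotient_algebra_simps two_sided_ideal_def)

lemma preimage_zero: "cl.preimage {\<zero>\<^bsub>L\<^esub>} = N"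
  using cl_zero_iff N_A by (auto simp: cl.preimage_def)

lemma ideal_above_preimage: "two_sided_ideal I L \<Longrightarrow> ideal_above (cl.preimage I)"
  using cl.preimage_ideal cl.kernel_subset preimage_zero by (simp add: ideal_above_def)

lemma ideal_image: "ideal_above I \<Longrightarrow> two_sided_ideal (cl ` I) L"
  by (simp add: ideal_above_def cl.image_ideal)

lemma preimage_ideal_image: "ideal_above I \<Longrightarrow> cl.preimage (cl ` I) = I"
  by (rule cl.preimage_image) (simp_all add: ideal_above_def preimage_zero)

lemma cl_mem_image_iff: "ideal_above I \<Longrightarrow> x \<in> A \<Longrightarrow> cl x \<in> cl ` I \<longleftrightarrow> x \<in> I"
  using preimage_ideal_image[of I] by (auto simp: cl.preimage_def)

lemma cl_eq_iff: "x \<in> A \<Longrightarrow> y \<in> A \<Longrightarrow> cl x = cl y \<longleftrightarrow> x \<approx> y"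
proof -
  assume xy: "x \<in> A" "y \<in> A"
  have "additive_subgroup N (lpa_free_algebra K E)"
    using N_ideal by (simp add: two_sided_ideal_def)
  moreover have "\<ominus>\<^bsub>lpa_free_algebra K E\<^esub> y = - y"
    by (rule cl.R.minus_equality) (use xy in \<open>simp_all add: A_simps\<close>)
  ultimately show ?thesis
    using cl.R.coset_eq_iff[of N x y] xy by (simp add: lpa_class_def cong_def A_simps)
qed

lemma cl_add: "x \<in> A \<Longrightarrow> y \<in> A \<Longrightarrow> cl x \<oplus>\<^bsub>L\<^esub> cl y = cl (x + y)"
  using cl.hom_add[of x y] by (simp add: A_simps)

lemma cl_mult: "x \<in> A \<Longrightarrow> y \<in> A \<Longrightarrow> cl x \<otimes>\<^bsub>L\<^esub> cl y = cl (x * y)"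
  using cl.hom_mult[of x y] by (simp add: A_simps)

lemma cl_smult: "x \<in> A \<Longrightarrow> c \<odot>\<^bsub>L\<^esub> cl x = cl (Poly_Mapping.single 0 c * x)"
proof -
  assume x: "x \<in> A"
  have Na: "additive_subgroup N (lpa_free_algebra K E)"
    using N_ideal by (simp add: two_sided_ideal_def)
  have const: "cl (Poly_Mapping.single 0 c * b) = cl (Poly_Mapping.single 0 c * x)" if b: "b \<in> cl x" for b
  proof -
    have "b \<in> A" "cl b = cl x"
      using cl.R.mem_coset_iff[OF Na x, of b] b by (simp_all add: lpa_class_def)
    then have "b \<approx> x" using cl_eq_iff x by simp
    then have "Poly_Mapping.single 0 c * b \<approx> Poly_Mapping.single 0 c * x" by (rule cong_left) simp
    then show ?thesis using cl_eq_iff x \<open>b \<in> A\<close> by simp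
  qed
  have "cl x \<noteq> {}" using cl.R.mem_coset_iff[OF Na x, of x] x by (auto simp: lpa_class_def)
  have "c \<odot>\<^bsub>L\<^esub> cl x = (\<Union>b\<in>cl x. cl (Poly_Mapping.single 0 c * b))"
    by (simp add: leavitt_path_algebra_def quotient_algebra_simps A_simps lpa_class_def)
  also have "\<dots> = (\<Union>b\<in>cl x. cl (Poly_Mapping.single 0 c * x))"
    by (rule SUP_cong[OF refl const])
  also have "\<dots> = cl (Poly_Mapping.single 0 c * x)" using \<open>cl x \<noteq> {}\<close> by simp
  finally show ?thesis .
qed

section \<open>Paths and ghost paths\<close>

text \<open>The leading vertex turns the trivial path at \<open>u\<close> into the vertex
  \<open>u\<close>, where the bare product of edges would give \<open>1\<close>.\<close>

definition path :: "'v \<Rightarrow> 'e list \<Rightarrow> ('v, 'e, 'k) lpa_free" where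
  "path u p = vtx u * prod_list (map edg p)"

definition gpath :: "'v \<Rightarrow> 'e list \<Rightarrow> ('v, 'e, 'k) lpa_free" where
  "gpath u p = prod_list (map gho (rev p)) * vtx u"

lemma edges_U: "set p \<subseteq> arcs E \<Longrightarrow> prod_list (map edg p) \<in> U"
  by (rule words_over_prod_list) auto

lemma ghosts_U: "set p \<subseteq> arcs E \<Longrightarrow> prod_list (map gho (rev p)) \<in> U"
  by (rule words_over_prod_list) auto

lemma path_A: "awalk u p v \<Longrightarrow> path u p \<in> A"
  unfolding path_def by (rule A_closed(6)) (auto simp: awalk_def intro: edges_U)

lemma gpath_A: "awalk u p v \<Longrightarrow> gpath u p \<in> A"
  unfolding gpath_def by (rule A_closed(5)) (auto simp: awalk_def intro!: ghosts_U)

lemma path_U [intro]: "awalk u p v \<Longrightarrow> path u p \<in> U"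
  by (rule A_U, rule path_A)

lemma gpath_U [intro]: "awalk u p v \<Longrightarrow> gpath u p \<in> U"
  by (rule A_U, rule gpath_A)

lemma path_Nil [simp]: "path u [] = vtx u"
  by (simp add: path_def)

lemma vtx_idem: "v \<in> verts E \<Longrightarrow> vtx v * vtx v \<approx> vtx v"
  using vtx_vtx[of v v] by simp

lemma path_Cons:
  assumes "awalk u (e # p) v"
  shows "path u (e # p) \<approx> edg e * path (head E e) p"
proof -
  from assms have e: "e \<in> arcs E" "u = tail E e" and p: "awalk (head E e) p v"
    by (simp_all add: awalk_Cons_iff)
  have pU: "prod_list (map edg p) \<in> U" using p by (intro edges_U) (auto simp: awalk_def)
  have "path u (e # p) = (vtx (tail E e) * edg e) * prod_list (map edg p)"
    by (simp add: path_def e(2) mult.assoc)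
  also have "\<dots> \<approx> edg e * prod_list (map edg p)"
    by (rule cong_right[OF tail_edg[OF e(1)] pU])
  also have "\<dots> \<approx> (edg e * vtx (head E e)) * prod_list (map edg p)"
    by (rule cong_right[OF cong_sym[OF edg_head[OF e(1)]] pU])
  finally show ?thesis by (simp add: path_def mult.assoc)
qed

lemma gpath_Cons:
  assumes "awalk u (e # p) v"
  shows "gpath u (e # p) \<approx> gpath (head E e) p * gho e"
proof -
  from assms have e: "e \<in> arcs E" "u = tail E e" and p: "awalk (head E e) p v"
    by (simp_all add: awalk_Cons_iff)
  have pU: "prod_list (map gho (rev p)) \<in> U" using p by (intro ghosts_U) (auto simp: awalk_def)
  have "gpath u (e # p) = prod_list (map gho (rev p)) * (gho e * vtx (tail E e))"
    by (simp add: gpath_def e(2) mult.assoc)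
  also have "\<dots> \<approx> prod_list (map gho (rev p)) * gho e"
    by (rule cong_left[OF gho_tail[OF e(1)] pU])
  also have "\<dots> \<approx> prod_list (map gho (rev p)) * (vtx (head E e) * gho e)"
    by (rule cong_left[OF cong_sym[OF head_gho[OF e(1)]] pU])
  finally show ?thesis by (simp add: gpath_def mult.assoc)
qed

lemma path_vtx: "awalk u p v \<Longrightarrow> path u p * vtx v \<approx> path u p"
proof (induction p arbitrary: u)
  case Nil
  then show ?case by (auto simp: awalk_Nil_iff intro: vtx_idem)
next
  case (Cons e p)
  then have e: "e \<in> arcs E" and p: "awalk (head E e) p v" and v: "v \<in> verts E"
    by (auto simp: awalk_Cons_iff dest: awalk_last_in_verts)
  have "path u (e # p) * vtx v \<approx> edg e * path (head E e) p * vtx v"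
    by (rule cong_right[OF path_Cons[OF Cons.prems] U_gens(1)[OF v]])
  also have "\<dots> = edg e * (path (head E e) p * vtx v)" by (simp add: mult.assoc)
  also have "\<dots> \<approx> edg e * path (head E e) p"
    by (rule cong_left[OF Cons.IH[OF p] U_gens(2)[OF e]])
  also have "\<dots> \<approx> path u (e # p)" by (rule cong_sym[OF path_Cons[OF Cons.prems]])
  finally show ?case .
qed

lemma path_append:
  assumes p: "awalk u p v" and q: "awalk v q w"
  shows "path u p * path v q \<approx> path u (p @ q)"
proof -
  have "path u p * path v q = (path u p * vtx v) * prod_list (map edg q)"
    by (simp add: path_def mult.assoc)
  also have "\<dots> \<approx> path u p * prod_list (map edg q)"
    by (rule cong_right[OF path_vtx[OF p] edges_U]) (use q in \<open>auto simp: awalk_def\<close>)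
  finally show ?thesis by (simp add: path_def mult.assoc)
qed

lemma path_snoc:
  assumes p: "awalk u p (tail E e)" and e: "e \<in> arcs E"
  shows "path u p * edg e = path u (p @ [e])" "awalk u (p @ [e]) (head E e)"
  using p e by (auto simp: path_def mult.assoc awalk_append_iff awalk_simps dest: awalk_last_in_verts
      awlast_if_cas elim!: awalkE)

text \<open>The relations for \<open>gho e * edg f\<close> cancel the two paths edge by edge from
  their common start. The bound on the lengths excludes a proper initial segment \<open>q\<close> of
  \<open>p\<close>, where a ghost path would remain.\<close>

lemma gpath_path:
  assumes "awalk u p v" "awalk u q w" "length p \<le> length q"
  shows "gpath u p * path u q \<approx> (if take (length p) q = p then path v (drop (length p) q) else 0)"
  using assms
proof (induction p arbitrary: u q)
  case Nil
  then have uv: "u = v" "u \<in> verts E" by (auto simp: awalk_Nil_iff)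
  have "gpath u [] * path u q = (vtx u * vtx u) * prod_list (map edg q)"
    by (simp add: gpath_def path_def mult.assoc)
  also have "\<dots> \<approx> vtx u * prod_list (map edg q)"
    using Nil.prems(2) by (intro cong_right[OF vtx_idem[OF uv(2)] edges_U]) (simp add: awalk_def)
  finally show ?case by (simp add: path_def uv(1))
next
  case (Cons e p)
  then obtain f q' where q: "q = f # q'" by (cases q) auto
  from Cons.prems have e: "e \<in> arcs E" and p: "awalk (head E e) p v"
    and f: "f \<in> arcs E" and q': "awalk (head E f) q' w"
    by (simp_all add: awalk_Cons_iff q)
  have U: "path u q \<in> U" "gpath (head E e) p \<in> U" "path (head E f) q' \<in> U"
    using path_U[OF Cons.prems(2)] gpath_U[OF p] path_U[OF q'] by simp_all
  have "gpath u (e # p) * path u q \<approx> gpath (head E e) p * gho e * path u q"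
    by (rule cong_right[OF gpath_Cons[OF Cons.prems(1)] U(1)])
  also have "\<dots> \<approx> gpath (head E e) p * gho e * (edg f * path (head E f) q')"
    unfolding q using Cons.prems(2) U(2) e
    by (intro cong_left[OF path_Cons[of _ _ _ w]]) (simp_all add: q U_closed(6))
  also have "\<dots> = gpath (head E e) p * (gho e * edg f) * path (head E f) q'"
    by (simp add: mult.assoc)
  also have "\<dots> \<approx> gpath (head E e) p * (if e = f then vtx (head E e) else 0) * path (head E f) q'"
    by (rule cong_right[OF cong_left[OF gho_edg[OF e f] U(2)] U(3)])
  also have "\<dots> \<approx> (if e = f then gpath (head E e) p * path (head E e) q' else 0)"
  proof (cases "e = f")
    case True
    have "gpath (head E e) p * vtx (head E e) \<approx> gpath (head E e) p"
      unfolding gpath_def mult.assoc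
      by (rule cong_left[OF vtx_idem ghosts_U]) (use p e in \<open>auto simp: awalk_def\<close>)
    then have "gpath (head E e) p * vtx (head E e) * path (head E f) q' \<approx>
        gpath (head E e) p * path (head E f) q'"
      using U(3) by (rule cong_right)
    then show ?thesis using True by simp
  qed simp
  also have "\<dots> \<approx> (if take (length (e # p)) q = e # p then path v (drop (length (e # p)) q) else 0)"
    using Cons.IH[OF p, of q'] q' Cons.prems(3) by (auto simp: q)
  finally show ?case .
qed

lemma gpath_path_same: "awalk u p v \<Longrightarrow> gpath u p * path u p \<approx> vtx v"
  using gpath_path[of u p v p v] by simp

section \<open>The elements attached to breaking vertices\<close>

text \<open>With \<open>F\<close> the set of edges leaving \<open>v\<close> with head outside
  \<open>H\<close> this is v^H. Allowing any \<open>F\<close> covers regular vertices as well: there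
  the last defining relation says that \<open>brk v (out_arcs E v)\<close> is zero.\<close>

definition brk :: "'v \<Rightarrow> 'e set \<Rightarrow> ('v, 'e, 'k) lpa_free" where
  "brk v F = vtx v - (\<Sum>e\<in>F. edg e * gho e)"

lemma breaking_element_eq:
  "breaking_element K E H v = cl (brk v {e \<in> out_arcs E v. head E e \<notin> H})"
  by (simp add: breaking_element_def brk_def)

context
  fixes v F
  assumes v: "v \<in> verts E" and F: "F \<subseteq> out_arcs E v" and fin: "finite F"
begin

lemma brk_A: "brk v F \<in> A"
  unfolding brk_def using v F by (intro A_closed(4) A_sum A_closed(6)) auto

text \<open>The sum of the \<open>edg f * gho f\<close> over \<open>F\<close> fixes every edge of
  \<open>F\<close> from the left, so its difference from \<open>v\<close> annihilates these
  edges.\<close>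

lemma brk_edg:
  assumes e: "e \<in> F"
  shows "brk v F * edg e \<approx> 0"
proof -
  from e F have ea: "e \<in> arcs E" "tail E e = v" by auto
  have "(\<Sum>f\<in>F. edg f * gho f * edg e) \<approx> (\<Sum>f\<in>F. if f = e then edg e else 0)"
  proof (rule cong_sum)
    fix f assume f: "f \<in> F"
    then have fa: "f \<in> arcs E" using F by auto
    have "edg f * (gho f * edg e) \<approx> edg f * (if f = e then vtx (head E f) else 0)"
      by (rule cong_left[OF gho_edg[OF fa ea(1)] U_gens(2)[OF fa]])
    also have "\<dots> \<approx> (if f = e then edg e else 0)" using edg_head[OF ea(1)] by auto
    finally show "edg f * gho f * edg e \<approx> (if f = e then edg e else 0)" by (simp add: mult.assoc)
  qed
  then have "(\<Sum>f\<in>F. edg f * gho f * edg e) \<approx> edg e" using e fin by (simp add: sum.delta)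
  moreover have "vtx v * edg e \<approx> edg e" using tail_edg[OF ea(1)] ea(2) by simp
  ultimately have "vtx v * edg e - (\<Sum>f\<in>F. edg f * gho f * edg e) \<approx> edg e - edg e"
    by (intro cong_diff)
  then show ?thesis by (simp add: brk_def left_diff_distrib sum_distrib_right)
qed

lemma gho_brk:
  assumes e: "e \<in> F"
  shows "gho e * brk v F \<approx> 0"
proof -
  from e F have ea: "e \<in> arcs E" "tail E e = v" by auto
  have "(\<Sum>f\<in>F. gho e * edg f * gho f) \<approx> (\<Sum>f\<in>F. if f = e then gho e else 0)"
  proof (rule cong_sum)
    fix f assume f: "f \<in> F"
    then have fa: "f \<in> arcs E" using F by auto
    have "(gho e * edg f) * gho f \<approx> (if e = f then vtx (head E e) else 0) * gho f"
      by (rule cong_right[OF gho_edg[OF ea(1) fa] U_gens(3)[OF fa]])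
    also have "\<dots> \<approx> (if f = e then gho e else 0)" using head_gho[OF ea(1)] by auto
    finally show "gho e * edg f * gho f \<approx> (if f = e then gho e else 0)" .
  qed
  then have "(\<Sum>f\<in>F. gho e * edg f * gho f) \<approx> gho e" using e fin by (simp add: sum.delta)
  moreover have "gho e * vtx v \<approx> gho e" using gho_tail[OF ea(1)] ea(2) by simp
  ultimately have "gho e * vtx v - (\<Sum>f\<in>F. gho e * edg f * gho f) \<approx> gho e - gho e"
    by (intro cong_diff)
  then show ?thesis by (simp add: brk_def right_diff_distrib sum_distrib_left mult.assoc)
qed

lemma vtx_brk: "vtx v * brk v F \<approx> brk v F"
proof -
  have "(\<Sum>e\<in>F. vtx v * edg e * gho e) \<approx> (\<Sum>e\<in>F. edg e * gho e)"
  proof (rule cong_sum)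
    fix e assume "e \<in> F"
    then have e: "e \<in> arcs E" "tail E e = v" using F by auto
    show "vtx v * edg e * gho e \<approx> edg e * gho e"
      using cong_right[OF tail_edg[OF e(1)] U_gens(3)[OF e(1)]] e(2) by simp
  qed
  then have "vtx v * vtx v - (\<Sum>e\<in>F. vtx v * edg e * gho e) \<approx> brk v F"
    unfolding brk_def by (intro cong_diff vtx_idem v)
  then show ?thesis by (simp add: brk_def right_diff_distrib sum_distrib_left mult.assoc)
qed

lemma brk_idem: "brk v F * brk v F \<approx> brk v F"
proof -
  have "(\<Sum>e\<in>F. edg e * (gho e * brk v F)) \<approx> (\<Sum>e\<in>F. 0)"
  proof (rule cong_sum)
    fix e assume "e \<in> F"
    then show "edg e * (gho e * brk v F) \<approx> 0"
      using cong_left[OF gho_brk[of e], of "edg e"] F by auto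
  qed
  then have "vtx v * brk v F - (\<Sum>e\<in>F. edg e * (gho e * brk v F)) \<approx> brk v F - 0"
    by (intro cong_diff vtx_brk) simp
  moreover have "brk v F * brk v F = vtx v * brk v F - (\<Sum>e\<in>F. edg e * (gho e * brk v F))"
    by (subst (1) brk_def) (simp add: left_diff_distrib sum_distrib_right mult.assoc)
  ultimately show ?thesis by simp
qed

lemma brk_path:
  assumes "awalk v (e # p) w" "e \<in> F"
  shows "brk v F * path v (e # p) \<approx> 0"
proof -
  have p: "awalk (head E e) p w" using assms(1) by (simp add: awalk_Cons_iff)
  have "brk v F * path v (e # p) \<approx> brk v F * (edg e * path (head E e) p)"
    by (rule cong_left[OF path_Cons[OF assms(1)] A_U[OF brk_A]])
  also have "\<dots> = (brk v F * edg e) * path (head E e) p" by (simp add: mult.assoc)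
  also have "\<dots> \<approx> 0 * path (head E e) p"
    by (rule cong_right[OF brk_edg[OF assms(2)] path_U[OF p]])
  finally show ?thesis by simp
qed

end

lemma brk_out_arcs: "regular_vertex E v \<Longrightarrow> brk v (out_arcs E v) \<approx> 0"
  using cong_diff[OF vtx_CK2 cong_refl, of v "\<Sum>e\<in>out_arcs E v. edg e * gho e"]
  by (simp add: brk_def)

lemma brk_diff:
  assumes "finite F" "G \<subseteq> F"
  shows "brk v G = brk v F + (\<Sum>e\<in>F - G. edg e * gho e)"
  by (simp add: brk_def sum.subset_diff[OF assms(2,1), of "\<lambda>e. edg e * gho e"])

section \<open>Vertices in ideals\<close>

definition verts_in :: "('v, 'e, 'k) lpa_free set \<Rightarrow> 'v set" where
  "verts_in I = {v \<in> verts E. vtx v \<in> I}"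

lemma gr_vertices_eq: "gr_vertices K E I = verts_in (cl.preimage I)"
  by (auto simp: gr_vertices_def verts_in_def cl.preimage_def)

lemma edg_in_ideal:
  assumes I: "ideal_above I" and e: "e \<in> arcs E" and "head E e \<in> verts_in I"
  shows "edg e \<in> I" "gho e \<in> I"
proof -
  have v: "vtx (head E e) \<in> I" using assms(3) by (simp add: verts_in_def)
  show "edg e \<in> I"
    using ideal_above_mult(1)[OF I v U_gens(2)[OF e]] ideal_above_cong[OF I edg_head[OF e]] by simp
  show "gho e \<in> I"
    using ideal_above_mult(2)[OF I v U_gens(3)[OF e]] ideal_above_cong[OF I head_gho[OF e]] by simp
qed

text \<open>The head of an edge is recovered from its tail as
  \<open>gho e * vtx (tail E e) * edg e\<close>.\<close>

lemma verts_in_step: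
  assumes I: "ideal_above I" and e: "e \<in> arcs E" and t: "tail E e \<in> verts_in I"
  shows "head E e \<in> verts_in I"
proof -
  have "vtx (tail E e) \<in> I" using t by (simp add: verts_in_def)
  then have "vtx (tail E e) * edg e \<in> I" by (rule ideal_above_mult(2)[OF I _ U_gens(2)[OF e]])
  then have "edg e \<in> I" using ideal_above_cong[OF I tail_edg[OF e]] by simp
  then have "gho e * edg e \<in> I" by (rule ideal_above_mult(1)[OF I _ U_gens(3)[OF e]])
  then have "vtx (head E e) \<in> I" using ideal_above_cong[OF I gho_edg[OF e e]] by simp
  then show ?thesis using e by (simp add: verts_in_def)
qed

lemma verts_in_awalk:
  assumes I: "ideal_above I"
  shows "awalk u p v \<Longrightarrow> u \<in> verts_in I \<Longrightarrow> v \<in> verts_in I"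
  by (induction p arbitrary: u) (auto simp: awalk_simps dest: verts_in_step[OF I])

lemma verts_in_hereditary: "ideal_above I \<Longrightarrow> hereditary E (verts_in I)"
  unfolding hereditary_def using verts_in_awalk by (auto simp: verts_in_def reachable_awalk)

lemma verts_in_saturated:
  assumes I: "ideal_above I"
  shows "saturated E (verts_in I)"
  unfolding saturated_def
proof (intro allI impI)
  fix v assume v: "regular_vertex E v \<and> head E ` out_arcs E v \<subseteq> verts_in I"
  have "(\<Sum>e\<in>out_arcs E v. edg e * gho e) \<in> I"
    using v by (intro ideal_above_sum[OF I] ideal_above_mult(2)[OF I] edg_in_ideal(1)[OF I]) auto
  then have "vtx v \<in> I" using ideal_above_cong[OF I vtx_CK2[of v]] v by simp
  then show "v \<in> verts_in I" using v by (simp add: verts_in_def regular_vertex_def)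
qed

end

section \<open>Closed paths\<close>

context wf_digraph
begin

lemma simple_closed_path_iff:
  "simple_closed_path G v c \<longleftrightarrow>
     (\<exists>e p. c = e # p \<and> e \<in> arcs G \<and> tail G e = v \<and> awalk (head G e) p v \<and> (\<forall>f\<in>set p. tail G f \<noteq> v))"
  by (cases c) (auto simp: simple_closed_path_def awalk_Cons_iff)

lemma awalk_first_visit:
  "awalk u p v \<Longrightarrow> \<exists>q r. p = q @ r \<and> awalk u q v \<and> awalk v r v \<and> (\<forall>f\<in>set q. tail G f \<noteq> v)"
proof (induction p arbitrary: u)
  case Nil
  then show ?case by (auto simp: awalk_Nil_iff)
next
  case (Cons e p)
  show ?case
  proof (cases "u = v")
    case True
    then show ?thesis using Cons.prems by (intro exI[of _ "[]"] exI[of _ "e # p"]) (auto simp: awalk_simps)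
  next
    case False
    obtain q r where "p = q @ r" "awalk (head G e) q v" "awalk v r v" "\<forall>f\<in>set q. tail G f \<noteq> v"
      using Cons.IH[of "head G e"] Cons.prems by (auto simp: awalk_Cons_iff)
    then show ?thesis using False Cons.prems
      by (intro exI[of _ "e # q"] exI[of _ r]) (auto simp: awalk_Cons_iff)
  qed
qed

lemma first_return:
  assumes "awalk v p v" "p \<noteq> []"
  obtains c r where "p = c @ r" "simple_closed_path G v c" "awalk v r v"
proof -
  obtain e p' where p: "p = e # p'" using assms(2) by (cases p) auto
  then have e: "e \<in> arcs G" "tail G e = v" "awalk (head G e) p' v"
    using assms(1) by (auto simp: awalk_Cons_iff)
  obtain q r where "p' = q @ r" "awalk (head G e) q v" "awalk v r v" "\<forall>f\<in>set q. tail G f \<noteq> v"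
    using awalk_first_visit[OF e(3)] by blast
  then show thesis
    using that[of "e # q" r] p e by (auto simp: simple_closed_path_iff)
qed

text \<open>Simple closed paths at \<open>v\<close> form a prefix code: a proper extension of one
  would leave \<open>v\<close> again at a later edge, which simplicity forbids.\<close>

lemma simple_closed_path_unique_prefix:
  assumes c: "simple_closed_path G v c" and d: "simple_closed_path G v d" and eq: "c @ x = d @ y"
  shows "c = d"
proof -
  have no: False if "simple_closed_path G v a" "simple_closed_path G v (a @ s)" "s \<noteq> []" for a s
  proof -
    obtain f s' where s: "s = f # s'" using \<open>s \<noteq> []\<close> by (cases s) auto
    from that(1) obtain e p where a: "a = e # p" "awalk (head G e) p v"
      by (auto simp: simple_closed_path_iff)
    from that(2) a s have "awalk (head G e) (p @ f # s') v" "tail G f \<noteq> v"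
      by (auto simp: simple_closed_path_iff)
    then have "tail G f = v"
      using a(2) by (auto simp: awalk_append_iff awalk_Cons_iff awlast_if_cas elim!: awalkE)
    with \<open>tail G f \<noteq> v\<close> show False by simp
  qed
  from eq obtain s where "c = d @ s \<or> c @ s = d" by (auto simp: append_eq_append_conv2)
  then show ?thesis using no[of c s] no[of d s] c d by (cases "s = []") auto
qed

lemma simple_closed_path_awalk: "simple_closed_path G v c \<Longrightarrow> awalk v c v"
  by (simp add: simple_closed_path_def)

text \<open>A path \<open>c\<^sup>M d\<close> with \<open>c \<noteq> d\<close> is not an initial segment of \<open>r c\<^sup>M d\<close> for short nonempty \<open>r\<close>,
  as both factor uniquely into simple closed paths.\<close>

lemma simple_closed_path_power_shift:
  assumes c: "simple_closed_path G v c" and d: "simple_closed_path G v d" and "c \<noteq> d"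
  shows "awalk v r v \<Longrightarrow> length r \<le> j \<Longrightarrow> j < M \<or> r \<noteq> [] \<and> j \<le> M \<Longrightarrow>
    concat (replicate j c) @ d @ t \<noteq> r @ concat (replicate M c) @ d"
proof (induction j arbitrary: r M)
  case 0
  then obtain M' where "r = []" "M = Suc M'" by (cases M) auto
  then show ?case
    using simple_closed_path_unique_prefix[OF c d] \<open>c \<noteq> d\<close> by auto metis
next
  case (Suc j)
  show ?case
  proof (cases "r = []")
    case True
    \<comment> \<open>Once \<open>r\<close> is used up, the right-hand side gives up one of its own
      copies of \<open>c\<close> and keeps a surplus over the left. As long as \<open>r\<close>
      lasts, simple closed paths are split off from \<open>r\<close> instead and \<open>M\<close>
      stays fixed.\<close>
    then obtain M' where M': "M = Suc M'" "j < M'" using Suc.prems(3) by (cases M) auto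
    have "concat (replicate j c) @ d @ t \<noteq> [] @ concat (replicate M' c) @ d"
      using Suc.prems(1) M' True by (intro Suc.IH) auto
    then show ?thesis using True M' by simp
  next
    case False
    then obtain c' r' where r: "r = c' @ r'" "simple_closed_path G v c'" "awalk v r' v"
      using first_return[OF Suc.prems(1)] by blast
    show ?thesis
    proof
      assume eq: "concat (replicate (Suc j) c) @ d @ t = r @ concat (replicate M c) @ d"
      then have "c @ (concat (replicate j c) @ d @ t) = c' @ (r' @ concat (replicate M c) @ d)"
        by (simp add: r(1))
      then have "c = c'" by (rule simple_closed_path_unique_prefix[OF c r(2)])
      then have eq': "concat (replicate j c) @ d @ t = r' @ concat (replicate M c) @ d"
        using eq by (simp add: r(1))
      have "c \<noteq> []" using c by (simp add: simple_closed_path_def)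
      then have "0 < length c" by simp
      moreover have "length c + length r' \<le> Suc j" using Suc.prems(2) r(1) \<open>c = c'\<close> by simp
      ultimately have "length r' \<le> j" by linarith
      moreover have "j < M" using Suc.prems(3) by auto
      ultimately show False using eq' Suc.IH[OF r(3), of M] by simp
    qed
  qed
qed

text \<open>The inequality makes \<open>gpath v \<tau> * path v \<gamma> * path v \<tau>\<close>
  vanish, whereas \<open>gpath v \<tau> * path v \<tau>\<close> is \<open>v\<close>. So one \<tau>
  separates the vertex \<open>v\<close> from all the closed paths in
  \<open>\<Gamma>\<close>.\<close>

lemma condition_K_separating_path:
  assumes K: "condition_K G" and v: "v \<in> verts G" and fin: "finite \<Gamma>"
    and closed: "\<And>\<gamma>. \<gamma> \<in> \<Gamma> \<Longrightarrow> awalk v \<gamma> v \<and> \<gamma> \<noteq> []"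
  shows "\<exists>\<tau>. awalk v \<tau> v \<and> (\<forall>\<gamma>\<in>\<Gamma>. take (length \<tau>) (\<gamma> @ \<tau>) \<noteq> \<tau>)"
proof (cases "\<Gamma> = {}")
  \<comment> \<open>Without a member of \<open>\<Gamma>\<close> there may be no closed path at
    \<open>v\<close> at all; the trivial path serves.\<close>
  case True
  then show ?thesis using v by (intro exI[of _ "[]"]) (simp add: awalk_Nil_iff)
next
  case False
  then obtain \<gamma>0 where "\<gamma>0 \<in> \<Gamma>" by blast
  then obtain c where c: "simple_closed_path G v c"
    using closed[of \<gamma>0] first_return[of v \<gamma>0] by blast
  then obtain d where d: "simple_closed_path G v d" "d \<noteq> c"
    using K unfolding condition_K_def by blast
  \<comment> \<open>Only a common bound for the lengths in \<open>\<Gamma>\<close>, as required by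
    \<open>simple_closed_path_power_shift\<close> with \<open>j = M\<close>.\<close>
  define M where "M = (\<Sum>\<gamma>\<in>\<Gamma>. length \<gamma>)"
  let ?\<tau> = "concat (replicate M c) @ d"
  have rep: "awalk v (concat (replicate j c)) v" for j
  proof (induction j)
    case (Suc j)
    have "awalk v (c @ concat (replicate j c)) v"
      by (rule awalk_appendI[OF simple_closed_path_awalk[OF c] Suc.IH])
    then show ?case by simp
  qed (simp add: awalk_Nil_iff v)
  have "awalk v ?\<tau> v"
    by (rule awalk_appendI[OF rep simple_closed_path_awalk[OF d(1)]])
  moreover have "take (length ?\<tau>) (\<gamma> @ ?\<tau>) \<noteq> ?\<tau>" if \<gamma>: "\<gamma> \<in> \<Gamma>" for \<gamma>
  proof
    assume "take (length ?\<tau>) (\<gamma> @ ?\<tau>) = ?\<tau>"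
    then have "?\<tau> @ drop (length ?\<tau>) (\<gamma> @ ?\<tau>) = \<gamma> @ ?\<tau>"
      by (metis append_take_drop_id)
    then have eq: "concat (replicate M c) @ d @ drop (length ?\<tau>) (\<gamma> @ ?\<tau>) = \<gamma> @ concat (replicate M c) @ d"
      by simp
    have "length \<gamma> \<le> M"
      unfolding M_def using \<gamma> fin by (intro member_le_sum) auto
    then have "concat (replicate M c) @ d @ drop (length ?\<tau>) (\<gamma> @ ?\<tau>) \<noteq> \<gamma> @ concat (replicate M c) @ d"
      using closed[OF \<gamma>] d(2)
      by (intro simple_closed_path_power_shift[OF c d(1)]) auto
    with eq show False by (rule notE[rotated])
  qed
  ultimately show ?thesis by blast
qed

end

section \<open>Ideals are determined by vertices and breaking vertices\<close>

context lpa
begin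

definition path_span :: "'v \<Rightarrow> 'v \<Rightarrow> ('v, 'e, 'k) lpa_free \<Rightarrow> bool" where
  "path_span u v b \<longleftrightarrow> (\<exists>Q k. finite Q \<and> (\<forall>p\<in>Q. awalk u p v) \<and>
     b = (\<Sum>p\<in>Q. Poly_Mapping.single 0 (k p) * path u p))"

lemma single_zero_mult_left: "Poly_Mapping.single 0 (c * d) = Poly_Mapping.single 0 c * (Poly_Mapping.single 0 d :: ('v, 'e, 'k) lpa_free)"
  by (simp add: mult_single)

lemma scalar_cancel:
  assumes I: "ideal_above I" and "c \<noteq> 0" "Poly_Mapping.single 0 c * x \<in> I"
  shows "x \<in> I"
  using ideal_above_scalar[OF I assms(3), of "inverse c"] assms(2)
  by (simp add: mult.assoc[symmetric] mult_single)

lemma scalar_move: "a * (Poly_Mapping.single 0 c * x) = Poly_Mapping.single 0 c * (a * (x :: ('v, 'e, 'k) lpa_free))"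
  using scalar_commute[of a c] by (simp add: mult.assoc[symmetric])

text \<open>A shortest path with nonzero coefficient is cancelled by its ghost; \<open>x\<close> and \<open>y\<close> then kill
  the remaining terms, which are multiples of nontrivial closed paths.\<close>

lemma path_independence:
  assumes I: "ideal_above I" and fin: "finite Q" and Q: "\<And>p. p \<in> Q \<Longrightarrow> awalk u p v"
    and z: "z \<in> U"
    and mem: "(\<Sum>p\<in>Q. Poly_Mapping.single 0 (k p) * path u p) * z \<in> I"
    and kill: "\<And>\<Gamma>. finite \<Gamma> \<Longrightarrow> (\<And>\<gamma>. \<gamma> \<in> \<Gamma> \<Longrightarrow> awalk v \<gamma> v \<and> \<gamma> \<noteq> []) \<Longrightarrow>
      \<exists>x\<in>U. \<exists>y\<in>U. (\<forall>\<gamma>\<in>\<Gamma>. x * path v \<gamma> * z * y \<in> I) \<and> x * vtx v * z * y \<notin> I"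
    and p: "p \<in> Q"
  shows "k p = 0"
proof (rule ccontr)
  assume "k p \<noteq> 0"
  define Q' where "Q' = {p \<in> Q. k p \<noteq> 0}"
  have Q': "finite Q'" "Q' \<subseteq> Q" "p \<in> Q'" using fin p \<open>k p \<noteq> 0\<close> by (auto simp: Q'_def)
  obtain p1 where p1: "p1 \<in> Q'" "\<And>q. q \<in> Q' \<Longrightarrow> length p1 \<le> length q"
    using ex_has_least_nat[of "\<lambda>q. q \<in> Q'" p length] Q'(3) by blast
  have w1: "awalk u p1 v" using p1(1) Q' Q by blast
  let ?n = "length p1"
  \<comment> \<open>What is left of the other paths beginning with the shortest path
    \<open>p1\<close> once \<open>p1\<close> is cancelled: closed paths at \<open>v\<close>, because
    all paths end there, and nontrivial, because they differ from \<open>p1\<close>. Paths that do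
    not begin with \<open>p1\<close> are killed by its ghost.\<close>
  define \<Gamma> where "\<Gamma> = drop ?n ` {q \<in> Q'. q \<noteq> p1 \<and> take ?n q = p1}"
  have closed: "awalk v (drop ?n q) v" "drop ?n q \<noteq> []" if "q \<in> Q'" "q \<noteq> p1" "take ?n q = p1" for q
  proof -
    have "awalk u (p1 @ drop ?n q) v"
      using that Q' Q append_take_drop_id[of ?n q] by (metis subsetD)
    then show "awalk v (drop ?n q) v"
      using w1 by (auto simp: awalk_append_iff awlast_if_cas elim!: awalkE)
    show "drop ?n q \<noteq> []"
      using that append_take_drop_id[of ?n q] by auto
  qed
  have "finite \<Gamma>" using Q'(1) by (simp add: \<Gamma>_def)
  then have "\<exists>x\<in>U. \<exists>y\<in>U. (\<forall>\<gamma>\<in>\<Gamma>. x * path v \<gamma> * z * y \<in> I) \<and> x * vtx v * z * y \<notin> I"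
  proof (rule kill)
    fix \<gamma> assume "\<gamma> \<in> \<Gamma>"
    then obtain q where "q \<in> Q'" "q \<noteq> p1" "take ?n q = p1" "\<gamma> = drop ?n q" unfolding \<Gamma>_def by blast
    then show "awalk v \<gamma> v \<and> \<gamma> \<noteq> []" using closed[of q] by simp
  qed
  then obtain x y where xy: "x \<in> U" "y \<in> U" "\<forall>\<gamma>\<in>\<Gamma>. x * path v \<gamma> * z * y \<in> I"
    "x * vtx v * z * y \<notin> I"
    by (elim bexE conjE)
  have g: "gpath u p1 \<in> U" using w1 by (rule gpath_U)
  define t where "t q = x * (gpath u p1 * path u q) * z * y" for q
  have "x * gpath u p1 * ((\<Sum>p\<in>Q. Poly_Mapping.single 0 (k p) * path u p) * z) * y =
      (\<Sum>q\<in>Q. Poly_Mapping.single 0 (k q) * t q)"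
    by (simp add: sum_distrib_left sum_distrib_right t_def mult.assoc scalar_move)
  also have "\<dots> = (\<Sum>q\<in>Q'. Poly_Mapping.single 0 (k q) * t q)"
    by (rule sum.mono_neutral_right[OF fin Q'(2)]) (auto simp: Q'_def)
  also have "\<dots> = Poly_Mapping.single 0 (k p1) * t p1 + (\<Sum>q\<in>Q' - {p1}. Poly_Mapping.single 0 (k q) * t q)"
    by (rule sum.remove[OF Q'(1) p1(1)])
  finally have sum: "Poly_Mapping.single 0 (k p1) * t p1 +
      (\<Sum>q\<in>Q' - {p1}. Poly_Mapping.single 0 (k q) * t q) \<in> I"
    using ideal_above_mult(2)[OF I ideal_above_mult(1)[OF I mem U_closed(6)[OF xy(1) g]] xy(2)] by simp
  have tcong: "t q \<approx> x * (if take ?n q = p1 then path v (drop ?n q) else 0) * z * y" if "q \<in> Q'" for q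
    unfolding t_def
    by (intro cong_right[OF cong_right[OF cong_left[OF gpath_path]]] xy z)
      (use w1 that Q' Q p1(2) in auto)
  have "t q \<in> I" if q: "q \<in> Q'" "q \<noteq> p1" for q
  proof (cases "take ?n q = p1")
    case True
    then have "x * path v (drop ?n q) * z * y \<in> I" using q xy(3) by (auto simp: \<Gamma>_def)
    then show ?thesis using ideal_above_cong[OF I tcong[OF q(1)]] True by simp
  next
    case False
    then show ?thesis using ideal_above_cong[OF I tcong[OF q(1)]] ideal_aboveD(3)[OF I] by simp
  qed
  then have rest: "(\<Sum>q\<in>Q' - {p1}. Poly_Mapping.single 0 (k q) * t q) \<in> I"
    by (intro ideal_above_sum[OF I] ideal_above_scalar[OF I]) auto
  have "Poly_Mapping.single 0 (k p1) * t p1 \<in> I"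
    using ideal_above_diff[OF I sum rest] by simp
  then have "t p1 \<in> I" by (rule scalar_cancel[OF I, rotated]) (use p1(1) in \<open>simp add: Q'_def\<close>)
  then have "x * vtx v * z * y \<in> I"
    using ideal_above_cong[OF I tcong[OF p1(1)]] by simp
  with xy(4) show False ..
qed

lemma path_spanE:
  assumes "path_span u v b"
  obtains Q k where "finite Q" "\<forall>p\<in>Q. awalk u p v"
    "b = (\<Sum>p\<in>Q. Poly_Mapping.single 0 (k p) * path u p)"
  using assms unfolding path_span_def by (elim exE conjE)

text \<open>A separating path supplies the multipliers: its ghost on the left and itself on the
  right annihilate the nontrivial closed paths and return \<open>v\<close>, which is not in
  \<open>I\<close>.\<close>

lemma path_independence_condition_K:
  assumes I: "ideal_above I" and K: "condition_K E" and v: "v \<in> verts E" "v \<notin> verts_in I"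
    and Q: "finite Q" "\<forall>p\<in>Q. awalk u p v"
    and mem: "(\<Sum>p\<in>Q. Poly_Mapping.single 0 (k p) * path u p) \<in> I" and p: "p \<in> Q"
  shows "k p = 0"
proof (rule path_independence[OF I Q(1) _ _ _ _ p])
    show "awalk u p v" if "p \<in> Q" for p using Q(2) that by blast
    show "1 \<in> U" by simp
    show "(\<Sum>p\<in>Q. Poly_Mapping.single 0 (k p) * path u p) * 1 \<in> I" using mem by simp
    fix \<Gamma> assume \<Gamma>: "finite \<Gamma>" "\<And>\<gamma>. \<gamma> \<in> \<Gamma> \<Longrightarrow> awalk v \<gamma> v \<and> \<gamma> \<noteq> []"
    obtain \<tau> where \<tau>: "awalk v \<tau> v" "\<And>\<gamma>. \<gamma> \<in> \<Gamma> \<Longrightarrow> take (length \<tau>) (\<gamma> @ \<tau>) \<noteq> \<tau>"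
      using condition_K_separating_path[OF K v(1) \<Gamma>] by blast
    note U = gpath_U[OF \<tau>(1)] path_U[OF \<tau>(1)]
    have "gpath v \<tau> * path v \<gamma> * 1 * path v \<tau> \<in> I" if \<gamma>: "\<gamma> \<in> \<Gamma>" for \<gamma>
    proof -
      have w: "awalk v \<gamma> v" using \<Gamma>(2)[OF \<gamma>] by blast
      have "gpath v \<tau> * path v \<gamma> * 1 * path v \<tau> = gpath v \<tau> * (path v \<gamma> * path v \<tau>)"
        by (simp add: mult.assoc)
      also have "\<dots> \<approx> gpath v \<tau> * path v (\<gamma> @ \<tau>)"
        by (rule cong_left[OF path_append[OF w \<tau>(1)] U(1)])
      also have "\<dots> \<approx> 0"
        using gpath_path[OF \<tau>(1) awalk_appendI[OF w \<tau>(1)]] \<tau>(2)[OF \<gamma>] by simp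
      finally have "gpath v \<tau> * path v \<gamma> * 1 * path v \<tau> \<approx> 0" .
      from ideal_above_cong[OF I this] show ?thesis using ideal_aboveD(3)[OF I] by simp
    qed
    moreover have "gpath v \<tau> * vtx v * 1 * path v \<tau> \<notin> I"
    proof -
      have "gpath v \<tau> * vtx v * 1 * path v \<tau> = gpath v \<tau> * (path v [] * path v \<tau>)"
        by (simp add: mult.assoc)
      also have "\<dots> \<approx> gpath v \<tau> * path v ([] @ \<tau>)"
        by (rule cong_left[OF path_append[OF _ \<tau>(1)] U(1)]) (simp add: awalk_Nil_iff v)
      also have "\<dots> \<approx> vtx v" using gpath_path_same[OF \<tau>(1)] by simp
      finally have "gpath v \<tau> * vtx v * 1 * path v \<tau> \<approx> vtx v" .
      from ideal_above_cong[OF I this] show ?thesis using v by (simp add: verts_in_def)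
    qed
    ultimately show "\<exists>x\<in>U. \<exists>y\<in>U. (\<forall>\<gamma>\<in>\<Gamma>. x * path v \<gamma> * 1 * y \<in> I) \<and> x * vtx v * 1 * y \<notin> I"
      using U by (intro bexI[of _ "gpath v \<tau>"] bexI[of _ "path v \<tau>"] conjI ballI)
qed

text \<open>A closed path at \<open>v\<close> starts with an edge of \<open>F\<close> and is
  annihilated by \<open>brk v F\<close> on its left, while the vertex itself becomes the idempotent
  \<open>brk v F\<close>, which is not in \<open>I\<close>. So \<open>brk v F\<close> isolates the
  shortest path.\<close>

lemma path_independence_brk:
  assumes I: "ideal_above I" and v: "v \<in> verts E" and F: "F \<subseteq> out_arcs E v" "finite F"
    and closed: "\<And>e p. awalk v (e # p) v \<Longrightarrow> e \<in> F"
    and brk: "brk v F \<notin> I"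
    and b: "path_span u v b" "b * brk v F \<in> I"
  shows "b = 0"
proof -
  from b(1) obtain Q k where Q: "finite Q" "\<forall>p\<in>Q. awalk u p v"
    "b = (\<Sum>p\<in>Q. Poly_Mapping.single 0 (k p) * path u p)"
    by (rule path_spanE)
  have zU: "brk v F \<in> U" using brk_A[OF v F] by (rule A_U)
  have "k p = 0" if "p \<in> Q" for p
  proof (rule path_independence[OF I Q(1) _ zU _ _ that])
    show "awalk u p v" if "p \<in> Q" for p using Q(2) that by blast
    show "(\<Sum>p\<in>Q. Poly_Mapping.single 0 (k p) * path u p) * brk v F \<in> I" using b(2) Q(3) by simp
    fix \<Gamma> assume \<Gamma>: "finite \<Gamma>" "\<And>\<gamma>. \<gamma> \<in> \<Gamma> \<Longrightarrow> awalk v \<gamma> v \<and> \<gamma> \<noteq> []"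
    have "brk v F * path v \<gamma> * brk v F * 1 \<in> I" if \<gamma>: "\<gamma> \<in> \<Gamma>" for \<gamma>
    proof -
      obtain e p where ep: "\<gamma> = e # p" "awalk v (e # p) v" using \<Gamma>(2)[OF \<gamma>] by (cases \<gamma>) auto
      have "brk v F * path v \<gamma> \<approx> 0" using brk_path[OF v F ep(2) closed[OF ep(2)]] ep(1) by simp
      then have "brk v F * path v \<gamma> * brk v F \<approx> 0 * brk v F" using zU by (rule cong_right)
      from ideal_above_cong[OF I this] show ?thesis using ideal_aboveD(3)[OF I] by simp
    qed
    moreover have "brk v F * vtx v * brk v F * 1 \<notin> I"
    proof -
      have "brk v F * (vtx v * brk v F) \<approx> brk v F * brk v F"
        by (rule cong_left[OF vtx_brk[OF v F] zU])
      also have "\<dots> \<approx> brk v F" by (rule brk_idem[OF v F])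
      finally have "brk v F * (vtx v * brk v F) \<approx> brk v F" .
      from ideal_above_cong[OF I this] show ?thesis using brk by (simp add: mult.assoc)
    qed
    ultimately show "\<exists>x\<in>U. \<exists>y\<in>U. (\<forall>\<gamma>\<in>\<Gamma>. x * path v \<gamma> * brk v F * y \<in> I) \<and> x * vtx v * brk v F * y \<notin> I"
      using zU by (intro bexI[of _ "brk v F"] bexI[of _ 1] conjI ballI) simp_all
  qed
  then show ?thesis unfolding Q(3) by (intro sum.neutral) simp
qed

lemma path_span_add:
  assumes "path_span u v b" "path_span u v c"
  shows "path_span u v (b + c)"
proof -
  from assms(1) obtain Q k where Q: "finite Q" "\<forall>p\<in>Q. awalk u p v"
    "b = (\<Sum>p\<in>Q. Poly_Mapping.single 0 (k p) * path u p)" by (rule path_spanE)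
  from assms(2) obtain Q' k' where Q': "finite Q'" "\<forall>p\<in>Q'. awalk u p v"
    "c = (\<Sum>p\<in>Q'. Poly_Mapping.single 0 (k' p) * path u p)" by (rule path_spanE)
  define l where "l p = (if p \<in> Q then k p else 0) + (if p \<in> Q' then k' p else 0)" for p
  have "b = (\<Sum>p\<in>Q \<union> Q'. Poly_Mapping.single 0 (if p \<in> Q then k p else 0) * path u p)"
    unfolding Q(3) using Q(1) Q'(1) by (intro sum.mono_neutral_cong_left) auto
  moreover have "c = (\<Sum>p\<in>Q \<union> Q'. Poly_Mapping.single 0 (if p \<in> Q' then k' p else 0) * path u p)"
    unfolding Q'(3) using Q(1) Q'(1) by (intro sum.mono_neutral_cong_left) auto
  ultimately have "b + c = (\<Sum>p\<in>Q \<union> Q'. Poly_Mapping.single 0 (l p) * path u p)"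
    by (simp add: sum.distrib[symmetric] distrib_right[symmetric] single_add[symmetric] l_def)
  then show ?thesis
    unfolding path_span_def using Q(1,2) Q'(1,2) by (intro exI[of _ "Q \<union> Q'"] exI[of _ l]) auto
qed

lemma path_span_zero: "path_span u v 0"
  unfolding path_span_def by (intro exI[of _ "{}"]) simp

lemma path_span_scalar:
  assumes "path_span u v b"
  shows "path_span u v (Poly_Mapping.single 0 c * b)"
proof -
  from assms obtain Q k where Q: "finite Q" "\<forall>p\<in>Q. awalk u p v"
    "b = (\<Sum>p\<in>Q. Poly_Mapping.single 0 (k p) * path u p)"
    by (rule path_spanE)
  have "Poly_Mapping.single 0 c * b = (\<Sum>p\<in>Q. Poly_Mapping.single 0 (c * k p) * path u p)"
    by (simp add: Q(3) sum_distrib_left single_zero_mult_left mult.assoc)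
  then show ?thesis using Q unfolding path_span_def by (intro exI[of _ Q] exI[of _ "\<lambda>p. c * k p"]) simp
qed

lemma path_span_U: "path_span u v b \<Longrightarrow> b \<in> U"
  unfolding path_span_def by (auto intro!: words_over_sum U_closed(6) path_U)

lemma path_span_vtx: "path_span u v b \<Longrightarrow> b * vtx v \<approx> b"
proof -
  assume "path_span u v b"
  then obtain Q k where Q: "finite Q" "\<forall>p\<in>Q. awalk u p v"
    "b = (\<Sum>p\<in>Q. Poly_Mapping.single 0 (k p) * path u p)"
    by (rule path_spanE)
  show ?thesis
    unfolding Q(3) sum_distrib_right mult.assoc
    by (intro cong_sum cong_left path_vtx) (use Q(2) in auto)
qed

text \<open>Appending \<open>e\<close> keeps distinct paths distinct. The coefficients of
  \<open>b * edg e\<close> are therefore those of \<open>b\<close>, found again with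
  \<open>butlast\<close>, and independence can be applied at the head of \<open>e\<close>.\<close>

lemma path_span_edg:
  assumes b: "path_span u (tail E e) b" and e: "e \<in> arcs E"
  shows "path_span u (head E e) (b * edg e)"
    and "ideal_above I \<Longrightarrow> condition_K E \<Longrightarrow> head E e \<notin> verts_in I \<Longrightarrow> b * edg e \<in> I \<Longrightarrow> b = 0"
proof -
  from b obtain Q k where Q: "finite Q" "\<forall>p\<in>Q. awalk u p (tail E e)"
    "b = (\<Sum>p\<in>Q. Poly_Mapping.single 0 (k p) * path u p)"
    by (rule path_spanE)
  let ?s = "\<lambda>p. p @ [e]"
  have "b * edg e = (\<Sum>p\<in>Q. Poly_Mapping.single 0 (k p) * path u (p @ [e]))"
    unfolding Q(3) sum_distrib_right mult.assoc
    by (intro sum.cong refl) (use Q(2) path_snoc(1)[OF _ e] in auto)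
  also have "\<dots> = (\<Sum>p\<in>?s ` Q. Poly_Mapping.single 0 (k (butlast p)) * path u p)"
    by (subst sum.reindex) (auto simp: inj_on_def)
  finally have eq: "b * edg e = (\<Sum>p\<in>?s ` Q. Poly_Mapping.single 0 (k (butlast p)) * path u p)" .
  have Q': "finite (?s ` Q)" "\<forall>p\<in>?s ` Q. awalk u p (head E e)" using Q path_snoc(2)[OF _ e] by auto
  show "path_span u (head E e) (b * edg e)"
    unfolding path_span_def using Q' eq by (intro exI[of _ "?s ` Q"] exI[of _ "\<lambda>p. k (butlast p)"]) simp
  assume I: "ideal_above I" "condition_K E" "head E e \<notin> verts_in I" "b * edg e \<in> I"
  have "k p = 0" if "p \<in> Q" for p
    using path_independence_condition_K[OF I(1,2) _ I(3) Q', of "\<lambda>p. k (butlast p)" "p @ [e]"] that e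
      I(4) eq by simp
  then show "b = 0" unfolding Q(3) by (intro sum.neutral) simp
qed

end

section \<open>Normal forms\<close>

context lpa
begin

lemma path_span_path: "awalk u p v \<Longrightarrow> path_span u v (path u p)"
  unfolding path_span_def by (intro exI[of _ "{p}"] exI[of _ "\<lambda>_. 1"]) simp

text \<open>Elements of u L v as combinations of real paths followed by ghost paths, grouped by
  their last ghost edge: \<open>b\<close> has no ghost edges, and \<open>c e\<close> is what stands
  before \<open>gho e\<close>. Induction on this predicate descends in the length of the ghost
  part.\<close>

inductive normal_form :: "'v \<Rightarrow> 'v \<Rightarrow> ('v, 'e, 'k) lpa_free \<Rightarrow> bool" for u where
  step: "path_span u v b \<Longrightarrow> v \<in> verts E \<Longrightarrow> finite T \<Longrightarrow> T \<subseteq> out_arcs E v \<Longrightarrow>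
    (\<And>e. e \<in> T \<Longrightarrow> normal_form u (head E e) (c e)) \<Longrightarrow>
    normal_form u v (b + (\<Sum>e\<in>T. c e * gho e))"

lemma normal_formE:
  assumes "normal_form u v x"
  obtains b T c where "path_span u v b" "finite T" "T \<subseteq> out_arcs E v"
    "\<forall>e\<in>T. normal_form u (head E e) (c e)" "x = b + (\<Sum>e\<in>T. c e * gho e)"
  using assms
proof cases
  case (step b T c)
  show ?thesis by (rule that[of b T c]) (use step in simp_all)
qed

lemma normal_form_U: "normal_form u v x \<Longrightarrow> x \<in> U"
proof (induction rule: normal_form.induct)
  case (step v b T c)
  then have "\<And>e. e \<in> T \<Longrightarrow> c e * gho e \<in> U" by (intro U_closed(6)) auto
  then show ?case using path_span_U[OF step(1)] by (intro U_closed(3) words_over_sum)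
qed

lemma normal_form_verts: "normal_form u v x \<Longrightarrow> v \<in> verts E"
  by (erule normal_form.cases) simp

lemma normal_form_vtx: "normal_form u v x \<Longrightarrow> x * vtx v \<approx> x"
proof (induction rule: normal_form.induct)
  case (step v b T c)
  have "(\<Sum>e\<in>T. c e * gho e * vtx v) \<approx> (\<Sum>e\<in>T. c e * gho e)"
  proof (rule cong_sum)
    fix e assume e: "e \<in> T"
    then have ea: "e \<in> arcs E" "tail E e = v" using step(4) by auto
    have "c e * (gho e * vtx v) \<approx> c e * gho e"
      using cong_left[OF gho_tail[OF ea(1)] normal_form_U[OF step(5)[OF e]]] ea(2) by simp
    then show "c e * gho e * vtx v \<approx> c e * gho e" by (simp add: mult.assoc)
  qed
  then have "b * vtx v + (\<Sum>e\<in>T. c e * gho e * vtx v) \<approx> b + (\<Sum>e\<in>T. c e * gho e)"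
    by (rule cong_add[OF path_span_vtx[OF step(1)]])
  then show ?case by (simp add: distrib_right sum_distrib_right)
qed

lemma normal_form_path_span: "path_span u v b \<Longrightarrow> v \<in> verts E \<Longrightarrow> normal_form u v b"
  using normal_form.step[of u v b "{}"] by simp

lemma normal_form_zero: "v \<in> verts E \<Longrightarrow> normal_form u v 0"
  by (rule normal_form_path_span[OF path_span_zero])

lemma normal_form_gho:
  assumes "normal_form u (head E e) x" "e \<in> arcs E"
  shows "normal_form u (tail E e) (x * gho e)"
  using normal_form.step[of u "tail E e" 0 "{e}" "\<lambda>_. x"] assms path_span_zero by simp

lemma normal_form_add: "normal_form u v x \<Longrightarrow> normal_form u v y \<Longrightarrow> normal_form u v (x + y)"
proof (induction arbitrary: y rule: normal_form.induct)
  case (step v b T c)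
  from step.prems obtain b' T' c' where y: "path_span u v b'" "finite T'" "T' \<subseteq> out_arcs E v"
    "\<forall>e\<in>T'. normal_form u (head E e) (c' e)" "y = b' + (\<Sum>e\<in>T'. c' e * gho e)"
    by (rule normal_formE)
  define d where "d e = (if e \<in> T then c e else 0) + (if e \<in> T' then c' e else 0)" for e
  have "(\<Sum>e\<in>T. c e * gho e) = (\<Sum>e\<in>T \<union> T'. (if e \<in> T then c e else 0) * gho e)"
    using step(3) y(2) by (intro sum.mono_neutral_cong_left) auto
  moreover have "(\<Sum>e\<in>T'. c' e * gho e) = (\<Sum>e\<in>T \<union> T'. (if e \<in> T' then c' e else 0) * gho e)"
    using step(3) y(2) by (intro sum.mono_neutral_cong_left) auto
  ultimately have eq: "b + (\<Sum>e\<in>T. c e * gho e) + y = (b + b') + (\<Sum>e\<in>T \<union> T'. d e * gho e)"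
    by (simp add: y(5) d_def distrib_right sum.distrib)
  show ?case
    unfolding eq
  proof (rule normal_form.step)
    show "path_span u v (b + b')" by (rule path_span_add[OF step(1) y(1)])
    show "v \<in> verts E" "finite (T \<union> T')" "T \<union> T' \<subseteq> out_arcs E v" using step y by auto
    fix e assume e: "e \<in> T \<union> T'"
    then have h: "head E e \<in> verts E" using step(4) y(3) by auto
    have d: "normal_form u (head E e) (if e \<in> T' then c' e else 0)"
      using y(4) normal_form_zero[OF h] by simp
    show "normal_form u (head E e) (d e)"
    proof (cases "e \<in> T")
      case True
      then show ?thesis using step(6)[OF True d] by (simp add: d_def)
    next
      case False
      then show ?thesis using d by (simp add: d_def)
    qed
  qed
qed

lemma normal_form_scalar: "normal_form u v x \<Longrightarrow> normal_form u v (Poly_Mapping.single 0 s * x)"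
proof (induction rule: normal_form.induct)
  case (step v b T c)
  have "normal_form u v (Poly_Mapping.single 0 s * b + (\<Sum>e\<in>T. (Poly_Mapping.single 0 s * c e) * gho e))"
    by (rule normal_form.step) (use step path_span_scalar in auto)
  then show ?case by (simp add: distrib_left sum_distrib_left mult.assoc)
qed

text \<open>Multiplication by \<open>f\<close> on the right reads off what stands before the ghost
  of \<open>f\<close> and so removes one ghost edge; this drives the comparison of ideals
  below.\<close>

lemma sum_gho_edg:
  assumes T: "finite T" "T \<subseteq> out_arcs E v" and f: "f \<in> out_arcs E v"
    and c: "\<And>e. e \<in> T \<Longrightarrow> normal_form u (head E e) (c e)"
  shows "(\<Sum>e\<in>T. c e * gho e) * edg f \<approx> (if f \<in> T then c f else 0)"
proof -
  have fa: "f \<in> arcs E" using f by simp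
  have "(\<Sum>e\<in>T. c e * gho e) * edg f = (\<Sum>e\<in>T. c e * (gho e * edg f))"
    by (simp add: sum_distrib_right mult.assoc)
  also have "\<dots> \<approx> (\<Sum>e\<in>T. if f = e then c e else 0)"
  proof (rule cong_sum)
    fix e assume e: "e \<in> T"
    then have ea: "e \<in> arcs E" using T(2) by auto
    have "c e * (gho e * edg f) \<approx> c e * (if e = f then vtx (head E e) else 0)"
      by (rule cong_left[OF gho_edg[OF ea fa] normal_form_U[OF c[OF e]]])
    also have "\<dots> \<approx> (if f = e then c e else 0)" using normal_form_vtx[OF c[OF e]] by auto
    finally show "c e * (gho e * edg f) \<approx> (if f = e then c e else 0)" .
  qed
  also have "\<dots> = (if f \<in> T then c f else 0)" using T(1) by (simp add: sum.delta)
  finally show ?thesis .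
qed

lemma normal_form_edg:
  assumes "normal_form u (tail E e) x" and e: "e \<in> arcs E"
  shows "\<exists>y. normal_form u (head E e) y \<and> x * edg e \<approx> y"
proof -
  from assms(1) obtain b T c where x: "path_span u (tail E e) b" "finite T" "T \<subseteq> out_arcs E (tail E e)"
    "\<forall>e\<in>T. normal_form u (head E e) (c e)" "x = b + (\<Sum>e\<in>T. c e * gho e)"
    by (rule normal_formE)
  let ?d = "if e \<in> T then c e else 0"
  have "x * edg e = b * edg e + (\<Sum>e\<in>T. c e * gho e) * edg e"
    by (simp add: x(5) distrib_right)
  also have "\<dots> \<approx> b * edg e + ?d"
    by (intro cong_add cong_refl sum_gho_edg[OF x(2,3)]) (use e x(4) in auto)
  finally have "x * edg e \<approx> b * edg e + ?d" .
  moreover have "normal_form u (head E e) (b * edg e + ?d)"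
  proof (rule normal_form_add)
    show "normal_form u (head E e) (b * edg e)"
      using e by (intro normal_form_path_span path_span_edg(1)[OF x(1)]) auto
    show "normal_form u (head E e) ?d" using x(4) e by (auto intro: normal_form_zero)
  qed
  ultimately show ?thesis by blast
qed

lemma normal_form_generator:
  assumes x: "normal_form u v x" and g: "g \<in> gens"
  shows "\<exists>w y. normal_form u w y \<and> x * generator g \<approx> y"
proof -
  note xU = normal_form_U[OF x] and v = normal_form_verts[OF x]
  have gU: "generator g \<in> U" using g by (rule U_closed(8))
  have zero: ?thesis if "vtx v * generator g \<approx> 0"
  proof -
    have "x * generator g \<approx> (x * vtx v) * generator g"
      by (rule cong_right[OF cong_sym[OF normal_form_vtx[OF x]] gU])
    also have "\<dots> = x * (vtx v * generator g)" by (simp add: mult.assoc)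
    also have "\<dots> \<approx> x * 0" by (rule cong_left[OF that xU])
    finally have "x * generator g \<approx> 0" by simp
    then show ?thesis using normal_form_zero[OF v] by blast
  qed
  from g consider w where "g = Vertex w" "w \<in> verts E" | e where "g = Edge e" "e \<in> arcs E"
    | e where "g = Ghost e" "e \<in> arcs E" by blast
  then show ?thesis
  proof cases
    case 1
    show ?thesis
    proof (cases "w = v")
      case True
      then show ?thesis using x normal_form_vtx[OF x] 1 by blast
    qed (use zero vtx_vtx[OF v 1(2)] 1 in auto)
  next
    case 2
    show ?thesis
    proof (cases "v = tail E e")
      case True
      then show ?thesis using normal_form_edg[of u e x] x 2 by blast
    qed (use zero vtx_edg[OF v 2(2)] 2 in auto)
  next
    case 3
    show ?thesis
    proof (cases "v = head E e")
      case True
      then show ?thesis using normal_form_gho[of u e x] x 3 by blast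
    qed (use zero vtx_gho[OF v 3(2)] 3 in auto)
  qed
qed

text \<open>The word is read from the left, one letter after the other, since normal forms starting
  at \<open>u\<close> are stable under right multiplication by generators.\<close>

lemma word_normal_form:
  assumes "u \<in> verts E" "set ws \<subseteq> gens"
  shows "\<exists>v y. normal_form u v y \<and> vtx u * Poly_Mapping.single (Free_Word ws) 1 \<approx> y"
  using assms(2)
proof (induction ws rule: rev_induct)
  case Nil
  have "normal_form u u (path u [])"
    using assms(1) by (intro normal_form_path_span path_span_path) (simp_all add: awalk_Nil_iff)
  then show ?case
    by (intro exI[of _ u] exI[of _ "vtx u"]) (simp add: zero_Free_Word[symmetric])
next
  case (snoc g ws)
  then obtain v y where y: "normal_form u v y" "vtx u * Poly_Mapping.single (Free_Word ws) 1 \<approx> y"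
    by auto
  obtain w z where z: "normal_form u w z" "y * generator g \<approx> z"
    using normal_form_generator[OF y(1), of g] snoc.prems by auto
  have "vtx u * Poly_Mapping.single (Free_Word (ws @ [g])) 1 =
      (vtx u * Poly_Mapping.single (Free_Word ws) 1) * generator g"
    by (simp add: generator_def mult.assoc mult_single plus_Free_Word)
  also have "\<dots> \<approx> y * generator g"
    by (rule cong_right[OF y(2)]) (use snoc.prems in \<open>auto intro: U_closed(8)\<close>)
  also have "\<dots> \<approx> z" by (rule z(2))
  finally show ?case using z(1) by blast
qed

lemma normal_form_exists:
  assumes x: "x \<in> U" and u: "u \<in> verts E" and v: "v \<in> verts E"
  shows "\<exists>y. normal_form u v y \<and> vtx u * x * vtx v \<approx> y"
proof (induction x rule: poly_mapping_single_induct)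
  case zero
  show ?case by (rule exI[of _ 0]) (simp add: normal_form_zero[OF v])
next
  case (single w s)
  have ws: "set (letters w) \<subseteq> gens" using x single by (rule single_in_ideal_closed)
  obtain v' y where y: "normal_form u v' y" "vtx u * Poly_Mapping.single (Free_Word (letters w)) 1 \<approx> y"
    using word_normal_form[OF u ws] by blast
  have v': "v' \<in> verts E" using y(1) by (rule normal_form_verts)
  let ?s = "Poly_Mapping.single 0 s :: ('v, 'e, 'k) lpa_free"
  have "vtx u * Poly_Mapping.single w s * vtx v =
      ?s * ((vtx u * Poly_Mapping.single (Free_Word (letters w)) 1) * vtx v)"
  proof -
    have "Poly_Mapping.single w s = ?s * Poly_Mapping.single (Free_Word (letters w)) 1"
      by (simp add: mult_single)
    then show ?thesis by (simp add: mult.assoc scalar_move)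
  qed
  also have "\<dots> \<approx> ?s * (y * vtx v)"
    using v by (intro cong_left[OF cong_right[OF y(2)]]) auto
  finally have *: "vtx u * Poly_Mapping.single w s * vtx v \<approx> ?s * (y * vtx v)" .
  show ?case
  proof (cases "v' = v")
    case True
    have "?s * (y * vtx v) \<approx> ?s * y" using normal_form_vtx[OF y(1)] True by (intro cong_left) auto
    with * have "vtx u * Poly_Mapping.single w s * vtx v \<approx> ?s * y" by (rule cong_trans)
    then show ?thesis using normal_form_scalar[OF y(1)] True by blast
  next
    case False
    have "y * vtx v \<approx> (y * vtx v') * vtx v"
      by (rule cong_right[OF cong_sym[OF normal_form_vtx[OF y(1)]] U_gens(1)[OF v]])
    also have "\<dots> = y * (vtx v' * vtx v)" by (simp add: mult.assoc)
    also have "\<dots> \<approx> y * 0"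
      using cong_left[OF vtx_vtx[OF v' v] normal_form_U[OF y(1)]] False by simp
    finally have "y * vtx v \<approx> 0" by simp
    then have "?s * (y * vtx v) \<approx> ?s * 0" by (rule cong_left) simp
    with * have "vtx u * Poly_Mapping.single w s * vtx v \<approx> 0" by (simp add: cong_trans)
    then show ?thesis using normal_form_zero[OF v] by blast
  qed
next
  case (add a b)
  then obtain y z where "normal_form u v y" "vtx u * a * vtx v \<approx> y"
    "normal_form u v z" "vtx u * b * vtx v \<approx> z" by blast
  then show ?case
    by (intro exI[of _ "y + z"]) (simp add: normal_form_add distrib_left distrib_right cong_add)
qed

section \<open>Comparing an ideal with one that contains its generators\<close>

definition nonideal_out_arcs :: "('v, 'e, 'k) lpa_free set \<Rightarrow> 'v \<Rightarrow> 'e set" where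
  "nonideal_out_arcs I v = {e \<in> out_arcs E v. head E e \<notin> verts_in I}"

context
  fixes I J
  assumes K: "condition_K E" and I: "ideal_above I" and J: "ideal_above J"
    and vJ: "\<And>v. v \<in> verts_in I \<Longrightarrow> vtx v \<in> J"
    and bJ: "\<And>v. v \<in> breaking_vertices E (verts_in I) \<Longrightarrow> brk v (nonideal_out_arcs I v) \<in> I \<Longrightarrow>
      brk v (nonideal_out_arcs I v) \<in> J"
begin

text \<open>At a regular vertex nothing has to be supplied: \<open>brk v (out_arcs E v)\<close> is
  zero by the relation at \<open>v\<close>, and the terms by which \<open>brk\<close> of the smaller
  set differs from it lie in \<open>J\<close> together with the heads of their edges. An infinite
  emitter \<open>v\<close> is a breaking vertex, and \<open>bJ\<close> applies.\<close>

lemma brk_in_J: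
  assumes v: "v \<in> verts E" "v \<notin> verts_in I" and fin: "finite (nonideal_out_arcs I v)"
    and brk: "brk v (nonideal_out_arcs I v) \<in> I"
  shows "brk v (nonideal_out_arcs I v) \<in> J"
proof -
  let ?T = "nonideal_out_arcs I v"
  have ne: "?T \<noteq> {}"
  proof
    assume "?T = {}"
    then have "vtx v \<in> I" using brk by (simp add: brk_def)
    with v show False by (simp add: verts_in_def)
  qed
  show ?thesis
  proof (cases "finite (out_arcs E v)")
    case True
    then have reg: "regular_vertex E v" using ne v(1) by (auto simp: regular_vertex_def nonideal_out_arcs_def)
    have "brk v (out_arcs E v) \<in> J"
      using ideal_above_cong[OF J brk_out_arcs[OF reg]] ideal_aboveD(3)[OF J] by simp
    moreover have "(\<Sum>e\<in>out_arcs E v - ?T. edg e * gho e) \<in> J"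
    proof (rule ideal_above_sum[OF J])
      fix e assume "e \<in> out_arcs E v - ?T"
      then have e: "e \<in> arcs E" "head E e \<in> verts_in J"
        using vJ by (auto simp: nonideal_out_arcs_def verts_in_def)
      show "edg e * gho e \<in> J"
        by (rule ideal_above_mult(2)[OF J edg_in_ideal(1)[OF J e] U_gens(3)[OF e(1)]])
    qed
    ultimately have "brk v (out_arcs E v) + (\<Sum>e\<in>out_arcs E v - ?T. edg e * gho e) \<in> J"
      by (rule ideal_aboveD(4)[OF J])
    moreover have "?T \<subseteq> out_arcs E v" by (auto simp: nonideal_out_arcs_def)
    ultimately show ?thesis by (simp only: brk_diff[OF True, of ?T v])
  next
    case False
    have "?T = {e \<in> out_arcs E v. head E e \<in> verts E - verts_in I}"
      by (auto simp: nonideal_out_arcs_def)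
    then have "v \<in> breaking_vertices E (verts_in I)"
      using False v ne fin by (simp add: breaking_vertices_def infinite_emitter_def)
    then show ?thesis using brk by (rule bJ)
  qed
qed

text \<open>Write the element as y = \<beta> + a with \<open>\<beta>\<close> free of ghosts. For e
  in \<open>T\<close> the product y e has a shorter ghost part and lies in \<open>I\<close>, hence
  in \<open>J\<close> by induction. Removing from y the terms \<open>y * edg e * gho e\<close>
  leaves \<open>\<beta> * brk v T\<close>, to which independence of paths applies. The summand
  \<open>b\<close> is carried along because y e brings the new real part \<beta> e into the
  induction hypothesis.\<close>

lemma normal_form_in_J:
  "normal_form u v x \<Longrightarrow> path_span u v b \<Longrightarrow> b + x \<in> I \<Longrightarrow> b + x \<in> J"
proof (induction arbitrary: b rule: normal_form.induct)
  case (step v b0 T c)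
  define \<beta> where "\<beta> = b + b0"
  define a where "a = (\<Sum>e\<in>T. c e * gho e)"
  define y where "y = \<beta> + a"
  have \<beta>: "path_span u v \<beta>" unfolding \<beta>_def by (rule path_span_add[OF step.prems(1) step(1)])
  note \<beta>U = path_span_U[OF \<beta>]
  have yI: "y \<in> I" using step.prems(2) by (simp add: y_def \<beta>_def a_def add.assoc)
  have yn: "normal_form u v y" unfolding y_def a_def by (rule normal_form.step[OF \<beta> step(2,3,4,5)])
  note yU = normal_form_U[OF yn]
  have "y \<in> J"
  proof (cases "v \<in> verts_in I")
    case True
    have "y * vtx v \<in> J" by (rule ideal_above_mult(1)[OF J vJ[OF True] yU])
    then show ?thesis using ideal_above_cong[OF J normal_form_vtx[OF yn]] by simp
  next
    case v: False
    have T: "T \<subseteq> arcs E" using step(4) by auto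
    have ye: "y * edg f \<approx> \<beta> * edg f + (if f \<in> T then c f else 0)" if f: "f \<in> out_arcs E v" for f
      unfolding y_def a_def distrib_right
      by (intro cong_add cong_refl sum_gho_edg[OF step(3,4) f step(5)])
    have yeI: "y * edg f \<in> I" if "f \<in> out_arcs E v" for f
      using that by (intro ideal_above_mult(2)[OF I yI]) auto
    have yeJ: "y * edg e \<in> J" if e: "e \<in> T" for e
    proof -
      have eo: "e \<in> out_arcs E v" using e step(4) by blast
      have *: "y * edg e \<approx> \<beta> * edg e + c e" using ye[OF eo] e by simp
      then have "\<beta> * edg e + c e \<in> I" using ideal_above_cong[OF I *] yeI[OF eo] by simp
      then have "\<beta> * edg e + c e \<in> J"
        using eo \<beta> by (intro step(6)[OF e] path_span_edg(1)) auto
      then show ?thesis using ideal_above_cong[OF J *] by simp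
    qed
    define \<Sigma> where "\<Sigma> = (\<Sum>e\<in>T. y * edg e * gho e)"
    have \<Sigma>J: "\<Sigma> \<in> J" unfolding \<Sigma>_def
      using T by (intro ideal_above_sum[OF J] ideal_above_mult(2)[OF J yeJ]) auto
    have \<Sigma>I: "\<Sigma> \<in> I" unfolding \<Sigma>_def
      using T step(4) by (intro ideal_above_sum[OF I] ideal_above_mult(2)[OF I yeI]) auto
    have "\<Sigma> \<approx> (\<Sum>e\<in>T. (\<beta> * edg e + c e) * gho e)"
      unfolding \<Sigma>_def
    proof (rule cong_sum)
      fix e assume e: "e \<in> T"
      have "y * edg e \<approx> \<beta> * edg e + c e" using ye[of e] e step(4) by auto
      then show "y * edg e * gho e \<approx> (\<beta> * edg e + c e) * gho e"
        using T e by (intro cong_right) auto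
    qed
    also have "\<dots> = \<beta> * (\<Sum>e\<in>T. edg e * gho e) + a"
      by (simp add: a_def distrib_right sum.distrib sum_distrib_left mult.assoc)
    finally have "y - \<Sigma> \<approx> (\<beta> + a) - (\<beta> * (\<Sum>e\<in>T. edg e * gho e) + a)"
      unfolding y_def by (intro cong_diff cong_refl)
    also have "\<dots> = \<beta> - \<beta> * (\<Sum>e\<in>T. edg e * gho e)" by simp
    also have "\<dots> \<approx> \<beta> * vtx v - \<beta> * (\<Sum>e\<in>T. edg e * gho e)"
      by (intro cong_diff cong_sym[OF path_span_vtx[OF \<beta>]] cong_refl)
    also have "\<dots> = \<beta> * brk v T" by (simp add: brk_def right_diff_distrib)
    finally have rest: "y - \<Sigma> \<approx> \<beta> * brk v T" .
    have restI: "\<beta> * brk v T \<in> I"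
      using ideal_above_cong[OF I rest] ideal_above_diff[OF I yI \<Sigma>I] by simp
    have "\<beta> * brk v T \<in> J"
    \<comment> \<open>If an edge \<open>f\<close> outside \<open>T\<close> has its head outside
      \<open>I\<close>, then y f is just \<beta> f, and independence forces
      \<open>\<beta> = 0\<close>. Otherwise \<open>T\<close> contains all edges of this kind and can
      be cut down to them.\<close>
    proof (cases "nonideal_out_arcs I v \<subseteq> T")
      case False
      then obtain f where f: "f \<in> out_arcs E v" "head E f \<notin> verts_in I" "f \<notin> T"
        by (auto simp: nonideal_out_arcs_def)
      have "\<beta> * edg f \<in> I" using ideal_above_cong[OF I ye[OF f(1)]] yeI[OF f(1)] f(3) by simp
      then have "\<beta> = 0" using path_span_edg(2)[of u f \<beta> I] \<beta> f I K by auto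
      then show ?thesis using ideal_aboveD(3)[OF J] by simp
    next
      case sub: True
      let ?T = "nonideal_out_arcs I v"
      have fin: "finite ?T" using sub step(3) by (rule finite_subset)
      define d :: "('v, 'e, 'k) lpa_free" where "d = (\<Sum>e\<in>T - ?T. edg e * gho e)"
      have dI: "edg e \<in> I" "edg e \<in> J" if "e \<in> T - ?T" for e
      proof -
        have e: "e \<in> arcs E" "head E e \<in> verts_in I" "head E e \<in> verts_in J"
          using that step(4) vJ by (auto simp: nonideal_out_arcs_def verts_in_def)
        show "edg e \<in> I" "edg e \<in> J" using edg_in_ideal(1)[OF I e(1,2)] edg_in_ideal(1)[OF J e(1,3)] .
      qed
      have d: "\<beta> * d \<in> I" "\<beta> * d \<in> J"
        unfolding d_def using T
        by (intro ideal_above_mult(1)[OF I _ \<beta>U] ideal_above_sum[OF I] ideal_above_mult(2)[OF I dI(1)]; auto)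
          (use T in \<open>intro ideal_above_mult(1)[OF J _ \<beta>U] ideal_above_sum[OF J] ideal_above_mult(2)[OF J dI(2)]; auto\<close>)
      have eq: "\<beta> * brk v ?T = \<beta> * brk v T + \<beta> * d"
        unfolding brk_diff[OF step(3) sub, of v] d_def by (simp add: distrib_left)
      show ?thesis
      proof (cases "brk v ?T \<in> I")
        case True
        have "\<beta> * brk v ?T \<in> J"
          by (rule ideal_above_mult(1)[OF J brk_in_J[OF step(2) v fin True] \<beta>U])
        then show ?thesis using ideal_above_diff[OF J _ d(2), of "\<beta> * brk v ?T"] eq by simp
      next
        case False
        have "\<beta> = 0"
        proof (rule path_independence_brk[OF I step(2) _ fin _ False \<beta>])
          show "?T \<subseteq> out_arcs E v" by (auto simp: nonideal_out_arcs_def)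
          show "\<beta> * brk v ?T \<in> I" using ideal_aboveD(4)[OF I restI d(1)] eq by simp
          \<comment> \<open>A closed path at \<open>v\<close> cannot start with an edge into
            \<open>verts_in I\<close>, since heredity would carry \<open>v\<close> itself into
            \<open>I\<close>.\<close>
          fix e p assume w: "awalk v (e # p) v"
          then have "e \<in> out_arcs E v" "awalk (head E e) p v" by (auto simp: awalk_Cons_iff)
          then show "e \<in> ?T" using verts_in_awalk[OF I, of "head E e" p v] v
            by (auto simp: nonideal_out_arcs_def)
        qed
        then show ?thesis using ideal_aboveD(3)[OF J] by simp
      qed
    qed
    then have "y - \<Sigma> \<in> J" using ideal_above_cong[OF J rest] by simp
    then show ?thesis using ideal_aboveD(4)[OF J _ \<Sigma>J] by fastforce
  qed
  then show ?case by (simp add: y_def \<beta>_def a_def add.assoc)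
qed

text \<open>A local unit cuts \<open>x\<close> into finitely many corners u x v, to each of which
  \<open>normal_form_in_J\<close> applies with \<open>b = 0\<close>.\<close>

theorem ideal_subset_of_generators: "I \<subseteq> J"
proof
  fix x assume xI: "x \<in> I"
  then have x: "x \<in> A" using ideal_aboveD(1)[OF I] by blast
  obtain T where T: "finite T" "T \<subseteq> verts E" "(\<Sum>v\<in>T. vtx v) * x \<approx> x" "x * (\<Sum>v\<in>T. vtx v) \<approx> x"
    using local_unit[OF x] by blast
  have TU: "(\<Sum>v\<in>T. vtx v) \<in> U" using T(2) by (intro words_over_sum) auto
  have "(\<Sum>u\<in>T. \<Sum>v\<in>T. vtx u * x * vtx v) = (\<Sum>v\<in>T. vtx v) * x * (\<Sum>v\<in>T. vtx v)"
    by (simp add: sum_distrib_right sum_distrib_left) (rule sum.swap)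
  also have "\<dots> \<approx> x * (\<Sum>v\<in>T. vtx v)" by (rule cong_right[OF T(3) TU])
  also have "\<dots> \<approx> x" by (rule T(4))
  finally have c: "(\<Sum>u\<in>T. \<Sum>v\<in>T. vtx u * x * vtx v) \<approx> x" .
  have "vtx u * x * vtx v \<in> J" if "u \<in> T" "v \<in> T" for u v
  proof -
    have uv: "u \<in> verts E" "v \<in> verts E" using that T(2) by auto
    obtain y where y: "normal_form u v y" "vtx u * x * vtx v \<approx> y"
      using normal_form_exists[OF A_U[OF x] uv] by blast
    have "vtx u * x * vtx v \<in> I"
      by (rule ideal_above_mult(2)[OF I ideal_above_mult(1)[OF I xI U_gens(1)[OF uv(1)]] U_gens(1)[OF uv(2)]])
    then have "0 + y \<in> I" using ideal_above_cong[OF I y(2)] by simp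
    then have "0 + y \<in> J" by (rule normal_form_in_J[OF y(1) path_span_zero])
    then show ?thesis using ideal_above_cong[OF J y(2)] by simp
  qed
  then have "(\<Sum>u\<in>T. \<Sum>v\<in>T. vtx u * x * vtx v) \<in> J"
    by (intro ideal_above_sum[OF J])
  then show "x \<in> J" using ideal_above_cong[OF J c] by simp
qed

end

end

section \<open>Representations from branching systems\<close>

lemma sum_fun_apply: "(\<Sum>i\<in>S. f i) x = (\<Sum>i\<in>S. f i x)"
  by (induction S rule: infinite_finite_induct) auto

text \<open>An edge will act on functions by transport along the injection
  \<open>\<sigma> e\<close>, its ghost by transport back. Disjointness of the images gives the
  relations between ghosts and edges; at a regular vertex the images partition \<open>D v\<close>,
  which gives the relation at that vertex. The weights in K[[t]] are units, so that edge and ghost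
  still undo each other.\<close>

locale branching_system = lpa E K
  for E :: "('v, 'e) pre_digraph" and K :: "'k::field itself" +
  fixes D :: "'v \<Rightarrow> 'x set" and \<sigma> :: "'e \<Rightarrow> 'x \<Rightarrow> 'x" and \<omega> \<omega>' :: "'e \<Rightarrow> 'k fps"
  assumes disjoint: "v \<in> verts E \<Longrightarrow> w \<in> verts E \<Longrightarrow> x \<in> D v \<Longrightarrow> x \<in> D w \<Longrightarrow> v = w"
    and inj: "e \<in> arcs E \<Longrightarrow> inj_on (\<sigma> e) (D (head E e))"
    and range: "e \<in> arcs E \<Longrightarrow> x \<in> D (head E e) \<Longrightarrow> \<sigma> e x \<in> D (tail E e)"
    and range_disjoint: "e \<in> arcs E \<Longrightarrow> f \<in> arcs E \<Longrightarrow> x \<in> D (head E e) \<Longrightarrow> y \<in> D (head E f) \<Longrightarrow>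
      \<sigma> e x = \<sigma> f y \<Longrightarrow> e = f"
    and cover: "regular_vertex E v \<Longrightarrow> y \<in> D v \<Longrightarrow>
      \<exists>e\<in>out_arcs E v. \<exists>x\<in>D (head E e). y = \<sigma> e x"
    and weight: "e \<in> arcs E \<Longrightarrow> \<omega> e * \<omega>' e = 1"
begin

fun act :: "('v, 'e) lpa_gen \<Rightarrow> ('x \<Rightarrow> 'k fps) \<Rightarrow> 'x \<Rightarrow> 'k fps" where
  "act (Vertex v) f x = (if x \<in> D v then f x else 0)"
| "act (Edge e) f x = (if x \<in> \<sigma> e ` D (head E e) then \<omega> e * f (the_inv_into (D (head E e)) (\<sigma> e) x) else 0)"
| "act (Ghost e) f x = (if x \<in> D (head E e) then \<omega>' e * f (\<sigma> e x) else 0)"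

definition sc :: "'k \<Rightarrow> ('x \<Rightarrow> 'k fps) \<Rightarrow> 'x \<Rightarrow> 'k fps" where
  "sc c f x = fps_const c * f x"

sublocale word_action act sc
proof
  show "act g (m + n) = act g m + act g n" for g m n
    by (rule ext, cases g) (simp_all add: distrib_left)
  show "act g (sc c m) = sc c (act g m)" for g c m
    by (rule ext, cases g) (simp_all add: sc_def mult_ac)
  show "sc c (m + n) = sc c m + sc c n" for c m n
    by (rule ext) (simp add: sc_def distrib_left)
  show "sc (c + d) m = sc c m + sc d m" for c d m
    by (rule ext) (simp add: sc_def distrib_right fps_const_add[symmetric] del: fps_const_add)
  show "sc (c * d) m = sc c (sc d m)" for c d m
    by (rule ext) (simp add: sc_def mult.assoc fps_const_mult[symmetric] del: fps_const_mult)
  show "sc 1 m = m" for m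
    by (rule ext) (simp add: sc_def)
qed

lemma act_Edge_apply: "e \<in> arcs E \<Longrightarrow> x \<in> D (head E e) \<Longrightarrow> act (Edge e) f (\<sigma> e x) = \<omega> e * f x"
  using inj[of e] by (simp add: the_inv_into_f_f)

lemma act_Edge_zero: "y \<notin> \<sigma> e ` D (head E e) \<Longrightarrow> act (Edge e) f y = 0"
  by simp

declare act.simps(2) [simp del]

lemma act_Edge_Ghost:
  assumes "e \<in> arcs E"
  shows "act (Edge e) (act (Ghost e) f) y = (if y \<in> \<sigma> e ` D (head E e) then f y else 0)"
proof (cases "y \<in> \<sigma> e ` D (head E e)")
  case True
  then obtain x where x: "x \<in> D (head E e)" "y = \<sigma> e x" by blast
  have "act (Edge e) (act (Ghost e) f) y = (\<omega> e * \<omega>' e) * f y"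
    unfolding x(2) using act_Edge_apply[OF assms x(1)] x(1) by (simp add: mult.assoc)
  then show ?thesis using True weight[OF assms] by simp
qed (simp add: act_Edge_zero)

lemma relator_acts_zero:
  assumes "r \<in> lpa_relators K E"
  shows "ev r f = 0"
proof -
  from assms consider
    (vv) v w where "v \<in> verts E" "w \<in> verts E" "r = vtx v * vtx w - (if v = w then vtx v else 0)"
    | (te) e where "e \<in> arcs E" "r = vtx (tail E e) * edg e - edg e"
    | (eh) e where "e \<in> arcs E" "r = edg e * vtx (head E e) - edg e"
    | (hg) e where "e \<in> arcs E" "r = vtx (head E e) * gho e - gho e"
    | (gt) e where "e \<in> arcs E" "r = gho e * vtx (tail E e) - gho e"
    | (ge) e g where "e \<in> arcs E" "g \<in> arcs E" "r = gho e * edg g - (if e = g then vtx (head E e) else 0)"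
    | (ck) v where "regular_vertex E v" "r = vtx v - (\<Sum>e\<in>out_arcs E v. edg e * gho e)"
    unfolding lpa_relators_def by blast
  then show ?thesis
  proof cases
    case vv
    have "act (Vertex v) (act (Vertex w) f) x = (if v = w then act (Vertex v) f x else 0)" for x
      using disjoint[OF vv(1,2), of x] by auto
    then have "act (Vertex v) (act (Vertex w) f) = (if v = w then act (Vertex v) f else 0)"
      by (intro ext) simp
    then show ?thesis by (simp add: vv(3) ev_diff_left ev_mult)
  next
    case te
    have "act (Vertex (tail E e)) (act (Edge e) f) x = act (Edge e) f x" for x
      using range[OF te(1)] by (auto simp: act.simps(2))
    then have "act (Vertex (tail E e)) (act (Edge e) f) = act (Edge e) f" by (rule ext)
    then show ?thesis by (simp add: te(2) ev_diff_left ev_mult)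
  next
    case eh
    have "act (Edge e) (act (Vertex (head E e)) f) x = act (Edge e) f x" for x
      using act_Edge_apply[OF eh(1)] by (cases "x \<in> \<sigma> e ` D (head E e)") (auto simp: act_Edge_zero)
    then have "act (Edge e) (act (Vertex (head E e)) f) = act (Edge e) f" by (rule ext)
    then show ?thesis by (simp add: eh(2) ev_diff_left ev_mult)
  next
    case hg
    have "act (Vertex (head E e)) (act (Ghost e) f) = act (Ghost e) f" by (rule ext) simp
    then show ?thesis by (simp add: hg(2) ev_diff_left ev_mult)
  next
    case gt
    have "act (Ghost e) (act (Vertex (tail E e)) f) = act (Ghost e) f"
      by (rule ext) (simp add: range[OF gt(1)])
    then show ?thesis by (simp add: gt(2) ev_diff_left ev_mult)
  next
    case ge
    have "act (Ghost e) (act (Edge g) f) x = (if e = g then act (Vertex (head E e)) f x else 0)" for x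
    proof (cases "x \<in> D (head E e)")
      case True
      show ?thesis
      proof (cases "e = g")
        case True
        have "act (Ghost e) (act (Edge e) f) x = (\<omega> e * \<omega>' e) * f x"
          using act_Edge_apply[OF ge(1) \<open>x \<in> D (head E e)\<close>] \<open>x \<in> D (head E e)\<close>
          by (simp add: mult_ac)
        then show ?thesis using True weight[OF ge(1)] \<open>x \<in> D (head E e)\<close> by simp
      next
        case False
        have "\<sigma> e x \<notin> \<sigma> g ` D (head E g)"
          using range_disjoint[OF ge(1,2) \<open>x \<in> D (head E e)\<close>] False by blast
        then show ?thesis using False by (simp add: act_Edge_zero)
      qed
    qed auto
    then have "act (Ghost e) (act (Edge g) f) = (if e = g then act (Vertex (head E e)) f else 0)"
      by (intro ext) simp
    then show ?thesis by (simp add: ge(3) ev_diff_left ev_mult)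
  next
    case ck
    have arcs: "e \<in> arcs E" if "e \<in> out_arcs E v" for e using that by simp
    have "(\<Sum>e\<in>out_arcs E v. act (Edge e) (act (Ghost e) f)) y = act (Vertex v) f y" for y
    proof (cases "y \<in> D v")
      case True
      \<comment> \<open>\<open>e\<close> is the only edge whose image contains \<open>y\<close>, so
        the sum has a single nonzero term at \<open>y\<close>.\<close>
      then obtain e x where e: "e \<in> out_arcs E v" "x \<in> D (head E e)" "y = \<sigma> e x"
        using cover[OF ck(1) True] by blast
      have "act (Edge g) (act (Ghost g) f) y = (if g = e then f y else 0)" if "g \<in> out_arcs E v" for g
      proof -
        have "y \<in> \<sigma> g ` D (head E g) \<longleftrightarrow> g = e"
        proof
          assume "y \<in> \<sigma> g ` D (head E g)"
          then obtain x' where "x' \<in> D (head E g)" "\<sigma> g x' = \<sigma> e x" using e(3) by auto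
          then show "g = e" using range_disjoint[OF arcs[OF that] arcs[OF e(1)] _ e(2)] by blast
        qed (use e in blast)
        then show ?thesis using act_Edge_Ghost[OF arcs[OF that]] by simp
      qed
      then have "(\<Sum>e\<in>out_arcs E v. act (Edge e) (act (Ghost e) f) y) = f y"
        using e(1) ck(1) by (simp add: regular_vertex_def)
      then show ?thesis using True by (simp add: sum_fun_apply)
    next
      case False
      have "act (Edge g) (act (Ghost g) f) y = 0" if g: "g \<in> out_arcs E v" for g
      proof -
        have "y \<notin> \<sigma> g ` D (head E g)" using False g range[OF arcs[OF g]] by auto
        then show ?thesis by (rule act_Edge_zero)
      qed
      then show ?thesis using False by (simp add: sum_fun_apply)
    qed
    then have "(\<Sum>e\<in>out_arcs E v. act (Edge e) (act (Ghost e) f)) = act (Vertex v) f" by (rule ext)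
    then show ?thesis by (simp add: ck(2) ev_diff_left ev_sum_left ev_mult)
  qed
qed

lemma action_ideal_above:
  assumes W: "0 \<in> W" "\<And>m n. m \<in> W \<Longrightarrow> n \<in> W \<Longrightarrow> m + n \<in> W" "\<And>m. m \<in> W \<Longrightarrow> - m \<in> W"
    "\<And>g m. m \<in> W \<Longrightarrow> act g m \<in> W" "\<And>c m. m \<in> W \<Longrightarrow> sc c m \<in> W"
  shows "ideal_above {x \<in> A. \<forall>m. ev x m \<in> W}"
proof -
  have "two_sided_ideal {x \<in> A. \<forall>m. ev x m \<in> W} (lpa_free_algebra K E)"
    using action_ideal[OF W, of K gens] by (simp add: lpa_free_algebra_eq)
  moreover have "N \<subseteq> {x \<in> A. \<forall>m. ev x m \<in> W}"
  proof (rule N_least)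
    show "lpa_relators K E \<subseteq> {x \<in> A. \<forall>m. ev x m \<in> W}"
      using relators_A relator_acts_zero W(1) by auto
    show "Poly_Mapping.single 0 c * a \<in> {x \<in> A. \<forall>m. ev x m \<in> W}"
      if "a \<in> {x \<in> A. \<forall>m. ev x m \<in> W}" for c a
      using that by (auto simp: ev_mult ev_scalar W(5) intro: A_closed(5))
  qed fact
  ultimately show ?thesis by (simp add: ideal_above_def)
qed

text \<open>The constant function 1 detects the vertex: elements of \<open>N\<close> act as zero,
  whereas \<open>v\<close> acts as restriction to the nonempty set \<open>D v\<close>.\<close>

lemma vtx_notin_N_if:
  assumes "x \<in> D v"
  shows "vtx v \<notin> N"
proof
  assume "vtx v \<in> N"
  moreover have "ideal_above {x \<in> A. \<forall>m. ev x m \<in> {0}}"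
    by (rule action_ideal_above) auto
  ultimately have "ev (vtx v) (\<lambda>_. 1) = 0" using ideal_aboveD(2) by blast
  then have "ev (vtx v) (\<lambda>_. 1) x = 0" by simp
  then show False using assms by simp
qed

end

context lpa
begin

text \<open>The sets \<open>D v = {v} \<times> ('e list \<times> nat)\<close> carry a branching system: at regular vertices split \<open>nat\<close> into
  residue classes, at infinite emitters prepend the edge to the list.\<close>

lemma vtx_notin_N:
  assumes "v \<in> verts E"
  shows "vtx v \<notin> N"
proof -
  define out where "out e = out_arcs E (tail E e)" for e
  define \<sigma> where "\<sigma> e x = (if regular_vertex E (tail E e)
      then (tail E e, fst (snd x), to_nat_on (out e) e + card (out e) * snd (snd x))
      else (tail E e, e # fst (snd x), snd (snd x)))" for e and x :: "'v \<times> 'e list \<times> nat"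
  have idx: "to_nat_on (out e) e < card (out e)" if "e \<in> arcs E" "regular_vertex E (tail E e)" for e
  proof -
    have "finite (out e)" "e \<in> out e" using that by (auto simp: out_def regular_vertex_def)
    then show ?thesis using to_nat_on_finite[of "out e"] by (auto dest: bij_betwE)
  qed
  interpret branching_system E K "\<lambda>v. {v} \<times> UNIV" \<sigma> "\<lambda>_. 1" "\<lambda>_. 1"
  proof
    fix e assume e: "e \<in> arcs E"
    show "inj_on (\<sigma> e) ({head E e} \<times> UNIV)"
      using idx[OF e] by (intro inj_onI) (auto simp: \<sigma>_def split: if_splits)
    fix f x y assume f: "f \<in> arcs E" and eq: "\<sigma> e x = \<sigma> f y"
    then have t: "tail E e = tail E f" by (auto simp: \<sigma>_def split: if_splits)
    show "e = f"
    proof (cases "regular_vertex E (tail E e)")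
      case True
      have o: "out f = out e" using t by (simp add: out_def)
      have "to_nat_on (out e) e + card (out e) * snd (snd x) = to_nat_on (out e) f + card (out e) * snd (snd y)"
        using eq True t o by (simp add: \<sigma>_def)
      \<comment> \<open>Reduction modulo the number of edges recovers the index of the edge from the
        image point.\<close>
      then have "(to_nat_on (out e) e + card (out e) * snd (snd x)) mod card (out e) =
          (to_nat_on (out e) f + card (out e) * snd (snd y)) mod card (out e)" by simp
      then have "to_nat_on (out e) e = to_nat_on (out e) f"
        using idx[OF e True] idx[OF f] True t o by simp
      moreover have "finite (out e)" "e \<in> out e" "f \<in> out e"
        using e f t True by (auto simp: out_def regular_vertex_def)
      ultimately show ?thesis
        using to_nat_on_finite[of "out e"] by (auto simp: bij_betw_def dest: inj_onD)
    next
      case False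
      then show ?thesis using eq t by (simp add: \<sigma>_def)
    qed
  next
    fix v and y :: "'v \<times> 'e list \<times> nat"
    assume v: "regular_vertex E v" and y: "y \<in> {v} \<times> UNIV"
    let ?O = "out_arcs E v"
    have O: "finite ?O" "?O \<noteq> {}" using v by (auto simp: regular_vertex_def)
    then have "snd (snd y) mod card ?O < card ?O" by (simp add: card_gt_0_iff)
    then obtain e where e: "e \<in> ?O" "to_nat_on ?O e = snd (snd y) mod card ?O"
      using to_nat_on_finite[OF O(1)] unfolding bij_betw_def by (metis imageE lessThan_iff)
    then have "y = \<sigma> e (head E e, fst (snd y), snd (snd y) div card ?O)"
      using y v by (auto simp: \<sigma>_def out_def)
    then show "\<exists>e\<in>?O. \<exists>x\<in>{head E e} \<times> UNIV. y = \<sigma> e x" using e(1) by blast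
  qed (auto simp: \<sigma>_def)
  show ?thesis by (rule vtx_notin_N_if[of "(v, [], 0)"]) simp
qed

end

section \<open>Quotient graphs\<close>

context lpa
begin

lemma cong_sum_mult:
  assumes "\<And>x y. x \<in> X \<Longrightarrow> y \<in> Y \<Longrightarrow> f x * g y \<approx> h x y"
  shows "sum f X * sum g Y \<approx> (\<Sum>x\<in>X. \<Sum>y\<in>Y. h x y)"
  unfolding sum_product by (intro cong_sum assms)

end

locale admissible = lpa E K for E :: "('v, 'e) pre_digraph" and K :: "'k::field itself" +
  fixes H S :: "'v set"
  assumes admissible: "admissible_pair E H S"
begin

abbreviation F :: "('v + 'v, 'e + 'e) pre_digraph" where
  "F \<equiv> quotient_graph E H S"

abbreviation B :: "'v set" where
  "B \<equiv> breaking_vertices E H"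

lemma H_hereditary: "hereditary E H" and H_saturated: "saturated E H" and S_B: "S \<subseteq> B"
  using admissible by (auto simp: admissible_pair_def)

lemma H_verts: "v \<in> H \<Longrightarrow> v \<in> verts E"
  using H_hereditary by (auto simp: hereditary_def)

lemma H_step: "e \<in> arcs E \<Longrightarrow> tail E e \<in> H \<Longrightarrow> head E e \<in> H"
  using H_hereditary reachable_adjI[of "tail E e" "head E e"]
  by (auto simp: hereditary_def dominatesI arc_to_ends_def)

lemma B_D: "v \<in> B \<Longrightarrow> v \<in> verts E" "v \<in> B \<Longrightarrow> v \<notin> H" "v \<in> B \<Longrightarrow> \<not> regular_vertex E v"
  by (auto simp: breaking_vertices_def infinite_emitter_def regular_vertex_def)

lemma F_simps:
  "verts F = Inl ` (verts E - H) \<union> Inr ` (B - S)"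
  "arcs F = Inl ` {e \<in> arcs E. head E e \<notin> H} \<union> Inr ` {e \<in> arcs E. head E e \<in> B - S}"
  "tail F (Inl e) = Inl (tail E e)" "tail F (Inr e) = Inl (tail E e)"
  "head F (Inl e) = Inl (head E e)" "head F (Inr e) = Inr (head E e)"
  by (simp_all add: quotient_graph_def)

sublocale F: lpa "quotient_graph E H S" K
proof
  have tail: "tail E e \<notin> H" if "e \<in> arcs E" "head E e \<notin> H" for e
    using that H_step by blast
  fix e assume "e \<in> arcs F"
  then show "tail F e \<in> verts F" "head F e \<in> verts F"
    using tail B_D by (auto simp: F_simps)
qed

text \<open>The copies of \<open>v\<close> in the quotient graph. A generator of L will be mapped to
  the sum over its copies, so that a vertex in \<open>B - S\<close> goes to the sum of
  \<open>v\<close> and its primed copy, and a vertex of \<open>H\<close> to zero.\<close>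

definition split_vertex :: "'v \<Rightarrow> ('v + 'v) set" where
  "split_vertex v = (if v \<notin> H then {Inl v} else {}) \<union> (if v \<in> B - S then {Inr v} else {})"

definition split_edge :: "'e \<Rightarrow> ('e + 'e) set" where
  "split_edge e = (if head E e \<notin> H then {Inl e} else {}) \<union> (if head E e \<in> B - S then {Inr e} else {})"

lemma split_finite [simp]: "finite (split_vertex v)" "finite (split_edge e)"
  by (simp_all add: split_vertex_def split_edge_def)

lemma split_vertex_verts: "v \<in> verts E \<Longrightarrow> x \<in> split_vertex v \<Longrightarrow> x \<in> verts F"
  by (auto simp: split_vertex_def F_simps split: if_splits)

lemma split_edge_arcs: "e \<in> arcs E \<Longrightarrow> f \<in> split_edge e \<Longrightarrow> f \<in> arcs F"
  by (auto simp: split_edge_def F_simps split: if_splits)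

lemma split_vertex_disjoint: "x \<in> split_vertex v \<Longrightarrow> x \<in> split_vertex w \<Longrightarrow> v = w"
  by (auto simp: split_vertex_def split: if_splits)

lemma split_edge_disjoint: "f \<in> split_edge e \<Longrightarrow> f \<in> split_edge g \<Longrightarrow> e = g"
  by (auto simp: split_edge_def split: if_splits)

lemma split_edge_tail: "e \<in> arcs E \<Longrightarrow> f \<in> split_edge e \<Longrightarrow> tail F f \<in> split_vertex (tail E e)"
  using H_step B_D(2) by (auto simp: split_edge_def split_vertex_def F_simps split: if_splits)

text \<open>A copy of an edge is determined by its head, so sums over the copies of \<open>e\<close>
  and over the copies of its head are interchangeable. Several relations between the images of
  generators rest on this.\<close>

lemma split_edge_head: "bij_betw (head F) (split_edge e) (split_vertex (head E e))"
  by (auto simp: bij_betw_def inj_on_def split_edge_def split_vertex_def F_simps split: if_splits)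

lemma split_edge_head_inj: "f \<in> split_edge e \<Longrightarrow> g \<in> split_edge e \<Longrightarrow> head F f = head F g \<longleftrightarrow> f = g"
  using split_edge_head[of e] by (auto simp: bij_betw_def dest: inj_onD)

lemma split_edge_H: "head E e \<in> H \<Longrightarrow> split_edge e = {}"
  using B_D(2) by (auto simp: split_edge_def)

lemma split_vertex_H: "v \<in> H \<Longrightarrow> split_vertex v = {}"
  using B_D(2) by (auto simp: split_vertex_def)

fun \<theta>_gen :: "('v, 'e) lpa_gen \<Rightarrow> ('v + 'v, 'e + 'e, 'k) lpa_free" where
  "\<theta>_gen (Vertex v) = (\<Sum>x\<in>split_vertex v. vtx x)"
| "\<theta>_gen (Edge e) = (\<Sum>f\<in>split_edge e. edg f)"
| "\<theta>_gen (Ghost e) = (\<Sum>f\<in>split_edge e. gho f)"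

text \<open>The homomorphism between the free algebras arises by letting each generator act by left
  multiplication with its image; evaluation at \<open>1\<close> then gives the image of an arbitrary
  element.\<close>

sublocale \<theta>: word_action "\<lambda>g m. \<theta>_gen g * m" "\<lambda>c m. Poly_Mapping.single 0 c * m"
proof
  fix c d :: 'k and g :: "('v, 'e) lpa_gen" and m n :: "('v + 'v, 'e + 'e, 'k) lpa_free"
  show "\<theta>_gen g * (m + n) = \<theta>_gen g * m + \<theta>_gen g * n"
    "Poly_Mapping.single 0 c * (m + n) = Poly_Mapping.single 0 c * m + Poly_Mapping.single 0 c * n"
    by (rule distrib_left)+
  show "\<theta>_gen g * (Poly_Mapping.single 0 c * m) = Poly_Mapping.single 0 c * (\<theta>_gen g * m)"
    by (rule F.scalar_move)
  show "Poly_Mapping.single 0 (c + d) * m = Poly_Mapping.single 0 c * m + Poly_Mapping.single 0 d * m"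
    by (simp add: single_add distrib_right)
  show "Poly_Mapping.single 0 (c * d) * m = Poly_Mapping.single 0 c * (Poly_Mapping.single 0 d * m)"
    by (simp add: F.single_zero_mult_left mult.assoc)
  show "Poly_Mapping.single 0 1 * m = m" by simp
qed

definition \<theta> :: "('v, 'e, 'k) lpa_free \<Rightarrow> ('v + 'v, 'e + 'e, 'k) lpa_free" where
  "\<theta> a = \<theta>.ev a 1"

lemma \<theta>_ev: "\<theta>.ev a m = \<theta> a * m"
  unfolding \<theta>_def
proof (induction a rule: poly_mapping_single_induct)
  case (single w c)
  have "foldr (\<lambda>g m. \<theta>_gen g * m) ws m = foldr (\<lambda>g m. \<theta>_gen g * m) ws 1 * m" for ws
    by (induction ws) (simp_all add: mult.assoc)
  then show ?case by (simp add: \<theta>.ev_single \<theta>.word_def mult.assoc)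
qed (simp_all add: \<theta>.ev_add_left distrib_right)

lemma \<theta>_simps:
  "\<theta> 0 = 0" "\<theta> (a + b) = \<theta> a + \<theta> b" "\<theta> (- a) = - \<theta> a" "\<theta> (a - b) = \<theta> a - \<theta> b" "\<theta> (a * b) = \<theta> a * \<theta> b"
  "\<theta> (sum f X) = (\<Sum>i\<in>X. \<theta> (f i))"
  "\<theta> (generator g) = \<theta>_gen g" "\<theta> (Poly_Mapping.single 0 c) = Poly_Mapping.single 0 c"
proof -
  show "\<theta> (a * b) = \<theta> a * \<theta> b"
  proof -
    have "\<theta> (a * b) = \<theta>.ev a (\<theta>.ev b 1)" by (simp add: \<theta>_def \<theta>.ev_mult)
    also have "\<dots> = \<theta> a * (\<theta> b * 1)" by (simp only: \<theta>_ev)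
    finally show ?thesis by simp
  qed
qed (simp_all add: \<theta>_def \<theta>.ev_add_left \<theta>.ev_uminus_left \<theta>.ev_diff_left \<theta>.ev_sum_left \<theta>.ev_scalar)

lemma \<theta>_gen_A: "g \<in> gens \<Longrightarrow> \<theta>_gen g \<in> F.A"
  using split_vertex_verts split_edge_arcs by (elim UnE imageE) (auto intro!: F.A_sum F.A_gens)

lemma \<theta>_A: "x \<in> A \<Longrightarrow> \<theta> x \<in> F.A"
proof -
  have "x \<in> A \<Longrightarrow> x \<in> A \<and> \<theta> x \<in> F.A"
    by (induction x rule: A_induct) (auto simp: \<theta>_simps \<theta>_gen_A intro: A_closed(5))
  then show "x \<in> A \<Longrightarrow> \<theta> x \<in> F.A" by blast
qed

lemma \<theta>_vtx_vtx:
  assumes v: "v \<in> verts E" and w: "w \<in> verts E"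
  shows "F.cong (\<theta>_gen (Vertex v) * \<theta>_gen (Vertex w)) (if v = w then \<theta>_gen (Vertex v) else 0)"
proof -
  have "F.cong (\<theta>_gen (Vertex v) * \<theta>_gen (Vertex w))
      (\<Sum>x\<in>split_vertex v. \<Sum>y\<in>split_vertex w. if x = y then vtx x else 0)"
    unfolding \<theta>_gen.simps
    by (intro F.cong_sum_mult F.vtx_vtx) (use split_vertex_verts[OF v] split_vertex_verts[OF w] in auto)
  also have "\<dots> = (if v = w then \<theta>_gen (Vertex v) else 0)"
    by (cases "v = w") (auto simp: sum.delta' dest: split_vertex_disjoint intro!: sum.neutral)
  finally show ?thesis .
qed

lemma \<theta>_tail_edg:
  assumes e: "e \<in> arcs E"
  shows "F.cong (\<theta>_gen (Vertex (tail E e)) * \<theta>_gen (Edge e)) (\<theta>_gen (Edge e))"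
proof -
  have "F.cong (\<theta>_gen (Vertex (tail E e)) * \<theta>_gen (Edge e))
      (\<Sum>x\<in>split_vertex (tail E e). \<Sum>f\<in>split_edge e. if x = tail F f then edg f else 0)"
    unfolding \<theta>_gen.simps
    by (intro F.cong_sum_mult F.vtx_edg) (use split_vertex_verts[OF tail_in_verts[OF e]] split_edge_arcs[OF e] in auto)
  also have "\<dots> = (\<Sum>f\<in>split_edge e. \<Sum>x\<in>split_vertex (tail E e). if x = tail F f then edg f else 0)"
    by (rule sum.swap)
  also have "\<dots> = \<theta>_gen (Edge e)"
    using split_edge_tail[OF e] by (auto simp: sum.delta intro!: sum.cong)
  finally show ?thesis .
qed

lemma \<theta>_gho_tail:
  assumes e: "e \<in> arcs E"
  shows "F.cong (\<theta>_gen (Ghost e) * \<theta>_gen (Vertex (tail E e))) (\<theta>_gen (Ghost e))"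
proof -
  have "F.cong (\<theta>_gen (Ghost e) * \<theta>_gen (Vertex (tail E e)))
      (\<Sum>f\<in>split_edge e. \<Sum>x\<in>split_vertex (tail E e). if x = tail F f then gho f else 0)"
    unfolding \<theta>_gen.simps
    by (intro F.cong_sum_mult F.gho_vtx) (use split_vertex_verts[OF tail_in_verts[OF e]] split_edge_arcs[OF e] in auto)
  also have "\<dots> = \<theta>_gen (Ghost e)"
    using split_edge_tail[OF e] by (auto simp: sum.delta intro!: sum.cong)
  finally show ?thesis .
qed

text \<open>The copies of \<open>e\<close> have different heads, so one copy of the head selects one
  copy of the edge. The same fact later lifts the edges of the quotient graph.\<close>

lemma \<theta>_edg_vtx:
  assumes e: "e \<in> arcs E" and f: "f \<in> split_edge e"
  shows "F.cong (\<theta>_gen (Edge e) * vtx (head F f)) (edg f)"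
proof -
  have hv: "head F f \<in> verts F" using split_edge_arcs[OF e f] by simp
  have "F.cong (\<theta>_gen (Edge e) * vtx (head F f)) (\<Sum>g\<in>split_edge e. if g = f then edg f else 0)"
    unfolding \<theta>_gen.simps sum_distrib_right
  proof (rule F.cong_sum)
    fix g assume g: "g \<in> split_edge e"
    show "F.cong (edg g * vtx (head F f)) (if g = f then edg f else 0)"
      using F.edg_vtx[OF hv split_edge_arcs[OF e g]] split_edge_head_inj[OF g f] by auto
  qed
  then show ?thesis using f by (simp add: sum.delta)
qed

lemma \<theta>_vtx_gho:
  assumes e: "e \<in> arcs E" and f: "f \<in> split_edge e"
  shows "F.cong (vtx (head F f) * \<theta>_gen (Ghost e)) (gho f)"
proof -
  have hv: "head F f \<in> verts F" using split_edge_arcs[OF e f] by simp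
  have "F.cong (vtx (head F f) * \<theta>_gen (Ghost e)) (\<Sum>g\<in>split_edge e. if g = f then gho f else 0)"
    unfolding \<theta>_gen.simps sum_distrib_left
  proof (rule F.cong_sum)
    fix g assume g: "g \<in> split_edge e"
    show "F.cong (vtx (head F f) * gho g) (if g = f then gho f else 0)"
      using F.vtx_gho[OF hv split_edge_arcs[OF e g]] split_edge_head_inj[OF g f] by auto
  qed
  then show ?thesis using f by (simp add: sum.delta)
qed

lemma \<theta>_edg_head:
  assumes e: "e \<in> arcs E"
  shows "F.cong (\<theta>_gen (Edge e) * \<theta>_gen (Vertex (head E e))) (\<theta>_gen (Edge e))"
proof -
  have "\<theta>_gen (Edge e) * \<theta>_gen (Vertex (head E e)) = (\<Sum>f\<in>split_edge e. \<theta>_gen (Edge e) * vtx (head F f))"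
    by (simp only: \<theta>_gen.simps(1) sum.reindex_bij_betw[OF split_edge_head, symmetric] sum_distrib_left)
  also have "F.cong \<dots> (\<Sum>f\<in>split_edge e. edg f)"
    by (intro F.cong_sum \<theta>_edg_vtx e)
  finally show ?thesis by simp
qed

lemma \<theta>_head_gho:
  assumes e: "e \<in> arcs E"
  shows "F.cong (\<theta>_gen (Vertex (head E e)) * \<theta>_gen (Ghost e)) (\<theta>_gen (Ghost e))"
proof -
  have "\<theta>_gen (Vertex (head E e)) * \<theta>_gen (Ghost e) = (\<Sum>f\<in>split_edge e. vtx (head F f) * \<theta>_gen (Ghost e))"
    by (simp only: \<theta>_gen.simps(1) sum.reindex_bij_betw[OF split_edge_head, symmetric] sum_distrib_right)
  also have "F.cong \<dots> (\<Sum>f\<in>split_edge e. gho f)"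
    by (intro F.cong_sum \<theta>_vtx_gho e)
  finally show ?thesis by simp
qed

lemma \<theta>_gho_edg:
  assumes e: "e \<in> arcs E" and g: "g \<in> arcs E"
  shows "F.cong (\<theta>_gen (Ghost e) * \<theta>_gen (Edge g)) (if e = g then \<theta>_gen (Vertex (head E e)) else 0)"
proof -
  have "F.cong (\<theta>_gen (Ghost e) * \<theta>_gen (Edge g))
      (\<Sum>x\<in>split_edge e. \<Sum>y\<in>split_edge g. if x = y then vtx (head F x) else 0)"
    unfolding \<theta>_gen.simps
    by (intro F.cong_sum_mult F.gho_edg) (use split_edge_arcs[OF e] split_edge_arcs[OF g] in auto)
  also have "\<dots> = (if e = g then \<Sum>x\<in>split_edge e. vtx (head F x) else 0)"
    by (cases "e = g") (auto simp: sum.delta' dest: split_edge_disjoint intro!: sum.neutral)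
  also have "\<dots> = (if e = g then \<theta>_gen (Vertex (head E e)) else 0)"
    using sum.reindex_bij_betw[OF split_edge_head[of e], of vtx] by auto
  finally show ?thesis .
qed

text \<open>Mixed products of a copy of \<open>e\<close> with the ghost of another copy vanish,
  because their heads are different vertices of \<open>F\<close>.\<close>

lemma \<theta>_edg_gho:
  assumes e: "e \<in> arcs E"
  shows "F.cong (\<theta>_gen (Edge e) * \<theta>_gen (Ghost e)) (\<Sum>f\<in>split_edge e. edg f * gho f)"
proof -
  have "F.cong (\<theta>_gen (Edge e) * \<theta>_gen (Ghost e))
      (\<Sum>f\<in>split_edge e. \<Sum>g\<in>split_edge e. if g = f then edg f * gho f else 0)"
    unfolding \<theta>_gen.simps
  proof (rule F.cong_sum_mult)
    fix f g assume f: "f \<in> split_edge e" and g: "g \<in> split_edge e"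
    note fa = split_edge_arcs[OF e f] and ga = split_edge_arcs[OF e g]
    have "F.cong (edg f * gho g) (edg f * (vtx (head F g) * gho g))"
      by (rule F.cong_left[OF F.cong_sym[OF F.head_gho[OF ga]] F.U_gens(2)[OF fa]])
    also have "\<dots> = (edg f * vtx (head F g)) * gho g" by (simp add: mult.assoc)
    also have "F.cong \<dots> ((if head F g = head F f then edg f else 0) * gho g)"
      by (intro F.cong_right F.edg_vtx F.U_gens fa ga) (use ga in simp)
    also have "\<dots> = (if g = f then edg f * gho f else 0)"
      using split_edge_head_inj[OF g f] by auto
    finally show "F.cong (edg f * gho g) (if g = f then edg f * gho f else 0)" .
  qed
  then show ?thesis by (simp add: sum.delta)
qed

definition kept_arcs :: "'v \<Rightarrow> 'e set" where
  "kept_arcs v = {e \<in> out_arcs E v. head E e \<notin> H}"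

lemma out_arcs_F: "v \<notin> H \<Longrightarrow> out_arcs F (Inl v) = (\<Union>e\<in>kept_arcs v. split_edge e)"
  using B_D(2) by (auto simp: out_arcs_def F_simps split_edge_def kept_arcs_def split: if_splits)

lemma out_arcs_F_Inr: "out_arcs F (Inr v) = {}"
  by (auto simp: out_arcs_def F_simps)

text \<open>The edges leaving \<open>Inl v\<close> are exactly the copies of the kept edges, so
  \<open>Inl v\<close> is regular in \<open>F\<close> even if \<open>v\<close> emits infinitely many
  edges, and the relation at \<open>Inl v\<close> evaluates the sum. For a split vertex this tells
  its two copies apart.\<close>

lemma \<theta>_kept:
  assumes v: "v \<in> verts E" "v \<notin> H" and T: "finite (kept_arcs v)" "kept_arcs v \<noteq> {}"
  shows "F.cong (\<theta> (\<Sum>e\<in>kept_arcs v. edg e * gho e)) (vtx (Inl v))"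
proof -
  have arcs: "e \<in> arcs E" if "e \<in> kept_arcs v" for e using that by (simp add: kept_arcs_def)
  have reg: "regular_vertex F (Inl v)"
    using v T unfolding regular_vertex_def out_arcs_F[OF v(2)]
    by (auto simp: F_simps split_edge_def kept_arcs_def)
  have "F.cong (\<theta> (\<Sum>e\<in>kept_arcs v. edg e * gho e)) (\<Sum>e\<in>kept_arcs v. \<Sum>f\<in>split_edge e. edg f * gho f)"
    unfolding \<theta>_simps by (intro F.cong_sum \<theta>_edg_gho arcs)
  also have "\<dots> = (\<Sum>f\<in>out_arcs F (Inl v). edg f * gho f)"
    unfolding out_arcs_F[OF v(2)]
    by (rule sum.UNION_disjoint[symmetric]) (use T split_edge_disjoint in auto)
  also have "F.cong \<dots> (vtx (Inl v))" by (rule F.cong_sym[OF F.vtx_CK2[OF reg]])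
  finally show ?thesis .
qed

lemma \<theta>_relators:
  assumes "r \<in> lpa_relators K E"
  shows "\<theta> r \<in> F.N"
proof -
  from assms consider
    (vv) v w where "v \<in> verts E" "w \<in> verts E" "r = vtx v * vtx w - (if v = w then vtx v else 0)"
    | (te) e where "e \<in> arcs E" "r = vtx (tail E e) * edg e - edg e"
    | (eh) e where "e \<in> arcs E" "r = edg e * vtx (head E e) - edg e"
    | (hg) e where "e \<in> arcs E" "r = vtx (head E e) * gho e - gho e"
    | (gt) e where "e \<in> arcs E" "r = gho e * vtx (tail E e) - gho e"
    | (ge) e g where "e \<in> arcs E" "g \<in> arcs E" "r = gho e * edg g - (if e = g then vtx (head E e) else 0)"
    | (ck) v where "regular_vertex E v" "r = vtx v - (\<Sum>e\<in>out_arcs E v. edg e * gho e)"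
    unfolding lpa_relators_def by blast
  then show ?thesis
  proof cases
    case vv
    then show ?thesis using \<theta>_vtx_vtx[OF vv(1,2)]
      by (cases "v = w") (simp_all add: \<theta>_simps F.cong_def del: \<theta>_gen.simps)
  next
    case te
    then show ?thesis using \<theta>_tail_edg by (simp add: \<theta>_simps F.cong_def del: \<theta>_gen.simps)
  next
    case eh
    then show ?thesis using \<theta>_edg_head by (simp add: \<theta>_simps F.cong_def del: \<theta>_gen.simps)
  next
    case hg
    then show ?thesis using \<theta>_head_gho by (simp add: \<theta>_simps F.cong_def del: \<theta>_gen.simps)
  next
    case gt
    then show ?thesis using \<theta>_gho_tail by (simp add: \<theta>_simps F.cong_def del: \<theta>_gen.simps)
  next
    case ge
    then show ?thesis using \<theta>_gho_edg[OF ge(1,2)]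
      by (cases "e = g") (simp_all add: \<theta>_simps F.cong_def del: \<theta>_gen.simps)
  next
    case ck
    have v: "v \<in> verts E" and fin: "finite (out_arcs E v)" using ck(1) by (auto simp: regular_vertex_def)
    have "(\<Sum>e\<in>out_arcs E v. \<theta> (edg e * gho e)) = (\<Sum>e\<in>kept_arcs v. \<theta> (edg e * gho e))"
      using fin split_edge_H by (intro sum.mono_neutral_right) (auto simp: kept_arcs_def \<theta>_simps)
    then have eq: "\<theta> r = \<theta>_gen (Vertex v) - \<theta> (\<Sum>e\<in>kept_arcs v. edg e * gho e)"
      unfolding ck(2) by (simp add: \<theta>_simps del: \<theta>_gen.simps)
    show ?thesis
    proof (cases "v \<in> H")
      case True
      then have "kept_arcs v = {}" using H_step by (auto simp: kept_arcs_def)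
      then show ?thesis unfolding eq using split_vertex_H[OF True] by (simp add: \<theta>_simps F.N_closed)
    next
      \<comment> \<open>Saturation provides an edge from \<open>v\<close> with head outside
        \<open>H\<close>; and a regular vertex is not breaking, so \<open>Inl v\<close> is the only
        copy of \<open>v\<close>.\<close>
      case False
      then have ne: "kept_arcs v \<noteq> {}"
        using H_saturated ck(1) by (fastforce simp: saturated_def kept_arcs_def)
      have "\<theta>_gen (Vertex v) = vtx (Inl v)" using False ck(1) B_D(3) by (auto simp: split_vertex_def)
      moreover have "F.cong (vtx (Inl v)) (\<theta> (\<Sum>e\<in>kept_arcs v. edg e * gho e))"
        by (intro F.cong_sym[OF \<theta>_kept[OF v False _ ne]] finite_subset[OF _ fin])
          (auto simp: kept_arcs_def)
      ultimately show ?thesis unfolding eq by (simp add: F.cong_def)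
    qed
  qed
qed

definition kernel :: "('v, 'e, 'k) lpa_free set" where
  "kernel = {x \<in> A. \<theta> x \<in> F.N}"

lemma kernel_ideal: "ideal_above kernel"
proof -
  have "two_sided_ideal kernel (lpa_free_algebra K E)"
    unfolding A_ideal_iff kernel_def
    by (auto simp: \<theta>_simps intro: F.N_closed F.N_mult F.A_U \<theta>_A A_closed(5,6))
  moreover have "N \<subseteq> kernel"
  proof (rule N_least)
    show "lpa_relators K E \<subseteq> kernel" using relators_A \<theta>_relators by (auto simp: kernel_def)
    show "Poly_Mapping.single 0 c * a \<in> kernel" if "a \<in> kernel" for c a
      using that by (auto simp: kernel_def \<theta>_simps intro: F.N_mult A_closed(5))
  qed fact
  ultimately show ?thesis by (simp add: ideal_above_def)
qed

lemma \<theta>_cong: "x \<approx> y \<Longrightarrow> F.cong (\<theta> x) (\<theta> y)"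
  using ideal_aboveD(2)[OF kernel_ideal] by (auto simp: cong_def F.cong_def \<theta>_simps kernel_def)

text \<open>A vertex outside \<open>H\<close> goes to a sum that contains \<open>Inl v\<close>.
  Multiplication by \<open>Inl v\<close> isolates this summand, and vertices of the quotient graph
  are nonzero in its algebra.\<close>

lemma kernel_verts: "verts_in kernel = H"
proof -
  have "vtx v \<in> kernel \<longleftrightarrow> v \<in> H" if v: "v \<in> verts E" for v
  proof
    assume "v \<in> H"
    then show "vtx v \<in> kernel" using v split_vertex_H by (simp add: kernel_def \<theta>_simps F.N_closed)
  next
    assume vk: "vtx v \<in> kernel"
    show "v \<in> H"
    proof (rule ccontr)
      assume "v \<notin> H"
      then have x: "Inl v \<in> split_vertex v" "Inl v \<in> verts F" using v by (auto simp: split_vertex_def F_simps)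
      have "\<theta>_gen (Vertex v) \<in> F.N" using vk by (simp add: kernel_def \<theta>_simps del: \<theta>_gen.simps)
      then have "vtx (Inl v) * \<theta>_gen (Vertex v) \<in> F.N" by (rule F.N_mult(1)[OF _ F.U_gens(1)[OF x(2)]])
      moreover have "F.cong (vtx (Inl v) * \<theta>_gen (Vertex v)) (\<Sum>y\<in>split_vertex v. if Inl v = y then vtx (Inl v) else 0)"
        unfolding \<theta>_gen.simps sum_distrib_left
        using x(2) v split_vertex_verts by (intro F.cong_sum F.vtx_vtx) auto
      then have "F.cong (vtx (Inl v) * \<theta>_gen (Vertex v)) (vtx (Inl v))"
        using x(1) by (simp add: sum.delta del: \<theta>_gen.simps)
      ultimately have "vtx (Inl v) \<in> F.N" using F.ideal_above_cong[OF F.ideal_above_N] by simp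
      then show False using F.vtx_notin_N[OF x(2)] by simp
    qed
  qed
  then show ?thesis using H_verts by (auto simp: verts_in_def)
qed

lemma kept_arcs_B: "v \<in> B \<Longrightarrow> finite (kept_arcs v)" "v \<in> B \<Longrightarrow> kept_arcs v \<noteq> {}"
proof -
  have "kept_arcs v = {e \<in> out_arcs E v. head E e \<in> verts E - H}" by (auto simp: kept_arcs_def)
  then show "v \<in> B \<Longrightarrow> finite (kept_arcs v)" "v \<in> B \<Longrightarrow> kept_arcs v \<noteq> {}"
    by (simp_all add: breaking_vertices_def)
qed

text \<open>The vertex goes to the sum of its copies and the sum over kept edges goes to
  \<open>Inl v\<close>, so their difference is mapped to the primed copy if there is one.\<close>

lemma \<theta>_brk:
  assumes v: "v \<in> B"
  shows "F.cong (\<theta> (brk v (kept_arcs v))) (if v \<in> S then 0 else vtx (Inr v))"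
proof -
  have "F.cong (\<theta> (brk v (kept_arcs v))) (\<theta>_gen (Vertex v) - vtx (Inl v))"
    unfolding brk_def \<theta>_simps(4)
    using \<theta>_kept[OF B_D(1,2)[OF v] kept_arcs_B[OF v]]
    by (intro F.cong_diff) (simp_all add: \<theta>_simps(7))
  also have "\<theta>_gen (Vertex v) - vtx (Inl v) = (if v \<in> S then 0 else vtx (Inr v))"
    using v B_D(2)[OF v] by (simp add: split_vertex_def)
  finally show ?thesis .
qed

lemma kernel_brk: "v \<in> B \<Longrightarrow> brk v (kept_arcs v) \<in> kernel \<longleftrightarrow> v \<in> S"
proof -
  assume v: "v \<in> B"
  have "brk v (kept_arcs v) \<in> A"
    using v kept_arcs_B[OF v] by (intro brk_A B_D) (auto simp: kept_arcs_def)
  then have "brk v (kept_arcs v) \<in> kernel \<longleftrightarrow> (if v \<in> S then 0 else vtx (Inr v)) \<in> F.N"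
    using F.ideal_above_cong[OF F.ideal_above_N \<theta>_brk[OF v]] by (simp add: kernel_def)
  also have "\<dots> \<longleftrightarrow> v \<in> S"
    using F.vtx_notin_N[of "Inr v"] v by (auto simp: F_simps F.N_closed)
  finally show ?thesis .
qed

text \<open>Vertices come first: for a split vertex the unprimed copy is hit by the sum over kept
  edges and the primed copy by the breaking element. A copy of an edge is then hit by the edge times
  a lift of the head of the copy.\<close>

lemma \<theta>_surjective:
  assumes "y \<in> F.A"
  shows "\<exists>x\<in>A. F.cong (\<theta> x) y"
proof -
  have vert: "\<exists>x\<in>A. F.cong (\<theta> x) (vtx w)" if w: "w \<in> verts F" for w
  proof -
    consider v where "w = Inl v" "v \<in> verts E" "v \<notin> H" "v \<notin> B - S" | v where "w = Inl v" "v \<in> B - S"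
      | v where "w = Inr v" "v \<in> B - S"
      using w by (auto simp: F_simps)
    then show ?thesis
    proof cases
      case 1
      then have "\<theta> (vtx v) = vtx w" by (auto simp: \<theta>_simps split_vertex_def)
      then show ?thesis using 1 by (intro bexI[of _ "vtx v"]) auto
    next
      case 2
      then have v: "v \<in> B" by simp
      have "(\<Sum>e\<in>kept_arcs v. edg e * gho e) \<in> A"
        by (intro A_sum A_closed(6)) (auto simp: kept_arcs_def)
      then show ?thesis
        unfolding 2(1) using \<theta>_kept[OF B_D(1,2)[OF v] kept_arcs_B[OF v]] by blast
    next
      case 3
      then have v: "v \<in> B" by simp
      have "brk v (kept_arcs v) \<in> A"
        using kept_arcs_B[OF v] by (intro brk_A B_D v) (auto simp: kept_arcs_def)
      moreover have "F.cong (\<theta> (brk v (kept_arcs v))) (vtx w)" using \<theta>_brk[OF v] 3 by simp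
      ultimately show ?thesis by blast
    qed
  qed
  have ex_edge: "\<exists>e\<in>arcs E. f \<in> split_edge e" if "f \<in> arcs F" for f
    using that B_D(2) by (auto simp: F_simps split_edge_def)
  have "y \<in> F.A \<and> (\<exists>x\<in>A. F.cong (\<theta> x) y)"
    using assms
  proof (induction y rule: F.A_induct)
    case zero
    show ?case by (auto intro!: bexI[of _ 0] simp: \<theta>_simps)
  next
    case (generator g)
    then consider w where "g = Vertex w" "w \<in> verts F" | f where "g = Edge f" "f \<in> arcs F"
      | f where "g = Ghost f" "f \<in> arcs F" by blast
    then show ?case
    proof cases
      case 1
      then show ?thesis using vert by simp
    next
      case 2
      obtain e where e: "e \<in> arcs E" "f \<in> split_edge e" using ex_edge[OF 2(2)] by blast
      obtain x where x: "x \<in> A" "F.cong (\<theta> x) (vtx (head F f))" using vert[of "head F f"] 2(2) by auto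
      have "F.cong (\<theta> (edg e * x)) (\<theta>_gen (Edge e) * vtx (head F f))"
        unfolding \<theta>_simps using e(1) by (intro F.cong_left[OF x(2)] F.A_U \<theta>_gen_A) auto
      also have "F.cong \<dots> (edg f)" by (rule \<theta>_edg_vtx[OF e])
      finally show ?thesis using 2 x(1) e(1) by (intro conjI bexI[of _ "edg e * x"]) (auto intro: A_closed(5))
    next
      case 3
      obtain e where e: "e \<in> arcs E" "f \<in> split_edge e" using ex_edge[OF 3(2)] by blast
      obtain x where x: "x \<in> A" "F.cong (\<theta> x) (vtx (head F f))" using vert[of "head F f"] 3(2) by auto
      have "F.cong (\<theta> (x * gho e)) (vtx (head F f) * \<theta>_gen (Ghost e))"
        unfolding \<theta>_simps using e(1) by (intro F.cong_right[OF x(2)] F.A_U \<theta>_gen_A) auto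
      also have "F.cong \<dots> (gho f)" by (rule \<theta>_vtx_gho[OF e])
      finally show ?thesis using 3 x(1) e(1) by (intro conjI bexI[of _ "x * gho e"]) (auto intro: A_closed(6))
    qed
  next
    case (add a b)
    then obtain x x' where "x \<in> A" "F.cong (\<theta> x) a" "x' \<in> A" "F.cong (\<theta> x') b" by blast
    then show ?case using add by (auto simp: \<theta>_simps intro!: bexI[of _ "x + x'"] F.cong_add)
  next
    case (mult a b)
    then obtain x x' where x: "x \<in> A" "F.cong (\<theta> x) a" "x' \<in> A" "F.cong (\<theta> x') b" by blast
    have "F.cong (\<theta> (x * x')) (a * b)"
      unfolding \<theta>_simps using mult x by (intro F.cong_mult F.A_U \<theta>_A) auto
    then show ?case using mult x by (auto intro!: bexI[of _ "x * x'"] A_closed(5) F.A_closed(5))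
  next
    case (scalar a c)
    then obtain x where x: "x \<in> A" "F.cong (\<theta> x) a" by blast
    have "F.cong (\<theta> (Poly_Mapping.single 0 c * x)) (Poly_Mapping.single 0 c * a)"
      unfolding \<theta>_simps by (rule F.cong_left[OF x(2)]) simp
    then show ?case using scalar x
      by (auto intro!: bexI[of _ "Poly_Mapping.single 0 c * x"] A_closed(5) F.A_closed(5))
  qed
  then show ?thesis by blast
qed

end

section \<open>Ideals in the form I(H,S)\<close>

context lpa
begin

lemma breaking_element_closed:
  assumes v: "v \<in> breaking_vertices E H"
  shows "brk v {e \<in> out_arcs E v. head E e \<notin> H} \<in> A"
proof (rule brk_A)
  have eq: "{e \<in> out_arcs E v. head E e \<notin> H} = {e \<in> out_arcs E v. head E e \<in> verts E - H}" by auto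
  show "v \<in> verts E" "finite {e \<in> out_arcs E v. head E e \<notin> H}"
    using v unfolding eq by (simp_all add: breaking_vertices_def)
qed auto

lemma breaking_idem:
  assumes v: "v \<in> breaking_vertices E H"
  shows "brk v {e \<in> out_arcs E v. head E e \<notin> H} * brk v {e \<in> out_arcs E v. head E e \<notin> H} \<approx>
    brk v {e \<in> out_arcs E v. head E e \<notin> H}"
proof (rule brk_idem)
  have eq: "{e \<in> out_arcs E v. head E e \<notin> H} = {e \<in> out_arcs E v. head E e \<in> verts E - H}" by auto
  show "v \<in> verts E" "finite {e \<in> out_arcs E v. head E e \<notin> H}"
    using v unfolding eq by (simp_all add: breaking_vertices_def)
qed auto

lemma admissible_generators:
  assumes "admissible_pair E H S"
  shows "(\<lambda>v. cl (vtx v)) ` H \<union> breaking_element K E H ` S \<subseteq> carrier L"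
  using assms breaking_element_closed[of _ H]
  by (fastforce simp: admissible_pair_def hereditary_def breaking_element_eq)

lemma admissible_ideal_ideal:
  assumes "admissible_pair E H S"
  shows "two_sided_ideal (admissible_ideal K E H S) L"
    "v \<in> H \<Longrightarrow> cl (vtx v) \<in> admissible_ideal K E H S"
    "v \<in> S \<Longrightarrow> breaking_element K E H v \<in> admissible_ideal K E H S"
  unfolding admissible_ideal_def
  using cl.S.ideal_generated_ideal[OF admissible_generators[OF assms]] by auto

lemma admissible_ideal_least:
  assumes "two_sided_ideal I L" "\<And>v. v \<in> H \<Longrightarrow> cl (vtx v) \<in> I" "\<And>v. v \<in> S \<Longrightarrow> breaking_element K E H v \<in> I"
  shows "admissible_ideal K E H S \<subseteq> I"
  unfolding admissible_ideal_def
  using assms by (intro cl.S.ideal_generated_least) auto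

lemma gr_admissible:
  assumes I: "two_sided_ideal I L"
  shows "admissible_pair E (gr_vertices K E I) (gr_breaking K E I)"
  using verts_in_hereditary[OF ideal_above_preimage[OF I]] verts_in_saturated[OF ideal_above_preimage[OF I]]
  by (auto simp: admissible_pair_def gr_vertices_eq gr_breaking_def)

lemma ideal_subset_if_gr:
  assumes K: "condition_K E" and I: "two_sided_ideal I L" and J: "two_sided_ideal J L"
    and v: "\<And>v. v \<in> gr_vertices K E I \<Longrightarrow> cl (vtx v) \<in> J"
    and b: "\<And>v. v \<in> gr_breaking K E I \<Longrightarrow> breaking_element K E (gr_vertices K E I) v \<in> J"
  shows "I \<subseteq> J"
proof -
  let ?I = "cl.preimage I" and ?J = "cl.preimage J"
  have H: "gr_vertices K E I = verts_in ?I" by (rule gr_vertices_eq)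
  have "?I \<subseteq> ?J"
  proof (rule ideal_subset_of_generators[OF K ideal_above_preimage[OF I] ideal_above_preimage[OF J]])
    fix v assume "v \<in> verts_in ?I"
    then show "vtx v \<in> ?J" using v by (simp add: H cl.preimage_def verts_in_def)
  next
    fix v assume v: "v \<in> breaking_vertices E (verts_in ?I)" and m: "brk v (nonideal_out_arcs ?I v) \<in> ?I"
    have bA: "brk v (nonideal_out_arcs ?I v) \<in> A"
      using breaking_element_closed[OF v] by (simp add: nonideal_out_arcs_def)
    have eq: "breaking_element K E (gr_vertices K E I) v = cl (brk v (nonideal_out_arcs ?I v))"
      by (simp only: breaking_element_eq H nonideal_out_arcs_def)
    have "cl (brk v (nonideal_out_arcs ?I v)) \<in> I" using m by (simp add: cl.preimage_def)
    then have "v \<in> gr_breaking K E I"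
      unfolding gr_breaking_def eq[symmetric] using v by (simp add: H)
    then have "cl (brk v (nonideal_out_arcs ?I v)) \<in> J" unfolding eq[symmetric] by (rule b)
    with bA show "brk v (nonideal_out_arcs ?I v) \<in> ?J" by (simp add: cl.preimage_def)
  qed
  then show ?thesis
    using cl.preimage_mono_iff[of I J] cl.S.idealD(1) I J by simp
qed

theorem ideal_eq_admissible_ideal:
  assumes K: "condition_K E" and I: "two_sided_ideal I L"
  shows "I = admissible_ideal K E (gr_vertices K E I) (gr_breaking K E I)"
proof
  note adm = gr_admissible[OF I]
  show "I \<subseteq> admissible_ideal K E (gr_vertices K E I) (gr_breaking K E I)"
    by (rule ideal_subset_if_gr[OF K I admissible_ideal_ideal(1)[OF adm]])
      (rule admissible_ideal_ideal(2,3)[OF adm], assumption)+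
  show "admissible_ideal K E (gr_vertices K E I) (gr_breaking K E I) \<subseteq> I"
    by (rule admissible_ideal_least[OF I]) (auto simp: gr_vertices_def gr_breaking_def)
qed

text \<open>The generators of \<open>I(H, S)\<close> are idempotents.\<close>

lemma ideal_idempotent:
  assumes K: "condition_K E" and I: "two_sided_ideal I L"
  shows "I \<subseteq> I \<cdot>\<^bsub>L\<^esub> I"
proof (rule ideal_subset_if_gr[OF K I cl.S.ideal_prod_ideal[OF I I]])
  fix v assume "v \<in> gr_vertices K E I"
  then have v: "v \<in> verts E" "cl (vtx v) \<in> I" by (auto simp: gr_vertices_def)
  have "cl (vtx v) \<otimes>\<^bsub>L\<^esub> cl (vtx v) = cl (vtx v * vtx v)"
    using v(1) by (intro cl_mult) auto
  also have "\<dots> = cl (vtx v)" using v(1) cl_eq_iff vtx_idem[OF v(1)] by (simp add: A_closed(5))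
  finally show "cl (vtx v) \<in> I \<cdot>\<^bsub>L\<^esub> I" using ideal_prod.prod[OF v(2,2), of L] by simp
next
  fix v assume v: "v \<in> gr_breaking K E I"
  let ?T = "{e \<in> out_arcs E v. head E e \<notin> gr_vertices K E I}"
  let ?b = "brk v ?T"
  have vb: "v \<in> breaking_vertices E (gr_vertices K E I)" and bI: "cl ?b \<in> I"
    using v by (auto simp: gr_breaking_def breaking_element_eq)
  have bA: "?b \<in> A" using vb by (rule breaking_element_closed)
  have "?b * ?b \<approx> ?b" using vb by (rule breaking_idem)
  then have "cl (?b * ?b) = cl ?b"
    by (rule cl_eq_iff[OF A_closed(5)[OF A_U[OF bA] bA] bA, THEN iffD2])
  then have "cl ?b \<otimes>\<^bsub>L\<^esub> cl ?b = cl ?b" unfolding cl_mult[OF bA bA] .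
  then show "breaking_element K E (gr_vertices K E I) v \<in> I \<cdot>\<^bsub>L\<^esub> I"
    using ideal_prod.prod[OF bI bI, of L] by (simp add: breaking_element_eq)
qed

lemma idempotent_ideals_L: "condition_K E \<Longrightarrow> idempotent_ideals L"
  by (intro idempotent_ideals.intro idempotent_ideals_axioms.intro cl.S.nonunital_ring_axioms
      ideal_idempotent)

text \<open>If \<open>H\<close> is empty, all infinitely many edges of an infinite emitter have
  their heads outside \<open>H\<close>, so there are no breaking vertices. An ideal without vertices
  therefore has no generators at all.\<close>

lemma nonzero_ideal_vertex:
  assumes K: "condition_K E" and I: "two_sided_ideal I L" and "I \<noteq> {\<zero>\<^bsub>L\<^esub>}"
  shows "gr_vertices K E I \<noteq> {}"
proof
  assume e: "gr_vertices K E I = {}"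
  then have "breaking_vertices E (gr_vertices K E I) = {}"
    by (auto simp: breaking_vertices_def infinite_emitter_def out_arcs_def cong: conj_cong)
  then have b: "gr_breaking K E I = {}" by (simp add: gr_breaking_def)
  have "I \<subseteq> {\<zero>\<^bsub>L\<^esub>}"
    by (rule ideal_subset_if_gr[OF K I cl.S.ideal_zero]) (simp_all add: e b)
  with assms(3) cl.S.idealD(2)[OF I] show False by blast
qed

text \<open>An ideal that contains all vertices contains the local units and with them every
  element.\<close>

lemma proper_ideal_gr:
  assumes "proper_ideal I L"
  shows "gr_vertices K E I \<noteq> verts E"
proof
  assume all: "gr_vertices K E I = verts E"
  have I: "two_sided_ideal I L" using assms by (simp add: proper_ideal_def)
  have "x \<in> cl.preimage I" if x: "x \<in> A" for x
  proof -
    obtain T where T: "finite T" "T \<subseteq> verts E" "(\<Sum>v\<in>T. vtx v) * x \<approx> x"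
      using local_unit[OF x] by blast
    have "(\<Sum>v\<in>T. vtx v) \<in> cl.preimage I"
      using T(2) all by (intro ideal_above_sum[OF ideal_above_preimage[OF I]])
        (auto simp: gr_vertices_eq verts_in_def)
    then have "(\<Sum>v\<in>T. vtx v) * x \<in> cl.preimage I"
      by (rule ideal_above_mult(2)[OF ideal_above_preimage[OF I] _ A_U[OF x]])
    then show ?thesis using ideal_above_cong[OF ideal_above_preimage[OF I] T(3)] by simp
  qed
  then have "cl.preimage (carrier L) \<subseteq> cl.preimage I" by (auto simp: cl.preimage_def)
  then have "carrier L \<subseteq> I"
    using cl.preimage_mono_iff[of "carrier L" I] cl.S.idealD(1)[OF I] by simp
  then show False using assms cl.S.idealD(1)[OF I] by (auto simp: proper_ideal_def)
qed

lemma gr_verts_proper: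
  assumes "two_sided_ideal I L" "gr_vertices K E I \<noteq> verts E"
  shows "proper_ideal I L"
proof -
  have "I \<noteq> carrier L"
  proof
    assume "I = carrier L"
    then have "gr_vertices K E I = verts E" by (auto simp: gr_vertices_def)
    with assms(2) show False ..
  qed
  then show ?thesis using assms(1) by (simp add: proper_ideal_def)
qed

end

section \<open>The isomorphism of L/I(H,S) with the algebra of the quotient graph\<close>

context admissible
begin

definition \<Theta> :: "('v, 'e, 'k) lpa_free set \<Rightarrow> ('v + 'v, 'e + 'e, 'k) lpa_free set" where
  "\<Theta> X = F.cl (\<theta> (SOME x. x \<in> A \<and> cl x = X))"

lemma \<Theta>_cl: "x \<in> A \<Longrightarrow> \<Theta> (cl x) = F.cl (\<theta> x)"
proof -
  assume x: "x \<in> A"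
  have "(SOME y. y \<in> A \<and> cl y = cl x) \<in> A \<and> cl (SOME y. y \<in> A \<and> cl y = cl x) = cl x"
    by (rule someI[of _ x]) (simp add: x)
  then have s: "(SOME y. y \<in> A \<and> cl y = cl x) \<in> A" "(SOME y. y \<in> A \<and> cl y = cl x) \<approx> x"
    using cl_eq_iff x by auto
  then show ?thesis
    unfolding \<Theta>_def using F.cl_eq_iff[OF \<theta>_A \<theta>_A] \<theta>_cong x by simp
qed

sublocale \<Theta>: surjective_hom "leavitt_path_algebra K E" "leavitt_path_algebra K (quotient_graph E H S)" \<Theta>
proof (intro surjective_hom.intro surjective_hom_axioms.intro)
  show "nonunital_ring L" by (rule cl.S.nonunital_ring_axioms)
  show "nonunital_ring F.L" by (rule F.cl.S.nonunital_ring_axioms)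
  have L: "carrier L = cl ` A" using cl.image by simp
  show "\<Theta> ` carrier L = carrier F.L"
  proof
    show "\<Theta> ` carrier L \<subseteq> carrier F.L" by (auto simp: L \<Theta>_cl \<theta>_A)
    show "carrier F.L \<subseteq> \<Theta> ` carrier L"
    proof
      fix Y assume "Y \<in> carrier F.L"
      then obtain y where y: "y \<in> F.A" "Y = F.cl y" using F.cl.image by auto
      obtain x where x: "x \<in> A" "F.cong (\<theta> x) y" using \<theta>_surjective[OF y(1)] by blast
      have "Y = \<Theta> (cl x)" using x y F.cl_eq_iff[OF \<theta>_A[OF x(1)] y(1)] by (simp add: \<Theta>_cl)
      then show "Y \<in> \<Theta> ` carrier L" using x(1) by simp
    qed
  qed
  fix X Y assume "X \<in> carrier L" "Y \<in> carrier L"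
  then obtain x y where xy: "x \<in> A" "y \<in> A" "X = cl x" "Y = cl y" by (auto simp: L)
  show "\<Theta> (X \<oplus>\<^bsub>L\<^esub> Y) = \<Theta> X \<oplus>\<^bsub>F.L\<^esub> \<Theta> Y"
    unfolding xy cl_add[OF xy(1,2)] \<Theta>_cl[OF xy(1)] \<Theta>_cl[OF xy(2)] \<Theta>_cl[OF A_closed(2)[OF xy(1,2)]]
      F.cl_add[OF \<theta>_A[OF xy(1)] \<theta>_A[OF xy(2)]] \<theta>_simps ..
  show "\<Theta> (X \<otimes>\<^bsub>L\<^esub> Y) = \<Theta> X \<otimes>\<^bsub>F.L\<^esub> \<Theta> Y"
    unfolding xy cl_mult[OF xy(1,2)] \<Theta>_cl[OF xy(1)] \<Theta>_cl[OF xy(2)] \<Theta>_cl[OF A_closed(5)[OF A_U[OF xy(1)] xy(2)]]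
      F.cl_mult[OF \<theta>_A[OF xy(1)] \<theta>_A[OF xy(2)]] \<theta>_simps ..
qed

lemma \<Theta>_zero_iff: "x \<in> A \<Longrightarrow> \<Theta> (cl x) = \<zero>\<^bsub>F.L\<^esub> \<longleftrightarrow> x \<in> kernel"
  using F.cl_zero_iff[OF \<theta>_A] by (simp add: \<Theta>_cl kernel_def)

lemma \<Theta>_kernel_gr:
  "gr_vertices K E (\<Theta>.preimage {\<zero>\<^bsub>F.L\<^esub>}) = H" "gr_breaking K E (\<Theta>.preimage {\<zero>\<^bsub>F.L\<^esub>}) = S"
proof -
  have eq: "cl.preimage (\<Theta>.preimage {\<zero>\<^bsub>F.L\<^esub>}) = kernel"
    using \<Theta>_zero_iff by (auto simp: cl.preimage_def \<Theta>.preimage_def kernel_def)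
  show H: "gr_vertices K E (\<Theta>.preimage {\<zero>\<^bsub>F.L\<^esub>}) = H"
    by (simp add: gr_vertices_eq eq kernel_verts)
  have "breaking_element K E H v \<in> \<Theta>.preimage {\<zero>\<^bsub>F.L\<^esub>} \<longleftrightarrow> v \<in> S" if v: "v \<in> B" for v
  proof -
    have A: "brk v (kept_arcs v) \<in> A"
      using breaking_element_closed[OF v] by (simp add: kept_arcs_def)
    have "breaking_element K E H v = cl (brk v (kept_arcs v))"
      by (simp add: breaking_element_eq kept_arcs_def)
    then show ?thesis using A kernel_brk[OF v] \<Theta>_zero_iff[OF A] by (simp add: \<Theta>.preimage_def)
  qed
  then show "gr_breaking K E (\<Theta>.preimage {\<zero>\<^bsub>F.L\<^esub>}) = S"
    unfolding gr_breaking_def H using S_B by auto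
qed

context
  assumes K: "condition_K E"
begin

text \<open>The kernel is an ideal whose pair is (H,S), and under Condition (K) an ideal is
  determined by its pair. So no inverse homomorphism has to be constructed.\<close>

lemma \<Theta>_kernel: "\<Theta>.preimage {\<zero>\<^bsub>F.L\<^esub>} = admissible_ideal K E H S"
  using ideal_eq_admissible_ideal[OF K \<Theta>.preimage_ideal[OF F.cl.S.ideal_zero]] by (simp add: \<Theta>_kernel_gr)

lemma gr_admissible_ideal:
  "gr_vertices K E (admissible_ideal K E H S) = H" "gr_breaking K E (admissible_ideal K E H S) = S"
  using \<Theta>_kernel_gr by (simp_all add: \<Theta>_kernel)

lemma quotient_isomorphic: "algebra_isomorphic (quotient_algebra L (admissible_ideal K E H S)) F.L"
proof (rule quotient_algebra_isomorphic[of _ _ \<Theta>])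
  show "surjective_hom L F.L \<Theta>" by (rule \<Theta>.surjective_hom_axioms)
  show "two_sided_ideal (admissible_ideal K E H S) L" by (rule admissible_ideal_ideal(1)[OF admissible])
  show "\<Theta> X = \<zero>\<^bsub>F.L\<^esub> \<longleftrightarrow> X \<in> admissible_ideal K E H S" if "X \<in> carrier L" for X
    using that \<Theta>_kernel by (auto simp: \<Theta>.preimage_def)
  fix c X assume "X \<in> carrier L"
  then obtain x where x: "x \<in> A" "X = cl x" using cl.image by auto
  have cx: "Poly_Mapping.single 0 c * x \<in> A" by (intro A_closed(5)) (simp_all add: x)
  show "c \<odot>\<^bsub>L\<^esub> X \<in> carrier L" using x cx by (simp add: cl_smult)
  show "\<Theta> (c \<odot>\<^bsub>L\<^esub> X) = c \<odot>\<^bsub>F.L\<^esub> \<Theta> X"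
    using x cx by (simp add: cl_smult \<Theta>_cl F.cl_smult \<theta>_A \<theta>_simps)
qed

text \<open>Primed vertices are sinks, so a closed path of \<open>F\<close> consists of unprimed
  edges and comes from a closed path of \<open>E\<close>. Conversely, a path of \<open>E\<close>
  that ends outside \<open>H\<close> has never entered \<open>H\<close> and survives in
  \<open>F\<close>.\<close>

lemma condition_K_quotient: "condition_K F"
  unfolding condition_K_def
proof (intro allI impI)
  have up: "\<exists>p' v. p = map Inl p' \<and> set p' \<subseteq> arcs E \<and> x = Inl v \<and> cas v p' w \<and> v \<notin> H"
    if "F.awalk x p (Inl w)" for x p w
    using that
  proof (induction p arbitrary: x)
    case Nil
    then show ?case by (intro exI[of _ "[]"] exI[of _ w]) (auto simp: F.awalk_Nil_iff F_simps)
  next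
    case (Cons f p)
    then have f: "f \<in> arcs F" "x = tail F f" and p: "F.awalk (head F f) p (Inl w)"
      by (auto simp: F.awalk_Cons_iff)
    obtain p' v where p': "p = map Inl p'" "set p' \<subseteq> arcs E" "head F f = Inl v" "cas v p' w" "v \<notin> H"
      using Cons.IH[OF p] by blast
    then obtain e where e: "f = Inl e" "e \<in> arcs E" "v = head E e" using f(1) by (auto simp: F_simps)
    then have "tail E e \<notin> H" using H_step p'(5) by blast
    then show ?case using e p' f
      by (intro exI[of _ "e # p'"] exI[of _ "tail E e"]) (auto simp: F_simps)
  qed
  have down: "F.awalk (Inl v) (map Inl p) (Inl w)" if "awalk v p w" "w \<notin> H" for v p w
    using that
  proof (induction p arbitrary: v)
    case Nil
    then show ?case by (auto simp: awalk_Nil_iff F.awalk_Nil_iff F_simps)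
  next
    case (Cons e p)
    then have e: "e \<in> arcs E" "v = tail E e" and p: "awalk (head E e) p w"
      by (auto simp: awalk_Cons_iff)
    have "head E e \<notin> H"
    proof
      assume "head E e \<in> H"
      then have "w \<in> H" using H_hereditary p by (auto simp: hereditary_def reachable_awalk)
      with Cons.prems(2) show False ..
    qed
    then show ?case using e Cons.IH[OF p Cons.prems(2)] by (auto simp: F.awalk_Cons_iff F_simps)
  qed
  fix x c assume c: "simple_closed_path F x c"
  obtain v where v: "x = Inl v"
    using c out_arcs_F_Inr by (cases x) (auto simp: F.simple_closed_path_iff out_arcs_def)
  have w: "F.awalk (Inl v) c (Inl v)" "c \<noteq> []" "\<forall>e\<in>set (tl c). tail F e \<noteq> Inl v"
    using c v by (auto simp: simple_closed_path_def)
  obtain c' where c': "c = map Inl c'" "set c' \<subseteq> arcs E" "cas v c' v" "v \<notin> H"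
    using up[OF w(1)] by auto
  have "v \<in> verts E" using F.awalk_hd_in_verts[OF w(1)] by (auto simp: F_simps)
  then have "simple_closed_path E v c'"
    using c' w(2,3) by (auto simp: simple_closed_path_def awalk_def F_simps map_tl[symmetric])
  then obtain d where d: "simple_closed_path E v d" "d \<noteq> c'"
    using K unfolding condition_K_def by blast
  have "simple_closed_path F (Inl v) (map Inl d)"
    using d(1) down[of v d v] c'(4) by (auto simp: simple_closed_path_def map_tl[symmetric] F_simps)
  moreover have "map Inl d \<noteq> c" using d(2) c'(1) by (auto simp: inj_map_eq_map)
  ultimately show "\<exists>c'. simple_closed_path F x c' \<and> c' \<noteq> c" using v by blast
qed

end

end

section \<open>Failure of Condition (K)\<close>

context lpa
begin

text \<open>If \<open>c\<close> is the only simple closed path based at \<open>v\<close>, the paths that reach \<open>v\<close> only at their end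
  carry a representation over \<open>K[[t]]\<close> on which \<open>c\<close> acts as \<open>1 + t\<close> at the trivial path.\<close>

lemma not_condition_K_filtration:
  assumes "\<not> condition_K E"
  shows "\<exists>P P0 z. (\<forall>n. ideal_above (P n)) \<and> ideal_above P0 \<and> (\<Inter>n. P n) \<subseteq> P0 \<and>
    (\<forall>m n. m \<le> n \<longrightarrow> P n \<subseteq> P m) \<and> z \<in> A \<and> (\<forall>n. z ^ Suc n \<in> P (Suc n)) \<and> (\<forall>n. z ^ Suc n \<notin> P0) \<and>
    (\<forall>x\<in>P (Suc 0). x * x \<approx> x \<longrightarrow> x \<in> P0)"
proof -
  obtain v c where c: "simple_closed_path E v c" and
    unique: "\<And>d. simple_closed_path E v d \<Longrightarrow> d = c"
    using assms unfolding condition_K_def by blast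
  obtain c1 c' where c1: "c = c1 # c'" "c1 \<in> arcs E" "tail E c1 = v" "awalk (head E c1) c' v"
    "\<forall>f\<in>set c'. tail E f \<noteq> v"
    using c by (auto simp: simple_closed_path_iff)
  have v: "v \<in> verts E" using c1 by auto
  define D where "D w = {p. awalk w p v \<and> (\<forall>e\<in>set p. tail E e \<noteq> v)}" for w
  \<comment> \<open>By uniqueness of \<open>c\<close>, the domain \<open>D (head E e)\<close> of an
    edge \<open>e\<close> leaving \<open>v\<close> is empty unless \<open>e\<close> is the first
    edge of \<open>c\<close>; that edge sends the rest of \<open>c\<close> to the trivial
    path.\<close>
  define \<sigma> where "\<sigma> e p = (if tail E e = v then [] else e # p)" for e and p :: "'e list"
  \<comment> \<open>1 + t is a unit of K[[t]] that differs from 1 by t, so that c - v will act as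
    multiplication by t at the trivial path.\<close>
  define \<omega> :: "'e \<Rightarrow> 'k fps" where "\<omega> e = (if tail E e = v then 1 + fps_X else 1)" for e
  define \<omega>' :: "'e \<Rightarrow> 'k fps" where "\<omega>' e = (if tail E e = v then inverse (1 + fps_X) else 1)" for e
  have closed: "e # p = c" if "e \<in> arcs E" "tail E e = v" "p \<in> D (head E e)" for e p
    using that by (intro unique) (auto simp: simple_closed_path_iff D_def)
  have Dv: "p \<in> D v \<longleftrightarrow> p = []" for p
    using v by (cases p) (auto simp: D_def awalk_simps)
  interpret branching_system E K D \<sigma> \<omega> \<omega>'
  proof
    fix u w x assume "x \<in> D u" "x \<in> D w"
    then show "u = w" by (cases x) (auto simp: D_def awalk_simps)
  next
    fix e assume e: "e \<in> arcs E"
    show "inj_on (\<sigma> e) (D (head E e))"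
      using closed[OF e] by (intro inj_onI) (auto simp: \<sigma>_def split: if_splits)
    show "\<sigma> e x \<in> D (tail E e)" if "x \<in> D (head E e)" for x
      using that e v by (auto simp: \<sigma>_def D_def awalk_simps)
    show "\<omega> e * \<omega>' e = 1"
      using inverse_mult_eq_1[of "1 + fps_X :: 'k fps"] by (simp add: \<omega>_def \<omega>'_def mult.commute)
    fix f x y assume f: "f \<in> arcs E" "x \<in> D (head E e)" "y \<in> D (head E f)" "\<sigma> e x = \<sigma> f y"
    then show "e = f" using closed[OF e] closed[of f y] by (auto simp: \<sigma>_def split: if_splits)
  next
    fix w y assume "y \<in> D w"
    show "\<exists>e\<in>out_arcs E w. \<exists>x\<in>D (head E e). y = \<sigma> e x"
    proof (cases y)
      case Nil
      then have "w = v" using \<open>y \<in> D w\<close> by (simp add: D_def awalk_simps)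
      then show ?thesis using c1 Nil
        by (intro bexI[of _ c1] bexI[of _ c']) (auto simp: \<sigma>_def D_def)
    next
      case (Cons e q)
      then show ?thesis using \<open>y \<in> D w\<close>
        by (intro bexI[of _ e] bexI[of _ q]) (auto simp: \<sigma>_def D_def awalk_simps)
    qed
  qed
  \<comment> \<open>Functions all of whose values are divisible by t^n.\<close>
  define W where "W n = {f :: 'e list \<Rightarrow> 'k fps. \<forall>p. \<forall>k<n. fps_nth (f p) k = 0}" for n
  have mult_low: "fps_nth (a * b) k = 0" if "\<forall>k<n. fps_nth b k = 0" "k < n" for a b :: "'k fps" and k n
    unfolding fps_mult_nth using that by (intro sum.neutral) auto
  have W: "0 \<in> W n" "f \<in> W n \<Longrightarrow> g \<in> W n \<Longrightarrow> f + g \<in> W n" "f \<in> W n \<Longrightarrow> - f \<in> W n"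
    "f \<in> W n \<Longrightarrow> act x f \<in> W n" "f \<in> W n \<Longrightarrow> sc s f \<in> W n"
    for n f g s and x :: "('v, 'e) lpa_gen"
  proof -
    show "0 \<in> W n" "f \<in> W n \<Longrightarrow> g \<in> W n \<Longrightarrow> f + g \<in> W n" "f \<in> W n \<Longrightarrow> - f \<in> W n"
      by (auto simp: W_def)
    show "f \<in> W n \<Longrightarrow> sc s f \<in> W n" by (auto simp: W_def sc_def)
    show "f \<in> W n \<Longrightarrow> act x f \<in> W n"
      using mult_low[where n = n] by (cases x) (auto simp: W_def act.simps(2))
  qed
  define P where "P n = {x \<in> A. \<forall>f. ev x f \<in> W n}" for n
  define P0 where "P0 = {x \<in> A. \<forall>f. ev x f \<in> {0}}"
  have PI: "ideal_above (P n)" for n unfolding P_def by (rule action_ideal_above) (rule W; assumption)+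
  have P0I: "ideal_above P0" unfolding P0_def by (rule action_ideal_above) auto
  have sub: "P n \<subseteq> P m" if "m \<le> n" for m n using that by (auto simp: P_def W_def)
  have W0: "f = 0" if "\<And>n. f \<in> W n" for f
  proof (rule ext, rule fps_ext)
    fix p k show "fps_nth (f p) k = fps_nth (0 p) k" using that[of "Suc k"] by (simp add: W_def)
  qed
  have inter: "(\<Inter>n. P n) \<subseteq> P0" using W0 by (auto simp: P_def P0_def)
  \<comment> \<open>The action commutes with multiplication by power series, so powers of t can be
    pulled out of it.\<close>
  have linear: "ev x (\<lambda>p. s * f p) = (\<lambda>p. s * ev x f p)"
    for x :: "('v, 'e, 'k) lpa_free" and s f
  proof (induction x rule: poly_mapping_single_induct)
    case (single w d)
    have act: "act g (\<lambda>p. s * f p) = (\<lambda>p. s * act g f p)" for g f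
      by (rule ext, cases g) (simp_all add: act.simps(2) mult_ac)
    have "foldr act ws (\<lambda>p. s * f p) = (\<lambda>p. s * foldr act ws f p)" for ws
      by (induction ws) (simp_all add: act)
    then show ?case by (simp only: ev_single word_def) (simp add: sc_def mult_ac)
  qed (simp_all add: fun_eq_iff ev_add_left distrib_left)
  \<comment> \<open>If x f = t^n g, then x f = x (x f) = t^n (x g), which is divisible by t^(n+1)
    since \<open>x\<close> takes only values divisible by t. An idempotent of this kind has values
    divisible by every power of t and acts as zero.\<close>
  have idem: "x \<in> P0" if x: "x \<in> P (Suc 0)" "x * x \<approx> x" for x
  proof -
    have "x * x - x \<in> P0" using x(2) P0I by (auto simp: cong_def ideal_above_def)
    then have xx: "ev x f = ev x (ev x f)" for f by (auto simp: P0_def ev_diff_left ev_mult)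
    have "\<forall>f. ev x f \<in> W (Suc n)" for n :: nat
    proof (induction n)
      case 0
      then show ?case using x(1) by (simp add: P_def)
    next
      case (Suc n)
      show ?case
      proof
        fix f
        define g where "g p = fps_shift (Suc n) (ev x f p)" for p
        have f: "ev x f = (\<lambda>p. fps_X ^ Suc n * g p)"
          unfolding g_def using Suc.IH
          by (intro ext fps_ext) (auto simp: W_def fps_X_power_mult_nth simp del: power_Suc)
        have "ev x (ev x f) = (\<lambda>p. fps_X ^ Suc n * ev x g p)"
          unfolding f by (rule linear)
        then have "ev x f = (\<lambda>p. fps_X ^ Suc n * ev x g p)"
          by (simp only: xx[of f, symmetric])
        moreover have "ev x g \<in> W (Suc 0)" using x(1) by (simp add: P_def)
        ultimately show "ev x f \<in> W (Suc (Suc n))"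
          by (auto simp: W_def fps_X_power_mult_nth simp del: power_Suc)
      qed
    qed
    then have "ev x f \<in> W n" for f n by (cases n) (auto simp: W_def)
    then show ?thesis using W0 x(1) by (auto simp: P_def P0_def)
  qed
  define z where "z = path v c - vtx v"
  have zA: "z \<in> A" unfolding z_def using path_A[OF simple_closed_path_awalk[OF c]] v by auto
  \<comment> \<open>On a path that leaves \<open>v\<close> nowhere all weights are 1, so the value
    at the trivial path is transported unchanged.\<close>
  have edges: "ev (prod_list (map edg q)) f q = f []" if "awalk w q v" "\<forall>e\<in>set q. tail E e \<noteq> v" for w q f
    using that
  proof (induction q arbitrary: w)
    case (Cons e q)
    then have "q \<in> D (head E e)" "e \<in> arcs E" "\<sigma> e q = e # q" "\<omega> e = 1"
      by (auto simp: D_def awalk_simps \<sigma>_def \<omega>_def)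
    then show ?case
      using act_Edge_apply[of e q] Cons.IH[of "head E e"] Cons.prems
      by (auto simp: ev_mult awalk_simps)
  qed simp
  have evz: "ev z f = (\<lambda>p. if p = [] then fps_X * f [] else 0)" for f
  proof
    fix p
    have "ev (path v c) f p = (if p = [] then (1 + fps_X) * f [] else 0)"
    proof (cases "p = []")
      case True
      have "c' \<in> D (head E c1)" using c1 by (simp add: D_def)
      moreover have "\<sigma> c1 c' = []" "\<omega> c1 = 1 + fps_X" using c1(3) by (simp_all add: \<sigma>_def \<omega>_def)
      ultimately have "act (Edge c1) (ev (prod_list (map edg c')) f) [] = (1 + fps_X) * f []"
        using act_Edge_apply[OF c1(2), of c' "ev (prod_list (map edg c')) f"] edges[OF c1(4,5)] by simp
      then show ?thesis using True Dv by (simp add: path_def c1(1) ev_mult)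
    qed (simp add: path_def ev_mult Dv)
    then show "ev z f p = (if p = [] then fps_X * f [] else 0)"
      by (simp add: z_def ev_diff_left Dv algebra_simps)
  qed
  have evzn: "ev (z ^ Suc n) f = (\<lambda>p. if p = [] then fps_X ^ Suc n * f [] else 0)" for n f
  proof (induction n)
    case (Suc n)
    have "ev (z ^ Suc (Suc n)) f = ev z (ev (z ^ Suc n) f)" by (simp only: power_Suc[of z "Suc n"] ev_mult)
    then show ?case unfolding Suc.IH evz by (simp add: mult.assoc cong: if_cong)
  qed (simp add: evz cong: if_cong)
  have znA: "z ^ Suc n \<in> A" for n
    by (induction n) (use zA in \<open>auto simp: A_closed(5)\<close>)
  have "z ^ Suc n \<in> P (Suc n)" for n
    using znA[of n] by (auto simp: P_def W_def evzn fps_X_power_mult_nth simp del: power_Suc)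
  moreover have "z ^ Suc n \<notin> P0" for n
  proof
    assume "z ^ Suc n \<in> P0"
    then have "ev (z ^ Suc n) (\<lambda>_. 1) = 0" by (simp add: P0_def del: power_Suc)
    from fun_cong[OF this[unfolded evzn], of "[]"] show False by simp
  qed
  ultimately show ?thesis
    using PI P0I inter sub zA idem
    by (intro exI[of _ P] exI[of _ P0] exI[of _ z]) simp
qed

lemma power_mem_ideal_list_prod:
  assumes "Ps \<noteq> []" "y \<in> A" "\<And>Q. Q \<in> set Ps \<Longrightarrow> cl y \<in> Q"
  shows "y ^ length Ps \<in> A \<and> cl (y ^ length Ps) \<in> ideal_list_prod L Ps"
  using assms
proof (induction Ps rule: induct_list012)
  case (3 P P' Ps)
  then have IH: "y ^ length (P' # Ps) \<in> A" "cl (y ^ length (P' # Ps)) \<in> ideal_list_prod L (P' # Ps)"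
    by simp_all
  have "cl y \<otimes>\<^bsub>L\<^esub> cl (y ^ length (P' # Ps)) \<in> P \<cdot>\<^bsub>L\<^esub> ideal_list_prod L (P' # Ps)"
    by (rule ideal_prod.prod[OF 3(5) IH(2)]) simp
  moreover have "cl y \<otimes>\<^bsub>L\<^esub> cl (y ^ length (P' # Ps)) = cl (y ^ length (P # P' # Ps))"
    using cl_mult[OF 3(4) IH(1)] by simp
  ultimately show ?case using A_closed(5)[OF A_U[OF 3(4)] IH(1)] by simp
qed auto

text \<open>A strongly prime factor contains the intersection of the filtration, hence one of its
  terms, and with it a power of \<open>z\<close>. As there are finitely many factors, one power of
  \<open>z\<close> lies in all of them and a further power in their product \<open>P0\<close>, which
  contains no positive power of \<open>z\<close>.\<close>

lemma condition_K_if_products: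
  assumes prod: "\<And>I. proper_ideal I L \<Longrightarrow> finite_product_of strongly_prime_ideal I L"
  shows "condition_K E"
proof (rule ccontr)
  assume notK: "\<not> condition_K E"
  obtain P P0 z where *: "(\<forall>n. ideal_above (P n)) \<and> ideal_above P0 \<and> (\<Inter>n. P n) \<subseteq> P0 \<and>
    (\<forall>m n. m \<le> n \<longrightarrow> P n \<subseteq> P m) \<and> z \<in> A \<and> (\<forall>n. z ^ Suc n \<in> P (Suc n)) \<and> (\<forall>n. z ^ Suc n \<notin> P0) \<and>
    (\<forall>x\<in>P (Suc 0). x * x \<approx> x \<longrightarrow> x \<in> P0)"
    using not_condition_K_filtration[OF notK] by (elim exE) (rule that)
  have P: "\<And>n. ideal_above (P n)" and P0: "ideal_above P0" "(\<Inter>n. P n) \<subseteq> P0"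
    and dec: "\<And>m n. m \<le> n \<Longrightarrow> P n \<subseteq> P m" and z: "z \<in> A" "\<And>n. z ^ Suc n \<in> P (Suc n)" "\<And>n. z ^ Suc n \<notin> P0"
    using * by (simp_all del: power_Suc)
  have "cl z \<notin> cl ` P0" using z(1) z(3)[of 0] cl_mem_image_iff[OF P0(1)] by simp
  then have "cl ` P0 \<noteq> carrier L" using cl.hom_closed[of z] z(1) by force
  then have "proper_ideal (cl ` P0) L" using ideal_image[OF P0(1)] by (simp add: proper_ideal_def)
  then have "finite_product_of strongly_prime_ideal (cl ` P0) L" by (rule prod)
  then obtain Ps where "Ps \<noteq> [] \<and> (\<forall>Q\<in>set Ps. strongly_prime_ideal Q L) \<and> cl ` P0 = ideal_list_prod L Ps"
    unfolding finite_product_of_def by (elim exE) (rule that)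
  then have Ps: "Ps \<noteq> []" "\<And>Q. Q \<in> set Ps \<Longrightarrow> strongly_prime_ideal Q L"
    "cl ` P0 = ideal_list_prod L Ps"
    by simp_all
  have "\<exists>n. cl ` P n \<subseteq> Q" if Q: "Q \<in> set Ps" for Q
  proof -
    have sp: "strongly_prime_ideal Q L" by (rule Ps(2)[OF Q])
    have ideals: "two_sided_ideal Q' L" if "Q' \<in> set Ps" for Q'
      using Ps(2)[OF that] by (simp add: strongly_prime_ideal_def proper_ideal_def)
    have sub: "cl ` P0 \<subseteq> Q" unfolding Ps(3) by (rule cl.S.ideal_list_prod_subset[OF ideals Q])
    have "(\<Inter>n. cl ` P n) \<subseteq> cl ` P0"
    proof
      fix X assume X: "X \<in> (\<Inter>n. cl ` P n)"
      then obtain x where x: "x \<in> P 0" "X = cl x" by blast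
      then have xA: "x \<in> A" using ideal_aboveD(1)[OF P] by blast
      have "x \<in> P n" for n using X x(2) cl_mem_image_iff[OF P xA] by auto
      then show "X \<in> cl ` P0" using P0(2) x(2) by blast
    qed
    then have "\<Inter>(range (\<lambda>n. cl ` P n)) \<subseteq> Q" using sub by (rule order_trans)
    moreover have "\<forall>B\<in>range (\<lambda>n. cl ` P n). two_sided_ideal B L" using ideal_image[OF P] by blast
    moreover have "range (\<lambda>n. cl ` P n) \<noteq> {}" by simp
    ultimately have "\<exists>B\<in>range (\<lambda>n. cl ` P n). B \<subseteq> Q"
      using sp unfolding strongly_prime_ideal_def by (elim conjE allE impE) assumption+
    then show ?thesis by blast
  qed
  then obtain n where "\<forall>Q\<in>set Ps. cl ` P (n Q) \<subseteq> Q" using bchoice[of "set Ps" "\<lambda>Q n. cl ` P n \<subseteq> Q"] by blast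
  then have n: "\<And>Q. Q \<in> set Ps \<Longrightarrow> cl ` P (n Q) \<subseteq> Q" by simp
  \<comment> \<open>\<open>Suc M\<close> exceeds every \<open>n Q\<close>. So
    \<open>z ^ Suc M\<close>, which lies in \<open>P (Suc M)\<close>, lies in each
    \<open>P (n Q)\<close> because the filtration is decreasing.\<close>
  define M where "M = Max (insert 0 (n ` set Ps))"
  have "cl (z ^ Suc M) \<in> Q" if "Q \<in> set Ps" for Q
  proof -
    have "n Q \<le> Suc M" using that by (auto simp: M_def intro: le_SucI)
    then have "z ^ Suc M \<in> P (n Q)" using z(2)[of M] dec[of "n Q" "Suc M"] by blast
    then show ?thesis using n[OF that] by blast
  qed
  moreover have "z ^ Suc M \<in> A" using z(2)[of M] ideal_aboveD(1)[OF P] by blast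
  ultimately have **: "(z ^ Suc M) ^ length Ps \<in> A" "cl ((z ^ Suc M) ^ length Ps) \<in> cl ` P0"
    using power_mem_ideal_list_prod[OF Ps(1), of "z ^ Suc M"] Ps(3) by simp_all
  obtain l where l: "Suc M * length Ps = Suc l" using Ps(1) by (cases "length Ps") auto
  have "(z ^ Suc M) ^ length Ps = z ^ Suc l" unfolding l[symmetric] by (simp only: power_mult)
  then show False using z(3)[of l] ** cl_mem_image_iff[OF P0(1) **(1)] by simp
qed

text \<open>The ideal \<open>P (Suc 0)\<close> gives the contradiction. The generators of an I(H,S)
  are idempotents, and idempotents of \<open>P (Suc 0)\<close> lie in \<open>P0\<close>, whereas
  \<open>z\<close> lies in \<open>P (Suc 0)\<close> but not in \<open>P0\<close>.\<close>

lemma condition_K_if_admissible_ideals: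
  assumes adm: "\<And>I. proper_ideal I L \<Longrightarrow> \<exists>H S. admissible_pair E H S \<and> I = admissible_ideal K E H S"
  shows "condition_K E"
proof (rule ccontr)
  assume notK: "\<not> condition_K E"
  obtain P P0 z where *: "(\<forall>n. ideal_above (P n)) \<and> ideal_above P0 \<and> (\<Inter>n. P n) \<subseteq> P0 \<and>
    (\<forall>m n. m \<le> n \<longrightarrow> P n \<subseteq> P m) \<and> z \<in> A \<and> (\<forall>n. z ^ Suc n \<in> P (Suc n)) \<and> (\<forall>n. z ^ Suc n \<notin> P0) \<and>
    (\<forall>x\<in>P (Suc 0). x * x \<approx> x \<longrightarrow> x \<in> P0)"
    using not_condition_K_filtration[OF notK] by (elim exE) (rule that)
  have P: "\<And>n. ideal_above (P n)" and P0: "ideal_above P0"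
    and z: "z \<in> A" "\<And>n. z ^ Suc n \<in> P (Suc n)" "\<And>n. z ^ Suc n \<notin> P0"
    and idem: "\<And>x. x \<in> P (Suc 0) \<Longrightarrow> x * x \<approx> x \<Longrightarrow> x \<in> P0"
    using * by (simp_all del: power_Suc)
  let ?I = "cl ` P (Suc 0)" and ?J = "cl ` P0"
  have I0: "two_sided_ideal ?J L" by (rule ideal_image[OF P0])
  have zI0: "cl z \<notin> ?J" using z(1) z(3)[of 0] cl_mem_image_iff[OF P0] by simp
  have vert: "cl (vtx v) \<in> ?J" if "v \<in> verts E" "cl (vtx v) \<in> ?I" for v
    using that idem[of "vtx v"] vtx_idem cl_mem_image_iff[OF P, of "vtx v"] by auto
  \<comment> \<open>If \<open>P (Suc 0)\<close> were everything, all vertices, being idempotent,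
    would lie in \<open>P0\<close>, which would then contain \<open>z\<close> too.\<close>
  have "proper_ideal ?I L"
  proof -
    have "?I \<noteq> carrier L"
    proof
      assume all: "?I = carrier L"
      have "cl (vtx v) \<in> ?J" if "v \<in> verts E" for v
        using that vert all by auto
      then have "gr_vertices K E ?J = verts E" by (auto simp: gr_vertices_def)
      then have "\<not> proper_ideal ?J L" using proper_ideal_gr by blast
      then have "?J = carrier L" using I0 by (simp add: proper_ideal_def)
      then show False using zI0 z(1) by auto
    qed
    then show ?thesis using ideal_image[OF P] by (simp add: proper_ideal_def)
  qed
  then obtain H S where HS: "admissible_pair E H S" "?I = admissible_ideal K E H S" using adm by blast
  have "admissible_ideal K E H S \<subseteq> ?J"
  proof (rule admissible_ideal_least[OF I0])
    fix v assume "v \<in> H"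
    then show "cl (vtx v) \<in> ?J"
      using HS admissible_ideal_ideal(2)[OF HS(1)]
      by (intro vert) (auto simp: admissible_pair_def hereditary_def)
  next
    fix v assume v: "v \<in> S"
    let ?b = "brk v {e \<in> out_arcs E v. head E e \<notin> H}"
    have vb: "v \<in> breaking_vertices E H" using v HS(1) by (auto simp: admissible_pair_def)
    have "cl ?b \<in> ?I" unfolding HS(2) using admissible_ideal_ideal(3)[OF HS(1) v] by (simp add: breaking_element_eq)
    then have "?b \<in> P (Suc 0)" using cl_mem_image_iff[OF P breaking_element_closed[OF vb]] by simp
    then have "?b \<in> P0" using breaking_idem[OF vb] by (rule idem)
    then show "breaking_element K E H v \<in> ?J" by (simp add: breaking_element_eq)
  qed
  moreover have "cl z \<in> ?I" using z(2)[of 0] by simp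
  ultimately show False using zI0 HS(2) by blast
qed

end

section \<open>The countable separation property\<close>

text \<open>A single vertex of this kind replaces the countable set of the strong CSP: its existence
  is equivalent to the strong CSP and, under Condition (K), to the existence of a least nonzero
  ideal.\<close>

definition core_vertex :: "('v, 'e) pre_digraph \<Rightarrow> 'v \<Rightarrow> bool" where
  "core_vertex G u \<longleftrightarrow>
     u \<in> verts G \<and> (\<forall>H. H \<noteq> {} \<and> hereditary G H \<and> saturated G H \<longrightarrow> u \<in> H)"

context wf_digraph
begin

lemma step_reachable: "e \<in> arcs G \<Longrightarrow> tail G e \<rightarrow>\<^sup>* head G e"
  by (intro reachable_adjI) (auto simp: dominatesI arc_to_ends_def)

lemma hereditary_iff:
  "hereditary G H \<longleftrightarrow> H \<subseteq> verts G \<and> (\<forall>e\<in>arcs G. tail G e \<in> H \<longrightarrow> head G e \<in> H)"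
proof
  show "hereditary G H \<Longrightarrow> H \<subseteq> verts G \<and> (\<forall>e\<in>arcs G. tail G e \<in> H \<longrightarrow> head G e \<in> H)"
    using step_reachable by (auto simp: hereditary_def)
next
  assume H: "H \<subseteq> verts G \<and> (\<forall>e\<in>arcs G. tail G e \<in> H \<longrightarrow> head G e \<in> H)"
  have "w \<in> H" if "v \<rightarrow>\<^sup>* w" "v \<in> H" for v w
    using that
  proof (induction rule: reachable_induct)
    case (step x y)
    then show ?case using H by (auto simp: arcs_ends_def arc_to_ends_def)
  qed
  then show "hereditary G H" using H by (auto simp: hereditary_def)
qed

lemma core_vertex_reachable:
  assumes "core_vertex G u" "u \<rightarrow>\<^sup>* w"
  shows "core_vertex G w"
  unfolding core_vertex_def
proof (intro conjI allI impI)
  show "w \<in> verts G" by (rule reachable_in_verts(2)[OF assms(2)])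
  fix H assume H: "H \<noteq> {} \<and> hereditary G H \<and> saturated G H"
  then have "u \<in> H" using assms(1) by (simp add: core_vertex_def)
  then show "w \<in> H" using H assms(2) by (simp add: hereditary_def)
qed

text \<open>The hereditary saturated closure of a vertex \<open>v\<close>. Beyond the descendants of
  \<open>v\<close> only regular vertices are added, and this is why a descendant of \<open>v\<close>
  can be reached from any member along edges that leave regular vertices.\<close>

inductive_set saturation :: "'a \<Rightarrow> 'a set" for v where
  base: "v \<rightarrow>\<^sup>* w \<Longrightarrow> w \<in> saturation v"
| step: "regular_vertex G x \<Longrightarrow> \<forall>e\<in>out_arcs G x. head G e \<in> saturation v \<Longrightarrow> x \<in> saturation v"

lemma saturation_hereditary: "hereditary G (saturation v)"
proof -
  have "x \<in> verts G \<and> (\<forall>e\<in>arcs G. tail G e = x \<longrightarrow> head G e \<in> saturation v)" if "x \<in> saturation v" for x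
    using that
  proof (induction rule: saturation.induct)
    case (base w)
    then show ?case
      using reachable_in_verts(2)[OF base] step_reachable reachable_trans[OF base] by (auto intro: saturation.base)
  next
    case (step x)
    then show ?case by (auto simp: regular_vertex_def)
  qed
  then show ?thesis unfolding hereditary_iff by blast
qed

lemma saturation_saturated: "saturated G (saturation v)"
  unfolding saturated_def by (auto intro: saturation.step)

definition regular_steps :: "('a \<times> 'a) set" where
  "regular_steps = {(tail G e, head G e) | e. e \<in> arcs G \<and> regular_vertex G (tail G e)}"

lemma saturation_reaches:
  "x \<in> saturation v \<Longrightarrow> \<exists>w. (x, w) \<in> regular_steps\<^sup>* \<and> v \<rightarrow>\<^sup>* w"
proof (induction rule: saturation.induct)
  case (step x)
  have "out_arcs G x \<noteq> {}" using step.hyps(1) by (simp add: regular_vertex_def)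
  then obtain e where e: "e \<in> out_arcs G x" unfolding ex_in_conv[symmetric] by (elim exE)
  then have "\<exists>w. (head G e, w) \<in> regular_steps\<^sup>* \<and> v \<rightarrow>\<^sup>* w" using step.IH by simp
  then obtain w where "(head G e, w) \<in> regular_steps\<^sup>*" "v \<rightarrow>\<^sup>* w" by (elim exE conjE)
  moreover have "(x, head G e) \<in> regular_steps"
    using e step.hyps(1) unfolding regular_steps_def by (intro CollectI exI[of _ e]) simp
  ultimately show ?case using converse_rtrancl_into_rtrancl[of x "head G e" regular_steps w] by auto
next
  case (base w)
  then show ?case by (intro exI[of _ w]) simp
qed

lemma regular_steps_reachable: "(x, w) \<in> regular_steps\<^sup>* \<Longrightarrow> x \<in> verts G \<Longrightarrow> x \<rightarrow>\<^sup>* w"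
proof (induction rule: rtrancl_induct)
  case (step y z)
  then obtain e where "e \<in> arcs G" "y = tail G e" "z = head G e" by (auto simp: regular_steps_def)
  then show ?case using step_reachable[of e] reachable_trans[OF step.IH[OF step.prems], of z] by simp
qed simp

text \<open>A core vertex lies in the hereditary saturated closure of every \<open>v\<close>, to
  which \<open>saturation_reaches\<close> applies.\<close>

lemma core_vertex_regular_steps:
  assumes "core_vertex G u" "v \<in> verts G"
  shows "\<exists>w. (u, w) \<in> regular_steps\<^sup>* \<and> v \<rightarrow>\<^sup>* w"
proof -
  have "v \<in> saturation v" using assms(2) by (intro saturation.base) simp
  then have "saturation v \<noteq> {} \<and> hereditary G (saturation v) \<and> saturated G (saturation v)"
    using saturation_hereditary saturation_saturated by (intro conjI) (erule ex_in_conv[THEN iffD1, OF exI])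
  then have "u \<in> saturation v"
    using assms(1) unfolding core_vertex_def by (elim conjE allE impE) simp_all
  then show ?thesis by (rule saturation_reaches)
qed

lemma strong_CSP_iff: "(\<exists>C. strong_CSP G C) \<longleftrightarrow> (\<exists>u. core_vertex G u)"
proof
  assume "\<exists>C. strong_CSP G C"
  then obtain C where C: "strong_CSP G C" by (elim exE)
  then obtain u where u: "u \<in> C" by (auto simp: strong_CSP_def)
  have "core_vertex G u"
    unfolding core_vertex_def using C u by (auto simp: strong_CSP_def)
  then show "\<exists>u. core_vertex G u" by (rule exI)
next
  assume "\<exists>u. core_vertex G u"
  then obtain u where u: "core_vertex G u" by (elim exE)
  define C where "C = regular_steps\<^sup>* `` {u}"
  have uv: "u \<in> verts G" using u by (simp add: core_vertex_def)
  have C: "core_vertex G w" if "w \<in> C" for w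
    using that regular_steps_reachable[OF _ uv] core_vertex_reachable[OF u] by (simp add: C_def)
  have "countable (regular_steps `` Y)" if "countable Y" for Y
  proof -
    \<comment> \<open>Only regular vertices have successors here, and they emit finitely many
      edges.\<close>
    have "finite (regular_steps `` {y})" for y
    proof -
      have "regular_steps `` {y} \<subseteq> (if finite (out_arcs G y) then head G ` out_arcs G y else {})"
        by (auto simp: regular_steps_def regular_vertex_def)
      then show ?thesis by (rule finite_subset) simp
    qed
    then have "countable (\<Union>y\<in>Y. regular_steps `` {y})"
      using that by (intro countable_UN) (auto intro: countable_finite)
    then show ?thesis by (simp add: Image_eq_UN[symmetric])
  qed
  then have "countable C" unfolding C_def by (intro countable_rtrancl) simp_all
  moreover have "\<exists>w\<in>C. v \<rightarrow>\<^sup>* w" if "v \<in> verts G" for v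
    using core_vertex_regular_steps[OF u that] by (auto simp: C_def)
  moreover have "u \<in> C" by (simp add: C_def)
  ultimately have "strong_CSP G C"
    using C by (auto simp: strong_CSP_def core_vertex_def)
  then show "\<exists>C. strong_CSP G C" by (rule exI)
qed

text \<open>\<open>core_vertex_regular_steps\<close> is used twice. It first gives a descendant
  \<open>w1\<close> of \<open>u\<close> below \<open>v1\<close>; as \<open>w1\<close> is again a
  core vertex, it then gives a descendant \<open>w2\<close> of \<open>w1\<close> below
  \<open>v2\<close>, which lies below both.\<close>

lemma core_vertex_downward_directed:
  assumes u: "core_vertex G u"
  shows "downward_directed G (verts G)"
  unfolding downward_directed_def
proof (intro ballI)
  fix v1 v2 assume v: "v1 \<in> verts G" "v2 \<in> verts G"
  have uv: "u \<in> verts G" using u by (simp add: core_vertex_def)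
  obtain w1 where w1: "(u, w1) \<in> regular_steps\<^sup>*" "v1 \<rightarrow>\<^sup>* w1"
    using core_vertex_regular_steps[OF u v(1)] by (elim exE conjE)
  have c1: "core_vertex G w1"
    by (rule core_vertex_reachable[OF u regular_steps_reachable[OF w1(1) uv]])
  obtain w2 where w2: "(w1, w2) \<in> regular_steps\<^sup>*" "v2 \<rightarrow>\<^sup>* w2"
    using core_vertex_regular_steps[OF c1 v(2)] by (elim exE conjE)
  have "w1 \<rightarrow>\<^sup>* w2" using regular_steps_reachable[OF w2(1)] c1 by (simp add: core_vertex_def)
  then show "\<exists>w\<in>verts G. v1 \<rightarrow>\<^sup>* w \<and> v2 \<rightarrow>\<^sup>* w"
    using w2(2) reachable_trans[OF w1(2)] reachable_in_verts(2)[OF w2(2)] by (intro bexI[of _ w2]) simp_all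
qed

lemma reachable_induced: "v \<rightarrow>\<^sup>*\<^bsub>G \<restriction> M\<^esub> w \<Longrightarrow> M \<subseteq> verts G \<Longrightarrow> v \<rightarrow>\<^sup>* w"
  using subgraph_induce_subgraphI by (auto intro: reachable_mono)

end

section \<open>Core vertices of quotient graphs and of tails\<close>

context admissible
begin

abbreviation tail_graph :: "('v, 'e) pre_digraph" where
  "tail_graph \<equiv> E \<restriction> (verts E - H)"

lemma out_arcs_tail_graph:
  "v \<in> verts E - H \<Longrightarrow> out_arcs tail_graph v = {e \<in> out_arcs E v. head E e \<notin> H}"
  by (auto simp: out_arcs_def)

lemma out_arcs_Inl:
  "out_arcs F (Inl v) = Inl ` {e \<in> out_arcs E v. head E e \<notin> H} \<union> Inr ` {e \<in> out_arcs E v. head E e \<in> B - S}"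
  by (auto simp: out_arcs_def F_simps)

text \<open>Primes are forgotten. A hereditary saturated set of the tail graph becomes one of
  \<open>F\<close> when the primed copies of its members are added: primed vertices are sinks, and
  if \<open>Inl v\<close> is regular in \<open>F\<close>, then so is \<open>v\<close> in the tail
  graph, where it emits the kept edges.\<close>

lemma quotient_core_imp_tail_core:
  assumes x: "core_vertex F x"
  shows "\<exists>u. core_vertex tail_graph u"
proof -
  interpret T: wf_digraph tail_graph by (rule wellformed_induce_subgraph)
  define u where "u = (case x of Inl v \<Rightarrow> v | Inr v \<Rightarrow> v)"
  have u: "u \<in> verts E - H"
    using x B_D by (auto simp: core_vertex_def u_def F_simps)
  have "u \<in> J" if J: "J \<noteq> {}" "hereditary tail_graph J" "saturated tail_graph J" for J
  proof -
    define J' where "J' = Inl ` J \<union> Inr ` (J \<inter> (B - S))"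
    have JM: "J \<subseteq> verts E - H" "\<And>e. e \<in> arcs E \<Longrightarrow> tail E e \<in> J \<Longrightarrow> head E e \<notin> H \<Longrightarrow> head E e \<in> J"
      using J(2) unfolding T.hereditary_iff by auto
    have "hereditary F J'"
      unfolding F.hereditary_iff using JM B_D(2) by (auto simp: J'_def F_simps)
    moreover have "saturated F J'"
      unfolding saturated_def
    proof (intro allI impI)
      fix y assume y: "regular_vertex F y \<and> head F ` out_arcs F y \<subseteq> J'"
      have "out_arcs F (Inr w) = {}" for w by (auto simp: out_arcs_def F_simps)
      then obtain v where v: "y = Inl v" using y by (cases y) (auto simp: regular_vertex_def)
      let ?T = "{e \<in> out_arcs E v. head E e \<notin> H}"
      have vM: "v \<in> verts E - H" using y by (auto simp: v regular_vertex_def F_simps)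
      have "finite (Inl ` ?T :: ('e + 'e) set)"
        using y by (auto simp: v regular_vertex_def out_arcs_Inl)
      then have "finite ?T" by (rule finite_imageD) simp
      moreover have "?T \<noteq> {}"
        using y B_D(2) by (auto simp: v regular_vertex_def out_arcs_Inl)
      moreover have "head E ` ?T \<subseteq> J"
      proof
        fix w assume "w \<in> head E ` ?T"
        then obtain e where e: "e \<in> ?T" "w = head E e" by blast
        then have "Inl e \<in> out_arcs F y" by (simp add: v out_arcs_Inl)
        then have "head F (Inl e) \<in> J'" using y by blast
        then show "w \<in> J" using e(2) by (auto simp: J'_def F_simps)
      qed
      ultimately have "v \<in> J"
        using J(3) vM out_arcs_tail_graph[OF vM] unfolding saturated_def regular_vertex_def by simp
      then show "y \<in> J'" by (simp add: J'_def v)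
    qed
    moreover have "J' \<noteq> {}" using J(1) by (simp add: J'_def)
    ultimately have "x \<in> J'" using x by (simp add: core_vertex_def)
    then show ?thesis by (auto simp: J'_def u_def)
  qed
  then show ?thesis using u by (auto simp: core_vertex_def)
qed

text \<open>With \<open>S = B\<close> no vertex is split, and \<open>F\<close> is a copy of the tail
  graph.\<close>

lemma tail_core_imp_quotient_core:
  assumes u: "core_vertex tail_graph u" and S: "S = B"
  shows "core_vertex F (Inl u)"
proof -
  interpret T: wf_digraph tail_graph by (rule wellformed_induce_subgraph)
  have uF: "Inl u \<in> verts F" using u by (simp add: core_vertex_def F_simps)
  have out: "out_arcs F (Inl v) = Inl ` {e \<in> out_arcs E v. head E e \<notin> H}" for v
    unfolding out_arcs_Inl using S by simp
  have "Inl u \<in> J" if J: "J \<noteq> {}" "hereditary F J" "saturated F J" for J :: "('v + 'v) set"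
  proof -
    define J' where "J' = {v. Inl v \<in> J}"
    have "verts F = Inl ` (verts E - H)" unfolding F_simps using S by simp
    then have JF: "J \<subseteq> Inl ` (verts E - H)" "\<And>e. e \<in> arcs F \<Longrightarrow> tail F e \<in> J \<Longrightarrow> head F e \<in> J"
      using J(2) unfolding F.hereditary_iff by simp_all
    have step: "head E e \<in> J'" if "e \<in> arcs E" "tail E e \<in> J'" "head E e \<notin> H" for e
      using that JF(2)[of "Inl e"] by (simp add: J'_def F_simps)
    have "J' \<noteq> {}" using J(1) JF(1) by (auto simp: J'_def)
    moreover have "hereditary tail_graph J'"
      unfolding T.hereditary_iff using step JF(1) by (auto simp: J'_def)
    moreover have "saturated tail_graph J'"
      unfolding saturated_def
    proof (intro allI impI)
      fix v assume v: "regular_vertex tail_graph v \<and> head tail_graph ` out_arcs tail_graph v \<subseteq> J'"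
      let ?T = "{e \<in> out_arcs E v. head E e \<notin> H}"
      have vM: "v \<in> verts E - H" using v by (simp add: regular_vertex_def)
      have "?T \<noteq> {}" "finite ?T" "head E ` ?T \<subseteq> J'"
        using v out_arcs_tail_graph[OF vM] by (simp_all add: regular_vertex_def)
      then have "regular_vertex F (Inl v)" "head F ` out_arcs F (Inl v) \<subseteq> J"
        using vM by (auto simp: regular_vertex_def out F_simps J'_def)
      then show "v \<in> J'" using J(3) by (simp add: saturated_def J'_def)
    qed
    ultimately have "u \<in> J'" using u by (simp add: core_vertex_def)
    then show ?thesis by (simp add: J'_def)
  qed
  then show ?thesis using uF by (simp add: core_vertex_def)
qed

end

text \<open>Conditions (ii) and (iii) of a maximal tail, read for the complement, give heredity and
  saturation.\<close>

lemma (in wf_digraph) maximal_tail_complement: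
  assumes "maximal_tail G M"
  shows "hereditary G (verts G - M)" "saturated G (verts G - M)"
proof -
  have M: "M \<subseteq> verts G" "\<And>u v. u \<in> M \<Longrightarrow> v \<rightarrow>\<^sup>* u \<Longrightarrow> v \<in> M"
    "\<And>u. u \<in> M \<Longrightarrow> out_arcs G u \<noteq> {} \<Longrightarrow> \<exists>e\<in>out_arcs G u. head G e \<in> M"
    using assms reachable_in_verts(1) unfolding maximal_tail_def by auto
  show "hereditary G (verts G - M)"
    unfolding hereditary_iff using M(2) step_reachable by auto
  show "saturated G (verts G - M)"
    unfolding saturated_def regular_vertex_def using M(3) by blast
qed

context lpa
begin

lemma cl_vtx_nonzero: "v \<in> verts E \<Longrightarrow> cl (vtx v) \<noteq> \<zero>\<^bsub>L\<^esub>"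
  using vtx_notin_N cl_zero_iff by auto

lemma core_vertex_in_nonzero_ideal:
  assumes K: "condition_K E" and u: "core_vertex E u"
    and I: "two_sided_ideal I L" "I \<noteq> {\<zero>\<^bsub>L\<^esub>}"
  shows "cl (vtx u) \<in> I"
proof -
  have "u \<in> gr_vertices K E I"
    using u nonzero_ideal_vertex[OF K I] gr_admissible[OF I(1)]
    unfolding core_vertex_def admissible_pair_def by simp
  then show ?thesis by (simp add: gr_vertices_def)
qed

text \<open>The vertices of a nonzero ideal form a nonempty hereditary saturated set, so a core
  vertex lies in all nonzero ideals. Conversely, a vertex of the least nonzero ideal lies in I(M,
  {}) for every nonempty hereditary saturated \<open>M\<close>, and the vertices of that ideal are
  exactly those of \<open>M\<close>.\<close>

lemma strongly_prime_zero_iff: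
  assumes K: "condition_K E"
  shows "cl.S.strongly_prime_over {\<zero>\<^bsub>L\<^esub>} \<longleftrightarrow> (\<exists>u. core_vertex E u)"
proof
  assume "\<exists>u. core_vertex E u"
  then obtain u where u: "core_vertex E u" by (elim exE)
  define \<A> where "\<A> = {A. two_sided_ideal A L \<and> {\<zero>\<^bsub>L\<^esub>} \<subset> A}"
  have uv: "u \<in> verts E" using u by (simp add: core_vertex_def)
  have uA: "cl (vtx u) \<in> B" if "B \<in> \<A>" for B
    using that core_vertex_in_nonzero_ideal[OF K u, of B] by (auto simp: \<A>_def)
  have "cl (vtx u) \<in> carrier L" using uv by simp
  then have "carrier L \<in> \<A>"
    using cl_vtx_nonzero[OF uv] cl.S.ideal_carrier by (auto simp: \<A>_def)
  then have J: "two_sided_ideal (\<Inter>\<A>) L"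
    by (intro cl.S.ideal_Inter) (auto simp: \<A>_def)
  have "cl (vtx u) \<in> \<Inter>\<A>" using uA by (rule InterI)
  moreover have "\<zero>\<^bsub>L\<^esub> \<in> \<Inter>\<A>" using cl.S.idealD(2)[OF J] .
  ultimately have "{\<zero>\<^bsub>L\<^esub>} \<subset> \<Inter>\<A>" using cl_vtx_nonzero[OF uv] by auto
  moreover have "\<forall>B. two_sided_ideal B L \<and> {\<zero>\<^bsub>L\<^esub>} \<subset> B \<longrightarrow> \<Inter>\<A> \<subseteq> B"
    by (auto simp: \<A>_def)
  ultimately show "cl.S.strongly_prime_over {\<zero>\<^bsub>L\<^esub>}"
    unfolding cl.S.strongly_prime_over_def using cl.S.ideal_zero J by (intro conjI exI[of _ "\<Inter>\<A>"])
next
  assume "cl.S.strongly_prime_over {\<zero>\<^bsub>L\<^esub>}"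
  then obtain J where J: "two_sided_ideal J L" "{\<zero>\<^bsub>L\<^esub>} \<subset> J"
    "\<forall>B. two_sided_ideal B L \<and> {\<zero>\<^bsub>L\<^esub>} \<subset> B \<longrightarrow> J \<subseteq> B"
    by (rule cl.S.strongly_prime_overE)
  then have "gr_vertices K E J \<noteq> {}" by (intro nonzero_ideal_vertex[OF K]) auto
  then obtain u where u: "u \<in> gr_vertices K E J" by auto
  have "u \<in> M" if M: "M \<noteq> {}" "hereditary E M" "saturated E M" for M
  proof -
    have adm: "admissible_pair E M {}" using M by (simp add: admissible_pair_def)
    interpret adm: admissible E K M "{}" by unfold_locales (rule adm)
    let ?I = "admissible_ideal K E M {}"
    obtain v where v: "v \<in> M" using M(1) by auto
    then have "cl (vtx v) \<in> ?I" "cl (vtx v) \<noteq> \<zero>\<^bsub>L\<^esub>"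
      using admissible_ideal_ideal(2)[OF adm] cl_vtx_nonzero M(2) by (auto simp: hereditary_def)
    moreover have "\<zero>\<^bsub>L\<^esub> \<in> ?I" by (rule cl.S.idealD(2)[OF admissible_ideal_ideal(1)[OF adm]])
    ultimately have "{\<zero>\<^bsub>L\<^esub>} \<subset> ?I" by auto
    then have "J \<subseteq> ?I" using J(3) admissible_ideal_ideal(1)[OF adm] by simp
    then have "u \<in> gr_vertices K E ?I" using u by (auto simp: gr_vertices_def)
    then show ?thesis using adm.gr_admissible_ideal(1)[OF K] by simp
  qed
  then have "core_vertex E u" using u by (auto simp: core_vertex_def gr_vertices_def)
  then show "\<exists>u. core_vertex E u" by (rule exI)
qed

lemma gr_admissible_locale:
  "two_sided_ideal P L \<Longrightarrow> admissible E (gr_vertices K E P) (gr_breaking K E P)"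
  by unfold_locales (rule gr_admissible)

lemma strongly_prime_over_iff:
  assumes K: "condition_K E" and P: "two_sided_ideal P L"
  shows "cl.S.strongly_prime_over P \<longleftrightarrow>
    (\<exists>u. core_vertex (quotient_graph E (gr_vertices K E P) (gr_breaking K E P)) u)"
proof -
  interpret Q: admissible E K "gr_vertices K E P" "gr_breaking K E P" by (rule gr_admissible_locale[OF P])
  have "P = Q.\<Theta>.preimage {\<zero>\<^bsub>Q.F.L\<^esub>}"
    using Q.\<Theta>_kernel[OF K] ideal_eq_admissible_ideal[OF K P] by simp
  then show ?thesis
    using Q.\<Theta>.strongly_prime_over_preimage_iff[OF Q.F.cl.S.ideal_zero]
      Q.F.strongly_prime_zero_iff[OF Q.condition_K_quotient[OF K]] by simp
qed

text \<open>A core vertex of the quotient graph gives an idempotent of L/P that lies in every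
  nonzero ideal, and \<open>faithful_simple_module_exists\<close> applies. Since primitivity refers
  to \<open>L Quot P\<close>, the vertex is first lifted along \<open>\<Theta>\<close> to L.\<close>

lemma strongly_prime_over_imp_primitive:
  assumes K: "condition_K E" and spo: "cl.S.strongly_prime_over P"
  shows "primitive_ideal P L"
proof -
  have P: "two_sided_ideal P L" by (rule cl.S.strongly_prime_over_ideal[OF spo])
  interpret Q: admissible E K "gr_vertices K E P" "gr_breaking K E P" by (rule gr_admissible_locale[OF P])
  interpret \<pi>: surjective_hom "leavitt_path_algebra K E" "leavitt_path_algebra K E Quot P"
      "\<lambda>x. P +>\<^bsub>leavitt_path_algebra K E\<^esub> x"
    by (rule cl.S.surjective_hom_Quot[OF P])
  have add: "additive_subgroup P L" using P by (simp add: two_sided_ideal_def)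
  have ker: "Q.\<Theta>.preimage {\<zero>\<^bsub>Q.F.L\<^esub>} = P"
    using Q.\<Theta>_kernel[OF K] ideal_eq_admissible_ideal[OF K P] by simp
  have mem: "x \<in> P \<longleftrightarrow> Q.\<Theta> x = \<zero>\<^bsub>Q.F.L\<^esub>" if "x \<in> carrier L" for x
  proof -
    have "x \<in> P \<longleftrightarrow> x \<in> Q.\<Theta>.preimage {\<zero>\<^bsub>Q.F.L\<^esub>}" by (simp only: ker)
    then show ?thesis using that by (simp only: Q.\<Theta>.preimage_def mem_Collect_eq singleton_iff simp_thms)
  qed
  have KF: "condition_K Q.F" by (rule Q.condition_K_quotient[OF K])
  obtain u where u: "core_vertex Q.F u" using strongly_prime_over_iff[OF K P] spo by auto
  have uv: "u \<in> verts Q.F" using u by (simp add: core_vertex_def)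
  have "Q.F.cl (vtx u) \<in> Q.\<Theta> ` carrier L" unfolding Q.\<Theta>.image using uv by simp
  then obtain y where y: "y \<in> carrier L" "Q.\<Theta> y = Q.F.cl (vtx u)" by auto
  let ?R = "L Quot P" and ?e = "P +>\<^bsub>L\<^esub> y"
  have zero: "\<zero>\<^bsub>?R\<^esub> = P" by (simp add: FactRing_def)
  have idem: "Q.\<Theta> (y \<otimes>\<^bsub>L\<^esub> y) = Q.\<Theta> y"
    using Q.F.cl_mult[of "vtx u" "vtx u"] Q.F.vtx_idem[OF uv] uv y
    by (simp add: Q.\<Theta>.hom_mult Q.F.cl_eq_iff Q.F.A_closed(5))
  have yy: "y \<otimes>\<^bsub>L\<^esub> y \<in> carrier L" by (rule cl.S.m_closed[OF y(1) y(1)])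
  have "Q.\<Theta> (y \<otimes>\<^bsub>L\<^esub> y \<oplus>\<^bsub>L\<^esub> \<ominus>\<^bsub>L\<^esub> y) = \<zero>\<^bsub>Q.F.L\<^esub>"
    using y(1) yy by (simp add: Q.\<Theta>.hom_add Q.\<Theta>.hom_minus idem Q.F.cl.S.r_neg)
  then have "y \<otimes>\<^bsub>L\<^esub> y \<oplus>\<^bsub>L\<^esub> \<ominus>\<^bsub>L\<^esub> y \<in> P"
    using y(1) yy by (subst mem) simp_all
  then have "P +>\<^bsub>L\<^esub> (y \<otimes>\<^bsub>L\<^esub> y) = ?e" unfolding cl.S.coset_eq_iff[OF add yy y(1)] .
  then have "?e \<otimes>\<^bsub>?R\<^esub> ?e = ?e" by (simp only: \<pi>.hom_mult[OF y(1) y(1)])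
  moreover have "?e \<noteq> \<zero>\<^bsub>?R\<^esub>"
    unfolding zero cl.S.coset_eq_self_iff[OF add y(1)] mem[OF y(1)]
    using Q.F.cl_vtx_nonzero[OF uv] y(2) by simp
  moreover have "?e \<in> B" if B: "two_sided_ideal B ?R" "B \<noteq> {\<zero>\<^bsub>?R\<^esub>}" for B
  proof -
    have I: "two_sided_ideal (\<pi>.preimage B) L" by (rule \<pi>.preimage_ideal[OF B(1)])
    have "\<zero>\<^bsub>?R\<^esub> \<in> B" by (rule \<pi>.S.idealD(2)[OF B(1)])
    then have PB: "P \<in> B" by (simp only: zero)
    have PI: "P \<subseteq> \<pi>.preimage B"
    proof
      fix x assume x: "x \<in> P"
      then have xL: "x \<in> carrier L" using cl.S.idealD(1)[OF P] by auto
      then have "P +>\<^bsub>L\<^esub> x = P" using x cl.S.coset_eq_self_iff[OF add] by simp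
      then show "x \<in> \<pi>.preimage B" using PB xL by (simp add: \<pi>.preimage_def)
    qed
    obtain b where b: "b \<in> B" "b \<noteq> \<zero>\<^bsub>?R\<^esub>" using B(2) PB unfolding zero by blast
    then have "b \<in> carrier ?R" using \<pi>.S.idealD(1)[OF B(1)] by auto
    then obtain x where x: "x \<in> carrier L" "b = P +>\<^bsub>L\<^esub> x" unfolding \<pi>.image[symmetric] by auto
    have xP: "x \<notin> P" using b(2) x cl.S.coset_eq_self_iff[OF add x(1)] zero by simp
    have I': "two_sided_ideal (Q.\<Theta> ` \<pi>.preimage B) Q.F.L" by (rule Q.\<Theta>.image_ideal[OF I])
    have "x \<in> \<pi>.preimage B" using x b(1) by (simp add: \<pi>.preimage_def)
    moreover have "Q.\<Theta> x \<noteq> \<zero>\<^bsub>Q.F.L\<^esub>" using xP mem[OF x(1)] by simp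
    ultimately have "Q.\<Theta> ` \<pi>.preimage B \<noteq> {\<zero>\<^bsub>Q.F.L\<^esub>}" by auto
    then have "Q.F.cl (vtx u) \<in> Q.\<Theta> ` \<pi>.preimage B"
      by (rule Q.F.core_vertex_in_nonzero_ideal[OF KF u I'])
    then have "y \<in> Q.\<Theta>.preimage (Q.\<Theta> ` \<pi>.preimage B)" using y by (simp add: Q.\<Theta>.preimage_def)
    then have "y \<in> \<pi>.preimage B" using Q.\<Theta>.preimage_image[OF I] PI ker by simp
    then show ?thesis by (simp add: \<pi>.preimage_def)
  qed
  ultimately have "\<exists>(M :: ('v, 'e, 'k) lpa_free set set set ring) act.
      simple_right_module ?R M act \<and> faithful_right_module ?R M act"
    by (intro \<pi>.S.faithful_simple_module_exists[of ?e] \<pi>.hom_closed y(1))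
  then show ?thesis using P by (simp add: primitive_ideal_def)
qed

section \<open>Graded ideals\<close>

definition homog :: "int \<Rightarrow> ('v, 'e, 'k) lpa_free set" where
  "homog n = {x. \<forall>w\<in>Poly_Mapping.keys x. sum_list (map lpa_gen_degree (letters w)) = n}"

lemma homog_closed:
  "0 \<in> homog n" "x \<in> homog n \<Longrightarrow> y \<in> homog n \<Longrightarrow> x + y \<in> homog n" "x \<in> homog n \<Longrightarrow> - x \<in> homog n"
  "x \<in> homog m \<Longrightarrow> y \<in> homog n \<Longrightarrow> x * y \<in> homog (m + n)"
  "generator g \<in> homog (lpa_gen_degree g)" "Poly_Mapping.single 0 c \<in> homog 0"
proof -
  show "x \<in> homog n \<Longrightarrow> y \<in> homog n \<Longrightarrow> x + y \<in> homog n"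
    unfolding homog_def using Poly_Mapping.keys_add[of x y] by blast
  show "x * y \<in> homog (m + n)" if "x \<in> homog m" "y \<in> homog n"
    unfolding homog_def
  proof (intro CollectI ballI)
    fix w assume "w \<in> Poly_Mapping.keys (x * y)"
    then obtain a b where "w = a + b" "a \<in> Poly_Mapping.keys x" "b \<in> Poly_Mapping.keys y"
      using keys_mult[of x y] by blast
    then show "sum_list (map lpa_gen_degree (letters w)) = m + n"
      using that by (simp add: letters_plus homog_def)
  qed
qed (auto simp: homog_def generator_def in_keys_iff lookup_single when_def letters_zero split: if_splits)

lemma homog_sum: "(\<And>i. i \<in> S \<Longrightarrow> f i \<in> homog n) \<Longrightarrow> sum f S \<in> homog n"
  by (induction S rule: infinite_finite_induct) (auto intro: homog_closed)

text \<open>The elements congruent to a finite sum of homogeneous elements of the preimage of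
  \<open>I\<close> represent an ideal \<open>G\<close>. It contains the vertices and breaking
  elements of \<open>I\<close>, which have degree 0 and generate \<open>I\<close> under Condition
  (K).\<close>

lemma graded_ideal_if_condition_K:
  assumes K: "condition_K E" and I: "two_sided_ideal I L"
  shows "graded_ideal K E I"
proof -
  let ?J = "cl.preimage I"
  have J: "ideal_above ?J" by (rule ideal_above_preimage[OF I])
  have JA: "x \<in> ?J \<Longrightarrow> x \<in> A" for x by (simp add: cl.preimage_def)
  have JI: "two_sided_ideal ?J (lpa_free_algebra K E)" using J by (simp add: ideal_above_def)
  \<comment> \<open>\<open>c\<close> is a total family that vanishes off \<open>M\<close>, so that
    two decompositions can be added over the union of their index sets.\<close>
  define decomp where "decomp x M c \<longleftrightarrow> finite M \<and> (\<forall>n. c n \<in> homog n \<inter> ?J) \<and> (\<forall>n. n \<notin> M \<longrightarrow> c n = 0) \<and>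
      x \<approx> sum c M" for x M c
  define G where "G = {x \<in> A. \<exists>M c. decomp x M c}"
  have zeroJ: "0 \<in> ?J" and plus: "x \<in> ?J \<Longrightarrow> y \<in> ?J \<Longrightarrow> x + y \<in> ?J" for x y
    using JI[unfolded A_ideal_iff] by auto
  have scaled: "x \<in> ?J \<Longrightarrow> Poly_Mapping.single 0 c * x \<in> ?J" for x c
    using ideal_above_scalar[OF J] by auto
  have G_homog: "x \<in> G" if "x \<in> homog n" "x \<in> ?J" for x n
  proof -
    have "decomp x {n} (\<lambda>k. if k = n then x else 0)"
      unfolding decomp_def using that(1) that(2) zeroJ homog_closed(1) by simp
    then show ?thesis using JA[OF that(2)] unfolding G_def by blast
  qed
  have G_add: "x + y \<in> G" if xy: "x \<in> G" "y \<in> G" for x y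
  proof -
    obtain M c where "decomp x M c" using xy(1) unfolding G_def by blast
    moreover obtain M' c' where "decomp y M' c'" using xy(2) unfolding G_def by blast
    ultimately have x: "finite M" "\<forall>n. c n \<in> homog n \<inter> ?J" "\<forall>n. n \<notin> M \<longrightarrow> c n = 0" "x \<approx> sum c M"
      and y: "finite M'" "\<forall>n. c' n \<in> homog n \<inter> ?J" "\<forall>n. n \<notin> M' \<longrightarrow> c' n = 0" "y \<approx> sum c' M'"
      by (simp_all add: decomp_def)
    have "sum c M = sum c (M \<union> M')" "sum c' M' = sum c' (M \<union> M')"
      using x y by (auto intro!: sum.mono_neutral_left)
    then have "x + y \<approx> sum (\<lambda>n. c n + c' n) (M \<union> M')"
      using cong_add[OF x(4) y(4)] by (simp add: sum.distrib)
    then have "decomp (x + y) (M \<union> M') (\<lambda>n. c n + c' n)"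
      using x y homog_closed(2) plus by (simp add: decomp_def)
    then show ?thesis using xy by (auto simp: G_def)
  qed
  \<comment> \<open>Scaling and multiplication by a generator on either side are treated at once, as
    additive maps that raise degrees by \<open>d\<close>.\<close>
  have G_map: "f x \<in> G" if x: "x \<in> G" and fA: "f x \<in> A"
    and f: "\<And>n z. z \<in> homog n \<Longrightarrow> f z \<in> homog (n + d)" "\<And>z. z \<in> ?J \<Longrightarrow> f z \<in> ?J"
      "\<And>z z'. z \<approx> z' \<Longrightarrow> f z \<approx> f z'" "f 0 = 0" "\<And>z z'. f (z + z') = f z + f z'" for x f d
  proof -
    obtain M c where "decomp x M c" using x by (auto simp: G_def)
    then have c: "finite M" "\<forall>n. c n \<in> homog n \<inter> ?J" "\<forall>n. n \<notin> M \<longrightarrow> c n = 0" "x \<approx> sum c M"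
      by (simp_all add: decomp_def)
    have "f (c (n - d)) \<in> homog n" for n using f(1)[of "c (n - d)" "n - d"] c(2) by simp
    moreover have "f (c (n - d)) = 0" if "n \<notin> (\<lambda>n. n + d) ` M" for n
    proof -
      have "n - d \<notin> M" using that by (metis diff_add_cancel imageI)
      then show ?thesis using c(3) f(4) by simp
    qed
    moreover have "sum (\<lambda>n. f (c (n - d))) ((\<lambda>n. n + d) ` M) = f (sum c M)"
    proof -
      have "f (sum c M') = (\<Sum>n\<in>M'. f (c n))" for M'
        by (induction M' rule: infinite_finite_induct) (simp_all add: f)
      then show ?thesis by (simp add: sum.reindex inj_on_def)
    qed
    ultimately have "decomp (f x) ((\<lambda>n. n + d) ` M) (\<lambda>n. f (c (n - d)))"
      using c f(2) f(3)[OF c(4)] by (simp add: decomp_def)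
    then show ?thesis using fA by (auto simp: G_def)
  qed
  have GA: "x \<in> G \<Longrightarrow> x \<in> A" for x by (simp add: G_def)
  have G_scalar: "Poly_Mapping.single 0 c * x \<in> G" if x: "x \<in> G" for x c
  proof (rule G_map[where f = "\<lambda>z. Poly_Mapping.single 0 c * z" and d = 0, OF x])
    show "Poly_Mapping.single 0 c * x \<in> A" using GA[OF x] by (intro A_closed(5)) simp_all
    show "Poly_Mapping.single 0 c * z \<in> homog (n + 0)" if "z \<in> homog n" for z n
      using homog_closed(4)[OF homog_closed(6) that, of c] by simp
    show "Poly_Mapping.single 0 c * z \<approx> Poly_Mapping.single 0 c * z'" if "z \<approx> z'" for z z'
      by (rule cong_left[OF that]) simp
  qed (simp_all only: scaled mult_zero_right distrib_left)
  have G_gen: "generator g * x \<in> G" "x * generator g \<in> G" if g: "g \<in> gens" and x: "x \<in> G" for g x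
  proof -
    have gA: "generator g \<in> A" using g by auto
    show "generator g * x \<in> G"
    proof (rule G_map[where f = "\<lambda>z. generator g * z" and d = "lpa_gen_degree g", OF x])
      show "generator g * x \<in> A" by (rule A_closed(5)[OF A_U[OF gA] GA[OF x]])
      show "generator g * z \<in> homog (n + lpa_gen_degree g)" if "z \<in> homog n" for z n
        using homog_closed(4)[OF homog_closed(5)[of g] that] by (simp add: add.commute)
      show "generator g * z \<approx> generator g * z'" if "z \<approx> z'" for z z'
        by (rule cong_left[OF that A_U[OF gA]])
    qed (simp_all only: ideal_aboveD(6)[OF J _ gA] mult_zero_right distrib_left)
    show "x * generator g \<in> G"
    proof (rule G_map[where f = "\<lambda>z. z * generator g" and d = "lpa_gen_degree g", OF x])
      show "x * generator g \<in> A" by (rule A_closed(5)[OF A_U[OF GA[OF x]] gA])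
      show "z * generator g \<in> homog (n + lpa_gen_degree g)" if "z \<in> homog n" for z n
        by (rule homog_closed(4)[OF that homog_closed(5)])
      show "z * generator g \<approx> z' * generator g" if "z \<approx> z'" for z z'
        by (rule cong_right[OF that A_U[OF gA]])
    qed (simp_all only: ideal_aboveD(7)[OF J _ gA] mult_zero_left distrib_right)
  qed
  have G_mult: "\<forall>x\<in>G. y * x \<in> G \<and> x * y \<in> G" if "y \<in> A" for y
    using that
  proof (induction y rule: A_induct)
    case zero
    then show ?case using G_homog[OF homog_closed(1) zeroJ] by simp
  next
    case (generator g)
    then show ?case using G_gen by simp
  next
    case (add a b)
    then show ?case using G_add by (simp add: distrib_left distrib_right)
  next
    case (mult a b)
    then show ?case by (simp add: mult.assoc) (simp add: mult.assoc[symmetric])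
  next
    case (scalar a c)
    have "x * (Poly_Mapping.single 0 c * a) = Poly_Mapping.single 0 c * (x * a)" for x
      by (rule scalar_move)
    then show ?case using scalar G_scalar by (simp add: mult.assoc)
  qed
  have "- x \<in> G" if "x \<in> G" for x
    using G_scalar[OF that, of "- 1"] by (simp add: single_uminus)
  then have "two_sided_ideal G (lpa_free_algebra K E)"
    unfolding A_ideal_iff using GA G_add G_mult G_homog[OF homog_closed(1) zeroJ] by auto
  moreover have "N \<subseteq> G"
  proof
    fix x assume x: "x \<in> N"
    then have "decomp x {} (\<lambda>_. 0)" using zeroJ homog_closed(1) by (simp add: decomp_def cong_def)
    then show "x \<in> G" using x N_A by (auto simp: G_def)
  qed
  ultimately have G: "ideal_above G" by (simp add: ideal_above_def)
  have "admissible_ideal K E (gr_vertices K E I) (gr_breaking K E I) \<subseteq> cl ` G"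
  proof (rule admissible_ideal_least[OF ideal_image[OF G]])
    fix v assume "v \<in> gr_vertices K E I"
    then show "cl (vtx v) \<in> cl ` G"
      using homog_closed(5)[of "Vertex v"]
      by (intro imageI G_homog[of _ 0]) (auto simp: gr_vertices_def cl.preimage_def)
  next
    fix v assume v: "v \<in> gr_breaking K E I"
    let ?T = "{e \<in> out_arcs E v. head E e \<notin> gr_vertices K E I}"
    have "brk v ?T \<in> A" using v by (intro breaking_element_closed) (simp add: gr_breaking_def)
    moreover have "cl (brk v ?T) \<in> I"
      using v by (simp add: gr_breaking_def breaking_element_eq)
    moreover have "brk v ?T \<in> homog 0"
    proof -
      have "edg e * gho e \<in> homog 0" for e
        using homog_closed(4)[OF homog_closed(5)[of "Edge e"] homog_closed(5)[of "Ghost e"]] by simp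
      then have "(\<Sum>e\<in>?T. edg e * gho e) \<in> homog 0" by (rule homog_sum)
      then have "vtx v + - (\<Sum>e\<in>?T. edg e * gho e) \<in> homog 0"
        using homog_closed(5)[of "Vertex v"] by (intro homog_closed(2,3)) simp_all
      then show ?thesis by (simp add: brk_def)
    qed
    ultimately show "breaking_element K E (gr_vertices K E I) v \<in> cl ` G"
      unfolding breaking_element_eq by (intro imageI G_homog) (auto simp: cl.preimage_def)
  qed
  then have IG: "I \<subseteq> cl ` G" using ideal_eq_admissible_ideal[OF K I] by simp
  have sum_cl: "finite M \<Longrightarrow> (\<And>n. c n \<in> A) \<Longrightarrow> cl (sum c M) = finsum L (\<lambda>n. cl (c n)) M" for M :: "int set" and c
  proof (induction M rule: finite_induct)
    case (insert n M)
    then show ?case by (simp add: cl.S.finsum_insert cl_add[symmetric] A_sum)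
  qed (simp add: cl.hom_zero[unfolded A_simps])
  show ?thesis
    unfolding graded_ideal_def
  proof (intro conjI ballI I)
    fix a assume "a \<in> I"
    then obtain x where x: "x \<in> G" "a = cl x" using IG by blast
    then obtain M c where c: "decomp x M c" by (auto simp: G_def)
    have cA: "c n \<in> A" for n using c JA by (simp add: decomp_def)
    have "a = cl (sum c M)" using x c cA GA by (simp add: cl_eq_iff decomp_def A_sum)
    then have "a = finsum L (\<lambda>n. cl (c n)) M" using sum_cl[of M c] cA c by (simp add: decomp_def)
    moreover have "cl (c n) \<in> I \<inter> lpa_component K E n" for n
      using c cA[of n] by (auto simp: decomp_def lpa_component_def homog_def cl.preimage_def)
    ultimately show "\<exists>N c. finite N \<and> (\<forall>n\<in>N. c n \<in> I \<inter> lpa_component K E n) \<and> a = finsum L c N"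
      using c by (intro exI[of _ M] exI[of _ "\<lambda>n. cl (c n)"]) (simp add: decomp_def)
  qed
qed

end

section \<open>Decompositions into strongly prime ideals\<close>

definition (in nonunital_ring) decomposes :: "'a set \<Rightarrow> bool" where
  "decomposes I \<longleftrightarrow> (\<exists>\<P>. finite \<P> \<and> \<P> \<noteq> {} \<and> (\<forall>P\<in>\<P>. strongly_prime_over P) \<and> I = \<Inter>\<P>)"

text \<open>To pass from a least ideal above \<open>P\<close> to strong primeness of the single
  ideal \<open>P\<close>, decompositions of other proper ideals are used. Hence the equivalence is
  between the two universal statements and not ideal by ideal.\<close>

lemma (in idempotent_ideals) strongly_prime_products_iff:
  "(\<forall>I. proper_ideal I R \<longrightarrow> finite_product_of strongly_prime_ideal I R) \<longleftrightarrow>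
   (\<forall>I. proper_ideal I R \<longrightarrow> decomposes I)"
proof -
  have iff: "finite_product_of strongly_prime_ideal I R \<longleftrightarrow>
      (\<exists>\<P>. finite \<P> \<and> \<P> \<noteq> {} \<and> (\<forall>P\<in>\<P>. strongly_prime_ideal P R) \<and> I = \<Inter>\<P>)" for I
    by (rule finite_product_of_iff) (simp add: strongly_prime_ideal_def proper_ideal_def)
  show ?thesis
  proof (intro iffI allI impI)
    fix I assume *: "\<forall>I. proper_ideal I R \<longrightarrow> finite_product_of strongly_prime_ideal I R" "proper_ideal I R"
    then have "\<exists>\<P>. finite \<P> \<and> \<P> \<noteq> {} \<and> (\<forall>P\<in>\<P>. strongly_prime_ideal P R) \<and> I = \<Inter>\<P>"
      unfolding iff by simp
    then show "decomposes I"
      unfolding decomposes_def by (elim exE) (rule exI, auto intro: strongly_prime_imp_over)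
  next
    fix I assume *: "\<forall>I. proper_ideal I R \<longrightarrow> decomposes I" "proper_ideal I R"
    have sp: "strongly_prime_ideal P R" if "strongly_prime_over P" for P
      using *(1) that unfolding decomposes_def by (intro strongly_prime_over_imp_strongly_prime) simp_all
    have "decomposes I" using * by simp
    then show "finite_product_of strongly_prime_ideal I R"
      unfolding decomposes_def iff by (elim exE) (rule exI, auto intro: sp)
  qed
qed

text \<open>Predicates \<open>\<Phi>\<close> and \<open>\<Psi>\<close> are left open because the
  statement serves twice, for prime ideals and for ideals with a least ideal above them. Members of
  a family that intersects in the kernel contain the kernel, so they are preimages.\<close>

lemma (in surjective_hom) Inter_kernel_iff:
  assumes R: "\<And>P. \<Phi> P \<Longrightarrow> two_sided_ideal P R" and S: "\<And>P. \<Psi> P \<Longrightarrow> two_sided_ideal P S"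
    and iff: "\<And>P. two_sided_ideal P S \<Longrightarrow> \<Phi> (preimage P) \<longleftrightarrow> \<Psi> P"
  shows "(\<exists>\<P>. finite \<P> \<and> \<P> \<noteq> {} \<and> (\<forall>P\<in>\<P>. \<Phi> P) \<and> preimage {\<zero>\<^bsub>S\<^esub>} = \<Inter>\<P>) \<longleftrightarrow>
    (\<exists>\<P>. finite \<P> \<and> \<P> \<noteq> {} \<and> (\<forall>P\<in>\<P>. \<Psi> P) \<and> {\<zero>\<^bsub>S\<^esub>} = \<Inter>\<P>)"
proof
  assume "\<exists>\<P>. finite \<P> \<and> \<P> \<noteq> {} \<and> (\<forall>P\<in>\<P>. \<Phi> P) \<and> preimage {\<zero>\<^bsub>S\<^esub>} = \<Inter>\<P>"
  then obtain \<P> where \<P>: "finite \<P>" "\<P> \<noteq> {}" "\<forall>P\<in>\<P>. \<Phi> P" "preimage {\<zero>\<^bsub>S\<^esub>} = \<Inter>\<P>"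
    by (elim exE conjE)
  let ?\<Q> = "(`) h ` \<P>"
  have I: "two_sided_ideal P R" "preimage (h ` P) = P" "two_sided_ideal (h ` P) S" if "P \<in> \<P>" for P
  proof -
    show P: "two_sided_ideal P R" using \<P>(3) that R by simp
    have "preimage {\<zero>\<^bsub>S\<^esub>} \<subseteq> P" unfolding \<P>(4) using that by (rule Inter_lower)
    then show "preimage (h ` P) = P" by (rule preimage_image[OF P])
    show "two_sided_ideal (h ` P) S" by (rule image_ideal[OF P])
  qed
  have Q: "two_sided_ideal Q S" if "Q \<in> ?\<Q>" for Q using that I(3) by auto
  have "{\<zero>\<^bsub>S\<^esub>} = \<Inter>?\<Q>"
  proof
    show "{\<zero>\<^bsub>S\<^esub>} \<subseteq> \<Inter>?\<Q>" using S.idealD(2)[OF I(3)] by simp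
    show "\<Inter>?\<Q> \<subseteq> {\<zero>\<^bsub>S\<^esub>}"
    proof
      fix y assume y: "y \<in> \<Inter>?\<Q>"
      obtain P where P: "P \<in> \<P>" using \<P>(2) by auto
      then have "y \<in> h ` P" using y by simp
      then have "y \<in> carrier S" using S.idealD(1)[OF I(3)[OF P]] by auto
      then obtain x where x: "x \<in> carrier R" "y = h x" unfolding image[symmetric] by auto
      have "x \<in> P" if P: "P \<in> \<P>" for P
      proof -
        have "x \<in> preimage (h ` P)" using x y P by (simp add: preimage_def)
        then show ?thesis unfolding I(2)[OF P] .
      qed
      then have "x \<in> preimage {\<zero>\<^bsub>S\<^esub>}" unfolding \<P>(4) by (rule InterI)
      then show "y \<in> {\<zero>\<^bsub>S\<^esub>}" using x by (simp add: preimage_def)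
    qed
  qed
  moreover have "\<Psi> Q" if Q: "Q \<in> ?\<Q>" for Q
  proof -
    obtain P where P: "P \<in> \<P>" "Q = h ` P" using Q by auto
    then show ?thesis using iff[OF I(3)[OF P(1)]] I(2)[OF P(1)] \<P>(3) by simp
  qed
  ultimately show "\<exists>\<P>. finite \<P> \<and> \<P> \<noteq> {} \<and> (\<forall>P\<in>\<P>. \<Psi> P) \<and> {\<zero>\<^bsub>S\<^esub>} = \<Inter>\<P>"
    using \<P>(1,2) by (intro exI[of _ ?\<Q>]) simp
next
  assume "\<exists>\<P>. finite \<P> \<and> \<P> \<noteq> {} \<and> (\<forall>P\<in>\<P>. \<Psi> P) \<and> {\<zero>\<^bsub>S\<^esub>} = \<Inter>\<P>"
  then obtain \<P> where \<P>: "finite \<P>" "\<P> \<noteq> {}" "\<forall>P\<in>\<P>. \<Psi> P" "{\<zero>\<^bsub>S\<^esub>} = \<Inter>\<P>"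
    by (elim exE conjE)
  have "preimage {\<zero>\<^bsub>S\<^esub>} = \<Inter>(preimage ` \<P>)"
    unfolding \<P>(4) using \<P>(2) by (auto simp: preimage_def)
  moreover have "\<forall>P\<in>\<P>. \<Phi> (preimage P)" using \<P>(3) S iff by simp
  ultimately show "\<exists>\<P>. finite \<P> \<and> \<P> \<noteq> {} \<and> (\<forall>P\<in>\<P>. \<Phi> P) \<and> preimage {\<zero>\<^bsub>S\<^esub>} = \<Inter>\<P>"
    using \<P>(1,2) by (intro exI[of _ "preimage ` \<P>"]) simp
qed

lemma (in surjective_hom) decomposes_kernel_iff:
  "R.decomposes (preimage {\<zero>\<^bsub>S\<^esub>}) \<longleftrightarrow> S.decomposes {\<zero>\<^bsub>S\<^esub>}"
  unfolding R.decomposes_def S.decomposes_def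
  by (rule Inter_kernel_iff) (simp_all add: R.strongly_prime_over_ideal S.strongly_prime_over_ideal
      strongly_prime_over_preimage_iff)

definition union_of_CSP_tails :: "('v, 'e) pre_digraph \<Rightarrow> bool" where
  "union_of_CSP_tails G \<longleftrightarrow> (\<exists>\<M>. finite \<M> \<and> verts G = \<Union>\<M> \<and>
     (\<forall>M\<in>\<M>. maximal_tail G M \<and> (\<exists>C\<subseteq>M. strong_CSP (G \<restriction> M) C)))"

text \<open>Passing to the maximal members of the cover secures condition (iii). If \<open>x\<close>
  in such an \<open>M\<close> emits edges but none into \<open>M\<close>, then \<open>x\<close> is
  the only vertex of \<open>M\<close> below \<open>x\<close>, and by directedness all of
  \<open>M\<close> lies above \<open>x\<close>. A member of the cover that contains the head of an
  edge from \<open>x\<close> then contains \<open>M\<close>, against maximality.\<close>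

lemma (in wf_digraph) union_of_CSP_tails_if_cover:
  assumes fin: "finite \<N>" and cover: "verts G = \<Union>\<N>"
    and core: "\<And>M. M \<in> \<N> \<Longrightarrow> \<exists>u. core_vertex (G \<restriction> M) u"
    and up: "\<And>M u v. M \<in> \<N> \<Longrightarrow> u \<in> M \<Longrightarrow> v \<rightarrow>\<^sup>* u \<Longrightarrow> v \<in> M"
  shows "union_of_CSP_tails G"
proof -
  let ?\<M> = "{M \<in> \<N>. \<forall>M'\<in>\<N>. M \<subseteq> M' \<longrightarrow> M = M'}"
  have sub: "M \<subseteq> verts G" if "M \<in> \<N>" for M using cover that by auto
  have above: "\<exists>M'\<in>?\<M>. M \<subseteq> M'" if "M \<in> \<N>" for M
    using finite_has_maximal2[OF fin that] by auto
  have "verts G = \<Union>?\<M>"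
  proof
    show "verts G \<subseteq> \<Union>?\<M>"
    proof
      fix v assume "v \<in> verts G"
      then obtain M where "M \<in> \<N>" "v \<in> M" unfolding cover by auto
      then show "v \<in> \<Union>?\<M>" using above[of M] by auto
    qed
  qed (use cover in auto)
  moreover have "maximal_tail G M \<and> (\<exists>C\<subseteq>M. strong_CSP (G \<restriction> M) C)" if M: "M \<in> ?\<M>" for M
  proof -
    interpret M: wf_digraph "G \<restriction> M" by (rule wellformed_induce_subgraph)
    have MN: "M \<in> \<N>" using M by simp
    obtain u where u: "core_vertex (G \<restriction> M) u" using core[OF MN] by (elim exE)
    have dir: "downward_directed G M"
      using M.core_vertex_downward_directed[OF u] reachable_induced[OF _ sub[OF MN]]
      unfolding downward_directed_def induce_subgraph_verts by meson
    have "\<exists>e\<in>out_arcs G x. head G e \<in> M" if x: "x \<in> M" "out_arcs G x \<noteq> {}" for x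
    proof (rule ccontr)
      assume none: "\<not> (\<exists>e\<in>out_arcs G x. head G e \<in> M)"
      obtain e where e: "e \<in> out_arcs G x" using x(2) unfolding ex_in_conv[symmetric] by (elim exE)
      have sink: "w = x" if w: "x \<rightarrow>\<^sup>* w" "w \<in> M" for w
        using w(1)
      proof (cases rule: converse_reachable_cases)
        case (step y)
        then obtain f where "f \<in> arcs G" "tail G f = x" "head G f = y"
          by (auto simp: arcs_ends_def arc_to_ends_def)
        moreover have "y \<in> M" using up[OF MN w(2) step(2)] .
        ultimately show ?thesis using none by auto
      qed simp
      have "head G e \<in> verts G" using e by auto
      then obtain M' where M': "M' \<in> \<N>" "head G e \<in> M'" unfolding cover by auto
      have xM': "x \<in> M'" using up[OF M' step_reachable[of e]] e by auto
      have "y \<in> M'" if y: "y \<in> M" for y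
      proof -
        obtain w where w: "w \<in> M" "x \<rightarrow>\<^sup>* w" "y \<rightarrow>\<^sup>* w"
          using dir x(1) y unfolding downward_directed_def by meson
        have "w = x" by (rule sink[OF w(2,1)])
        then show ?thesis using up[OF M'(1) xM', of y] w(3) by simp
      qed
      then have "M \<subseteq> M'" by (rule subsetI)
      then have "M = M'" using M M'(1) by simp
      then show False using none e M'(2) by auto
    qed
    then have "maximal_tail G M"
      unfolding maximal_tail_def using sub[OF MN] dir up[OF MN] by auto
    moreover obtain C where "strong_CSP (G \<restriction> M) C" using M.strong_CSP_iff u by auto
    then have "C \<subseteq> M \<and> strong_CSP (G \<restriction> M) C" by (simp add: strong_CSP_def)
    ultimately show ?thesis by (rule conjI[OF _ exI])
  qed
  ultimately show ?thesis
    unfolding union_of_CSP_tails_def using fin by (intro exI[of _ ?\<M>]) simp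
qed

context lpa
begin

text \<open>An ideal \<open>P\<close> of a decomposition yields the set of vertices outside
  \<open>P\<close>, and a maximal tail yields an ideal I(H,S) for its complement \<open>H\<close>.
  Nonemptiness of the graph excludes the empty union of tails, which would correspond to the empty
  family of ideals.\<close>

lemma decomposes_zero_iff:
  assumes K: "condition_K E"
  shows "cl.S.decomposes {\<zero>\<^bsub>L\<^esub>} \<longleftrightarrow> verts E \<noteq> {} \<and> union_of_CSP_tails E"
proof
  assume "cl.S.decomposes {\<zero>\<^bsub>L\<^esub>}"
  then obtain \<P> where \<P>: "finite \<P>" "\<P> \<noteq> {}" "\<forall>P\<in>\<P>. cl.S.strongly_prime_over P" "{\<zero>\<^bsub>L\<^esub>} = \<Inter>\<P>"
    unfolding cl.S.decomposes_def by (elim exE conjE)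
  let ?M = "\<lambda>P. verts E - gr_vertices K E P"
  have PI: "two_sided_ideal P L" if "P \<in> \<P>" for P
    using \<P>(3) that cl.S.strongly_prime_over_ideal by simp
  have core: "\<exists>u. core_vertex (E \<restriction> M) u" if M: "M \<in> ?M ` \<P>" for M
  proof -
    obtain P where P: "P \<in> \<P>" "M = ?M P" using M by auto
    interpret Q: admissible E K "gr_vertices K E P" "gr_breaking K E P"
      by (rule gr_admissible_locale[OF PI[OF P(1)]])
    have "\<exists>u. core_vertex Q.F u" using strongly_prime_over_iff[OF K PI[OF P(1)]] \<P>(3) P(1) by simp
    then show ?thesis unfolding P(2) by (elim exE) (rule Q.quotient_core_imp_tail_core)
  qed
  have "union_of_CSP_tails E"
  proof (rule union_of_CSP_tails_if_cover)
    show "finite (?M ` \<P>)" using \<P>(1) by simp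
    show "verts E = \<Union>(?M ` \<P>)"
    proof
      show "verts E \<subseteq> \<Union>(?M ` \<P>)"
      proof
        fix v assume v: "v \<in> verts E"
        then have "cl (vtx v) \<notin> \<Inter>\<P>" using cl_vtx_nonzero unfolding \<P>(4)[symmetric] by simp
        then obtain P where "P \<in> \<P>" "cl (vtx v) \<notin> P" by auto
        then show "v \<in> \<Union>(?M ` \<P>)" using v by (auto simp: gr_vertices_def)
      qed
    qed auto
    show "v \<in> M" if M: "M \<in> ?M ` \<P>" "u \<in> M" "v \<rightarrow>\<^sup>*\<^bsub>E\<^esub> u" for M u v
    proof -
      obtain P where P: "P \<in> \<P>" "M = ?M P" using M(1) by auto
      have "hereditary E (gr_vertices K E P)"
        using gr_admissible[OF PI[OF P(1)]] by (simp add: admissible_pair_def)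
      then show ?thesis using M(2,3) reachable_in_verts(1)[OF M(3)] unfolding P(2) hereditary_def by auto
    qed
  qed (rule core)
  moreover have "verts E \<noteq> {}"
  proof -
    obtain P where P: "P \<in> \<P>" using \<P>(2) by auto
    then obtain u where "core_vertex (E \<restriction> ?M P) u" using core[of "?M P"] by auto
    then show ?thesis by (auto simp: core_vertex_def)
  qed
  ultimately show "verts E \<noteq> {} \<and> union_of_CSP_tails E" by simp
next
  assume *: "verts E \<noteq> {} \<and> union_of_CSP_tails E"
  then obtain \<M> where \<M>: "finite \<M>" "verts E = \<Union>\<M>"
    "\<forall>M\<in>\<M>. maximal_tail E M \<and> (\<exists>C\<subseteq>M. strong_CSP (E \<restriction> M) C)"
    unfolding union_of_CSP_tails_def by (elim exE conjE)
  define H where "H M = verts E - M" for M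
  \<comment> \<open>All breaking vertices are included, so that the quotient graph has no primed
    vertices and is a copy of the tail.\<close>
  define P where "P M = admissible_ideal K E (H M) (breaking_vertices E (H M))" for M
  have P: "two_sided_ideal (P M) L \<and> gr_vertices K E (P M) = H M \<and> cl.S.strongly_prime_over (P M)"
    if M: "M \<in> \<M>" for M
  proof -
    have tail: "maximal_tail E M" using \<M>(3) M by simp
    have adm: "admissible_pair E (H M) (breaking_vertices E (H M))"
      using maximal_tail_complement[OF tail] by (simp add: admissible_pair_def H_def)
    interpret Q: admissible E K "H M" "breaking_vertices E (H M)" by unfold_locales (rule adm)
    interpret T: wf_digraph "E \<restriction> M" by (rule wellformed_induce_subgraph)
    have PI: "two_sided_ideal (P M) L" unfolding P_def by (rule admissible_ideal_ideal(1)[OF adm])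
    note gr = Q.gr_admissible_ideal[OF K, folded P_def]
    have "\<exists>C. strong_CSP (E \<restriction> M) C" using \<M>(3) M by auto
    then obtain u where u: "core_vertex (E \<restriction> M) u" unfolding T.strong_CSP_iff by (elim exE)
    have "verts E - H M = M" using \<M>(2) M by (auto simp: H_def)
    then have "core_vertex Q.F (Inl u)" using u by (intro Q.tail_core_imp_quotient_core) simp_all
    then have "cl.S.strongly_prime_over (P M)"
      unfolding strongly_prime_over_iff[OF K PI] gr by (rule exI)
    then show ?thesis using PI gr(1) by simp
  qed
  have ne: "\<M> \<noteq> {}" using * \<M>(2) by auto
  have I: "two_sided_ideal (\<Inter>(P ` \<M>)) L" using ne P by (intro cl.S.ideal_Inter) auto
  have "gr_vertices K E (\<Inter>(P ` \<M>)) = {}"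
  proof -
    have False if v: "v \<in> verts E" "cl (vtx v) \<in> \<Inter>(P ` \<M>)" for v
    proof -
      obtain M where M: "M \<in> \<M>" "v \<in> M" using v(1) unfolding \<M>(2) by auto
      then have "v \<in> gr_vertices K E (P M)" using v by (simp add: gr_vertices_def)
      then show False using P[OF M(1)] M(2) by (simp add: H_def)
    qed
    then show ?thesis by (auto simp: gr_vertices_def)
  qed
  then have "{\<zero>\<^bsub>L\<^esub>} = \<Inter>(P ` \<M>)" using nonzero_ideal_vertex[OF K I] by metis
  then show "cl.S.decomposes {\<zero>\<^bsub>L\<^esub>}"
    unfolding cl.S.decomposes_def using \<M>(1) ne P by (intro exI[of _ "P ` \<M>"]) simp
qed

lemma decomposes_zero_if_strongly_prime:
  "cl.S.strongly_prime_over {\<zero>\<^bsub>L\<^esub>} \<Longrightarrow> cl.S.decomposes {\<zero>\<^bsub>L\<^esub>}"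
  unfolding cl.S.decomposes_def by (intro exI[of _ "{{\<zero>\<^bsub>L\<^esub>}}"]) simp

lemma strong_CSP_gr_iff:
  assumes K: "condition_K E" and P: "two_sided_ideal P L"
  shows "(\<exists>C. strong_CSP (quotient_graph E (gr_vertices K E P) (gr_breaking K E P)) C) \<longleftrightarrow>
    cl.S.strongly_prime_over P"
proof -
  interpret Q: admissible E K "gr_vertices K E P" "gr_breaking K E P" by (rule gr_admissible_locale[OF P])
  show ?thesis using Q.F.strong_CSP_iff strongly_prime_over_iff[OF K P] by simp
qed

lemma decomposes_zero_imp_minimal_primes:
  assumes K: "condition_K E" and dec: "cl.S.decomposes {\<zero>\<^bsub>L\<^esub>}"
  shows "finite {P. minimal_prime_ideal P L} \<and>
    (\<forall>P. minimal_prime_ideal P L \<longrightarrow> strongly_primitive_ideal K E P)"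
proof -
  interpret id: idempotent_ideals L by (rule idempotent_ideals_L[OF K])
  obtain \<P> where \<P>: "finite \<P>" "\<forall>P\<in>\<P>. cl.S.strongly_prime_over P" "\<Inter>\<P> = {\<zero>\<^bsub>L\<^esub>}"
    using dec unfolding cl.S.decomposes_def by (elim exE conjE) (rule that, assumption, assumption, erule sym)
  have sub: "{P. minimal_prime_ideal P L} \<subseteq> \<P>"
    using \<P> id.strongly_prime_over_imp_prime by (intro id.minimal_primes_of_zero(1)) simp_all
  have "strongly_primitive_ideal K E P" if "minimal_prime_ideal P L" for P
  proof -
    have P: "cl.S.strongly_prime_over P" using sub that \<P>(2) by auto
    then show ?thesis
      unfolding strongly_primitive_ideal_def strong_CSP_gr_iff[OF K cl.S.strongly_prime_over_ideal[OF P]]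
      by (intro conjI strongly_prime_over_imp_primitive[OF K])
  qed
  then show ?thesis using finite_subset[OF sub \<P>(1)] by simp
qed

text \<open>The minimal primes lie among the finitely many given primes and have the same
  intersection, zero. Strong primitivity includes the strong CSP of the quotient graph, which yields
  a least ideal above each of them.\<close>

lemma decomposes_zero_if_minimal_primes:
  assumes K: "condition_K E"
    and primes: "\<exists>\<P>. finite \<P> \<and> \<P> \<noteq> {} \<and> (\<forall>P\<in>\<P>. prime_ideal P L) \<and> {\<zero>\<^bsub>L\<^esub>} = \<Inter>\<P>"
    and minimal: "\<And>P. minimal_prime_ideal P L \<Longrightarrow> strongly_primitive_ideal K E P"
  shows "cl.S.decomposes {\<zero>\<^bsub>L\<^esub>}"
proof -
  interpret id: idempotent_ideals L by (rule idempotent_ideals_L[OF K])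
  obtain \<P> where \<P>: "finite \<P>" "\<P> \<noteq> {}" "\<forall>P\<in>\<P>. prime_ideal P L" "{\<zero>\<^bsub>L\<^esub>} = \<Inter>\<P>"
    using primes by (elim exE conjE)
  let ?\<Q> = "{P. minimal_prime_ideal P L}"
  have sub: "?\<Q> \<subseteq> \<P>" and below: "\<And>Q. Q \<in> \<P> \<Longrightarrow> \<exists>P. minimal_prime_ideal P L \<and> P \<subseteq> Q"
    using id.minimal_primes_of_zero[OF \<P>(1)] \<P>(3,4) by simp_all
  have "{\<zero>\<^bsub>L\<^esub>} = \<Inter>?\<Q>"
  proof
    show "{\<zero>\<^bsub>L\<^esub>} \<subseteq> \<Inter>?\<Q>" unfolding \<P>(4) by (rule Inter_anti_mono[OF sub])
    show "\<Inter>?\<Q> \<subseteq> {\<zero>\<^bsub>L\<^esub>}"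
      unfolding \<P>(4)
    proof (rule Inter_greatest)
      fix Q assume "Q \<in> \<P>"
      then obtain P where "minimal_prime_ideal P L" "P \<subseteq> Q" using below by auto
      then show "\<Inter>?\<Q> \<subseteq> Q" by auto
    qed
  qed
  moreover have "?\<Q> \<noteq> {}" using below \<P>(2) by auto
  moreover have "cl.S.strongly_prime_over P" if P: "minimal_prime_ideal P L" for P
  proof -
    have "two_sided_ideal P L"
      using P by (simp add: minimal_prime_ideal_def prime_ideal_def proper_ideal_def)
    then show ?thesis
      using minimal[OF P] strong_CSP_gr_iff[OF K] unfolding strongly_primitive_ideal_def by simp
  qed
  ultimately show ?thesis
    unfolding cl.S.decomposes_def using finite_subset[OF sub \<P>(1)] by (intro exI[of _ ?\<Q>]) simp
qed

lemma proper_ideal_cases: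
  assumes K: "condition_K E" and I: "proper_ideal I L"
  shows "admissible_pair E (gr_vertices K E I) (gr_breaking K E I)"
    "I = admissible_ideal K E (gr_vertices K E I) (gr_breaking K E I)"
    "gr_vertices K E I \<noteq> verts E"
  using gr_admissible ideal_eq_admissible_ideal[OF K] proper_ideal_gr[OF I] I
  by (simp_all add: proper_ideal_def)

lemma (in admissible) decomposes_iff:
  assumes K: "condition_K E"
  shows "cl.S.decomposes (admissible_ideal K E H S) \<longleftrightarrow> F.cl.S.decomposes {\<zero>\<^bsub>F.L\<^esub>}"
  using \<Theta>.decomposes_kernel_iff \<Theta>_kernel[OF K] by simp

lemma (in admissible) admissible_ideal_proper:
  assumes K: "condition_K E" and H: "H \<noteq> verts E"
  shows "proper_ideal (admissible_ideal K E H S) L"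
  using admissible_ideal_ideal(1)[OF admissible] gr_admissible_ideal(1)[OF K] H
  by (intro gr_verts_proper) simp_all

section \<open>The three conditions as decomposition of all proper ideals\<close>

abbreviation all_ideals_decompose :: bool where
  "all_ideals_decompose \<equiv> \<forall>I. proper_ideal I L \<longrightarrow> cl.S.decomposes I"

text \<open>The first alternative gives a core vertex of the quotient graph, whose algebra then has
  the one-member decomposition of its zero ideal. Thus both alternatives lead to a decomposition of
  I(H,S), and under Condition (K) every proper ideal is of this form.\<close>

lemma tails_iff:
  assumes K: "condition_K E"
  shows "(\<forall>H S. admissible_pair E H S \<and> H \<noteq> verts E \<longrightarrow>
      (downward_directed (quotient_graph E H S) (verts (quotient_graph E H S)) \<and>
        (\<exists>C. strong_CSP (quotient_graph E H S) C)) \<or>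
      union_of_CSP_tails (quotient_graph E H S)) \<longleftrightarrow> all_ideals_decompose"
    (is "(\<forall>H S. ?adm H S \<longrightarrow> ?tails H S) \<longleftrightarrow> _")
proof -
  have *: "?tails H S \<longleftrightarrow> cl.S.decomposes (admissible_ideal K E H S)" if "?adm H S" for H S
  proof -
    interpret Q: admissible E K H S by unfold_locales (use that in simp)
    have KF: "condition_K Q.F" by (rule Q.condition_K_quotient[OF K])
    have "H \<subseteq> verts E" "H \<noteq> verts E" using that by (auto simp: admissible_pair_def hereditary_def)
    then have "verts Q.F \<noteq> {}" by (auto simp: Q.F_simps)
    then have iff: "cl.S.decomposes (admissible_ideal K E H S) \<longleftrightarrow> union_of_CSP_tails Q.F"
      unfolding Q.decomposes_iff[OF K] Q.F.decomposes_zero_iff[OF KF] by simp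
    have "cl.S.decomposes (admissible_ideal K E H S)" if "\<exists>C. strong_CSP Q.F C"
      unfolding Q.decomposes_iff[OF K]
      using that Q.F.strong_CSP_iff Q.F.strongly_prime_zero_iff[OF KF] Q.F.decomposes_zero_if_strongly_prime
      by simp
    then show ?thesis using iff by auto
  qed
  show ?thesis
  proof (intro iffI allI impI)
    fix I assume tails: "\<forall>H S. ?adm H S \<longrightarrow> ?tails H S" and I: "proper_ideal I L"
    note gr = proper_ideal_cases[OF K I]
    have adm: "?adm (gr_vertices K E I) (gr_breaking K E I)" using gr(1,3) by simp
    then have "cl.S.decomposes (admissible_ideal K E (gr_vertices K E I) (gr_breaking K E I))"
      using tails *[OF adm] by simp
    then show "cl.S.decomposes I" using gr(2) by simp
  next
    fix H S assume dec: all_ideals_decompose and adm: "?adm H S"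
    interpret Q: admissible E K H S by unfold_locales (use adm in simp)
    have "proper_ideal (admissible_ideal K E H S) L" using adm by (intro Q.admissible_ideal_proper[OF K]) simp
    then show "?tails H S" unfolding *[OF adm] using dec by simp
  qed
qed

text \<open>The generalized ZPI property writes \<open>I\<close> as a finite intersection of primes;
  modulo \<open>I\<close> they intersect in zero, which makes
  \<open>decomposes_zero_if_minimal_primes\<close> applicable. In the other direction the members of
  a decomposition are prime, while gradedness and the isomorphisms come from Condition (K).\<close>

lemma minimal_primes_iff:
  assumes K: "condition_K E"
  shows "((\<forall>I. two_sided_ideal I L \<longrightarrow> graded_ideal K E I) \<and> generalized_ZPI_ring L \<and>
    (\<forall>I. proper_ideal I L \<longrightarrow>
       (\<exists>H S. admissible_pair E H S \<and> I = admissible_ideal K E H S \<and>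
          algebra_isomorphic (quotient_algebra L I) (leavitt_path_algebra K (quotient_graph E H S)) \<and>
          (strongly_prime_ring (leavitt_path_algebra K (quotient_graph E H S)) \<or>
           finite {P. minimal_prime_ideal P (leavitt_path_algebra K (quotient_graph E H S))} \<and>
           (\<forall>P. minimal_prime_ideal P (leavitt_path_algebra K (quotient_graph E H S)) \<longrightarrow>
              strongly_primitive_ideal K (quotient_graph E H S) P))))) \<longleftrightarrow> all_ideals_decompose"
    (is "(?graded \<and> ?ZPI \<and> (\<forall>I. proper_ideal I L \<longrightarrow> (\<exists>H S. ?Q I H S))) \<longleftrightarrow> _")
proof -
  interpret id: idempotent_ideals L by (rule idempotent_ideals_L[OF K])
  have ZPI: "finite_product_of prime_ideal I L \<longleftrightarrow>
      (\<exists>\<P>. finite \<P> \<and> \<P> \<noteq> {} \<and> (\<forall>P\<in>\<P>. prime_ideal P L) \<and> I = \<Inter>\<P>)" for I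
    by (rule id.finite_product_of_iff) (simp add: prime_ideal_def proper_ideal_def)
  show ?thesis
  proof (intro iffI allI impI)
    fix I assume asm: "?graded \<and> ?ZPI \<and> (\<forall>I. proper_ideal I L \<longrightarrow> (\<exists>H S. ?Q I H S))" and I: "proper_ideal I L"
    then have "\<exists>H S. ?Q I H S" by simp
    then obtain H S where Q: "?Q I H S" by (elim exE)
    then have adm: "admissible_pair E H S" and eq: "I = admissible_ideal K E H S" by simp_all
    interpret Q: admissible E K H S by unfold_locales (rule adm)
    have KF: "condition_K Q.F" by (rule Q.condition_K_quotient[OF K])
    have idF: "idempotent_ideals Q.F.L" by (rule Q.F.idempotent_ideals_L[OF KF])
    have "finite_product_of prime_ideal I L" using asm I by (simp add: generalized_ZPI_ring_def)
    then have primes: "\<exists>\<P>. finite \<P> \<and> \<P> \<noteq> {} \<and> (\<forall>P\<in>\<P>. prime_ideal P L) \<and> Q.\<Theta>.preimage {\<zero>\<^bsub>Q.F.L\<^esub>} = \<Inter>\<P>"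
      unfolding ZPI Q.\<Theta>_kernel[OF K] eq .
    have "\<exists>\<P>. finite \<P> \<and> \<P> \<noteq> {} \<and> (\<forall>P\<in>\<P>. prime_ideal P Q.F.L) \<and> {\<zero>\<^bsub>Q.F.L\<^esub>} = \<Inter>\<P>"
    proof (rule iffD1[OF Q.\<Theta>.Inter_kernel_iff primes])
      show "prime_ideal (Q.\<Theta>.preimage P) L \<longleftrightarrow> prime_ideal P Q.F.L" if "two_sided_ideal P Q.F.L" for P
        by (rule Q.\<Theta>.prime_preimage_iff[OF id.idempotent_ideals_axioms idF that])
    qed (simp_all add: prime_ideal_def proper_ideal_def)
    note dec_min = Q.F.decomposes_zero_if_minimal_primes[OF KF this]
    have "strongly_prime_ring Q.F.L \<or> (\<forall>P. minimal_prime_ideal P Q.F.L \<longrightarrow> strongly_primitive_ideal K Q.F P)"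
      using Q by (elim conjE disjE) simp_all
    then have "Q.F.cl.S.decomposes {\<zero>\<^bsub>Q.F.L\<^esub>}"
    proof
      assume "strongly_prime_ring Q.F.L"
      then show ?thesis
        using Q.F.decomposes_zero_if_strongly_prime Q.F.cl.S.strongly_prime_ring_iff by simp
    next
      assume "\<forall>P. minimal_prime_ideal P Q.F.L \<longrightarrow> strongly_primitive_ideal K Q.F P"
      then show ?thesis by (intro dec_min) simp
    qed
    then show "cl.S.decomposes I" unfolding eq Q.decomposes_iff[OF K] .
  next
    assume dec: all_ideals_decompose
    have Q: "?Q I (gr_vertices K E I) (gr_breaking K E I)" if I: "proper_ideal I L" for I
    proof -
      note gr = proper_ideal_cases[OF K I]
      interpret Q: admissible E K "gr_vertices K E I" "gr_breaking K E I" by unfold_locales (rule gr(1))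
      have KF: "condition_K Q.F" by (rule Q.condition_K_quotient[OF K])
      have "Q.F.cl.S.decomposes {\<zero>\<^bsub>Q.F.L\<^esub>}"
        using dec I Q.decomposes_iff[OF K, folded gr(2)] by simp
      then show ?thesis
        by (intro conjI[OF gr(1)] conjI[OF gr(2)] conjI[OF Q.quotient_isomorphic[OF K, folded gr(2)]]
            disjI2 Q.F.decomposes_zero_imp_minimal_primes[OF KF])
    qed
    have prod: "finite_product_of prime_ideal I L" if "proper_ideal I L" for I
    proof -
      have "cl.S.decomposes I" using dec that by simp
      then show ?thesis
        unfolding ZPI cl.S.decomposes_def
        by (elim exE) (rule exI, auto intro: id.strongly_prime_over_imp_prime)
    qed
    show "?graded \<and> ?ZPI \<and> (\<forall>I. proper_ideal I L \<longrightarrow> (\<exists>H S. ?Q I H S))"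
    proof (intro conjI)
      show ?graded using graded_ideal_if_condition_K[OF K] by simp
      show ?ZPI unfolding generalized_ZPI_ring_def using prod by simp
      show "\<forall>I. proper_ideal I L \<longrightarrow> (\<exists>H S. ?Q I H S)"
      proof (intro allI impI)
        fix I assume "proper_ideal I L"
        from Q[OF this] show "\<exists>H S. ?Q I H S" by (intro exI)
      qed
    qed
  qed
qed

end

theorem theorem4p16:
  fixes E :: "('v, 'e) pre_digraph" and K :: "'k::field itself"
  assumes "wf_digraph E"
  defines "L \<equiv> leavitt_path_algebra K E"
  defines "cond1 \<equiv> (\<forall>I. proper_ideal I L \<longrightarrow> finite_product_of strongly_prime_ideal I L)"
  defines "cond2 \<equiv>
    (\<forall>I. two_sided_ideal I L \<longrightarrow> graded_ideal K E I) \<and>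
    generalized_ZPI_ring L \<and>
    (\<forall>I. proper_ideal I L \<longrightarrow>
       (\<exists>H S. admissible_pair E H S \<and> I = admissible_ideal K E H S \<and>
          (let F = quotient_graph E H S; R = leavitt_path_algebra K F in
             algebra_isomorphic (quotient_algebra L I) R \<and>
             (strongly_prime_ring R \<or>
              finite {P. minimal_prime_ideal P R} \<and>
              (\<forall>P. minimal_prime_ideal P R \<longrightarrow> strongly_primitive_ideal K F P)))))"
  defines "cond3 \<equiv>
    condition_K E \<and>
    (\<forall>H S. admissible_pair E H S \<and> H \<noteq> verts E \<longrightarrow>
       (let F = quotient_graph E H S in
          (downward_directed F (verts F) \<and> (\<exists>C. strong_CSP F C)) \<or>
          (\<exists>\<M>. finite \<M> \<and> verts F = \<Union>\<M> \<and>
             (\<forall>M\<in>\<M>. maximal_tail F M \<and> (\<exists>C\<subseteq>M. strong_CSP (F \<restriction> M) C)))))"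
  shows "(cond1 \<longleftrightarrow> cond2) \<and> (cond2 \<longleftrightarrow> cond3)"
proof -
  interpret lpa E K by (rule lpa.intro[OF assms(1)])
  \<comment> \<open>Condition (K) is drawn from (1) and from (2) separately, since every comparison
    below presupposes it.\<close>
  have K1: "condition_K E" if cond1
    using that unfolding cond1_def L_def by (intro condition_K_if_products) simp
  \<comment> \<open>That a homomorphic image is a Leavitt path algebra is expressed by writing the
    ideal as I(H,S), and this form of all proper ideals forces (K).\<close>
  have K2: "condition_K E" if cond2
  proof (rule condition_K_if_admissible_ideals)
    fix I assume "proper_ideal I (leavitt_path_algebra K E)"
    then have "\<exists>H S. admissible_pair E H S \<and> I = admissible_ideal K E H S \<and>
        (let F = quotient_graph E H S; R = leavitt_path_algebra K F in
             algebra_isomorphic (quotient_algebra L I) R \<and>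
             (strongly_prime_ring R \<or>
              finite {P. minimal_prime_ideal P R} \<and>
              (\<forall>P. minimal_prime_ideal P R \<longrightarrow> strongly_primitive_ideal K F P)))"
      using that unfolding cond2_def L_def by simp
    then show "\<exists>H S. admissible_pair E H S \<and> I = admissible_ideal K E H S"
      by (elim exE conjE) (intro exI conjI)
  qed
  have iff: "cond1 \<longleftrightarrow> all_ideals_decompose" "cond2 \<longleftrightarrow> all_ideals_decompose" "cond3 \<longleftrightarrow> all_ideals_decompose"
    if K: "condition_K E"
  proof -
    show "cond1 \<longleftrightarrow> all_ideals_decompose"
      unfolding cond1_def L_def
      by (rule idempotent_ideals.strongly_prime_products_iff[OF idempotent_ideals_L[OF K]])
    show "cond2 \<longleftrightarrow> all_ideals_decompose"
      unfolding cond2_def L_def Let_def by (rule minimal_primes_iff[OF K])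
    show "cond3 \<longleftrightarrow> all_ideals_decompose"
      unfolding cond3_def Let_def union_of_CSP_tails_def[symmetric] tails_iff[OF K] using K by simp
  qed
  have "condition_K E" if cond3 using that by (simp add: cond3_def)
  then show ?thesis using K1 K2 iff by blast
qed

end
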